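(* Let $Q>0$, let $S\in L^\infty(I)$ with $S_1\ge S(x)\ge S_0>0$ a.e. in $I=(-1,1)$, let $g:\mathbb{R}\to\mathbb{R}$ be continuous and increasing, and let $\beta$ be a bounded maximal monotone graph in $\mathbb{R}^2$ (i.e. $\beta(s)\subset[m,M]$ for all $s\in\mathbb{R}$). Fix $\omega$ and write $Z_t=(G\cdot W)_t$ for the given (pathwise) stochastic term, regarded as a datum. Let $f\in L^\infty(I\times(0,\infty))$ and $\frac{\partial}{\partial x}\big(\varrho\frac{\partial Z_t}{\partial x}\big)\in L^\infty(I\times(0,\infty))$. Assume there exist $f_\infty\in V'$ and $Z_\infty=(G\cdot W)_\infty\in V$ with $Z_\infty=\lim_{t\to+\infty}Z_t=\lim_{t\to+\infty}\int_0^tG_s\,dW_s$ and $\frac{\partial}{\partial x}\big(\varrho\frac{\partial Z_\infty}{\partial x}\big)\in L^\infty(I)$, such that, as $t\to\infty$, $$\int_{t-1}^{t+1}\|f(\tau,\cdot)-f_\infty\|_{V'}d\tau\to0,\qquad\int_{t-1}^{t+1}\Big\|\frac{\partial}{\partial x}\Big(\varrho\frac{\partial Z_\tau}{\partial x}\Big)-\frac{\partial}{\partial x}\Big(\varrho\frac{\partial Z_\infty}{\partial x}\Big)\Big\|_{V'}d\tau\to0,\qquad\int_{t-1}^{t+1}\|Z_\tau-Z_\infty\|_Vd\tau\to0 .$$ Let $u_0\in L^\infty(I)\cap V$, let $u$ be a mild solution of the stochastic problem $$\frac{\partial u}{\partial t}-\frac{\partial}{\partial x}\Big(\varrho\frac{\partial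 u}{\partial x}\Big)+g(u)\in QS(x)\beta(u)+f+G\frac{\partial W}{\partial t},\qquad u(x,0)=u_0(x),$$ and let $y=u-Z$ be the corresponding bounded solution of $$\frac{d}{dt}y_t-\frac{\partial}{\partial x}\Big(\varrho\frac{\partial y_t}{\partial x}\Big)+g(y_t+Z_t)\in QS\beta(y_t+Z_t)+f_t+\frac{\partial}{\partial x}\Big(\varrho\frac{\partial Z_t}{\partial x}\Big),\qquad y_0=u_0,$$ satisfying $y\in L^\infty(0,\infty;V)$ and $\frac{\partial y}{\partial t}\in L^2(0,\infty;L^2(I))$. Then: (i) $\omega(y)\ne\emptyset$. (ii) If $y_\infty\in\omega(y)$, then there exists $t_n\to+\infty$ such that $y(t_n+s,\cdot)\to y_\infty$ in $L^2(-1,1;L^2(I))$ (as functions of $s\in(-1,1)$), and $y_\infty\in V$. Moreover $u_\infty:=y_\infty+Z_\infty$ is a bounded solution of the stationary problem $$-\frac{\partial}{\partial x}\Big(\varrho\frac{\partial u_\infty}{\partial x}\Big)+g(u_\infty)\in QS\beta(u_\infty)+f_\infty\quad\text{in }I .$$ (iii) In fact, if $y_\infty\in\omega(y)$, then there exists $\hat t_n\to+\infty$ such that $y(\hat t_n,\cdot)\to y_\infty$ strongly in $V$.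
   Context: $I=(-1,1)$, $\varrho(x)=1-x^2$, $V=\{w\in L^2(I):\int_I\varrho|w'|^2dx<\infty\}$ with norm $\|w\|_V=\|w\|_{L^2(I)}+(\int_I\varrho|w'|^2dx)^{1/2}$ and dual $V'$. The $\omega$-limit set is $$\omega(y)=\{y_\infty\in V\cap L^\infty(I):\ \exists\,t_n\to+\infty\text{ such that }y(t_n,\cdot)\to y_\infty\text{ in }L^2(I)\}.$$ "Bounded solution" $y$ means $y$ essentially bounded on $I\times(0,\infty)$. A mild solution of a multivalued problem is a mild solution (variation of constants formula with the semigroup on $L^2(I)$ generated by $v\mapsto(\varrho v')'$) for some measurable section $b(x,t)\in\beta(u(x,t))$ in place of $\beta(u)$. A bounded solution of the stationary problem is $u_\infty\in V\cap L^\infty(I)$ for which there is $z\in L^\infty(I)$, $z(x)\in\beta(u_\infty(x))$ a.e., with $\int_I\varrho u_\infty'v'dx+\int_Ig(u_\infty)v\,dx=\int_IQS z v\,dx+\langle f_\infty,v\rangle$ for all $v\in V$. $W$ is a Wiener process and $(G\cdot W)_t=\int_0^tG_sdW_s$ is the stochastic integral; in this statement its path $t\mapsto Z_t\in V$ is treated only as a given function satisfying the stated hypotheses. *)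

theory Defs
  imports "HOL-Analysis.Analysis"
begin

abbreviation II :: "real set" where
  "II \<equiv> {-1<..<1}"

definition leb_I :: "real measure" where
  "leb_I = restrict_space lborel II"

lemma space_leb_I [simp]: "space leb_I = {-1<..<1}"
  by (simp add: leb_I_def space_restrict_space)

lemma emeasure_space_leb_I: "emeasure leb_I (space leb_I) = 2"
  by (simp add: leb_I_def space_restrict_space emeasure_restrict_space)

interpretation leb_I: finite_measure leb_I
  by standard (simp add: emeasure_space_leb_I del: space_leb_I)

definition sq_int :: "(real \<Rightarrow> real) \<Rightarrow> bool" where
  "sq_int f \<longleftrightarrow> f \<in> borel_measurable leb_I \<and> integrable leb_I (\<lambda>x. (f x)\<^sup>2)"

lemma sq_int_mult:
  assumes "sq_int f" "sq_int g"
  shows "integrable leb_I (\<lambda>x. f x * g x)"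
proof (rule Bochner_Integration.integrable_bound)
  show "integrable leb_I (\<lambda>x. (f x)\<^sup>2 + (g x)\<^sup>2)"
    using assms by (auto simp: sq_int_def)
  show "(\<lambda>x. f x * g x) \<in> borel_measurable leb_I"
    using assms by (auto simp: sq_int_def)
  have "\<bar>a * b\<bar> \<le> a\<^sup>2 + b\<^sup>2" for a b :: real
  proof -
    have "0 \<le> (\<bar>a\<bar> - \<bar>b\<bar>)\<^sup>2" by simp
    then have "2 * (\<bar>a\<bar> * \<bar>b\<bar>) \<le> a\<^sup>2 + b\<^sup>2" by (simp add: power2_diff)
    moreover have "0 \<le> \<bar>a\<bar> * \<bar>b\<bar>" by simp
    ultimately show ?thesis unfolding abs_mult by linarith
  qed
  then show "AE x in leb_I. norm (f x * g x) \<le> norm ((f x)\<^sup>2 + (g x)\<^sup>2)"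
    by simp
qed

lemma sq_int_zero: "sq_int (\<lambda>x. 0)"
  by (simp add: sq_int_def)

lemma sq_int_add:
  assumes "sq_int f" "sq_int g"
  shows "sq_int (\<lambda>x. f x + g x)"
  using assms sq_int_mult[OF assms] by (auto simp: sq_int_def power2_sum mult.assoc)

lemma sq_int_scale:
  assumes "sq_int f"
  shows "sq_int (\<lambda>x. c * f x)"
  using assms by (auto simp: sq_int_def power_mult_distrib)

lemma sq_int_minus:
  assumes "sq_int f" "sq_int g"
  shows "sq_int (\<lambda>x. f x - g x)"
  using sq_int_add[OF assms(1) sq_int_scale[OF assms(2), of "-1"]] by simp

(* L2I is the Hilbert space of classes, modulo equality almost everywhere, of square integrable
   functions on (-1,1).  Classes are formed from Borel measurable functions, which gives the same
   space as Lebesgue measurable ones.  L2_fun picks a representative; to_L2 returns the class of a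
   square integrable function, and 0 on all other functions. *)

definition ae_eq :: "(real \<Rightarrow> real) \<Rightarrow> (real \<Rightarrow> real) \<Rightarrow> bool" where
  "ae_eq f g \<longleftrightarrow> sq_int f \<and> sq_int g \<and> (AE x in leb_I. f x = g x)"

quotient_type L2I = "real \<Rightarrow> real" / partial: ae_eq
proof (rule part_equivpI)
  show "\<exists>f. ae_eq f f" by (rule exI[of _ "\<lambda>x. 0"]) (simp add: ae_eq_def sq_int_zero)
  show "symp ae_eq" by (rule sympI) (auto simp: ae_eq_def elim: eventually_mono)
  show "transp ae_eq" by (rule transpI) (auto simp: ae_eq_def elim: eventually_elim2)
qed

instantiation L2I :: real_vector
begin

lift_definition zero_L2I :: L2I is "\<lambda>x. 0"
  by (simp add: ae_eq_def sq_int_zero)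

lift_definition plus_L2I :: "L2I \<Rightarrow> L2I \<Rightarrow> L2I" is "\<lambda>f g x. f x + g x"
  by (auto simp: ae_eq_def sq_int_add elim: eventually_elim2)

lift_definition minus_L2I :: "L2I \<Rightarrow> L2I \<Rightarrow> L2I" is "\<lambda>f g x. f x - g x"
  by (auto simp: ae_eq_def sq_int_minus elim: eventually_elim2)

lift_definition uminus_L2I :: "L2I \<Rightarrow> L2I" is "\<lambda>f x. - f x"
  using sq_int_scale[of _ "-1"] by (auto simp: ae_eq_def elim: eventually_mono)

lift_definition scaleR_L2I :: "real \<Rightarrow> L2I \<Rightarrow> L2I" is "\<lambda>c f x. c * f x"
  by (auto simp: ae_eq_def sq_int_scale elim: eventually_mono)

instance
  by standard
    (transfer, force simp: ae_eq_def sq_int_add sq_int_minus sq_int_scale sq_int_zero algebra_simps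
       intro: sq_int_scale[of _ "-1", simplified] sq_int_add sq_int_minus sq_int_scale)+

end

instantiation L2I :: real_inner
begin

lift_definition inner_L2I :: "L2I \<Rightarrow> L2I \<Rightarrow> real" is "\<lambda>f g. LINT x|leb_I. f x * g x"
proof -
  fix f f' g g' assume "ae_eq f f'" "ae_eq g g'"
  then show "(LINT x|leb_I. f x * g x) = (LINT x|leb_I. f' x * g' x)"
    by (intro integral_cong_AE) (auto simp: ae_eq_def sq_int_def elim: eventually_elim2)
qed

definition norm_L2I :: "L2I \<Rightarrow> real" where "norm_L2I f = sqrt (inner f f)"
definition dist_L2I :: "L2I \<Rightarrow> L2I \<Rightarrow> real" where "dist_L2I f g = norm (f - g)"
definition sgn_L2I :: "L2I \<Rightarrow> L2I" where "sgn_L2I f = f /\<^sub>R norm f"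
definition uniformity_L2I :: "(L2I \<times> L2I) filter" where
  "uniformity_L2I = (INF e\<in>{0<..}. principal {(x, y). dist x y < e})"
definition open_L2I :: "L2I set \<Rightarrow> bool" where
  "open_L2I U = (\<forall>x\<in>U. eventually (\<lambda>(x', y). x' = x \<longrightarrow> y \<in> U) uniformity)"

instance
proof
  fix x y z :: L2I and r :: real
  show "dist x y = norm (x - y)" by (rule dist_L2I_def)
  show "sgn x = x /\<^sub>R norm x" by (rule sgn_L2I_def)
  show "uniformity = (INF e\<in>{0<..}. principal {(x :: L2I, y). dist x y < e})"
    by (rule uniformity_L2I_def)
  show "open U = (\<forall>x\<in>U. eventually (\<lambda>(x', y). x' = x \<longrightarrow> y \<in> U) uniformity)" for U :: "L2I set"
    by (rule open_L2I_def)
  show "norm x = sqrt (inner x x)" by (rule norm_L2I_def)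
  show "inner x y = inner y x" by transfer (simp add: mult.commute)
  show "inner (x + y) z = inner x z + inner y z"
    by transfer (simp add: ae_eq_def sq_int_mult distrib_right)
  show "inner (r *\<^sub>R x) y = r * inner x y"
    by transfer (simp add: mult.assoc)
  show "0 \<le> inner x x" by transfer simp
  show "(inner x x = 0) = (x = 0)"
  proof transfer
    fix f assume "ae_eq f f"
    then show "((LINT x|leb_I. f x * f x) = 0) = ae_eq f (\<lambda>x. 0)"
      by (subst integral_nonneg_eq_0_iff_AE) (auto simp: ae_eq_def sq_int_mult sq_int_zero)
  qed
qed

end

abbreviation L2_fun :: "L2I \<Rightarrow> real \<Rightarrow> real" where
  "L2_fun \<equiv> rep_L2I"

definition to_L2 :: "(real \<Rightarrow> real) \<Rightarrow> L2I" where
  "to_L2 f = (if sq_int f then abs_L2I f else 0)"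

lemma sq_int_L2_fun: "sq_int (L2_fun w)"
  using Quotient_rep_reflp[OF Quotient_L2I, of w] by (simp add: ae_eq_def)

lemma to_L2_L2_fun: "to_L2 (L2_fun w) = w"
  by (simp add: to_L2_def sq_int_L2_fun Quotient_abs_rep[OF Quotient_L2I])

lemma L2_fun_to_L2: "sq_int f \<Longrightarrow> AE x in leb_I. L2_fun (to_L2 f) x = f x"
  using Quotient_rep_abs[OF Quotient_L2I, of f]  by (simp add: to_L2_def ae_eq_def)

lemma to_L2_eq_iff: "sq_int f \<Longrightarrow> sq_int g \<Longrightarrow> to_L2 f = to_L2 g \<longleftrightarrow> (AE x in leb_I. f x = g x)"
  using Quotient_rel[OF Quotient_L2I, of f g] by (auto simp: to_L2_def ae_eq_def)

lemma to_L2_add: "sq_int f \<Longrightarrow> sq_int g \<Longrightarrow> to_L2 (\<lambda>x. f x + g x) = to_L2 f + to_L2 g"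
  by (simp add: to_L2_def sq_int_add plus_L2I.abs_eq ae_eq_def)

lemma to_L2_diff: "sq_int f \<Longrightarrow> sq_int g \<Longrightarrow> to_L2 (\<lambda>x. f x - g x) = to_L2 f - to_L2 g"
  by (simp add: to_L2_def sq_int_minus minus_L2I.abs_eq ae_eq_def)

lemma to_L2_scale: "sq_int f \<Longrightarrow> to_L2 (\<lambda>x. c * f x) = c *\<^sub>R to_L2 f"
  by (simp add: to_L2_def sq_int_scale scaleR_L2I.abs_eq ae_eq_def)

lemma norm_to_L2_sq: "sq_int f \<Longrightarrow> (norm (to_L2 f))\<^sup>2 = (LINT x|leb_I. (f x)\<^sup>2)"
  unfolding power2_norm_eq_inner
  by (simp add: to_L2_def inner_L2I.abs_eq ae_eq_def power2_eq_square)

lemma nn_integral_sq: "sq_int f \<Longrightarrow> (\<integral>\<^sup>+x. ennreal ((f x)\<^sup>2) \<partial>leb_I) = ennreal ((norm (to_L2 f))\<^sup>2)"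
  unfolding norm_to_L2_sq by (rule nn_integral_eq_integral) (auto simp: sq_int_def)

instance L2I :: banach
proof
  fix X :: "nat \<Rightarrow> L2I" assume X: "Cauchy X"
  have "\<exists>N. \<forall>m\<ge>N. \<forall>n\<ge>N. norm (X m - X n) < (1/2)^k" for k
    using CauchyD[OF X, of "(1/2)^k"] by simp
  then obtain N where N: "\<And>k m n. m \<ge> N k \<Longrightarrow> n \<ge> N k \<Longrightarrow> norm (X m - X n) < (1/2)^k"
    by metis
  define r where "r k = (\<Sum>i\<le>k. N i) + k" for k
  have rN: "N k \<le> r k" for k
  proof -
    have "N k \<le> (\<Sum>i\<le>k. N i)" by (rule member_le_sum) auto
    then show ?thesis by (simp add: r_def)
  qed
  have r: "strict_mono r"
    by (rule strict_monoI_Suc) (simp add: r_def)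
  have rk: "norm (X (r m) - X (r n)) < (1/2)^k" if "k \<le> m" "k \<le> n" for k m n
  proof (rule N)
    show "N k \<le> r m" using rN[of k] strict_mono_mono[OF r] that by (meson monoD order_trans)
    show "N k \<le> r n" using rN[of k] strict_mono_mono[OF r] that by (meson monoD order_trans)
  qed
  define f where "f n = L2_fun (X (r n))" for n
  have sf: "sq_int (f n)" for n by (simp add: f_def sq_int_L2_fun)
  have Xf: "X (r n) = to_L2 (f n)" for n by (simp add: f_def to_L2_L2_fun)
  have [measurable]: "f n \<in> borel_measurable leb_I" for n using sf by (auto simp: sq_int_def)
  define d where "d n x = \<bar>f (Suc n) x - f n x\<bar>" for n x
  have sd: "sq_int (\<lambda>x. f m x - f n x)" for m n using sf by (intro sq_int_minus)
  have sone: "sq_int (\<lambda>x. 1)" by (simp add: sq_int_def)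
  have int_d: "integrable leb_I (d n)" for n
    unfolding d_def using sq_int_mult[OF sd[of "Suc n" n] sone] by auto
  have d_bound: "(LINT x|leb_I. d n x) \<le> 2 * (1/2)^n" for n
  proof -
    have "d n \<in> borel_measurable leb_I" unfolding d_def by measurable
    then have sad: "sq_int (d n)" using sd[of "Suc n" n] by (auto simp: sq_int_def d_def)
    have "(LINT x|leb_I. d n x) = inner (to_L2 (d n)) (to_L2 (\<lambda>x. 1))"
      using sad sone by (simp add: to_L2_def inner_L2I.abs_eq ae_eq_def)
    also have "\<dots> \<le> norm (to_L2 (d n)) * norm (to_L2 (\<lambda>x. 1))" by (rule norm_cauchy_schwarz)
    also have "norm (to_L2 (d n)) = norm (X (r (Suc n)) - X (r n))"
    proof -
      have "(norm (to_L2 (d n)))\<^sup>2 = (norm (to_L2 (\<lambda>x. f (Suc n) x - f n x)))\<^sup>2"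
        unfolding norm_to_L2_sq[OF sad] norm_to_L2_sq[OF sd] by (simp add: d_def)
      then show ?thesis by (simp add: Xf to_L2_diff sf)
    qed
    also have "norm (to_L2 (\<lambda>x. 1)) \<le> 2"
    proof (rule power2_le_imp_le)
      have "measure leb_I {-1<..<1} = 2"
        using emeasure_space_leb_I by (simp add: measure_def)
      then show "(norm (to_L2 (\<lambda>x. 1)))\<^sup>2 \<le> 2\<^sup>2"
        unfolding norm_to_L2_sq[OF sone] by simp
    qed simp
    also have "norm (X (r (Suc n)) - X (r n)) \<le> (1/2)^n"
      using rk[of n "Suc n" n] by simp
    finally show ?thesis by (simp add: mult_right_mono mult_left_mono mult.commute)
  qed
  have "(\<integral>\<^sup>+x. (\<Sum>n. ennreal (d n x)) \<partial>leb_I) = (\<Sum>n. \<integral>\<^sup>+x. ennreal (d n x) \<partial>leb_I)"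
    by (rule nn_integral_suminf) (simp add: d_def)
  also have "\<dots> = (\<Sum>n. ennreal (LINT x|leb_I. d n x))"
    using int_d by (subst nn_integral_eq_integral) (auto simp: d_def)
  also have "\<dots> \<le> (\<Sum>n. ennreal (2 * (1/2)^n))"
    by (intro suminf_le) (auto intro!: ennreal_leI d_bound)
  also have "\<dots> < \<infinity>"
    by (subst suminf_ennreal2) (auto intro!: summable_mult summable_geometric)
  finally have "(\<integral>\<^sup>+x. (\<Sum>n. ennreal (d n x)) \<partial>leb_I) \<noteq> \<infinity>" by simp
  then have "AE x in leb_I. (\<Sum>n. ennreal (d n x)) \<noteq> \<infinity>"
    by (intro nn_integral_PInf_AE) (auto simp: d_def)
  then have conv: "AE x in leb_I. convergent (\<lambda>n. f n x)"
  proof eventually_elim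
    fix x assume "(\<Sum>n. ennreal (d n x)) \<noteq> \<infinity>"
    then have "summable (\<lambda>n. d n x)"
      by (intro summable_suminf_not_top) (auto simp: d_def)
    then have "summable (\<lambda>n. f (Suc n) x - f n x)"
      unfolding d_def by (rule summable_rabs_cancel)
    then have "convergent (\<lambda>n. \<Sum>i<n. f (Suc i) x - f i x)"
      by (simp add: summable_iff_convergent)
    then have "convergent (\<lambda>n. f n x - f 0 x)"
      by (simp add: sum_lessThan_telescope[of "\<lambda>n. f n x"])
    then show "convergent (\<lambda>n. f n x)" using convergent_diff_const_right_iff by blast
  qed
  define F where "F x = lim (\<lambda>n. f n x)" for x
  have [measurable]: "F \<in> borel_measurable leb_I" unfolding F_def by measurable
  have lim: "AE x in leb_I. (\<lambda>n. f n x) \<longlonglongrightarrow> F x"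
    using conv by eventually_elim (simp add: F_def convergent_LIMSEQ_iff)
  have bnd: "(\<integral>\<^sup>+x. ennreal ((F x - f n x)\<^sup>2) \<partial>leb_I) \<le> ennreal (((1/2)^n)\<^sup>2)" for n
  proof -
    have "(\<integral>\<^sup>+x. ennreal ((F x - f n x)\<^sup>2) \<partial>leb_I)
        = (\<integral>\<^sup>+x. liminf (\<lambda>m. ennreal ((f m x - f n x)\<^sup>2)) \<partial>leb_I)"
    proof (rule nn_integral_cong_AE, use lim in eventually_elim)
      fix x assume "(\<lambda>n. f n x) \<longlonglongrightarrow> F x"
      then have "(\<lambda>m. ennreal ((f m x - f n x)\<^sup>2)) \<longlonglongrightarrow> ennreal ((F x - f n x)\<^sup>2)"
        by (intro tendsto_intros)
      from lim_imp_Liminf[OF _ this]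
      show "ennreal ((F x - f n x)\<^sup>2) = liminf (\<lambda>m. ennreal ((f m x - f n x)\<^sup>2))" by simp
    qed
    also have "\<dots> \<le> liminf (\<lambda>m. \<integral>\<^sup>+x. ennreal ((f m x - f n x)\<^sup>2) \<partial>leb_I)"
      by (rule nn_integral_liminf) simp
    also have "\<dots> \<le> liminf (\<lambda>m::nat. ennreal (((1/2)^n)\<^sup>2))"
    proof (rule Liminf_mono)
      show "\<forall>\<^sub>F m in sequentially. (\<integral>\<^sup>+x. ennreal ((f m x - f n x)\<^sup>2) \<partial>leb_I) \<le> ennreal (((1/2)^n)\<^sup>2)"
        using eventually_ge_at_top[of n]
      proof eventually_elim
        fix m assume "n \<le> m"
        then have "norm (X (r m) - X (r n)) \<le> (1/2)^n" using rk[of n m n] by simp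
        then have "(norm (X (r m) - X (r n)))\<^sup>2 \<le> ((1/2)^n)\<^sup>2" by (rule power_mono) simp
        then show "(\<integral>\<^sup>+x. ennreal ((f m x - f n x)\<^sup>2) \<partial>leb_I) \<le> ennreal (((1/2)^n)\<^sup>2)"
          unfolding nn_integral_sq[OF sd] by (intro ennreal_leI) (simp add: Xf to_L2_diff sf)
      qed
    qed
    also have "\<dots> = ennreal (((1/2)^n)\<^sup>2)" by (simp add: Liminf_const)
    finally show ?thesis .
  qed
  have sFf: "sq_int (\<lambda>x. F x - f n x)" for n
    unfolding sq_int_def
  proof
    show "integrable leb_I (\<lambda>x. (F x - f n x)\<^sup>2)"
      using bnd[of n] by (intro integrableI_bounded) (auto simp: le_less_trans ennreal_less_top)
  qed simp
  have sF: "sq_int F" using sq_int_add[OF sFf[of 0] sf[of 0]] by simp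
  have "norm (X (r n) - to_L2 F) \<le> (1/2)^n" for n
  proof (rule power2_le_imp_le)
    have "ennreal ((norm (X (r n) - to_L2 F))\<^sup>2) \<le> ennreal (((1/2)^n)\<^sup>2)"
      using bnd[of n] unfolding nn_integral_sq[OF sFf]
      by (simp add: Xf to_L2_diff sf sF norm_minus_commute)
    then show "(norm (X (r n) - to_L2 F))\<^sup>2 \<le> ((1/2)^n)\<^sup>2" by (subst (asm) ennreal_le_iff) auto
  qed simp
  then have "(\<lambda>n. X (r n) - to_L2 F) \<longlonglongrightarrow> 0"
    by (rule Lim_null_comparison[OF always_eventually, rule_format]) (auto intro: LIMSEQ_power_zero)
  then have "(X \<circ> r) \<longlonglongrightarrow> to_L2 F" by (simp add: LIM_zero_iff comp_def)
  then have "X \<longlonglongrightarrow> to_L2 F"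
    using Cauchy_converges_subseq[OF X r] by blast
  then show "convergent X" by (auto simp: convergent_def)
qed

definition L2_step :: "(rat \<times> rat) list \<Rightarrow> L2I" where
  "L2_step l = (\<Sum>(c, q)\<leftarrow>l. of_rat c *\<^sub>R to_L2 (indicator {..of_rat q}))"

lemma L2_step_dense: "closure (range L2_step) = UNIV"
proof -
  define K where "K = closure (range L2_step)"
  have K_seq: "x \<in> K" if "\<And>n. f n \<in> K" "f \<longlonglongrightarrow> x" for f :: "nat \<Rightarrow> L2I" and x
    using closed_sequentially[of K f x] that by (auto simp: K_def)
  have K0: "0 \<in> K"
    unfolding K_def by (rule subsetD[OF closure_subset], rule range_eqI[of _ _ "[]"]) (simp add: L2_step_def)
  have Kadd: "x + y \<in> K" if "x \<in> K" "y \<in> K" for x y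
  proof -
    obtain a b where ab: "\<And>n. a n \<in> range L2_step" "a \<longlonglongrightarrow> x" "\<And>n. b n \<in> range L2_step" "b \<longlonglongrightarrow> y"
      using \<open>x \<in> K\<close> \<open>y \<in> K\<close> unfolding K_def closure_sequential by blast
    have "a n + b n \<in> range L2_step" for n
    proof -
      obtain l m where "a n = L2_step l" "b n = L2_step m" using ab by blast
      then have "a n + b n = L2_step (l @ m)" by (simp add: L2_step_def)
      then show ?thesis by blast
    qed
    then show ?thesis unfolding K_def closure_sequential
      using tendsto_add[OF ab(2,4)] by (intro exI[of _ "\<lambda>n. a n + b n"] conjI allI)
  qed
  have Krat: "of_rat c *\<^sub>R x \<in> range L2_step" if x: "x \<in> range L2_step" for c x
  proof -
    obtain l where l: "x = L2_step l" using x by blast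
    have "of_rat c *\<^sub>R L2_step l = L2_step (map (\<lambda>(d, q). (c * d, q)) l)"
      by (induction l) (auto simp: L2_step_def scaleR_add_right of_rat_mult)
    then show ?thesis using l by blast
  qed
  have Kscale: "c *\<^sub>R x \<in> K" if x: "x \<in> K" for c x
  proof -
    obtain a where a: "\<And>n. a n \<in> range L2_step" "a \<longlonglongrightarrow> x"
      using x unfolding K_def closure_sequential by blast
    have "\<exists>q::rat. \<bar>of_rat q - c\<bar> < 1 / Suc n" for n
    proof -
      have "c - 1 / Suc n < c + 1 / Suc n" by (simp add: field_simps)
      then obtain q where "c - 1 / Suc n < of_rat q" "of_rat q < c + 1 / Suc n"
        using of_rat_dense by blast
      then show ?thesis by (intro exI[of _ q]) auto
    qed
    then obtain q :: "nat \<Rightarrow> rat" where q: "\<And>n. \<bar>of_rat (q n) - c\<bar> < 1 / Suc n" by metis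
    have "(\<lambda>n. of_rat (q n) - c) \<longlonglongrightarrow> 0"
      by (rule Lim_null_comparison[OF always_eventually LIMSEQ_inverse_real_of_nat])
        (use q in \<open>auto simp: inverse_eq_divide intro: less_imp_le\<close>)
    then have "(\<lambda>n. of_rat (q n)) \<longlonglongrightarrow> c" by (simp add: LIM_zero_iff)
    then have "(\<lambda>n. of_rat (q n) *\<^sub>R a n) \<longlonglongrightarrow> c *\<^sub>R x" using a(2) by (rule tendsto_scaleR)
    then show ?thesis unfolding K_def closure_sequential
      by (intro exI[of _ "\<lambda>n. of_rat (q n) *\<^sub>R a n"] conjI allI Krat a(1))
  qed
  have Kdiff: "x - y \<in> K" if "x \<in> K" "y \<in> K" for x y
    using Kadd[OF that(1) Kscale[OF that(2), of "-1"]] by simp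
  have Kconv: "to_L2 F \<in> K"
    if U: "\<And>n. sq_int (U n)" "\<And>n. to_L2 (U n) \<in> K" and F: "sq_int F" and G: "sq_int G"
      and lim: "AE x in leb_I. (\<lambda>n. U n x) \<longlonglongrightarrow> F x"
      and dom: "\<And>n. AE x in leb_I. \<bar>U n x - F x\<bar> \<le> \<bar>G x\<bar>" for U F G
  proof (rule K_seq)
    have meas: "U n \<in> borel_measurable leb_I" "F \<in> borel_measurable leb_I" for n
      using U F by (auto simp: sq_int_def)
    have "(\<lambda>n. LINT x|leb_I. (U n x - F x)\<^sup>2) \<longlonglongrightarrow> (LINT x|leb_I. 0)"
    proof (rule integral_dominated_convergence)
      show "integrable leb_I (\<lambda>x. (G x)\<^sup>2)" using G by (simp add: sq_int_def)
      show "AE x in leb_I. (\<lambda>n. (U n x - F x)\<^sup>2) \<longlonglongrightarrow> 0"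
        using lim
      proof eventually_elim
        fix x assume "(\<lambda>n. U n x) \<longlonglongrightarrow> F x"
        then have "(\<lambda>n. (U n x - F x)\<^sup>2) \<longlonglongrightarrow> (F x - F x)\<^sup>2" by (intro tendsto_intros)
        then show "(\<lambda>n. (U n x - F x)\<^sup>2) \<longlonglongrightarrow> 0" by simp
      qed
      show "AE x in leb_I. norm ((U n x - F x)\<^sup>2) \<le> (G x)\<^sup>2" for n
        using dom[of n]
      proof eventually_elim
        fix x assume "\<bar>U n x - F x\<bar> \<le> \<bar>G x\<bar>"
        then show "norm ((U n x - F x)\<^sup>2) \<le> (G x)\<^sup>2" by (simp add: abs_le_square_iff)
      qed
    qed (use meas in auto)
    then have "(\<lambda>n. (norm (to_L2 (U n) - to_L2 F))\<^sup>2) \<longlonglongrightarrow> 0"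
      using U F by (simp add: norm_to_L2_sq[OF sq_int_minus] flip: to_L2_diff)
    then have "(\<lambda>n. sqrt ((norm (to_L2 (U n) - to_L2 F))\<^sup>2)) \<longlonglongrightarrow> sqrt 0" by (rule tendsto_real_sqrt)
    then have "(\<lambda>n. norm (to_L2 (U n) - to_L2 F)) \<longlonglongrightarrow> 0" by simp
    then show "(\<lambda>n. to_L2 (U n)) \<longlonglongrightarrow> to_L2 F"
      by (simp add: tendsto_norm_zero_iff LIM_zero_iff)
  qed (rule U(2))
  have sI: "sq_int (indicator A)" if "A \<in> sets borel" for A
  proof -
    have "indicator A \<in> borel_measurable leb_I"
      unfolding leb_I_def using that by (intro measurable_restrict_space1) simp
    moreover have "(\<lambda>x. (indicator A x)\<^sup>2) = (indicator A :: real \<Rightarrow> real)"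
      by (auto simp: indicator_def)
    ultimately show ?thesis
      unfolding sq_int_def
      by (auto intro!: leb_I.integrable_const_bound[of _ 1])
  qed
  have one: "sq_int (\<lambda>x. 1)" using sI[of UNIV] by simp
  have Krat_ind: "to_L2 (indicator {..of_rat q}) \<in> K" for q
    unfolding K_def by (rule subsetD[OF closure_subset], rule range_eqI[of _ _ "[(1, q)]"]) (simp add: L2_step_def)
  have K_atMost: "to_L2 (indicator {..a}) \<in> K" for a :: real
  proof -
    have "\<exists>q::rat. a < of_rat q \<and> of_rat q < a + 1 / Suc n" for n
      by (rule of_rat_dense) (simp add: field_simps)
    then obtain q :: "nat \<Rightarrow> rat" where q: "\<And>n. a < of_rat (q n)" "\<And>n. of_rat (q n) < a + 1 / Suc n" by metis
    show ?thesis
    proof (rule Kconv[OF _ Krat_ind _ one])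
      have "(\<lambda>n. indicator {..of_rat (q n)} x :: real) \<longlonglongrightarrow> indicator {..a} x" for x
      proof (cases "x \<le> a")
        case True
        then have "x \<le> of_rat (q n)" for n using q(1)[of n] by linarith
        with True show ?thesis by simp
      next
        case False
        have "eventually (\<lambda>n. 1 / real (Suc n) < x - a) sequentially"
          using False LIMSEQ_inverse_real_of_nat by (intro order_tendstoD(2)) (auto simp: inverse_eq_divide)
        then have "eventually (\<lambda>n. (indicator {..of_rat (q n)} x :: real) = indicator {..a} x) sequentially"
        proof eventually_elim
          fix n assume "1 / real (Suc n) < x - a"
          then show "(indicator {..of_rat (q n)} x :: real) = indicator {..a} x"
            using q(2)[of n] False by (simp add: indicator_def)
        qed
        then show ?thesis by (rule tendsto_eventually)
      qed
      then show "AE x in leb_I. (\<lambda>n. indicator {..of_rat (q n)} x :: real) \<longlonglongrightarrow> indicator {..a} x" by simp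
      show "AE x in leb_I. \<bar>indicator {..of_rat (q n)} x - indicator {..a} x\<bar> \<le> \<bar>1::real\<bar>" for n
        by (auto simp: indicator_def)
    qed (auto intro: sI)
  qed
  have K_borel: "to_L2 (indicator A) \<in> K" if A: "A \<in> sets borel" for A :: "real set"
  proof -
    have sb: "sets borel = sigma_sets UNIV (range (\<lambda>a::real. {..a}))"
      by (subst borel_eq_atMost) simp
    have "Int_stable (range (\<lambda>a::real. {..a}))"
      by (auto simp: Int_stable_def Int_atMost)
    moreover have "range (\<lambda>a::real. {..a}) \<subseteq> Pow UNIV" by simp
    moreover have "A \<in> sigma_sets UNIV (range (\<lambda>a::real. {..a}))"
      using A unfolding sb .
    ultimately show ?thesis
    proof (induction rule: sigma_sets_induct_disjoint)
      case (basic A)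
      then show ?case using K_atMost by auto
    next
      case empty
      have "to_L2 (\<lambda>x. 0) = 0" using to_L2_scale[OF sq_int_zero, of 0] by simp
      then show ?case using K0 by (simp add: indicator_def)
    next
      case (compl A)
      then have A: "A \<in> sets borel" using sb by simp
      have "to_L2 (indicator {..1}) \<in> K" by (rule K_atMost)
      also have "to_L2 (indicator {..1}) = to_L2 (\<lambda>x. 1)"
        by (subst to_L2_eq_iff) (auto simp: one sI indicator_def AE_restrict_space_iff leb_I_def)
      finally have "to_L2 (\<lambda>x. 1) - to_L2 (indicator A) \<in> K" using compl.IH by (rule Kdiff)
      moreover have "(indicator (UNIV - A) :: real \<Rightarrow> real) = (\<lambda>x. 1 - indicator A x)"
        by (auto simp: indicator_def)
      ultimately show ?case by (simp add: to_L2_diff one sI A)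
    next
      case (union A)
      have A: "A i \<in> sets borel" for i using union(2) sb by auto
      have part: "to_L2 (indicator (\<Union>i<n. A i)) \<in> K" for n :: nat
      proof (induction n)
        case 0
        have "to_L2 (\<lambda>x. 0) = 0" using to_L2_scale[OF sq_int_zero, of 0] by simp
        then show ?case using K0 by (simp add: indicator_def)
      next
        case (Suc n)
        have "(indicator (\<Union>i<Suc n. A i) :: real \<Rightarrow> real)
            = (\<lambda>x. indicator (\<Union>i<n. A i) x + indicator (A n) x)"
        proof
          fix x
          have "A n \<inter> (\<Union>i<n. A i) = {}"
            using union(1) unfolding disjoint_family_on_def by (fastforce dest: less_imp_neq)
          then show "(indicator (\<Union>i<Suc n. A i) x :: real)
            = indicator (\<Union>i<n. A i) x + indicator (A n) x"
            by (auto simp: indicator_def lessThan_Suc)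
        qed
        moreover have "sq_int (indicator (\<Union>i<n. A i))" by (intro sI sets.finite_UN) (auto simp: A)
        ultimately show ?case using Kadd[OF Suc union(3)[of n]] by (simp add: to_L2_add sI A)
      qed
      show ?case
      proof (rule Kconv[OF _ part _ one])
        show "sq_int (indicator (\<Union>i<n. A i))" for n by (intro sI sets.finite_UN) (auto simp: A)
        show "sq_int (indicator (\<Union>i. A i))" by (intro sI sets.countable_UN) (auto simp: A)
        show "AE x in leb_I. (\<lambda>n. indicator (\<Union>i<n. A i) x :: real) \<longlonglongrightarrow> indicator (\<Union>i. A i) x"
          by (intro always_eventually allI LIMSEQ_indicator_UN)
        show "AE x in leb_I. \<bar>indicator (\<Union>i<n. A i) x - indicator (\<Union>i. A i) x\<bar> \<le> \<bar>1::real\<bar>" for n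
          by (auto simp: indicator_def)
      qed
    qed
  qed
  have K_leb_I: "to_L2 (indicator A) \<in> K" if "A \<in> sets leb_I" for A
  proof -
    have "A \<in> sets borel" using that by (auto simp: leb_I_def sets_restrict_space)
    then show ?thesis by (rule K_borel)
  qed
  have K_nonneg: "sq_int u \<longrightarrow> to_L2 u \<in> K" if "u \<in> borel_measurable leb_I" "\<And>x. 0 \<le> u x" for u
    using that
  proof (induction rule: borel_measurable_induct_real)
    case (set A)
    then show ?case using K_leb_I by simp
  next
    case (mult u c)
    show ?case
    proof (cases "c = 0")
      case True
      then show ?thesis using K0 to_L2_scale[OF sq_int_zero, of 0] by simp
    next
      case False
      show ?thesis
      proof
        assume "sq_int (\<lambda>x. c * u x)"
        then have "sq_int u" using sq_int_scale[of "\<lambda>x. c * u x" "1/c"] False by simp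
        then show "to_L2 (\<lambda>x. c * u x) \<in> K" using mult by (simp add: to_L2_scale Kscale)
      qed
    qed
  next
    case (add u v)
    show ?case
    proof
      assume s: "sq_int (\<lambda>x. v x + u x)"
      have "sq_int u" unfolding sq_int_def
      proof
        show "integrable leb_I (\<lambda>x. (u x)\<^sup>2)"
          by (rule Bochner_Integration.integrable_bound[of _ "\<lambda>x. (v x + u x)\<^sup>2"])
            (use s add in \<open>auto simp: sq_int_def intro!: power_mono\<close>)
      qed (use add in simp)
      moreover have "sq_int v" unfolding sq_int_def
      proof
        show "integrable leb_I (\<lambda>x. (v x)\<^sup>2)"
          by (rule Bochner_Integration.integrable_bound[of _ "\<lambda>x. (v x + u x)\<^sup>2"])
            (use s add in \<open>auto simp: sq_int_def intro!: power_mono\<close>)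
      qed (use add in simp)
      ultimately show "to_L2 (\<lambda>x. v x + u x) \<in> K" using add by (simp add: to_L2_add Kadd)
    qed
  next
    case (seq U)
    show ?case
    proof
      assume s: "sq_int u"
      have le: "U n x \<le> u x" if "x \<in> space leb_I" for n x
      proof (rule incseq_le)
        show "incseq (\<lambda>i. U i x)" using \<open>incseq U\<close> by (auto simp: incseq_def le_fun_def)
        show "(\<lambda>i. U i x) \<longlonglongrightarrow> u x" by (rule seq.hyps) (use that in simp)
      qed
      have sU: "sq_int (U n)" for n unfolding sq_int_def
      proof
        show "integrable leb_I (\<lambda>x. (U n x)\<^sup>2)"
          by (rule Bochner_Integration.integrable_bound[of _ "\<lambda>x. (u x)\<^sup>2"])
            (use s seq.hyps(1,2) le in \<open>auto simp: sq_int_def intro!: power_mono AE_I2\<close>)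
      qed (use seq in simp)
      show "to_L2 u \<in> K"
      proof (rule Kconv[OF sU _ s s])
        show "to_L2 (U n) \<in> K" for n using seq.IH sU by blast
        show "AE x in leb_I. (\<lambda>n. U n x) \<longlonglongrightarrow> u x" using seq.hyps(4) by (intro AE_I2)
        show "AE x in leb_I. \<bar>U n x - u x\<bar> \<le> \<bar>u x\<bar>" for n
        proof (rule AE_I2)
          fix x assume "x \<in> space leb_I"
          then show "\<bar>U n x - u x\<bar> \<le> \<bar>u x\<bar>" using le[of x n] seq.hyps(2)[of n x] by linarith
        qed
      qed
    qed
  qed
  have "w \<in> K" for w
  proof -
    define h where "h = L2_fun w"
    have h: "sq_int h" by (simp add: h_def sq_int_L2_fun)
    have hm [measurable]: "h \<in> borel_measurable leb_I" using h by (simp add: sq_int_def)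
    have sp: "sq_int (\<lambda>x. max 0 (h x))" unfolding sq_int_def
    proof
      show "integrable leb_I (\<lambda>x. (max 0 (h x))\<^sup>2)"
        by (rule Bochner_Integration.integrable_bound[of _ "\<lambda>x. (h x)\<^sup>2"])
          (use h in \<open>auto simp: sq_int_def max_def\<close>)
    qed measurable
    have sn: "sq_int (\<lambda>x. max 0 (- h x))" unfolding sq_int_def
    proof
      show "integrable leb_I (\<lambda>x. (max 0 (- h x))\<^sup>2)"
        by (rule Bochner_Integration.integrable_bound[of _ "\<lambda>x. (h x)\<^sup>2"])
          (use h in \<open>auto simp: sq_int_def max_def\<close>)
    qed measurable
    have "w = to_L2 (\<lambda>x. max 0 (h x) - max 0 (- h x))"
    proof -
      have "(\<lambda>x. max 0 (h x) - max 0 (- h x)) = h" by (auto simp: max_def)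
      then show ?thesis by (simp add: h_def to_L2_L2_fun)
    qed
    also have "\<dots> \<in> K" unfolding to_L2_diff[OF sp sn]
      by (rule Kdiff) (use K_nonneg sp sn in \<open>auto simp: sq_int_def\<close>)
    finally show ?thesis .
  qed
  then show ?thesis by (auto simp: K_def)
qed

instance L2I :: second_countable_topology
proof
  define B where "B = (\<lambda>(l, q). ball (L2_step l) (of_rat q)) ` (UNIV :: ((rat \<times> rat) list \<times> rat) set)"
  have "countable B" unfolding B_def by (intro countable_image) simp
  moreover have "topological_basis B"
  proof (rule topological_basisI)
    show "open b" if "b \<in> B" for b using that by (auto simp: B_def)
    fix U :: "L2I set" and x assume "open U" "x \<in> U"
    then obtain e where e: "e > 0" "ball x e \<subseteq> U" by (auto elim: openE)
    have "x \<in> closure (range L2_step)" by (simp add: L2_step_dense)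
    then obtain l where l: "dist (L2_step l) x < e / 3"
      using e(1) unfolding closure_approachable by (metis (no_types) divide_pos_pos rangeE zero_less_numeral)
    obtain q where q: "e / 3 < of_rat q" "of_rat q < e / 2"
      using of_rat_dense[of "e / 3" "e / 2"] e(1) by auto
    have "ball (L2_step l) (of_rat q) \<subseteq> U"
    proof
      fix z assume "z \<in> ball (L2_step l) (of_rat q)"
      then have "dist x z < e" using l q dist_triangle[of x z "L2_step l"] by (simp add: dist_commute)
      then show "z \<in> U" using e(2) by auto
    qed
    moreover have "x \<in> ball (L2_step l) (of_rat q)" using l q by simp
    moreover have "ball (L2_step l) (of_rat q) \<in> B" by (auto simp: B_def)
    ultimately show "\<exists>b\<in>B. x \<in> b \<and> b \<subseteq> U" by blast
  qed
  ultimately show "\<exists>B::L2I set set. countable B \<and> open = generate_topology B"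
    using topological_basis_imp_subbasis by blast
qed

definition Linf_I :: "L2I set" where
  "Linf_I = {w. \<exists>C. AE x in leb_I. \<bar>L2_fun w x\<bar> \<le> C}"

definition test_function :: "real set \<Rightarrow> (real \<Rightarrow> real) \<Rightarrow> bool" where
  "test_function J \<phi> \<longleftrightarrow>
     (\<forall>k x. (deriv ^^ k) \<phi> differentiable (at x)) \<and>
     (\<exists>K. compact K \<and> K \<subseteq> J \<and> (\<forall>x. x \<notin> K \<longrightarrow> \<phi> x = 0))"

(* Distributional derivative on the open set J, used both for real functions of x and for
   L2I-valued functions of t. *)
definition weak_deriv ::
  "real set \<Rightarrow> (real \<Rightarrow> 'b::{banach, second_countable_topology}) \<Rightarrow> (real \<Rightarrow> 'b) \<Rightarrow> bool" where
  "weak_deriv J f d \<longleftrightarrow>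
     (\<forall>K. compact K \<and> K \<subseteq> J \<longrightarrow> set_integrable lborel K f \<and> set_integrable lborel K d) \<and>
     (\<forall>\<phi>. test_function J \<phi> \<longrightarrow>
        (LINT x:J|lborel. deriv \<phi> x *\<^sub>R f x) = - (LINT x:J|lborel. \<phi> x *\<^sub>R d x))"

definition rho :: "real \<Rightarrow> real" where
  "rho x = 1 - x\<^sup>2"

definition V :: "L2I set" where
  "V = {w. \<exists>d. weak_deriv II (L2_fun w) d \<and> set_integrable lborel II (\<lambda>x. rho x * (d x)\<^sup>2)}"

(* A representative of the weak derivative w', determined up to a null set; only meaningful if the
   weak derivative exists, in particular for w in V. *)
definition wd :: "L2I \<Rightarrow> real \<Rightarrow> real" where
  "wd w = (SOME d. weak_deriv II (L2_fun w) d)"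

definition energy :: "L2I \<Rightarrow> L2I \<Rightarrow> real" where
  "energy v w = (LINT x:II|lborel. rho x * wd v x * wd w x)"

definition norm_V :: "L2I \<Rightarrow> real" where
  "norm_V w = norm w + sqrt (LINT x:II|lborel. rho x * (wd w x)\<^sup>2)"

(* Elements of V' are functions on L2I of which only the values on V matter.  A function h in L2I is
   identified with the functional inner h. *)
definition dual_V :: "(L2I \<Rightarrow> real) set" where
  "dual_V = {\<phi>. (\<forall>v\<in>V. \<forall>w\<in>V. \<phi> (v + w) = \<phi> v + \<phi> w) \<and>
                (\<forall>c. \<forall>v\<in>V. \<phi> (c *\<^sub>R v) = c * \<phi> v) \<and>
                (\<exists>C. \<forall>v\<in>V. \<bar>\<phi> v\<bar> \<le> C * norm_V v)}"

definition dual_norm_V :: "(L2I \<Rightarrow> real) \<Rightarrow> ennreal" where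
  "dual_norm_V \<phi> = (SUP v\<in>{v \<in> V. norm_V v \<le> 1}. ennreal \<bar>\<phi> v\<bar>)"

(* The graph of v |-> (rho v')' on its maximal domain in L2I.  No boundary condition has to be added:
   if v is in V and (rho v')' in L^2, then rho v' has limits at both endpoints, and these vanish since
   rho |v'|^2 would not be integrable otherwise. *)
definition diffusion_graph :: "(L2I \<times> L2I) set" where
  "diffusion_graph = {(v, h). v \<in> V \<and> weak_deriv II (\<lambda>x. rho x * wd v x) (L2_fun h)}"

definition diffusion :: "L2I \<Rightarrow> L2I" where
  "diffusion v = (THE h. (v, h) \<in> diffusion_graph)"

definition C0_semigroup :: "(real \<Rightarrow> L2I \<Rightarrow>\<^sub>L L2I) \<Rightarrow> bool" where
  "C0_semigroup T \<longleftrightarrow>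
     T 0 = id_blinfun \<and>
     (\<forall>s\<ge>0. \<forall>t\<ge>0. T (s + t) = T s o\<^sub>L T t) \<and>
     (\<forall>v. ((\<lambda>t. T t v) \<longlongrightarrow> v) (at_right 0))"

definition generator :: "(real \<Rightarrow> L2I \<Rightarrow>\<^sub>L L2I) \<Rightarrow> (L2I \<times> L2I) set" where
  "generator T = {(v, h). ((\<lambda>t. (1 / t) *\<^sub>R (T t v - v)) \<longlongrightarrow> h) (at_right 0)}"

(* L^oo(I x (0,oo)): a function F(x,t) is viewed as the function of t with values F(.,t) in L2I. *)
definition Linf_cyl :: "(real \<Rightarrow> L2I) set" where
  "Linf_cyl = {w. \<exists>F C. F \<in> borel_measurable borel \<and>
     (AE p in lborel. p \<in> II \<times> {0<..} \<longrightarrow> \<bar>F p\<bar> \<le> C) \<and>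
     (AE t in lborel. 0 < t \<longrightarrow> (AE x in leb_I. L2_fun (w t) x = F (x, t)))}"

definition Linf_time_V :: "(real \<Rightarrow> L2I) set" where
  "Linf_time_V = {w. set_borel_measurable lborel {0<..} w \<and>
     (\<exists>C. AE t in lborel. 0 < t \<longrightarrow> w t \<in> V \<and> norm_V (w t) \<le> C)}"

definition L2_time_L2 :: "(real \<Rightarrow> L2I) set" where
  "L2_time_L2 = {w. set_borel_measurable lborel {0<..} w \<and>
     set_integrable lborel {0<..} (\<lambda>t. (norm (w t))\<^sup>2)}"

definition maximal_monotone :: "(real \<Rightarrow> real set) \<Rightarrow> bool" where
  "maximal_monotone \<beta> \<longleftrightarrow>
     (\<forall>r s. \<forall>a\<in>\<beta> r. \<forall>b\<in>\<beta> s. 0 \<le> (a - b) * (r - s)) \<and>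
     (\<forall>r a. (\<forall>s. \<forall>b\<in>\<beta> s. 0 \<le> (a - b) * (r - s)) \<longrightarrow> a \<in> \<beta> r)"

definition measurable_section ::
  "(real \<Rightarrow> real set) \<Rightarrow> (real \<Rightarrow> L2I) \<Rightarrow> (real \<times> real \<Rightarrow> real) \<Rightarrow> bool" where
  "measurable_section \<beta> u b \<longleftrightarrow>
     b \<in> borel_measurable borel \<and>
     (AE t in lborel. 0 < t \<longrightarrow> (AE x in leb_I. b (x, t) \<in> \<beta> (L2_fun (u t) x)))"

definition reaction ::
  "real \<Rightarrow> L2I \<Rightarrow> (real \<Rightarrow> real) \<Rightarrow> (real \<times> real \<Rightarrow> real) \<Rightarrow> (real \<Rightarrow> L2I) \<Rightarrow> real \<Rightarrow> L2I" where
  "reaction Q S g b u t = to_L2 (\<lambda>x. Q * L2_fun S x * b (x, t) - g (L2_fun (u t) x))"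

definition variation_of_constants ::
  "(real \<Rightarrow> L2I \<Rightarrow>\<^sub>L L2I) \<Rightarrow> L2I \<Rightarrow> (real \<Rightarrow> L2I) \<Rightarrow> (real \<Rightarrow> L2I) \<Rightarrow> bool" where
  "variation_of_constants T y0 F y \<longleftrightarrow>
     (\<forall>t\<ge>0. set_integrable lborel {0..t} F \<and>
             y t = T t y0 + (LINT s:{0..t}|lborel. T (t - s) (F s)))"

(* y' - (rho y')' + g(y + Z) in Q S beta(y + Z) + h, y(0) = y0.  The condition on g(y + Z) makes the
   class formed by to_L2 in reaction meaningful. *)
definition mild_solution ::
  "(real \<Rightarrow> L2I \<Rightarrow>\<^sub>L L2I) \<Rightarrow> real \<Rightarrow> L2I \<Rightarrow> (real \<Rightarrow> real) \<Rightarrow> (real \<Rightarrow> real set) \<Rightarrow>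
   (real \<Rightarrow> L2I) \<Rightarrow> (real \<Rightarrow> L2I) \<Rightarrow> L2I \<Rightarrow> (real \<Rightarrow> L2I) \<Rightarrow> bool" where
  "mild_solution T Q S g \<beta> Z h y0 y \<longleftrightarrow>
     (\<exists>b. measurable_section \<beta> (\<lambda>t. y t + Z t) b \<and>
          (AE t in lborel. 0 < t \<longrightarrow> sq_int (\<lambda>x. g (L2_fun (y t + Z t) x))) \<and>
          variation_of_constants T y0 (\<lambda>t. reaction Q S g b (\<lambda>t. y t + Z t) t + h t) y)"

(* The pathwise value of the stochastic convolution of T(t-s) with G_s dW_s over [0,t], expressed
   through the path Z_t of the stochastic integral of G (with Z_0 = 0) by integration by parts in s,
   where d/ds T(t-s) = - T(t-s) A for the generator A of T. *)
definition stochastic_convolution ::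
  "(real \<Rightarrow> L2I \<Rightarrow>\<^sub>L L2I) \<Rightarrow> (real \<Rightarrow> L2I) \<Rightarrow> real \<Rightarrow> L2I" where
  "stochastic_convolution T Z t = Z t + (LINT s:{0..t}|lborel. T (t - s) (diffusion (Z s)))"

(* du - (rho u')' dt + g(u) dt in Q S beta(u) dt + f dt + G dW, u(0) = u0, for a fixed path Z of the
   stochastic integral of G. *)
definition stochastic_mild_solution ::
  "(real \<Rightarrow> L2I \<Rightarrow>\<^sub>L L2I) \<Rightarrow> real \<Rightarrow> L2I \<Rightarrow> (real \<Rightarrow> real) \<Rightarrow> (real \<Rightarrow> real set) \<Rightarrow>
   (real \<Rightarrow> L2I) \<Rightarrow> (real \<Rightarrow> L2I) \<Rightarrow> L2I \<Rightarrow> (real \<Rightarrow> L2I) \<Rightarrow> bool" where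
  "stochastic_mild_solution T Q S g \<beta> f Z u0 u \<longleftrightarrow>
     u 0 = u0 \<and>
     (\<exists>b. measurable_section \<beta> u b \<and>
          (AE t in lborel. 0 < t \<longrightarrow> sq_int (\<lambda>x. g (L2_fun (u t) x))) \<and>
          variation_of_constants T u0 (\<lambda>t. reaction Q S g b u t + f t)
            (\<lambda>t. u t - stochastic_convolution T Z t))"

definition omega_limit :: "(real \<Rightarrow> L2I) \<Rightarrow> L2I set" where
  "omega_limit y = {w \<in> V \<inter> Linf_I.
     \<exists>t :: nat \<Rightarrow> real. filterlim t at_top sequentially \<and> (\<lambda>n. y (t n)) \<longlonglongrightarrow> w}"

definition bounded_stationary_solution ::
  "real \<Rightarrow> L2I \<Rightarrow> (real \<Rightarrow> real) \<Rightarrow> (real \<Rightarrow> real set) \<Rightarrow> (L2I \<Rightarrow> real) \<Rightarrow> L2I \<Rightarrow> bool" where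
  "bounded_stationary_solution Q S g \<beta> \<phi> w \<longleftrightarrow>
     w \<in> V \<inter> Linf_I \<and>
     (\<exists>z\<in>Linf_I. (AE x in leb_I. L2_fun z x \<in> \<beta> (L2_fun w x)) \<and>
        (\<forall>v\<in>V. energy w v + (LINT x|leb_I. g (L2_fun w x) * L2_fun v x)
               = (LINT x|leb_I. Q * L2_fun S x * L2_fun z x * L2_fun v x) + \<phi> v))"

end

theory Submission
  imports Defs "HOL-Complex_Analysis.Great_Picard"
begin

text \<open>The operator \<open>v \<mapsto> (rho v')'\<close> is characterised by \<open>inner (wgrad w) (wgrad v) = - inner h v\<close> for all \<open>v\<close>
  in \<open>V\<close>; in particular its graph is a closed subspace. Averaging the variation of constants formula over
  \<open>[a, c]\<close> puts \<open>(\<integral>y, y c - y a - \<integral>F)\<close> into this graph, and since \<open>y\<close> has the time derivative \<open>dy\<close>, the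
  equation \<open>(rho y')' = dy - F\<close> holds at almost every time.

  Given \<open>y (t n)\<close> converging to \<open>y_inf\<close>, the three windowed integrals over \<open>[t n, t n + 1]\<close> tend to zero, so there
  are times \<open>s n\<close> in these windows at which the pointwise equation holds while \<open>dy\<close> and the dual norms of
  the deviations of \<open>f\<close> and of the diffusion of \<open>Z\<close> are small. As \<open>dy\<close> is square integrable, \<open>y (s n)\<close>
  converges to \<open>y_inf\<close> as well. A weak cluster point of \<open>wgrad (y (s n))\<close> and of the sections
  \<open>b (\<cdot>, s n)\<close>, moved to the nearest points of the segments \<open>\<beta> (u_inf)\<close>, gives the stationary equation. Testing
  the difference of the two equations with \<open>y (s n) - y_inf\<close> gives strong convergence in \<open>V\<close>.\<close>

text \<open>The operator degenerates at both endpoints, which shapes two steps. No boundary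
  condition is imposed, so testing with all of \<open>V\<close> requires the flux
  \<open>rho w'\<close> to vanish at the endpoints; integrability of \<open>rho |w'|^2\<close>
  forces this. Near the endpoints a bound in \<open>V\<close> gives no uniform continuity, so
  compactness combines local Hoelder bounds with the sup bound on \<open>y\<close>. A mild solution
  satisfies the equation a priori only after integration in time, and the data converge only in
  averaged dual norms. Hence single times are selected; the times in (iii) are these and need not be
  the given ones. \<open>g\<close> has no growth bound, so \<open>g(u)\<close> passes to the limit
  only while \<open>u\<close> stays bounded; for \<open>Z\<close> this comes from the bound on
  \<open>(rho Z')'\<close>. The sections of \<open>\<beta>\<close> have only weak limits, which are
  located by means of closed convex sets. In (iii) the sections are paired with a difference that
  tends to 0 in \<open>L2I\<close>, so their boundedness is enough.\<close>

section \<open>Test functions\<close>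

text \<open>\<open>exp(-c/x)\<close> is flat at 0, so cutting it off there keeps it smooth. The
  factor \<open>poly p (1 / x)\<close> makes the family closed under differentiation, and the rate
  \<open>c\<close> is kept as a parameter because bumps with small \<open>c\<close> approach
  indicators.\<close>

definition exp_cut :: "real \<Rightarrow> real poly \<Rightarrow> real \<Rightarrow> real" where
  "exp_cut c p x = (if x > 0 then poly p (1 / x) * exp (- c / x) else 0)"

text \<open>In \<open>t = 1/x\<close> this is a polynomial times \<open>exp(-c t)\<close> at
  infinity.\<close>

lemma exp_cut_aux_tendsto:
  fixes c :: real
  assumes "c > 0"
  shows "((\<lambda>x. poly p (1 / x) * exp (- c / x)) \<longlongrightarrow> 0) (at_right 0)"
proof -
  have 1: "((\<lambda>t::real. t ^ k / exp (c * t)) \<longlongrightarrow> 0) at_top" for k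
  proof -
    have "((\<lambda>t::real. (c * t) ^ k / exp (c * t)) \<longlongrightarrow> 0) at_top"
      by (rule filterlim_compose[OF tendsto_power_div_exp_0 filterlim_tendsto_pos_mult_at_top[OF tendsto_const assms filterlim_ident]])
    then have "((\<lambda>t::real. (1 / c ^ k) * ((c * t) ^ k / exp (c * t))) \<longlongrightarrow> (1 / c ^ k) * 0) at_top"
      by (intro tendsto_intros)
    moreover have "(1 / c ^ k) * ((c * t) ^ k / exp (c * t)) = t ^ k / exp (c * t)" for t
      using assms by (simp add: power_mult_distrib)
    ultimately show ?thesis by simp
  qed
  have "((\<lambda>t::real. \<Sum>i\<le>degree p. coeff p i * (t ^ i / exp (c * t))) \<longlongrightarrow> (\<Sum>i\<le>degree p. coeff p i * 0)) at_top"
    by (intro tendsto_intros 1)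
  then have "((\<lambda>t::real. poly p t * exp (- c * t)) \<longlongrightarrow> 0) at_top"
    by (simp add: poly_altdef sum_distrib_right sum_divide_distrib exp_minus field_simps)
  from filterlim_compose[OF this filterlim_inverse_at_top_right]
  show ?thesis by (simp add: inverse_eq_divide)
qed

text \<open>With \<open>t = 1/x\<close> one has \<open>d/dx = -t^2 d/dt\<close>, which sends
  \<open>p(t) exp(-c t)\<close> to \<open>t^2 (c p - p') exp(-c t)\<close>;
  \<open>[:0, 0, 1:]\<close> is the polynomial \<open>t^2\<close>. At 0 the difference quotient is
  the same expression with \<open>t p\<close> in place of \<open>p\<close>, so it tends to
  0.\<close>

lemma exp_cut_deriv:
  assumes c: "c > 0"
  shows "(exp_cut c p has_real_derivative exp_cut c ([:0, 0, 1:] * (smult c p - pderiv p)) x) (at x)"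
proof -
  define q where "q = [:0, 0, 1:] * (smult c p - pderiv p)"
  consider "x > 0" | "x < 0" | "x = 0" by linarith
  then show ?thesis
  proof cases
    case 1
    have "((\<lambda>x. poly p (1 / x) * exp (- c / x)) has_real_derivative poly q (1 / x) * exp (- c / x)) (at x)"
      using 1 by (auto intro!: derivative_eq_intros poly_DERIV[THEN DERIV_chain2]
          simp: q_def algebra_simps power2_eq_square)
    moreover have "eventually (\<lambda>y. y \<in> {0<..}) (nhds x)"
      using 1 by (intro eventually_nhds_in_open) auto
    then have "eventually (\<lambda>y. exp_cut c p y = poly p (1 / y) * exp (- c / y)) (nhds x)"
      by eventually_elim (simp add: exp_cut_def)
    ultimately show ?thesis using 1
      by (subst DERIV_cong_ev[OF refl _ refl]) (auto simp: exp_cut_def q_def)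
  next
    case 2
    have "eventually (\<lambda>y. y \<in> {..<0}) (nhds x)"
      using 2 by (intro eventually_nhds_in_open) auto
    then have "eventually (\<lambda>y. exp_cut c p y = 0) (nhds x)"
      by eventually_elim (simp add: exp_cut_def)
    then show ?thesis using 2
      by (subst DERIV_cong_ev[OF refl _ refl]) (auto simp: exp_cut_def)
  next
    case 3
    have "((\<lambda>h. exp_cut c p h / h) \<longlongrightarrow> 0) (at_right 0)"
    proof (rule Lim_transform_eventually[OF exp_cut_aux_tendsto[OF c, of "[:0, 1:] * p"]])
      show "eventually (\<lambda>x. poly ([:0, 1:] * p) (1 / x) * exp (- c / x) = exp_cut c p x / x) (at_right 0)"
        unfolding eventually_at_right_field by (auto simp: exp_cut_def intro!: exI[of _ 1])
    qed
    moreover have "((\<lambda>h. exp_cut c p h / h) \<longlongrightarrow> 0) (at_left 0)"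
    proof (rule tendsto_eventually)
      show "eventually (\<lambda>x. exp_cut c p x / x = 0) (at_left 0)"
        unfolding eventually_at_left_field by (auto simp: exp_cut_def intro!: exI[of _ "-1"])
    qed
    ultimately have "((\<lambda>h. exp_cut c p h / h) \<longlongrightarrow> 0) (at 0)"
      by (simp add: filterlim_at_split)
    then show ?thesis using 3
      by (simp add: DERIV_def exp_cut_def)
  qed
qed

definition smooth :: "(real \<Rightarrow> real) \<Rightarrow> bool" where
  "smooth f \<longleftrightarrow> (\<forall>k x. (deriv ^^ k) f differentiable (at x))"

text \<open>All iterated derivatives of a member remain in \<open>X\<close>, so smoothness is shown
  by exhibiting one family that is stable under differentiation.\<close>

lemma smoothI_coinduct:
  assumes "f \<in> X" and "\<And>f. f \<in> X \<Longrightarrow> (\<exists>f'\<in>X. \<forall>x. (f has_real_derivative f' x) (at x))"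
  shows "smooth f"
proof -
  have "(deriv ^^ k) f \<in> X" for k
  proof (induction k)
    case (Suc k)
    obtain f' where "f' \<in> X" "\<And>x. ((deriv ^^ k) f has_real_derivative f' x) (at x)"
      using assms(2)[OF Suc] by blast
    moreover from this(2) have "deriv ((deriv ^^ k) f) = f'" by (auto intro!: DERIV_imp_deriv)
    ultimately show ?case by simp
  qed (use assms in simp)
  then show ?thesis
    unfolding smooth_def using assms(2) real_differentiable_def by blast
qed

lemma smooth_DERIV: "smooth f \<Longrightarrow> (f has_real_derivative deriv f x) (at x)"
  unfolding smooth_def using DERIV_deriv_iff_real_differentiable by (metis funpow_0)

lemma smooth_deriv: "smooth f \<Longrightarrow> smooth (deriv f)"
  unfolding smooth_def by (metis comp_apply funpow_Suc_right)

lemma smooth_primitive: "smooth f' \<Longrightarrow> (\<And>x. (f has_real_derivative f' x) (at x)) \<Longrightarrow> smooth f"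
  by (rule smoothI_coinduct[of f "insert f {g. smooth g}"])
    (auto intro: smooth_DERIV smooth_deriv)

lemma smooth_cont: "smooth f \<Longrightarrow> continuous_on A f"
  by (meson DERIV_isCont continuous_at_imp_continuous_on smooth_DERIV)

lemma smooth_lincomb: 
  assumes "smooth f" "smooth g"
  shows "smooth (\<lambda>x. a * f x + b * g x)"
proof (rule smoothI_coinduct[of _ "{\<lambda>x. a * f x + b * g x | f g. smooth f \<and> smooth g}"])
  show "(\<lambda>x. a * f x + b * g x) \<in> {\<lambda>x. a * f x + b * g x | f g. smooth f \<and> smooth g}"
    using assms by blast
  fix h assume "h \<in> {\<lambda>x. a * f x + b * g x | f g. smooth f \<and> smooth g}"
  then obtain f g where h: "h = (\<lambda>x. a * f x + b * g x)" "smooth f" "smooth g" by blast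
  have "(h has_real_derivative a * deriv f x + b * deriv g x) (at x)" for x
    unfolding h(1) using smooth_DERIV[OF h(2)] smooth_DERIV[OF h(3)] by (intro DERIV_add DERIV_cmult)
  then show "\<exists>f'\<in>{\<lambda>x. a * f x + b * g x | f g. smooth f \<and> smooth g}. \<forall>x. (h has_real_derivative f' x) (at x)"
    using smooth_deriv[OF h(2)] smooth_deriv[OF h(3)]
    by (intro bexI[of _ "\<lambda>x. a * deriv f x + b * deriv g x"]) auto
qed

text \<open>Finite sums of products of two \<open>exp_cut\<close> factors are stable under
  differentiation: the product rule turns \<open>n\<close> summands into \<open>n + n\<close>, the
  first block differentiating the left factor and the second the right one, with a minus sign from
  \<open>b - x\<close>.\<close>

lemma smooth_bump:
  assumes c: "c > 0"
  shows "smooth (\<lambda>x. exp_cut c 1 (x - a) * exp_cut c 1 (b - x))"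
proof -
  define X where "X = {\<lambda>x. \<Sum>i<(n::nat). exp_cut c (p i) (x - a) * exp_cut c (q i) (b - x) | n p q. True}"
  define D where "D p = [:0, 0, 1:] * (smult c p - pderiv p)" for p :: "real poly"
  show ?thesis
  proof (rule smoothI_coinduct[of _ X])
    have "(\<lambda>x. exp_cut c 1 (x - a) * exp_cut c 1 (b - x)) = (\<lambda>x. \<Sum>i<(1::nat). exp_cut c 1 (x - a) * exp_cut c 1 (b - x))"
      by simp
    then show "(\<lambda>x. exp_cut c 1 (x - a) * exp_cut c 1 (b - x)) \<in> X"
      unfolding X_def mem_Collect_eq by (intro exI[of _ "1::nat"] exI[of _ "\<lambda>_. 1"] conjI) auto
  next
    fix f assume "f \<in> X"
    then obtain n p q where f: "f = (\<lambda>x. \<Sum>i<(n::nat). exp_cut c (p i) (x - a) * exp_cut c (q i) (b - x))"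
      by (auto simp: X_def)
    define p' where "p' i = (if i < n then D (p i) else p (i - n))" for i
    define q' where "q' i = (if i < n then q i else - D (q (i - n)))" for i
    have neg: "exp_cut c (- r) x = - exp_cut c r x" for r x by (simp add: exp_cut_def)
    have sp: "(\<Sum>i<n + n. h i) = (\<Sum>i<n. h i + h (i + n))" for h :: "nat \<Rightarrow> real"
      using sum.atLeastLessThan_concat[of 0 n "n + n" h] sum.shift_bounds_nat_ivl[of h 0 n n]
      by (simp add: sum.distrib atLeast0LessThan)
    have "(f has_real_derivative (\<Sum>i<n. exp_cut c (D (p i)) (x - a) * exp_cut c (q i) (b - x)
             + exp_cut c (p i) (x - a) * (- exp_cut c (D (q i)) (b - x)))) (at x)" for x
    proof -
      have "((\<lambda>x. exp_cut c r (x - a)) has_real_derivative exp_cut c (D r) (x - a) * 1) (at x)" for r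
        unfolding D_def
        by (rule DERIV_chain2[where f = "exp_cut c r", OF exp_cut_deriv[OF c]]) (auto intro!: derivative_eq_intros)
      then have 1: "((\<lambda>x. exp_cut c r (x - a)) has_real_derivative exp_cut c (D r) (x - a)) (at x)" for r
        by simp
      have "((\<lambda>x. exp_cut c r (b - x)) has_real_derivative exp_cut c (D r) (b - x) * (- 1)) (at x)" for r
        unfolding D_def
        by (rule DERIV_chain2[where f = "exp_cut c r", OF exp_cut_deriv[OF c]]) (auto intro!: derivative_eq_intros)
      then have 2: "((\<lambda>x. exp_cut c r (b - x)) has_real_derivative - exp_cut c (D r) (b - x)) (at x)" for r
        by simp
      show ?thesis unfolding f by (auto intro!: derivative_eq_intros 1 2 simp: algebra_simps)
    qed
    moreover have "(\<lambda>x. \<Sum>i<n. exp_cut c (D (p i)) (x - a) * exp_cut c (q i) (b - x)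
             + exp_cut c (p i) (x - a) * (- exp_cut c (D (q i)) (b - x)))
       = (\<lambda>x. \<Sum>i<n + n. exp_cut c (p' i) (x - a) * exp_cut c (q' i) (b - x))"
      unfolding sp by (intro ext sum.cong) (auto simp: p'_def q'_def neg)
    moreover have "(\<lambda>x. \<Sum>i<n + n. exp_cut c (p' i) (x - a) * exp_cut c (q' i) (b - x)) \<in> X"
      unfolding X_def by blast
    ultimately show "\<exists>f'\<in>X. \<forall>x. (f has_real_derivative f' x) (at x)"
      by (metis (no_types, lifting))
  qed
qed

text \<open>For \<open>c > 0\<close> its values lie in \<open>[0, 1]\<close> and are positive
  exactly on the open interval from \<open>a\<close> to \<open>b\<close>; as \<open>c\<close> tends
  to 0 it converges pointwise to the indicator of that interval.\<close>

definition bump :: "real \<Rightarrow> real \<Rightarrow> real \<Rightarrow> real \<Rightarrow> real" where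
  "bump c a b x = exp_cut c 1 (x - a) * exp_cut c 1 (b - x)"

lemma test_function_iff: "test_function J \<phi> \<longleftrightarrow> smooth \<phi> \<and>
     (\<exists>K. compact K \<and> K \<subseteq> J \<and> (\<forall>x. x \<notin> K \<longrightarrow> \<phi> x = 0))"
  by (simp add: test_function_def smooth_def)

lemma test_function_bump:
  assumes "c > 0" "{a..b} \<subseteq> J"
  shows "test_function J (bump c a b)"
  unfolding test_function_iff
proof
  show "smooth (bump c a b)" unfolding bump_def by (rule smooth_bump[OF assms(1)])
  show "\<exists>K. compact K \<and> K \<subseteq> J \<and> (\<forall>x. x \<notin> K \<longrightarrow> bump c a b x = 0)"
    by (rule exI[of _ "{a..b}"]) (use assms in \<open>auto simp: bump_def exp_cut_def\<close>)
qed

lemma bump_bounds: "c > 0 \<Longrightarrow> 0 \<le> bump c a b x" "c > 0 \<Longrightarrow> bump c a b x \<le> 1"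
  by (auto simp: bump_def exp_cut_def mult_le_one)

lemma bump_pos: "x \<in> {a<..<b} \<Longrightarrow> bump c a b x > 0"
  by (auto simp: bump_def exp_cut_def)

lemma bump_tendsto: "(\<lambda>n. bump (1 / Suc n) a b x) \<longlonglongrightarrow> indicator {a<..<b} x"
proof (cases "x \<in> {a<..<b}")
  case True
  have "(\<lambda>n. exp (- (1 / real (Suc n)) / (x - a)) * exp (- (1 / real (Suc n)) / (b - x))) \<longlonglongrightarrow> exp (- 0 / (x - a)) * exp (- 0 / (b - x))"
    by (intro tendsto_intros LIMSEQ_Suc lim_1_over_n) (use True in auto)
  then show ?thesis using True by (simp add: bump_def exp_cut_def)
next
  case False
  then show ?thesis by (auto simp: bump_def exp_cut_def)
qed

lemma test_function_cont: "test_function J \<phi> \<Longrightarrow> continuous_on A \<phi>"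
  by (auto simp: test_function_iff smooth_cont)

lemma test_function_measurable: "test_function J \<phi> \<Longrightarrow> \<phi> \<in> borel_measurable borel"
  using test_function_cont borel_measurable_continuous_onI by blast

text \<open>The support is only known to lie in some compact subset of \<open>J\<close>. Adding a
  point of \<open>J\<close> makes this set nonempty, so that its minimum and maximum exist even for
  \<open>\<phi> = 0\<close>; convexity of \<open>J\<close> then admits the whole interval between
  them.\<close>

lemma test_function_interval:
  assumes "test_function J \<phi>" "is_interval J" "J \<noteq> {}"
  obtains \<alpha> \<beta> where "\<alpha> \<le> \<beta>" "{\<alpha>..\<beta>} \<subseteq> J" "\<forall>x. x \<notin> {\<alpha>..\<beta>} \<longrightarrow> \<phi> x = 0"
proof -
  obtain K where K: "compact K" "K \<subseteq> J" "\<And>x. x \<notin> K \<Longrightarrow> \<phi> x = 0"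
    using assms(1) by (auto simp: test_function_iff)
  obtain z where z: "z \<in> J" using assms(3) by blast
  define K' where "K' = insert z K"
  have K': "compact K'" "K' \<subseteq> J" "K' \<noteq> {}" using K z by (auto simp: K'_def)
  obtain \<alpha> where a: "\<alpha> \<in> K'" "\<And>x. x \<in> K' \<Longrightarrow> \<alpha> \<le> x" using compact_attains_inf[OF K'(1,3)] by blast
  obtain \<beta> where b: "\<beta> \<in> K'" "\<And>x. x \<in> K' \<Longrightarrow> x \<le> \<beta>" using compact_attains_sup[OF K'(1,3)] by blast
  show thesis
  proof (rule that)
    show "\<alpha> \<le> \<beta>" using a b by blast
    have "\<alpha> \<in> J" "\<beta> \<in> J" using a(1) b(1) K'(2) by auto
    then show "{\<alpha>..\<beta>} \<subseteq> J"
      using mem_is_interval_1_I[OF assms(2) \<open>\<alpha> \<in> J\<close> \<open>\<beta> \<in> J\<close>] by (meson atLeastAtMost_iff subsetI)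
    show "\<forall>x. x \<notin> {\<alpha>..\<beta>} \<longrightarrow> \<phi> x = 0"
    proof (intro allI impI, rule K(3), rule notI)
      fix x assume "x \<notin> {\<alpha>..\<beta>}" "x \<in> K"
      moreover from this have "x \<in> K'" by (simp add: K'_def)
      ultimately show False using a(2) b(2) by simp
    qed
  qed
qed

lemma test_function_deriv_zero:
  assumes "smooth \<phi>" "\<forall>x. x \<notin> {\<alpha>..\<beta>} \<longrightarrow> \<phi> x = 0"
  shows "\<forall>x. x \<notin> {\<alpha>..\<beta>} \<longrightarrow> deriv \<phi> x = 0"
proof (intro allI impI)
  fix x assume x: "x \<notin> {\<alpha>..\<beta>}"
  have "eventually (\<lambda>y. y \<in> - {\<alpha>..\<beta>}) (nhds x)"
    using x by (intro eventually_nhds_in_open) auto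
  then have "eventually (\<lambda>y. \<phi> y = 0) (nhds x)" by eventually_elim (use assms(2) in auto)
  then have "(\<phi> has_real_derivative 0) (at x)" by (subst DERIV_cong_ev[OF refl _ refl]) auto
  then show "deriv \<phi> x = 0" by (rule DERIV_imp_deriv)
qed

lemma test_function_deriv:
  assumes "test_function J \<phi>" "is_interval J" "J \<noteq> {}"
  shows "test_function J (deriv \<phi>)"
proof -
  have s: "smooth \<phi>" using assms(1) by (simp add: test_function_iff)
  obtain \<alpha> \<beta> where ab: "{\<alpha>..\<beta>} \<subseteq> J" "\<forall>x. x \<notin> {\<alpha>..\<beta>} \<longrightarrow> \<phi> x = 0"
    by (rule test_function_interval[OF assms]) auto
  show ?thesis unfolding test_function_iff
  proof (intro conjI exI[of _ "{\<alpha>..\<beta>}"] allI impI)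
    show "deriv \<phi> x = 0" if "x \<notin> {\<alpha>..\<beta>}" for x
      using that test_function_deriv_zero[OF s ab(2)] by blast
  qed (use s ab in \<open>auto intro: smooth_deriv\<close>)
qed

section \<open>Locally integrable functions\<close>

text \<open>A Dynkin class argument: half-lines form an intersection-stable generator of the Borel
  sets, complements use the full integral, and countable disjoint unions use that \<open>G\<close>
  is closed.\<close>

lemma set_integral_in_closed_subspace:
  fixes q :: "real \<Rightarrow> 'a::{banach, second_countable_topology}"
  assumes q: "integrable lborel q" and G: "closed G" "subspace G"
    and half: "\<And>a. (LINT x:{..a}|lborel. q x) \<in> G" and full: "(LINT x|lborel. q x) \<in> G"
    and E: "E \<in> sets borel"
  shows "(LINT x:E|lborel. q x) \<in> G"
proof -
  have qE: "set_integrable lborel A q" if "A \<in> sets borel" for A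
    using q that by (simp add: set_integrable_def integrable_mult_indicator)
  have sb: "sets borel = sigma_sets UNIV (range (\<lambda>a::real. {..a}))"
    by (subst borel_eq_atMost) simp
  have "Int_stable (range (\<lambda>a::real. {..a}))"
    by (auto simp: Int_stable_def Int_atMost)
  moreover have "range (\<lambda>a::real. {..a}) \<subseteq> Pow UNIV" by simp
  moreover have "E \<in> sigma_sets UNIV (range (\<lambda>a::real. {..a}))" using E unfolding sb .
  ultimately show ?thesis
  proof (induction rule: sigma_sets_induct_disjoint)
    case (basic A)
    then show ?case using half by auto
  next
    case empty
    then show ?case using subspace_0[OF G(2)] by (simp add: set_lebesgue_integral_def)
  next
    case (compl A)
    then have A: "A \<in> sets borel" using sb by simp
    have "(LINT x:A \<union> (UNIV - A)|lborel. q x) = (LINT x:A|lborel. q x) + (LINT x:UNIV - A|lborel. q x)"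
      using A by (intro set_integral_Un qE) auto
    then have "(LINT x:UNIV - A|lborel. q x) = (LINT x|lborel. q x) - (LINT x:A|lborel. q x)"
      by (simp add: set_lebesgue_integral_def)
    then show ?case using subspace_diff[OF G(2) full compl(2)] by simp
  next
    case (union A)
    have A: "A i \<in> sets borel" for i using union(2) sb by auto
    have part: "(LINT x:(\<Union>i<n. A i)|lborel. q x) \<in> G" for n :: nat
    proof (induction n)
      case 0
      then show ?case using subspace_0[OF G(2)] by (simp add: set_lebesgue_integral_def)
    next
      case (Suc n)
      have "(\<Union>i<n. A i) \<inter> A n = {}"
        using union(1) unfolding disjoint_family_on_def by (fastforce dest: less_imp_neq)
      then have "(LINT x:(\<Union>i<n. A i) \<union> A n|lborel. q x) = (LINT x:(\<Union>i<n. A i)|lborel. q x) + (LINT x:A n|lborel. q x)"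
        using A by (intro set_integral_Un qE) auto
      moreover have "(\<Union>i<Suc n. A i) = (\<Union>i<n. A i) \<union> A n" by (auto simp: lessThan_Suc)
      ultimately show ?case using subspace_add[OF G(2) Suc union(3)] by simp
    qed
    have "(\<lambda>n. LINT x:(\<Union>i<n. A i)|lborel. q x) \<longlonglongrightarrow> (LINT x:(\<Union>n. \<Union>i<n. A i)|lborel. q x)"
      by (rule set_integral_cont_up) (use A in \<open>auto intro!: qE sets.countable_UN sets.finite_UN incseq_SucI simp: lessThan_Suc\<close>)
    moreover have "(\<Union>n. \<Union>i<n. A i) = (\<Union>i. A i)" by auto
    ultimately show ?case using closed_sequentially[OF G(1), of "\<lambda>n. LINT x:(\<Union>i<n. A i)|lborel. q x"] part by simp
  qed
qed

text \<open>The mean of \<^term>\<open>q\<close> over the set where \<^term>\<open>q\<close> lies in a ball disjoint from \<^term>\<open>G\<close> would lie both in that ball and in \<^term>\<open>G\<close>.\<close>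

lemma AE_in_closed_subspace_integrable:
  fixes q :: "real \<Rightarrow> 'a::{banach, second_countable_topology}"
  assumes q: "integrable lborel q" and G: "closed G" "subspace G"
    and half: "\<And>a. (LINT x:{..a}|lborel. q x) \<in> G" and full: "(LINT x|lborel. q x) \<in> G"
  shows "AE x in lborel. q x \<in> G"
proof -
  have [measurable]: "q \<in> borel_measurable borel" using borel_measurable_integrable[OF q] by simp
  \<comment> \<open>The closed balls have to miss \<open>G\<close> because the mean value below is
    only known to lie in the closed ball. The corresponding open balls still cover the complement of
    \<open>G\<close>, and by Lindeloef countably many of them do.\<close>
  define F where "F = {ball c r | c r. cball c r \<inter> G = {}}"
  obtain F' where F': "F' \<subseteq> F" "countable F'" "\<Union>F' = \<Union>F"
    by (rule Lindelof[of F]) (auto simp: F_def)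
  have cov: "\<Union>F' = - G"
  proof
    show "\<Union>F' \<subseteq> - G" unfolding F' F_def using ball_subset_cball by blast
    show "- G \<subseteq> \<Union>F'" unfolding F'(3)
    proof
      fix x assume "x \<in> - G"
      moreover have "open (- G)" using G(1) by (simp add: closed_def)
      ultimately obtain e where "e > 0" "cball x e \<subseteq> - G" by (auto simp: open_contains_cball)
      then have "ball x e \<in> F" "x \<in> ball x e" by (auto simp: F_def)
      then show "x \<in> \<Union>F" by blast
    qed
  qed
  have "AE x in lborel. q x \<notin> B" if "B \<in> F'" for B
  proof -
    obtain c r where B: "B = ball c r" "cball c r \<inter> G = {}" using \<open>B \<in> F'\<close> F'(1) unfolding F_def by blast
    \<comment> \<open>Truncation makes the measure of \<open>E\<close> finite, so that the mean of
      \<open>q\<close> over \<open>E\<close> exists.\<close>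
    have "AE x in lborel. x \<in> {-real n..real n} \<longrightarrow> q x \<notin> B" for n
    proof -
      define E where "E = {x. q x \<in> B} \<inter> {-real n..real n}"
      have "E = q -` B \<inter> {-real n..real n}" by (auto simp: E_def)
      then have E [measurable]: "E \<in> sets borel"
        using measurable_sets_borel[of q borel B] by (simp add: B(1))
      have "emeasure lborel E \<le> emeasure lborel {-real n..real n}"
        by (rule emeasure_mono) (auto simp: E_def)
      also have "\<dots> < \<infinity>" by (simp add: emeasure_lborel_Icc_eq)
      finally have fin: "emeasure lborel E < \<infinity>" .
      have "measure lborel E = 0"
      proof (rule ccontr)
        assume "measure lborel E \<noteq> 0"
        then have m: "measure lborel E > 0" by (simp add: zero_less_measure_iff)
        define v where "v = (LINT x:E|lborel. q x)"
        have v: "v \<in> G" unfolding v_def by (rule set_integral_in_closed_subspace[OF q G half full E])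
        have c: "integrable lborel (\<lambda>x. indicator E x *\<^sub>R c)"
          using fin by (intro integrable_scaleR_left integrable_real_indicator) auto
        have qi: "integrable lborel (\<lambda>x. indicator E x *\<^sub>R q x)"
          using q by (simp add: integrable_mult_indicator)
        have "v - measure lborel E *\<^sub>R c = (LINT x|lborel. indicator E x *\<^sub>R q x - indicator E x *\<^sub>R c)"
          unfolding v_def set_lebesgue_integral_def using c qi fin by simp
        also have "norm \<dots> \<le> (LINT x|lborel. indicator E x *\<^sub>R r)"
        proof (rule Bochner_Integration.integral_norm_bound_integral)
          show "norm (indicator E x *\<^sub>R q x - indicator E x *\<^sub>R c) \<le> indicator E x *\<^sub>R r" for x
            by (auto simp: indicator_def E_def B(1) dist_norm norm_minus_commute less_imp_le)
        qed (use c qi fin in auto)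
        also have "\<dots> = measure lborel E * r" using fin by simp
        finally have "norm (v - measure lborel E *\<^sub>R c) \<le> measure lborel E * r" .
        then have "norm (measure lborel E *\<^sub>R ((1 / measure lborel E) *\<^sub>R v - c)) \<le> measure lborel E * r"
          using m by (simp add: scaleR_diff_right)
        then have "norm ((1 / measure lborel E) *\<^sub>R v - c) \<le> r" using m by simp
        moreover have "(1 / measure lborel E) *\<^sub>R v \<in> G" using subspace_scale[OF G(2) v] .
        ultimately show False using B(2) by (auto simp: dist_norm norm_minus_commute)
      qed
      then have "emeasure lborel E = 0" using fin by (simp add: emeasure_eq_ennreal_measure)
      then have "AE x in lborel. x \<notin> E" using AE_iff_measurable[of E lborel "\<lambda>x. x \<notin> E"] by simp
      then show ?thesis by eventually_elim (auto simp: E_def)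
    qed
    then have "AE x in lborel. \<forall>n. x \<in> {-real n..real n} \<longrightarrow> q x \<notin> B" unfolding AE_all_countable by blast
    then show ?thesis
    proof eventually_elim
      case (elim x)
      obtain n :: nat where "\<bar>x\<bar> \<le> real n" using real_arch_simple by blast
      then show ?case using elim by (auto simp: abs_le_iff)
    qed
  qed
  then have "AE x in lborel. \<forall>B\<in>F'. q x \<notin> B" unfolding AE_ball_countable[OF F'(2)] by blast
  then show ?thesis by eventually_elim (use cov in auto)
qed

text \<open>Localises the integrable case: outside a compact interval the function is set to 0,
  which lies in \<open>G\<close>, and \<open>J\<close> is a countable union of compact
  intervals.\<close>

lemma AE_in_closed_subspace:
  fixes p :: "real \<Rightarrow> 'a::{banach, second_countable_topology}"
  assumes J: "open J" and G: "closed G" "subspace G"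
    and p: "\<And>a b. {a..b} \<subseteq> J \<Longrightarrow> set_integrable lborel {a..b} p"
    and int: "\<And>a b. a < b \<Longrightarrow> {a..b} \<subseteq> J \<Longrightarrow> (LINT x:{a..b}|lborel. p x) \<in> G"
  shows "AE x in lborel. x \<in> J \<longrightarrow> p x \<in> G"
proof -
  \<comment> \<open>Degenerate and empty intervals occur below when a half-line cuts
    \<open>[a, b]\<close> off at or before \<open>a\<close>.\<close>
  have int': "(LINT x:{a..b}|lborel. p x) \<in> G" if "{a..b} \<subseteq> J" for a b
  proof (cases "a < b")
    case False
    have "AE x in lborel. x \<notin> {a..b}"
      using AE_lborel_singleton[of a] by eventually_elim (use False in auto)
    then have "(LINT x:{a..b}|lborel. p x) = 0"
      unfolding set_lebesgue_integral_def by (intro integral_eq_zero_AE) (auto elim: eventually_mono)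
    then show ?thesis using subspace_0[OF G(2)] by simp
  qed (use int that in blast)
  have *: "AE x in lborel. x \<in> {a..b} \<longrightarrow> p x \<in> G" if "{a..b} \<subseteq> J" for a b
  proof -
    have "AE x in lborel. indicator {a..b} x *\<^sub>R p x \<in> G"
    proof (rule AE_in_closed_subspace_integrable[OF _ G])
      show "integrable lborel (\<lambda>x. indicator {a..b} x *\<^sub>R p x)"
        using p[OF that] by (simp add: set_integrable_def)
      show "(LINT x|lborel. indicator {a..b} x *\<^sub>R p x) \<in> G"
        using int'[OF that] by (simp add: set_lebesgue_integral_def)
      fix c
      have "(LINT x:{..c}|lborel. indicator {a..b} x *\<^sub>R p x) = (LINT x:{a..min b c}|lborel. p x)"
        unfolding set_lebesgue_integral_def by (intro Bochner_Integration.integral_cong) (auto simp: indicator_def)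
      then show "(LINT x:{..c}|lborel. indicator {a..b} x *\<^sub>R p x) \<in> G"
        using int'[of a "min b c"] order_trans[OF _ that, of "{a..min b c}"] by auto
    qed
    then show ?thesis by eventually_elim (auto simp: indicator_def)
  qed
  obtain \<D> where \<D>: "countable \<D>" "\<D> \<subseteq> Pow J" "\<And>X. X \<in> \<D> \<Longrightarrow> \<exists>a b. X = cbox a b" "\<Union>\<D> = J"
    using open_countable_Union_open_cbox[OF J] by metis
  have "AE x in lborel. x \<in> X \<longrightarrow> p x \<in> G" if "X \<in> \<D>" for X
    using \<D>(3)[OF that] \<D>(2) that * by auto
  then have "AE x in lborel. \<forall>X\<in>\<D>. x \<in> X \<longrightarrow> p x \<in> G" unfolding AE_ball_countable[OF \<D>(1)] by blast
  then show ?thesis by eventually_elim (use \<D>(4) in auto)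
qed

section \<open>Local integrability and testing against test functions\<close>

lemma weak_deriv_loc_integrable:
  "weak_deriv J f d \<Longrightarrow> {a..b} \<subseteq> J \<Longrightarrow> set_integrable lborel {a..b} f"
  "weak_deriv J f d \<Longrightarrow> {a..b} \<subseteq> J \<Longrightarrow> set_integrable lborel {a..b} d"
  by (auto simp: weak_deriv_def)

definition loc_int :: "real set \<Rightarrow> (real \<Rightarrow> 'b::{banach, second_countable_topology}) \<Rightarrow> bool" where
  "loc_int J h \<longleftrightarrow> (\<forall>K. compact K \<and> K \<subseteq> J \<longrightarrow> set_integrable lborel K h)"

lemma weak_deriv_iff: "weak_deriv J f d \<longleftrightarrow> loc_int J f \<and> loc_int J d \<and>
     (\<forall>\<phi>. test_function J \<phi> \<longrightarrow>
        (LINT x:J|lborel. deriv \<phi> x *\<^sub>R f x) = - (LINT x:J|lborel. \<phi> x *\<^sub>R d x))"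
  by (auto simp: weak_deriv_def loc_int_def)

lemma loc_int_add: "loc_int J f \<Longrightarrow> loc_int J g \<Longrightarrow> loc_int J (\<lambda>x. f x + g x)"
  by (auto simp: loc_int_def intro!: set_integral_add)

lemma loc_int_diff: "loc_int J f \<Longrightarrow> loc_int J g \<Longrightarrow> loc_int J (\<lambda>x. f x - g x)"
  by (auto simp: loc_int_def intro!: set_integral_diff)

lemma loc_int_scale: "loc_int J f \<Longrightarrow> loc_int J (\<lambda>x. c *\<^sub>R f x)"
  by (auto simp: loc_int_def)

lemma loc_int_const: "loc_int J (\<lambda>x. c)"
  unfolding loc_int_def
proof (intro allI impI)
  fix K :: "real set" assume "compact K \<and> K \<subseteq> J"
  then show "set_integrable lborel K (\<lambda>x. c)"
    unfolding set_integrable_def using emeasure_bounded_finite[of K] compact_imp_bounded[of K]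
    by (intro integrable_scaleR_left integrable_real_indicator) (auto simp: compact_imp_closed borel_closed)
qed

lemma test_function_mult_integrable:
  fixes h :: "real \<Rightarrow> 'b::{banach, second_countable_topology}"
  assumes \<phi>: "test_function J \<phi>" and h: "loc_int J h"
  shows "set_integrable lborel J (\<lambda>x. \<phi> x *\<^sub>R h x)"
proof -
  obtain K where K: "compact K" "K \<subseteq> J" "\<And>x. x \<notin> K \<Longrightarrow> \<phi> x = 0"
    using \<phi> by (auto simp: test_function_iff)
  have hK: "integrable lborel (\<lambda>x. indicator K x *\<^sub>R h x)" using h K by (auto simp: loc_int_def set_integrable_def)
  have "compact (\<phi> ` K)" using test_function_cont[OF \<phi>] K(1) by (intro compact_continuous_image)
  then obtain C where C: "\<And>x. x \<in> K \<Longrightarrow> \<bar>\<phi> x\<bar> \<le> C"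
    using compact_imp_bounded bounded_iff by (metis imageI real_norm_def)
  have "integrable lborel (\<lambda>x. \<phi> x *\<^sub>R (indicator K x *\<^sub>R h x))"
  proof (rule Bochner_Integration.integrable_bound[of _ "\<lambda>x. C *\<^sub>R (indicator K x *\<^sub>R h x)"])
    show "(\<lambda>x. \<phi> x *\<^sub>R indicator K x *\<^sub>R h x) \<in> borel_measurable lborel"
      using test_function_measurable[OF \<phi>] borel_measurable_integrable[OF hK] by measurable
    show "AE x in lborel. norm (\<phi> x *\<^sub>R indicator K x *\<^sub>R h x) \<le> norm (C *\<^sub>R indicator K x *\<^sub>R h x)"
      using C by (intro AE_I2) (force simp: indicator_def intro!: mult_right_mono)
  qed (intro integrable_scaleR_right hK)
  moreover have "(\<lambda>x. \<phi> x *\<^sub>R (indicator K x *\<^sub>R h x)) = (\<lambda>x. indicator J x *\<^sub>R (\<phi> x *\<^sub>R h x))"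
    using K by (intro ext) (auto simp: indicator_def)
  ultimately show ?thesis by (simp add: set_integrable_def)
qed

lemma fundamental_lemma:
  fixes h :: "real \<Rightarrow> 'b::{banach, second_countable_topology}"
  assumes J: "open J" and h: "loc_int J h"
    and z: "\<And>\<phi>. test_function J \<phi> \<Longrightarrow> (LINT x:J|lborel. \<phi> x *\<^sub>R h x) = 0"
  shows "AE x in lborel. x \<in> J \<longrightarrow> h x = 0"
proof -
  have "AE x in lborel. x \<in> J \<longrightarrow> h x \<in> {0}"
  proof (rule AE_in_closed_subspace[OF J])
    show p: "set_integrable lborel {a..b} h" if "{a..b} \<subseteq> J" for a b
      using h that by (auto simp: loc_int_def)
    fix a b :: real assume ab: "a < b" "{a..b} \<subseteq> J"
    have hi: "integrable lborel (\<lambda>x. indicator {a..b} x *\<^sub>R h x)" using p[OF ab(2)] by (simp add: set_integrable_def)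
    have "(\<lambda>n. LINT x|lborel. bump (1 / Suc n) a b x *\<^sub>R (indicator {a..b} x *\<^sub>R h x))
        \<longlonglongrightarrow> (LINT x|lborel. indicator {a<..<b} x *\<^sub>R (indicator {a..b} x *\<^sub>R h x))"
    proof (rule integral_dominated_convergence)
      show "AE x in lborel. (\<lambda>n. bump (1 / Suc n) a b x *\<^sub>R (indicator {a..b} x *\<^sub>R h x))
           \<longlonglongrightarrow> indicator {a<..<b} x *\<^sub>R (indicator {a..b} x *\<^sub>R h x)"
        by (intro AE_I2 tendsto_intros bump_tendsto)
      show "integrable lborel (\<lambda>x. norm (indicator {a..b} x *\<^sub>R h x))" using hi by (rule integrable_norm)
      have "norm (bump (1 / Suc n) a b x *\<^sub>R v) \<le> norm v" for n x and v :: 'b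
        using bump_bounds[of "1 / Suc n" a b x] mult_right_mono[of "bump (1 / Suc n) a b x" 1 "norm v"] by simp
      then show "AE x in lborel. norm (bump (1 / Suc n) a b x *\<^sub>R (indicator {a..b} x *\<^sub>R h x))
        \<le> norm (indicator {a..b} x *\<^sub>R h x)" for n by blast
      have [measurable]: "bump (1 / Suc n) a b \<in> borel_measurable borel" for n
        using test_function_measurable[OF test_function_bump[OF _ ab(2)]] by simp
      have [measurable]: "(\<lambda>x. indicator {a..b} x *\<^sub>R h x) \<in> borel_measurable borel"
        using borel_measurable_integrable[OF hi] by simp
      show "(\<lambda>x. bump (1 / Suc n) a b x *\<^sub>R (indicator {a..b} x *\<^sub>R h x)) \<in> borel_measurable lborel" for n
        by measurable
      show "(\<lambda>x. indicator {a<..<b} x *\<^sub>R (indicator {a..b} x *\<^sub>R h x)) \<in> borel_measurable lborel"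
        by measurable
    qed
    moreover have "(LINT x|lborel. bump (1 / Suc n) a b x *\<^sub>R (indicator {a..b} x *\<^sub>R h x)) = 0" for n
    proof -
      have "(LINT x|lborel. bump (1 / Suc n) a b x *\<^sub>R (indicator {a..b} x *\<^sub>R h x))
        = (LINT x:J|lborel. bump (1 / Suc n) a b x *\<^sub>R h x)"
        unfolding set_lebesgue_integral_def using ab(2)
        by (intro Bochner_Integration.integral_cong) (auto simp: indicator_def bump_def exp_cut_def)
      also have "\<dots> = 0" by (rule z[OF test_function_bump[OF _ ab(2)]]) simp
      finally show ?thesis .
    qed
    ultimately have "(LINT x|lborel. indicator {a<..<b} x *\<^sub>R (indicator {a..b} x *\<^sub>R h x)) = 0"
      by (simp add: LIMSEQ_const_iff)
    moreover have "(LINT x|lborel. indicator {a<..<b} x *\<^sub>R (indicator {a..b} x *\<^sub>R h x))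
       = (LINT x|lborel. indicator {a..b} x *\<^sub>R h x)"
    proof (rule integral_cong_AE)
      have [measurable]: "(\<lambda>x. indicator {a..b} x *\<^sub>R h x) \<in> borel_measurable borel"
        using borel_measurable_integrable[OF hi] by simp
      show "(\<lambda>x. indicator {a<..<b} x *\<^sub>R (indicator {a..b} x *\<^sub>R h x)) \<in> borel_measurable lborel"
        by measurable
      show "(\<lambda>x. indicator {a..b} x *\<^sub>R h x) \<in> borel_measurable lborel" by measurable
      show "AE x in lborel. indicator {a<..<b} x *\<^sub>R (indicator {a..b} x *\<^sub>R h x) = indicator {a..b} x *\<^sub>R h x"
        using AE_lborel_singleton[of a] AE_lborel_singleton[of b]
        by eventually_elim (auto simp: indicator_def)
    qed
    ultimately show "(LINT x:{a..b}|lborel. h x) \<in> {0}" by (simp add: set_lebesgue_integral_def)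
  qed (auto simp: subspace_single_0)
  then show ?thesis by simp
qed

lemma weak_deriv_unique:
  fixes d e :: "real \<Rightarrow> 'b::{banach, second_countable_topology}"
  assumes J: "open J" and "weak_deriv J f d" "weak_deriv J f e"
  shows "AE x in lborel. x \<in> J \<longrightarrow> d x = e x"
proof -
  have "AE x in lborel. x \<in> J \<longrightarrow> d x - e x = 0"
  proof (rule fundamental_lemma[OF J])
    show "loc_int J (\<lambda>x. d x - e x)" using assms by (auto simp: weak_deriv_iff intro: loc_int_diff)
    fix \<phi> assume \<phi>: "test_function J \<phi>"
    then show "(LINT x:J|lborel. \<phi> x *\<^sub>R (d x - e x)) = 0"
      using assms test_function_mult_integrable[OF \<phi>, of d] test_function_mult_integrable[OF \<phi>, of e]
      by (simp add: weak_deriv_iff scaleR_diff_right)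
  qed
  then show ?thesis by simp
qed

section \<open>Weak derivatives and primitives\<close>

lemma set_integral_Icc_degenerate:
  fixes h :: "real \<Rightarrow> 'b::{banach, second_countable_topology}"
  assumes "b \<le> a"
  shows "(LINT s:{a..b}|lborel. h s) = 0"
proof -
  have "AE x in lborel. indicator {a..b} x *\<^sub>R h x = 0"
    using AE_lborel_singleton[of a] by eventually_elim (use assms in \<open>auto simp: indicator_def\<close>)
  then show ?thesis
    unfolding set_lebesgue_integral_def by (rule integral_eq_zero_AE)
qed

lemma set_integral_Icc_split:
  fixes h :: "real \<Rightarrow> 'b::{banach, second_countable_topology}"
  assumes "x \<le> y" "y \<le> z" "set_integrable lborel {x..z} h"
  shows "(LINT s:{x..z}|lborel. h s) = (LINT s:{x..y}|lborel. h s) + (LINT s:{y..z}|lborel. h s)"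
proof -
  have "{x..z} = {x..y} \<union> {y..z}" using assms by auto
  moreover have "(LINT s:{x..y} \<union> {y..z}|lborel. h s) = (LINT s:{x..y}|lborel. h s) + (LINT s:{y..z}|lborel. h s)"
  proof (rule set_integral_Un_AE)
    show "AE s in lborel. \<not> (s \<in> {x..y} \<and> s \<in> {y..z})"
      using AE_lborel_singleton[of y] by eventually_elim auto
  qed (use assms(1,2) in \<open>auto intro!: set_integrable_subset[OF assms(3)]\<close>)
  ultimately show ?thesis by simp
qed

text \<open>The oriented integral from \<open>a\<close> to \<open>x\<close>: one of the two terms
  always vanishes, its interval being empty or a point.\<close>

definition prim :: "real \<Rightarrow> (real \<Rightarrow> 'b::{banach, second_countable_topology}) \<Rightarrow> real \<Rightarrow> 'b" where
  "prim a d x = (LINT s:{a..x}|lborel. d s) - (LINT s:{x..a}|lborel. d s)"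

lemma Icc_subset_interval: "is_interval J \<Longrightarrow> (x::real) \<in> J \<Longrightarrow> z \<in> J \<Longrightarrow> {x..z} \<subseteq> J"
  using mem_is_interval_1_I[of J x z] by (meson atLeastAtMost_iff subsetI)

lemma prim_diff:
  fixes d :: "real \<Rightarrow> 'b::{banach, second_countable_topology}"
  assumes J: "is_interval J" and d: "loc_int J d" and axz: "a \<in> J" "x \<in> J" "z \<in> J" "x \<le> z"
  shows "prim a d z = prim a d x + (LINT s:{x..z}|lborel. d s)"
proof -
  have i: "set_integrable lborel {u..v} d" if "u \<in> J" "v \<in> J" for u v
    using d Icc_subset_interval[OF J that] by (auto simp: loc_int_def)
  consider "a \<le> x" | "x \<le> a" "a \<le> z" | "z \<le> a" by linarith
  then show ?thesis
  proof cases
    case 1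
    then show ?thesis using axz set_integral_Icc_split[of a x z d] i[of a z]
      by (simp add: prim_def set_integral_Icc_degenerate)
  next
    case 2
    then show ?thesis using axz set_integral_Icc_split[of x a z d] i[of x z]
      by (simp add: prim_def set_integral_Icc_degenerate)
  next
    case 3
    then show ?thesis using axz set_integral_Icc_split[of x z a d] i[of x a]
      by (simp add: prim_def set_integral_Icc_degenerate)
  qed
qed

lemma eventually_indicator_atMost:
  fixes x s :: real
  assumes u: "u \<longlonglongrightarrow> x" and "s \<noteq> x"
  shows "eventually (\<lambda>n. (indicator {..u n} s :: real) = indicator {..x} s) sequentially"
proof (cases "s < x")
  case True
  then show ?thesis using order_tendstoD(1)[OF u True] by (auto elim!: eventually_mono)
next
  case False
  then have "x < s" using assms by simp
  then show ?thesis using order_tendstoD(2)[OF u, of s] by (auto elim!: eventually_mono)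
qed

lemma indicator_Iic_integral_continuous:
  fixes q :: "real \<Rightarrow> 'b::{banach, second_countable_topology}"
  assumes q: "integrable lborel q"
  shows "continuous_on UNIV (\<lambda>x. LINT s|lborel. indicator {..x} s *\<^sub>R q s)"
proof (clarsimp simp: continuous_on_sequentially)
  fix u :: "nat \<Rightarrow> real" and x assume u: "u \<longlonglongrightarrow> x"
  have [measurable]: "q \<in> borel_measurable borel" using borel_measurable_integrable[OF q] by simp
  have "(\<lambda>n. LINT s|lborel. indicator {..u n} s *\<^sub>R q s) \<longlonglongrightarrow> (LINT s|lborel. indicator {..x} s *\<^sub>R q s)"
  proof (rule integral_dominated_convergence[where w = "\<lambda>s. norm (q s)"])
    show "AE s in lborel. (\<lambda>n. indicator {..u n} s *\<^sub>R q s) \<longlonglongrightarrow> indicator {..x} s *\<^sub>R q s"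
      using AE_lborel_singleton[of x]
      by eventually_elim (intro tendsto_intros tendsto_eventually eventually_indicator_atMost u)
  qed (use q in \<open>auto intro: integrable_norm simp: indicator_def\<close>)
  then show "((\<lambda>x. LINT s|lborel. indicator {..x} s *\<^sub>R q s) \<circ> u) \<longlonglongrightarrow> (LINT s|lborel. indicator {..x} s *\<^sub>R q s)"
    by (simp add: comp_def)
qed

lemma prim_continuous:
  fixes d :: "real \<Rightarrow> 'b::{banach, second_countable_topology}"
  assumes J: "open J" "is_interval J" and d: "loc_int J d" and a: "a \<in> J"
  shows "continuous_on J (prim a d)"
proof (rule continuous_at_imp_continuous_on, rule ballI)
  fix x assume x: "x \<in> J"
  obtain e where e: "e > 0" "cball x e \<subseteq> J" using J(1) x by (auto simp: open_contains_cball)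
  have xe: "x - e \<in> J" "x + e \<in> J" using e by (auto simp: dist_real_def subset_iff)
  define q where "q s = indicator {x - e..x + e} s *\<^sub>R d s" for s
  have q: "integrable lborel q"
    using d Icc_subset_interval[OF J(2) xe] by (auto simp: q_def[abs_def] loc_int_def set_integrable_def)
  have "isCont (\<lambda>z. prim a d (x - e) + (LINT s|lborel. indicator {..z} s *\<^sub>R q s)) x"
    using indicator_Iic_integral_continuous[OF q] by (intro continuous_intros) (simp add: continuous_on_eq_continuous_at)
  moreover have "eventually (\<lambda>z. z \<in> ball x e) (nhds x)" using e by (intro eventually_nhds_in_open) auto
  then have "eventually (\<lambda>z. prim a d z = prim a d (x - e) + (LINT s|lborel. indicator {..z} s *\<^sub>R q s)) (nhds x)"
  proof eventually_elim
    case (elim z)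
    then have z: "z \<in> J" "x - e \<le> z" "z \<le> x + e" using e(2) ball_subset_cball by (auto simp: dist_real_def subset_iff)
    have "(LINT s:{x - e..z}|lborel. d s) = (LINT s|lborel. indicator {..z} s *\<^sub>R q s)"
      unfolding set_lebesgue_integral_def q_def using z
      by (intro Bochner_Integration.integral_cong) (auto simp: indicator_def)
    then show ?case using prim_diff[OF J(2) d a xe(1) z(1,2)] by simp
  qed
  ultimately show "isCont (prim a d) x" using isCont_cong by fastforce
qed

lemma integral_atMost_add_greaterThan:
  fixes H :: "real \<Rightarrow> real"
  assumes H: "integrable lborel H"
  shows "(LINT s|lborel. indicator {..x} s * H s) + (LINT s|lborel. indicator {x<..} s * H s) = (LINT s|lborel. H s)"
proof -
  have i: "integrable lborel (\<lambda>s. indicator A s * H s)" if "A \<in> sets borel" for A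
    using integrable_mult_indicator[OF _ H, of A] that by simp
  show ?thesis
    by (subst Bochner_Integration.integral_add[OF i i, symmetric])
      (auto intro!: Bochner_Integration.integral_cong simp: indicator_def)
qed

text \<open>The subset of \<open>J\<close> where \<open>f\<close> leaves \<open>C\<close> is open;
  if nonempty it contains a ball, which has positive measure.\<close>

lemma continuous_AE_in_closed:
  fixes f :: "real \<Rightarrow> 'b::topological_space"
  assumes J: "open J" and f: "continuous_on J f" and C: "closed C"
    and ae: "AE x in lborel. x \<in> J \<longrightarrow> f x \<in> C" and x: "x \<in> J"
  shows "f x \<in> C"
proof (rule ccontr)
  assume "f x \<notin> C"
  moreover have "open (J \<inter> f -` (- C))"
    using continuous_open_preimage[OF f J open_Compl[OF C]] .
  ultimately obtain e where e: "e > 0" "ball x e \<subseteq> J \<inter> f -` (- C)"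
    using x unfolding open_contains_ball by blast
  have "AE z in lborel. z \<notin> ball x e" using ae by eventually_elim (use e(2) in auto)
  then have "emeasure lborel (ball x e) = 0" by (subst (asm) AE_iff_measurable[of "ball x e"]) auto
  then show False using e(1) by (simp add: ball_eq_greaterThanLessThan)
qed

section \<open>Integration by parts against test functions\<close>

lemma smooth_integrable:
  assumes "smooth \<phi>" "\<forall>x. x \<notin> {\<alpha>..\<beta>} \<longrightarrow> \<phi> x = 0"
  shows "integrable lborel \<phi>"
proof -
  have "integrable lborel (\<lambda>x. indicator {\<alpha>..\<beta>} x *\<^sub>R \<phi> x)"
    using borel_integrable_compact[of "{\<alpha>..\<beta>}" \<phi>] smooth_cont[OF assms(1)] by simp
  moreover have "(\<lambda>x. indicator {\<alpha>..\<beta>} x *\<^sub>R \<phi> x) = \<phi>" using assms(2) by (force simp: indicator_def)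
  ultimately show ?thesis by simp
qed

lemma smooth_deriv_integral_tail:
  assumes s: "smooth \<phi>" and z: "\<forall>x. x \<notin> {\<alpha>..\<beta>} \<longrightarrow> \<phi> x = 0"
  shows "(LINT x|lborel. indicator {s..} x * deriv \<phi> x) = - \<phi> s"
proof -
  define B where "B = max s \<beta> + 1"
  have "(LINT x|lborel. deriv \<phi> x * indicator {s..B} x) = \<phi> B - \<phi> s"
    using smooth_cont[OF smooth_deriv[OF s], of UNIV]
    by (intro integral_FTC_Icc_real smooth_DERIV[OF s]) (auto simp: B_def continuous_on_eq_continuous_at)
  moreover have "(\<lambda>x. deriv \<phi> x * indicator {s..B} x) = (\<lambda>x. indicator {s..} x * deriv \<phi> x)"
    using test_function_deriv_zero[OF s z] by (force simp: indicator_def B_def)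
  moreover have "\<phi> B = 0" by (rule z[rule_format]) (auto simp: B_def)
  ultimately show ?thesis by simp
qed

lemma smooth_deriv_integral:
  assumes s: "smooth \<phi>" and z: "\<forall>x. x \<notin> {\<alpha>..\<beta>} \<longrightarrow> \<phi> x = 0"
  shows "(LINT x|lborel. deriv \<phi> x) = 0"
proof -
  have "(\<lambda>x. indicator {\<alpha> - 1..} x * deriv \<phi> x) = deriv \<phi>"
    using test_function_deriv_zero[OF s z] by (force simp: indicator_def)
  then show ?thesis using smooth_deriv_integral_tail[OF s z, of "\<alpha> - 1"] z[rule_format, of "\<alpha> - 1"] by simp
qed

text \<open>Fubini for the kernel \<open>deriv \<phi> x * indicator {s..} x\<close> times
  \<open>d s\<close>: integrating in \<open>x\<close> first gives minus \<open>\<phi> s\<close>,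
  since \<open>\<phi>\<close> vanishes far to the right.\<close>

lemma integral_deriv_times_primitive:
  fixes d :: "real \<Rightarrow> 'b::{banach, second_countable_topology}"
  assumes s: "smooth \<phi>" and z: "\<forall>x. x \<notin> {\<alpha>..\<beta>} \<longrightarrow> \<phi> x = 0" and d: "integrable lborel d"
  shows "(LINT x|lborel. deriv \<phi> x *\<^sub>R (LINT s|lborel. indicator {..x} s *\<^sub>R d s)) = - (LINT s|lborel. \<phi> s *\<^sub>R d s)"
proof -
  define k where "k x s = (deriv \<phi> x * indicator {s..} x) *\<^sub>R d s" for x s
  have ds: "integrable lborel (deriv \<phi>)"
    by (rule smooth_integrable[OF smooth_deriv[OF s] test_function_deriv_zero[OF s z]])
  have [measurable]: "d \<in> borel_measurable borel" "deriv \<phi> \<in> borel_measurable borel"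
    using borel_measurable_integrable[OF d] borel_measurable_integrable[OF ds] by simp_all
  have [measurable]: "(\<lambda>z::real \<times> real. indicator {snd z..} (fst z) :: real) \<in> borel_measurable (lborel \<Otimes>\<^sub>M lborel)"
    unfolding indicator_def atLeast_iff by measurable
  have km: "case_prod k \<in> borel_measurable (lborel \<Otimes>\<^sub>M lborel)"
    unfolding k_def split_beta' by measurable
  have ki: "integrable (lborel \<Otimes>\<^sub>M lborel) (case_prod k)"
  proof (rule Bochner_Integration.integrable_bound[OF _ km])
    show "integrable (lborel \<Otimes>\<^sub>M lborel) (\<lambda>(x, s). deriv \<phi> x *\<^sub>R norm (d s))"
    proof (rule lborel_pair.Fubini_integrable)
      show "(\<lambda>(x, s). deriv \<phi> x *\<^sub>R norm (d s)) \<in> borel_measurable (lborel \<Otimes>\<^sub>M lborel)"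
        unfolding split_beta' by measurable
      show "integrable lborel (\<lambda>x. LINT y|lborel. norm (case (x, y) of (x, s) \<Rightarrow> deriv \<phi> x *\<^sub>R norm (d s)))"
        using ds by (simp add: abs_mult)
      show "AE x in lborel. integrable lborel (\<lambda>y. case (x, y) of (x, s) \<Rightarrow> deriv \<phi> x *\<^sub>R norm (d s))"
        using d by auto
    qed
    show "AE p in lborel \<Otimes>\<^sub>M lborel. norm (case p of (x, s) \<Rightarrow> k x s) \<le> norm (case p of (x, s) \<Rightarrow> deriv \<phi> x *\<^sub>R norm (d s))"
      by (intro AE_I2) (auto simp: k_def indicator_def abs_mult)
  qed
  have "(LINT x|lborel. LINT s|lborel. k x s) = (LINT s|lborel. LINT x|lborel. k x s)"
    using lborel_pair.Fubini_integral[OF ki] by simp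
  moreover have "(LINT s|lborel. k x s) = deriv \<phi> x *\<^sub>R (LINT s|lborel. indicator {..x} s *\<^sub>R d s)" for x
  proof -
    have e: "(\<lambda>s. k x s) = (\<lambda>s. deriv \<phi> x *\<^sub>R (indicator {..x} s *\<^sub>R d s))" by (auto simp: k_def indicator_def fun_eq_iff)
    show ?thesis unfolding e using integrable_mult_indicator[OF _ d, of "{..x}"]
      by (intro integral_scaleR_right)
  qed
  moreover have "(LINT x|lborel. k x s') = - \<phi> s' *\<^sub>R d s'" for s'
  proof -
    have "integrable lborel (\<lambda>x. deriv \<phi> x * indicator {s'..} x)"
      using integrable_mult_indicator[OF _ ds, of "{s'..}"] by (simp add: mult.commute)
    then have "(LINT x|lborel. k x s') = (LINT x|lborel. deriv \<phi> x * indicator {s'..} x) *\<^sub>R d s'"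
      unfolding k_def by simp
    then show ?thesis using smooth_deriv_integral_tail[OF s z, of s'] by (simp add: mult.commute)
  qed
  ultimately show ?thesis by simp
qed

lemma weak_deriv_prim:
  fixes d :: "real \<Rightarrow> 'b::{banach, second_countable_topology}"
  assumes J: "open J" "is_interval J" and d: "loc_int J d" and a: "a \<in> J"
  shows "weak_deriv J (\<lambda>x. C + prim a d x) d"
  unfolding weak_deriv_iff
proof (intro conjI allI impI)
  show "loc_int J (\<lambda>x. C + prim a d x)"
    unfolding loc_int_def
  proof (intro allI impI)
    fix K assume "compact K \<and> K \<subseteq> J"
    then show "set_integrable lborel K (\<lambda>x. C + prim a d x)"
      unfolding set_integrable_def
      by (intro borel_integrable_compact continuous_intros continuous_on_subset[OF prim_continuous[OF J d a]]) auto
  qed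
  fix \<phi> assume \<phi>: "test_function J \<phi>"
  have s: "smooth \<phi>" using \<phi> by (simp add: test_function_iff)
  obtain \<alpha> \<beta> where ab: "\<alpha> \<le> \<beta>" "{\<alpha>..\<beta>} \<subseteq> J" and z: "\<forall>x. x \<notin> {\<alpha>..\<beta>} \<longrightarrow> \<phi> x = 0"
    using a by (rule_tac test_function_interval[OF \<phi> J(2)]) auto
  have ab': "\<alpha> \<in> J" "\<beta> \<in> J" using ab by auto
  note dz = test_function_deriv_zero[OF s z]
  define q where "q s = indicator {\<alpha>..\<beta>} s *\<^sub>R d s" for s
  have q: "integrable lborel q"
    using d ab by (auto simp: q_def[abs_def] loc_int_def set_integrable_def)
  \<comment> \<open>On the support of \<open>\<phi>\<close> the function equals \<open>C'\<close>
    plus a primitive started at \<open>\<alpha>\<close>; the constant disappears because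
    \<open>deriv \<phi>\<close> has integral 0.\<close>
  define C' where "C' = C + prim a d \<alpha>"
  have ds: "integrable lborel (deriv \<phi>)"
    by (rule smooth_integrable[OF smooth_deriv[OF s] dz])
  have "(LINT x:J|lborel. deriv \<phi> x *\<^sub>R (C + prim a d x))
     = (LINT x|lborel. deriv \<phi> x *\<^sub>R C' + deriv \<phi> x *\<^sub>R (LINT s|lborel. indicator {..x} s *\<^sub>R q s))"
    unfolding set_lebesgue_integral_def
  proof (intro Bochner_Integration.integral_cong refl)
    fix x
    show "indicator J x *\<^sub>R deriv \<phi> x *\<^sub>R (C + prim a d x)
      = deriv \<phi> x *\<^sub>R C' + deriv \<phi> x *\<^sub>R (LINT s|lborel. indicator {..x} s *\<^sub>R q s)"
    proof (cases "x \<in> {\<alpha>..\<beta>}")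
      case True
      then have x: "x \<in> J" using ab by auto
      have "(LINT s:{\<alpha>..x}|lborel. d s) = (LINT s|lborel. indicator {..x} s *\<^sub>R q s)"
        unfolding set_lebesgue_integral_def q_def using True
        by (intro Bochner_Integration.integral_cong) (auto simp: indicator_def)
      then have "prim a d x = prim a d \<alpha> + (LINT s|lborel. indicator {..x} s *\<^sub>R q s)"
        using prim_diff[OF J(2) d a ab'(1) x] True by simp
      then show ?thesis using x by (simp add: C'_def scaleR_add_right)
    qed (simp add: dz)
  qed
  also have "\<dots> = (LINT x|lborel. deriv \<phi> x) *\<^sub>R C' + (LINT x|lborel. deriv \<phi> x *\<^sub>R (LINT s|lborel. indicator {..x} s *\<^sub>R q s))"
  proof (subst Bochner_Integration.integral_add)
    have c: "continuous_on {\<alpha>..\<beta>} (\<lambda>x. deriv \<phi> x *\<^sub>R (LINT s|lborel. indicator {..x} s *\<^sub>R q s))"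
      by (intro continuous_intros smooth_cont smooth_deriv s continuous_on_subset[OF indicator_Iic_integral_continuous[OF q]]) auto
    have "integrable lborel (\<lambda>x. indicator {\<alpha>..\<beta>} x *\<^sub>R deriv \<phi> x *\<^sub>R (LINT s|lborel. indicator {..x} s *\<^sub>R q s))"
      by (rule borel_integrable_compact[OF _ c]) auto
    moreover have "(\<lambda>x. indicator {\<alpha>..\<beta>} x *\<^sub>R deriv \<phi> x *\<^sub>R (LINT s|lborel. indicator {..x} s *\<^sub>R q s))
      = (\<lambda>x. deriv \<phi> x *\<^sub>R (LINT s|lborel. indicator {..x} s *\<^sub>R q s))"
      using dz by (auto simp: fun_eq_iff indicator_def)
    ultimately show "integrable lborel (\<lambda>x. deriv \<phi> x *\<^sub>R (LINT s|lborel. indicator {..x} s *\<^sub>R q s))" by simp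
  qed (use ds in auto)
  also have "\<dots> = - (LINT s|lborel. \<phi> s *\<^sub>R q s)"
    using integral_deriv_times_primitive[OF s z q] smooth_deriv_integral[OF s z] by simp
  also have "(LINT s|lborel. \<phi> s *\<^sub>R q s) = (LINT x:J|lborel. \<phi> x *\<^sub>R d x)"
    unfolding set_lebesgue_integral_def q_def using ab z
    by (intro Bochner_Integration.integral_cong) (auto simp: indicator_def)
  finally show "(LINT x:J|lborel. deriv \<phi> x *\<^sub>R (C + prim a d x)) = - (LINT x:J|lborel. \<phi> x *\<^sub>R d x)" .
qed (rule d)

text \<open>A primitive normalised at \<open>\<alpha>\<close> vanishes to the left of the support;
  zero mean is exactly what makes it vanish to the right as well.\<close>

lemma smooth_zero_mean_primitive:
  assumes s: "smooth g" and z: "\<forall>x. x \<notin> {\<alpha>..\<beta>} \<longrightarrow> g x = 0" and "\<alpha> \<le> \<beta>" and m: "(LINT x|lborel. g x) = 0"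
  obtains F where "smooth F" "deriv F = g" "\<forall>x. x \<notin> {\<alpha>..\<beta>} \<longrightarrow> F x = 0"
proof -
  have cont: "isCont g x" for x
    using smooth_cont[OF s, of UNIV] by (simp add: continuous_on_eq_continuous_at)
  obtain F0 where F0: "\<And>x. (F0 has_real_derivative g x) (at x)"
    using einterval_antiderivative[of "-\<infinity>" "\<infinity>" g] cont
    by (auto simp: has_real_derivative_iff_has_vector_derivative)
  define F where "F x = F0 x - F0 \<alpha>" for x
  have F: "(F has_real_derivative g x) (at x)" for x
    unfolding F_def using F0[of x] by (auto intro!: derivative_eq_intros)
  have int: "(LINT x|lborel. g x * indicator {u..v} x) = F v - F u" if "u \<le> v" for u v
    by (rule integral_FTC_Icc_real[OF that F cont])
  show thesis
  proof (rule that)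
    show "smooth F" by (rule smooth_primitive[OF s F])
    show "deriv F = g" using F by (auto intro!: DERIV_imp_deriv)
    have F\<alpha>: "F \<alpha> = 0" by (simp add: F_def)
    have "F x = 0" if x: "x \<notin> {\<alpha>..\<beta>}" for x
    proof (cases "x < \<alpha>")
      case True
      have "(LINT y|lborel. g y * indicator {x..\<alpha>} y) = 0"
        using AE_lborel_singleton[of \<alpha>] by (intro integral_eq_zero_AE, eventually_elim)
          (use z in \<open>auto simp: indicator_def\<close>)
      then show ?thesis using int[of x \<alpha>] True F\<alpha> by simp
    next
      case False
      have "(LINT y|lborel. g y * indicator {\<alpha>..x} y) = (LINT y|lborel. g y)"
      proof (intro Bochner_Integration.integral_cong refl)
        fix y
        show "g y * indicator {\<alpha>..x} y = g y"
          using z[rule_format, of y] x False by (cases "y \<in> {\<alpha>..\<beta>}") (auto simp: indicator_def)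
      qed
      then show ?thesis using int[of \<alpha> x] False F\<alpha> m by simp
    qed
    then show "\<forall>x. x \<notin> {\<alpha>..\<beta>} \<longrightarrow> F x = 0" by blast
  qed
qed

text \<open>The du Bois-Reymond argument: a test function minus a suitable multiple of one fixed
  bump \<open>\<eta>\<close> has zero mean and is thus the derivative of a test function. The
  constant is the \<open>\<eta>\<close>-weighted mean of \<open>h\<close>.\<close>

lemma weak_deriv_zero_const:
  fixes h :: "real \<Rightarrow> 'b::{banach, second_countable_topology}"
  assumes J: "open J" "is_interval J" "J \<noteq> {}" and w: "weak_deriv J h (\<lambda>x. 0)"
  obtains C where "AE x in lborel. x \<in> J \<longrightarrow> h x = C"
proof -
  have h: "loc_int J h" using w by (simp add: weak_deriv_iff)
  obtain a where "a \<in> J" using J(3) by blast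
  then obtain e where e: "e > 0" "cball a e \<subseteq> J" using J(1) by (auto simp: open_contains_cball)
  define \<eta> where "\<eta> = bump 1 (a - e) (a + e)"
  have ae: "{a - e..a + e} \<subseteq> J" using e by (auto simp: cball_eq_atLeastAtMost)
  have \<eta>: "test_function J \<eta>" unfolding \<eta>_def by (rule test_function_bump[OF _ ae]) simp
  have \<eta>z: "\<forall>x. x \<notin> {a - e..a + e} \<longrightarrow> \<eta> x = 0" by (auto simp: \<eta>_def bump_def exp_cut_def)
  have \<eta>i: "integrable lborel \<eta>"
    using \<eta> by (intro smooth_integrable[OF _ \<eta>z]) (auto simp: test_function_iff)
  define c where "c = (LINT x|lborel. \<eta> x)"
  have "c \<noteq> 0"
  proof
    assume "c = 0"
    then have "AE x in lborel. \<eta> x = 0"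
      using integral_nonneg_eq_0_iff_AE[OF \<eta>i] bump_bounds(1)[of 1] by (simp add: c_def \<eta>_def)
    then have "AE x in lborel. x \<notin> {a - e<..<a + e}"
    proof eventually_elim
      case (elim x)
      then show ?case using bump_pos[of x "a - e" "a + e" 1] by (auto simp: \<eta>_def)
    qed
    then have "emeasure lborel {a - e<..<a + e} = 0"
      by (subst (asm) AE_iff_measurable[OF _ refl]) (auto simp: greaterThanLessThan_def Int_def)
    then show False using e(1) by simp
  qed
  define C where "C = (1 / c) *\<^sub>R (LINT x:J|lborel. \<eta> x *\<^sub>R h x)"
  have "AE x in lborel. x \<in> J \<longrightarrow> h x - C = 0"
  proof (rule fundamental_lemma[OF J(1)])
    show "loc_int J (\<lambda>x. h x - C)" by (intro loc_int_diff h loc_int_const)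
    fix \<psi> assume \<psi>: "test_function J \<psi>"
    obtain \<alpha> \<beta> where ab: "\<alpha> \<le> \<beta>" "{\<alpha>..\<beta>} \<subseteq> J" and z: "\<forall>x. x \<notin> {\<alpha>..\<beta>} \<longrightarrow> \<psi> x = 0"
      by (rule test_function_interval[OF \<psi> J(2,3)]) auto
    have s: "smooth \<psi>" "smooth \<eta>" using \<psi> \<eta> by (auto simp: test_function_iff)
    have \<psi>i: "integrable lborel \<psi>" by (rule smooth_integrable[OF s(1) z])
    define m where "m = (LINT x|lborel. \<psi> x)"
    define g where "g x = 1 * \<psi> x + (- m / c) * \<eta> x" for x
    have gs: "smooth g" unfolding g_def[abs_def] by (rule smooth_lincomb[OF s])
    \<comment> \<open>The supports of \<open>\<psi>\<close> and \<open>\<eta>\<close> may be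
      disjoint, so an interval containing both is needed.\<close>
    define A where "A = min \<alpha> (a - e)"
    define B where "B = max \<beta> (a + e)"
    have AJ: "A \<in> J" "B \<in> J" using ab ae e(1) by (auto simp: A_def B_def min_def max_def)
    have AB: "{A..B} \<subseteq> J" by (rule Icc_subset_interval[OF J(2) AJ])
    have "\<forall>x. x \<notin> {A..B} \<longrightarrow> g x = 0"
    proof (intro allI impI)
      fix x assume "x \<notin> {A..B}"
      then have "x \<notin> {\<alpha>..\<beta>}" "x \<notin> {a - e..a + e}" by (auto simp: A_def B_def)
      then have "\<psi> x = 0" "\<eta> x = 0" using z \<eta>z by blast+
      then show "g x = 0" by (simp add: g_def)
    qed
    moreover have "A \<le> B" using ab(1) by (auto simp: A_def B_def)
    moreover have "(LINT x|lborel. g x) = 0"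
      using \<psi>i \<eta>i \<open>c \<noteq> 0\<close> by (simp add: g_def flip: m_def c_def)
    ultimately obtain F where F: "smooth F" "deriv F = g" "\<forall>x. x \<notin> {A..B} \<longrightarrow> F x = 0"
      using smooth_zero_mean_primitive[OF gs] by blast
    have "test_function J F" unfolding test_function_iff using F AB by (intro conjI exI[of _ "{A..B}"]) auto
    then have "(LINT x:J|lborel. g x *\<^sub>R h x) = 0" using w F(2) by (auto simp: weak_deriv_iff)
    moreover have "(LINT x:J|lborel. g x *\<^sub>R h x) = (LINT x:J|lborel. \<psi> x *\<^sub>R h x) + (- m / c) *\<^sub>R (LINT x:J|lborel. \<eta> x *\<^sub>R h x)"
    proof -
      have "(\<lambda>x. g x *\<^sub>R h x) = (\<lambda>x. \<psi> x *\<^sub>R h x + (- m / c) *\<^sub>R (\<eta> x *\<^sub>R h x))"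
        by (auto simp: g_def scaleR_diff_left)
      then show ?thesis
        using test_function_mult_integrable[OF \<psi> h] test_function_mult_integrable[OF \<eta> h]
        by (simp only: set_integral_add(2) set_integral_scaleR_right set_integrable_scaleR_right)
    qed
    ultimately have "(LINT x:J|lborel. \<psi> x *\<^sub>R h x) = m *\<^sub>R C" by (simp add: C_def)
    moreover have "(LINT x:J|lborel. \<psi> x *\<^sub>R C) = m *\<^sub>R C"
    proof -
      have "(LINT x:J|lborel. \<psi> x *\<^sub>R C) = (LINT x|lborel. \<psi> x *\<^sub>R C)"
        unfolding set_lebesgue_integral_def
      proof (intro Bochner_Integration.integral_cong refl)
        fix x
        show "indicator J x *\<^sub>R \<psi> x *\<^sub>R C = \<psi> x *\<^sub>R C"
          using z[rule_format, of x] subsetD[OF ab(2), of x] by (cases "x \<in> {\<alpha>..\<beta>}") simp_all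
      qed
      then show ?thesis using \<psi>i by (simp add: m_def)
    qed
    ultimately show "(LINT x:J|lborel. \<psi> x *\<^sub>R (h x - C)) = 0"
      using test_function_mult_integrable[OF \<psi> h] test_function_mult_integrable[OF \<psi> loc_int_const[of J C]]
      by (simp add: scaleR_diff_right)
  qed
  then show thesis by (intro that[of C]) simp
qed

lemma weak_deriv_add_scaled:
  fixes f g :: "real \<Rightarrow> 'b::{banach, second_countable_topology}"
  assumes J: "is_interval J" "J \<noteq> {}" and "weak_deriv J f d" "weak_deriv J g e"
  shows "weak_deriv J (\<lambda>x. f x + c *\<^sub>R g x) (\<lambda>x. d x + c *\<^sub>R e x)"
  unfolding weak_deriv_iff
proof (intro conjI allI impI)
  show "loc_int J (\<lambda>x. f x + c *\<^sub>R g x)" "loc_int J (\<lambda>x. d x + c *\<^sub>R e x)"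
    using assms by (auto simp: weak_deriv_iff intro: loc_int_add loc_int_scale)
  have l: "(LINT x:J|lborel. \<phi> x *\<^sub>R (u x + c *\<^sub>R v x)) = (LINT x:J|lborel. \<phi> x *\<^sub>R u x) + c *\<^sub>R (LINT x:J|lborel. \<phi> x *\<^sub>R v x)"
    if "test_function J \<phi>" "loc_int J u" "loc_int J v" for \<phi> and u v :: "real \<Rightarrow> 'b"
  proof -
    have "(\<lambda>x. \<phi> x *\<^sub>R (u x + c *\<^sub>R v x)) = (\<lambda>x. \<phi> x *\<^sub>R u x + c *\<^sub>R (\<phi> x *\<^sub>R v x))"
      by (auto simp: scaleR_add_right)
    then show ?thesis
      using test_function_mult_integrable[OF that(1,2)] test_function_mult_integrable[OF that(1,3)]
      by (simp only: set_integral_add(2) set_integral_scaleR_right set_integrable_scaleR_right)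
  qed
  fix \<phi> assume \<phi>: "test_function J \<phi>"
  show "(LINT x:J|lborel. deriv \<phi> x *\<^sub>R (f x + c *\<^sub>R g x)) = - (LINT x:J|lborel. \<phi> x *\<^sub>R (d x + c *\<^sub>R e x))"
    using assms \<phi> l[OF \<phi>, of d e] l[OF test_function_deriv[OF \<phi> J], of f g]
    by (simp add: weak_deriv_iff)
qed

text \<open>The primitive of \<open>d\<close> has the same weak derivative as \<open>f\<close>, so
  their difference is constant. This supplies the continuous representatives used for elements of
  \<open>V\<close> in space and for \<open>y\<close> in time.\<close>

theorem weak_deriv_primitive:
  fixes f :: "real \<Rightarrow> 'b::{banach, second_countable_topology}"
  assumes J: "open J" "is_interval J" and a: "a \<in> J" and w: "weak_deriv J f d"
  obtains C where "AE x in lborel. x \<in> J \<longrightarrow> f x = C + prim a d x"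
proof -
  have d: "loc_int J d" using w by (simp add: weak_deriv_iff)
  have J': "J \<noteq> {}" using a by blast
  have "weak_deriv J (\<lambda>x. f x - (0 + prim a d x)) (\<lambda>x. 0)"
    using weak_deriv_add_scaled[OF J(2) J' w weak_deriv_prim[OF J d a, of 0], of "- 1"] by simp
  then obtain C where "AE x in lborel. x \<in> J \<longrightarrow> f x - (0 + prim a d x) = C"
    using weak_deriv_zero_const[OF J J'] by blast
  then have "AE x in lborel. x \<in> J \<longrightarrow> f x = C + prim a d x"
    by eventually_elim (auto simp: algebra_simps)
  then show thesis by (rule that)
qed

section \<open>Weak cluster points and uniform boundedness\<close>

text \<open>Points of nearly minimal norm are chosen in each set. The infima of the norms increase
  to a limit, and the parallelogram law, applied to a midpoint lying in the larger of two sets,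
  makes the chosen points Cauchy; their limit lies in every set.\<close>

lemma nested_closed_convex:
  fixes C :: "nat \<Rightarrow> 'a::{real_inner, banach} set"
  assumes C: "\<And>n. closed (C n)" "\<And>n. convex (C n)" "\<And>n. C n \<noteq> {}" and dec: "decseq C"
    and bnd: "bounded (C 0)"
  shows "(\<Inter>n. C n) \<noteq> {}"
proof -
  obtain R where R: "\<And>z. z \<in> C 0 \<Longrightarrow> norm z \<le> R" using bnd by (auto simp: bounded_iff)
  have sub: "C m \<subseteq> C n" if "n \<le> m" for m n using dec that by (auto simp: decseq_def)
  define d where "d n = Inf (norm ` C n)" for n
  have bb: "bdd_below (norm ` C n)" for n by (auto intro!: bdd_belowI[of _ 0])
  have dle: "d n \<le> norm z" if "z \<in> C n" for n z
    unfolding d_def using that bb by (intro cInf_lower) auto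
  have "incseq d" unfolding incseq_def d_def
    using sub C(3) bb by (auto intro!: cInf_superset_mono)
  moreover have "d n \<le> R" for n
  proof -
    obtain z where "z \<in> C n" using C(3) by blast
    then show ?thesis using dle[of z n] R[of z] sub[of 0 n] by force
  qed
  ultimately obtain D where D: "d \<longlonglongrightarrow> D" "\<And>n. d n \<le> D"
    using incseq_convergent by blast
  have "\<exists>z\<in>C n. norm z < d n + 1 / Suc n" for n
  proof -
    have "\<exists>r\<in>norm ` C n. r < d n + 1 / Suc n"
      unfolding d_def using C(3) by (intro cInf_lessD) auto
    then show ?thesis by auto
  qed
  then obtain x where x: "\<And>n. x n \<in> C n" "\<And>n. norm (x n) < d n + 1 / Suc n" by metis
  \<comment> \<open>Four times the gap between the squared bound for the norms in the tail and the
    squared infimum: this is what the parallelogram law leaves for the squared distance.\<close>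
  define e where "e n = 4 * (D + 1 / Suc n)\<^sup>2 - 4 * (d n)\<^sup>2" for n
  have "e \<longlonglongrightarrow> 4 * (D + 0)\<^sup>2 - 4 * D\<^sup>2"
    unfolding e_def by (intro tendsto_intros D LIMSEQ_Suc lim_1_over_n)
  then have e0: "e \<longlonglongrightarrow> 0" by simp
  have d0: "0 \<le> d n" for n unfolding d_def using C(3) by (intro cInf_greatest) auto
  have key: "(norm (x m - x n))\<^sup>2 \<le> e n" if "n \<le> m" for m n
  proof -
    have xm: "x m \<in> C n" using x(1) sub[OF that] by blast
    have "(1/2) *\<^sub>R x m + (1/2) *\<^sub>R x n \<in> C n"
      using C(2)[of n] xm x(1)[of n] by (intro convexD) auto
    then have "d n \<le> norm ((1/2) *\<^sub>R (x m + x n))" using dle by (simp add: scaleR_add_right)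
    then have "2 * d n \<le> norm (x m + x n)" by simp
    then have 1: "4 * (d n)\<^sup>2 \<le> (norm (x m + x n))\<^sup>2"
      using power_mono[of "2 * d n" _ 2] d0[of n] by (simp add: power_mult_distrib)
    have "norm (x n) \<le> D + 1 / Suc n" using x(2)[of n] D(2)[of n] by linarith
    then have 2: "(norm (x n))\<^sup>2 \<le> (D + 1 / Suc n)\<^sup>2" by (intro power_mono) auto
    have "1 / real (Suc m) \<le> 1 / Suc n" using that by (simp add: frac_le)
    then have "norm (x m) \<le> D + 1 / Suc n" using x(2)[of m] D(2)[of m] by linarith
    then have 3: "(norm (x m))\<^sup>2 \<le> (D + 1 / Suc n)\<^sup>2" by (intro power_mono) auto
    have "(norm (x m - x n))\<^sup>2 = 2 * (norm (x m))\<^sup>2 + 2 * (norm (x n))\<^sup>2 - (norm (x m + x n))\<^sup>2"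
      by (simp add: power2_norm_eq_inner inner_diff inner_add inner_commute algebra_simps)
    then show ?thesis using 1 2 3 by (simp add: e_def)
  qed
  have "Cauchy x"
  proof (rule CauchyI')
    fix r :: real assume r: "r > 0"
    then obtain N where N: "\<And>n. n \<ge> N \<Longrightarrow> e n < r\<^sup>2"
      using order_tendstoD(2)[OF e0, of "r\<^sup>2"] by (auto simp: eventually_sequentially)
    show "\<exists>M. \<forall>m\<ge>M. \<forall>n>m. dist (x m) (x n) < r"
    proof (intro exI[of _ N] allI impI)
      fix m n assume "N \<le> m" "m < n"
      then have "(norm (x n - x m))\<^sup>2 < r\<^sup>2" using key[of m n] N[of m] by simp
      then show "dist (x m) (x n) < r" using r by (simp add: dist_norm norm_minus_commute power2_less_imp_less)
    qed
  qed
  then obtain q where q: "x \<longlonglongrightarrow> q" using Cauchy_convergent convergentD by blast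
  have "q \<in> C n" for n
    by (rule closed_sequentially[OF C(1), of "\<lambda>m. x (m + n)"])
      (use x(1) sub le_add2 LIMSEQ_ignore_initial_segment[OF q] in blast)+
  then show ?thesis by blast
qed

text \<open>A point in the closed convex hull of every tail replaces a weak cluster point, so that neither the
  Riesz representation theorem nor weak compactness is needed.\<close>

lemma weak_cluster_point:
  fixes p :: "nat \<Rightarrow> 'a::{real_inner, banach}"
  assumes bnd: "bounded (range p)"
  obtains q where "\<And>v c. (\<lambda>n. inner (p n) v) \<longlonglongrightarrow> c \<Longrightarrow> inner q v = c"
    "\<And>K. closed K \<Longrightarrow> convex K \<Longrightarrow> range p \<subseteq> K \<Longrightarrow> q \<in> K"
proof -
  define C where "C n = closure (convex hull (p ` {n..}))" for n
  have "(\<Inter>n. C n) \<noteq> {}"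
  proof (rule nested_closed_convex)
    show "decseq C" unfolding decseq_def C_def by (intro allI impI closure_mono hull_mono) auto
    show "bounded (C 0)" unfolding C_def
      using bnd by (intro bounded_closure bounded_convex_hull) (auto intro: bounded_subset)
  qed (auto simp: C_def convex_convex_hull convex_closure)
  then obtain q where q: "\<And>n. q \<in> C n" by blast
  have qK: "q \<in> K" if "closed K" "convex K" "p ` {N..} \<subseteq> K" for K N
  proof -
    have "C N \<subseteq> K" unfolding C_def using that by (intro closure_minimal hull_minimal) auto
    then show ?thesis using q by blast
  qed
  show thesis
  proof (rule that)
    fix v c assume l: "(\<lambda>n. inner (p n) v) \<longlonglongrightarrow> c"
    \<comment> \<open>The slab of vectors whose product with \<open>v\<close> is within
      \<open>e\<close> of \<open>c\<close> is closed and convex and contains a tail of the sequence,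
      hence also \<open>q\<close>.\<close>
    have "\<bar>inner q v - c\<bar> \<le> e" if "e > 0" for e
    proof -
      obtain N where N: "\<And>n. n \<ge> N \<Longrightarrow> dist (inner (p n) v) c < e"
        using tendstoD[OF l \<open>e > 0\<close>] by (auto simp: eventually_sequentially)
      define K where "K = {z. inner v z \<le> c + e} \<inter> {z. inner v z \<ge> c - e}"
      have "q \<in> K"
      proof (rule qK[of _ N])
        show "closed K" unfolding K_def by (intro closed_Int closed_halfspace_le closed_halfspace_ge)
        show "convex K" unfolding K_def by (intro convex_Int convex_halfspace_le convex_halfspace_ge)
        show "p ` {N..} \<subseteq> K"
        proof (rule image_subsetI)
          fix n assume "n \<in> {N..}"
          then have "\<bar>inner (p n) v - c\<bar> < e" using N by (simp add: dist_real_def)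
          then show "p n \<in> K" unfolding K_def by (simp add: inner_commute abs_less_iff)
        qed
      qed
      then show ?thesis by (auto simp: K_def inner_commute abs_le_iff)
    qed
    then show "inner q v = c" by (metis abs_le_zero_iff dense_ge eq_iff_diff_eq_0)
  next
    fix K assume "closed K" "convex K" "range p \<subseteq> K"
    then show "q \<in> K" by (intro qK[of K 0]) auto
  qed
qed

text \<open>Baire: the closed sets \<open>E k\<close> cover the space, so their complements cannot
  all be dense, and some \<open>E k\<close> contains a ball. Differences of two points of the ball
  then bound all operators at once.\<close>

theorem uniform_boundedness:
  fixes F :: "nat \<Rightarrow> 'a::banach \<Rightarrow>\<^sub>L 'b::real_normed_vector"
  assumes pw: "\<And>x. bounded (range (\<lambda>n. F n x))"
  shows "bounded (range F)"
proof -
  define E where "E k = {x. \<forall>n. norm (F n x) \<le> real k}" for k :: nat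
  have cl: "closed (E k)" for k
  proof -
    have "E k = (\<Inter>n. {x. norm (F n x) \<le> real k})" by (auto simp: E_def)
    moreover have "closed {x. norm (F n x) \<le> real k}" for n
      by (intro closed_Collect_le continuous_intros)
    ultimately show ?thesis by auto
  qed
  have cov: "\<exists>k. x \<in> E k" for x
  proof -
    obtain B where "\<And>n. norm (F n x) \<le> B" using pw[of x] by (auto simp: bounded_iff)
    moreover obtain k :: nat where "B \<le> real k" using real_arch_simple by blast
    ultimately have "\<forall>n. norm (F n x) \<le> real k" by (blast intro: order_trans)
    then show ?thesis by (auto simp: E_def)
  qed
  have "\<exists>k. closure (- E k) \<noteq> UNIV"
  proof (rule ccontr)
    assume "\<not> ?thesis"
    then have dense: "closure (- E k) = UNIV" for k by blast
    have "Met_TC.mtopology closure_of (\<Inter>(range (\<lambda>k. - E k))) = UNIV"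
    proof (rule Met_TC.metric_Baire_category)
      show "Metric_space.mcomplete (UNIV :: 'a set) dist" by (simp add: complete_UNIV)
      fix U assume "U \<in> range (\<lambda>k. - E k)"
      then obtain k where "U = - E k" by blast
      then show "openin Met_TC.mtopology U \<and> Met_TC.mtopology closure_of U = UNIV"
        using cl[of k] dense[of k] by (simp add: open_Compl)
    qed simp
    moreover have "\<Inter>(range (\<lambda>k. - E k)) = {}" using cov by auto
    ultimately show False by simp
  qed
  then obtain k x0 where "x0 \<notin> closure (- E k)" by blast
  then obtain r where r: "r > 0" "ball x0 r \<subseteq> E k"
    by (metis Compl_iff closure_approachable dist_commute mem_ball subsetI)
  have "norm (F n) \<le> 4 * real k / r" for n
  proof (rule norm_blinfun_bound)
    show "0 \<le> 4 * real k / r" using r by simp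
    fix x
    show "norm (F n x) \<le> 4 * real k / r * norm x"
    proof (cases "x = 0")
      case False
      \<comment> \<open>Scaling \<open>x\<close> to length \<open>r / 2\<close> keeps
        \<open>x0 + c x\<close> inside the ball; with the factor 2 from the difference of two points
        this yields the constant \<open>4 k / r\<close>.\<close>
      define c where "c = r / (2 * norm x)"
      have c: "c > 0" using r False by (simp add: c_def)
      have "x0 + c *\<^sub>R x \<in> ball x0 r" using r False by (simp add: dist_norm c_def)
      then have "norm (F n (x0 + c *\<^sub>R x)) \<le> real k" using r by (auto simp: E_def)
      moreover have "norm (F n x0) \<le> real k" using subsetD[OF r(2), of x0] r(1) by (simp add: E_def)
      moreover have "F n (c *\<^sub>R x) = F n (x0 + c *\<^sub>R x) - F n x0" by (simp add: blinfun.add_right)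
      ultimately have "norm (F n (c *\<^sub>R x)) \<le> 2 * real k"
        using norm_triangle_ineq4[of "F n (x0 + c *\<^sub>R x)" "F n x0"] by simp
      then have "c * norm (F n x) \<le> 2 * real k" using c by (simp add: blinfun.scaleR_right)
      then have "norm (F n x) \<le> 2 * real k / c" using c by (simp add: field_simps)
      also have "\<dots> = 4 * real k / r * norm x" using r False by (simp add: c_def field_simps)
      finally show ?thesis .
    qed simp
  qed
  then show ?thesis by (auto simp: bounded_iff)
qed

section \<open>Mild solutions\<close>

text \<open>If the norms were unbounded near 0, there would be times tending to 0 whose operators
  have norm above \<open>Suc n\<close>, although these operators converge pointwise; this
  contradicts uniform boundedness.\<close>

lemma C0_semigroup_bounded_near_0:
  assumes T: "C0_semigroup T"
  obtains \<delta> M where "\<delta> > 0" "M \<ge> 1" "\<And>t. 0 \<le> t \<Longrightarrow> t \<le> \<delta> \<Longrightarrow> norm (T t) \<le> M"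
proof -
  have "\<exists>\<delta>>0. \<exists>M\<ge>1. \<forall>t. 0 \<le> t \<longrightarrow> t \<le> \<delta> \<longrightarrow> norm (T t) \<le> M"
  proof (rule ccontr)
    assume c: "\<not> ?thesis"
    have "\<exists>t. 0 \<le> t \<and> t \<le> 1 / real (Suc n) \<and> real (Suc n) < norm (T t)" for n
    proof -
      have "1 / real (Suc n) > 0" "real (Suc n) \<ge> 1" by auto
      then show ?thesis using c by (meson not_le)
    qed
    then obtain t where t: "\<And>n. 0 \<le> t n" "\<And>n. t n \<le> 1 / real (Suc n)" "\<And>n. real (Suc n) < norm (T (t n))"
      by metis
    have T0: "T 0 = id_blinfun" using T by (simp add: C0_semigroup_def)
    \<comment> \<open>The limit at 0 is one-sided and excludes 0 itself, where the norm is at most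
      1.\<close>
    have tpos: "0 < t n" for n
    proof (rule ccontr)
      assume "\<not> 0 < t n"
      then have "t n = 0" using t(1)[of n] by linarith
      then have "norm (T (t n)) \<le> 1" using T0 norm_blinfun_id_le by simp
      then show False using t(3)[of n] by simp
    qed
    have "t \<longlonglongrightarrow> 0"
      by (rule tendsto_sandwich[OF _ _ tendsto_const LIMSEQ_inverse_real_of_nat])
        (use t in \<open>auto simp: inverse_eq_divide\<close>)
    then have lim: "filterlim t (at_right 0) sequentially"
      by (rule tendsto_imp_filterlim_at_right) (use tpos in simp)
    have "bounded (range (\<lambda>n. T (t n) v))" for v
    proof -
      have "((\<lambda>t. T t v) \<longlongrightarrow> v) (at_right 0)" using T by (simp add: C0_semigroup_def)
      then have "(\<lambda>n. T (t n) v) \<longlonglongrightarrow> v" using lim by (rule filterlim_compose)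
      then show ?thesis by (rule convergent_imp_bounded)
    qed
    then have "bounded (range (\<lambda>n. T (t n)))" by (rule uniform_boundedness)
    then obtain B where B: "\<And>n. norm (T (t n)) \<le> B" by (auto simp: bounded_iff)
    obtain n where "B < real n" using reals_Archimedean2 by blast
    then show False using B[of n] t(3)[of n] by simp
  qed
  then show thesis using that by blast
qed

text \<open>A time up to \<open>n \<delta>\<close> is split into at most \<open>n\<close> steps of
  length at most \<open>\<delta>\<close>; \<open>M \<ge> 1\<close> makes the powers increase, so
  shorter times are covered too.\<close>

lemma C0_semigroup_bounded:
  assumes T: "C0_semigroup T"
  obtains M where "M \<ge> 1" "\<And>t. 0 \<le> t \<Longrightarrow> t \<le> K \<Longrightarrow> norm (T t) \<le> M"
proof -
  obtain \<delta> M where d: "\<delta> > 0" "M \<ge> 1" "\<And>t. 0 \<le> t \<Longrightarrow> t \<le> \<delta> \<Longrightarrow> norm (T t) \<le> M"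
    using C0_semigroup_bounded_near_0[OF T] by blast
  have add: "T (s + t) = T s o\<^sub>L T t" if "0 \<le> s" "0 \<le> t" for s t
    using T that by (simp add: C0_semigroup_def)
  have *: "norm (T t) \<le> M ^ n" if "0 \<le> t" "t \<le> real n * \<delta>" "n > 0" for n t
    using that
  proof (induction n arbitrary: t)
    case (Suc n)
    show ?case
    proof (cases "t \<le> \<delta>")
      case True
      then have "norm (T t) \<le> M" using d Suc by blast
      also have "\<dots> \<le> M ^ Suc n" using self_le_power[OF d(2), of "Suc n"] by simp
      finally show ?thesis .
    next
      case False
      then have "n > 0" using Suc.prems by (cases n) auto
      have "T t = T \<delta> o\<^sub>L T (t - \<delta>)" using add[of \<delta> "t - \<delta>"] d False by simp
      then have "norm (T t) \<le> norm (T \<delta>) * norm (T (t - \<delta>))" by (simp add: norm_blinfun_compose)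
      also have "\<dots> \<le> M * M ^ n"
        using Suc.IH[of "t - \<delta>"] Suc.prems False d \<open>n > 0\<close>
        by (intro mult_mono d(3)) (auto simp: algebra_simps)
      finally show ?thesis by simp
    qed
  qed simp
  obtain n :: nat where "K / \<delta> \<le> real n" using real_arch_simple by blast
  then have n: "K \<le> real (Suc n) * \<delta>" using d(1) by (simp add: field_simps)
  show thesis
    by (rule that[of "M ^ Suc n"]) (use * n d one_le_power[OF d(2)] in \<open>auto simp del: power_Suc intro!: order_trans[OF _ n]\<close>)
qed

text \<open>Taking the modulus of the time extends the map continuously to all of
  \<open>real \<times> L2I\<close>, which gives plain joint measurability for the convolution
  integrals. Continuity in time follows from that at 0 by factoring \<open>T b\<close> out of
  \<open>T a - T b\<close>, and the local bound on the norms controls the change of the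
  vector.\<close>

lemma C0_semigroup_joint_continuous:
  assumes T: "C0_semigroup T"
  shows "continuous_on UNIV (\<lambda>(r, v). T \<bar>r\<bar> v)"
proof -
  have add: "T (s + t) = T s o\<^sub>L T t" if "0 \<le> s" "0 \<le> t" for s t
    using T that by (simp add: C0_semigroup_def)
  have T0: "T 0 = id_blinfun" using T by (simp add: C0_semigroup_def)
  have "((\<lambda>(r, v). T \<bar>r\<bar> v) \<longlongrightarrow> T \<bar>r\<^sub>0\<bar> v\<^sub>0) (at (r\<^sub>0, v\<^sub>0))" for r\<^sub>0 v\<^sub>0
  proof -
    obtain M where M: "M \<ge> 1" "\<And>t. 0 \<le> t \<Longrightarrow> t \<le> \<bar>r\<^sub>0\<bar> + 1 \<Longrightarrow> norm (T t) \<le> M"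
      using C0_semigroup_bounded[OF T, of "\<bar>r\<^sub>0\<bar> + 1"] by blast
    have diff: "norm (T a v - T b v) \<le> M * norm (T \<bar>a - b\<bar> v - v)"
      if "0 \<le> a" "0 \<le> b" "a \<le> \<bar>r\<^sub>0\<bar> + 1" "b \<le> \<bar>r\<^sub>0\<bar> + 1" for a b v
    proof -
      have *: "norm (T a v - T b v) \<le> M * norm (T \<bar>a - b\<bar> v - v)" if "0 \<le> b" "b \<le> a" "a \<le> \<bar>r\<^sub>0\<bar> + 1" for a b
      proof -
        have "T a v - T b v = T b (T (a - b) v - v)"
          using add[of b "a - b"] that by (simp add: blinfun.diff_right)
        then have "norm (T a v - T b v) \<le> norm (T b) * norm (T (a - b) v - v)" by (simp add: norm_blinfun)
        also have "\<dots> \<le> M * norm (T (a - b) v - v)" using M(2)[of b] that by (intro mult_right_mono) auto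
        finally show ?thesis using that by simp
      qed
      show ?thesis
        using *[of b a] *[of a b] that by (cases "b \<le> a") (auto simp: norm_minus_commute abs_minus_commute)
    qed
    have c0: "((\<lambda>r. T \<bar>r\<bar> v) \<longlongrightarrow> v) (at 0)" for v
    proof -
      have r: "((\<lambda>t. T t v) \<longlongrightarrow> v) (at_right 0)" using T by (simp add: C0_semigroup_def)
      have "((\<lambda>t. T \<bar>t\<bar> v) \<longlongrightarrow> v) (at_right 0)"
        by (rule Lim_transform_eventually[OF r]) (auto simp: eventually_at_filter)
      moreover have "((\<lambda>t. T \<bar>t\<bar> v) \<longlongrightarrow> v) (at_left 0)"
        using calculation by (simp add: filterlim_at_left_to_right)
      ultimately show ?thesis by (simp add: filterlim_at_split)
    qed
    have c0': "((\<lambda>r. T \<bar>r\<bar> v) \<longlongrightarrow> v) (nhds 0)" for v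
      using c0[of v] T0 by (simp add: tendsto_nhds_iff)
    have f: "(fst \<longlongrightarrow> r\<^sub>0) (at (r\<^sub>0, v\<^sub>0))" "(snd \<longlongrightarrow> v\<^sub>0) (at (r\<^sub>0, v\<^sub>0))"
      using tendsto_fst[OF tendsto_ident_at, of "(r\<^sub>0, v\<^sub>0)" UNIV] tendsto_snd[OF tendsto_ident_at, of "(r\<^sub>0, v\<^sub>0)" UNIV]
      by simp_all
    have "((\<lambda>p. T \<bar>fst p\<bar> (snd p) - T \<bar>r\<^sub>0\<bar> v\<^sub>0) \<longlongrightarrow> 0) (at (r\<^sub>0, v\<^sub>0))"
    proof (rule Lim_null_comparison)
      have "((\<lambda>p. \<bar>fst p\<bar> - \<bar>r\<^sub>0\<bar>) \<longlongrightarrow> \<bar>r\<^sub>0\<bar> - \<bar>r\<^sub>0\<bar>) (at (r\<^sub>0, v\<^sub>0))" by (intro tendsto_intros f)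
      then have "((\<lambda>p. T \<bar>\<bar>fst p\<bar> - \<bar>r\<^sub>0\<bar>\<bar> v\<^sub>0) \<longlongrightarrow> v\<^sub>0) (at (r\<^sub>0, v\<^sub>0))"
        by (intro filterlim_compose[OF c0']) simp
      then have "((\<lambda>p. M * norm (snd p - v\<^sub>0) + M * norm (T \<bar>\<bar>fst p\<bar> - \<bar>r\<^sub>0\<bar>\<bar> v\<^sub>0 - v\<^sub>0)) \<longlongrightarrow>
          M * norm (v\<^sub>0 - v\<^sub>0) + M * norm (v\<^sub>0 - v\<^sub>0)) (at (r\<^sub>0, v\<^sub>0))"
        by (intro tendsto_intros f)
      then show "((\<lambda>p. M * norm (snd p - v\<^sub>0) + M * norm (T \<bar>\<bar>fst p\<bar> - \<bar>r\<^sub>0\<bar>\<bar> v\<^sub>0 - v\<^sub>0)) \<longlongrightarrow> 0) (at (r\<^sub>0, v\<^sub>0))"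
        by simp
      show "\<forall>\<^sub>F p in at (r\<^sub>0, v\<^sub>0). norm (T \<bar>fst p\<bar> (snd p) - T \<bar>r\<^sub>0\<bar> v\<^sub>0)
          \<le> M * norm (snd p - v\<^sub>0) + M * norm (T \<bar>\<bar>fst p\<bar> - \<bar>r\<^sub>0\<bar>\<bar> v\<^sub>0 - v\<^sub>0)"
        using tendstoD[OF f(1), of 1, simplified]
      proof eventually_elim
        case (elim p)
        then have r: "\<bar>fst p\<bar> \<le> \<bar>r\<^sub>0\<bar> + 1" by (auto simp: dist_real_def)
        have "T \<bar>fst p\<bar> (snd p) - T \<bar>r\<^sub>0\<bar> v\<^sub>0 = T \<bar>fst p\<bar> (snd p - v\<^sub>0) + (T \<bar>fst p\<bar> v\<^sub>0 - T \<bar>r\<^sub>0\<bar> v\<^sub>0)"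
          by (simp add: blinfun.diff_right)
        then have "norm (T \<bar>fst p\<bar> (snd p) - T \<bar>r\<^sub>0\<bar> v\<^sub>0) \<le> norm (T \<bar>fst p\<bar> (snd p - v\<^sub>0)) + norm (T \<bar>fst p\<bar> v\<^sub>0 - T \<bar>r\<^sub>0\<bar> v\<^sub>0)"
          by (metis norm_triangle_ineq)
        moreover have "norm (T \<bar>fst p\<bar> (snd p - v\<^sub>0)) \<le> norm (T \<bar>fst p\<bar>) * norm (snd p - v\<^sub>0)" by (rule norm_blinfun)
        moreover have "\<dots> \<le> M * norm (snd p - v\<^sub>0)" using M(2)[of "\<bar>fst p\<bar>"] r by (intro mult_right_mono) auto
        moreover have "norm (T \<bar>fst p\<bar> v\<^sub>0 - T \<bar>r\<^sub>0\<bar> v\<^sub>0) \<le> M * norm (T \<bar>\<bar>fst p\<bar> - \<bar>r\<^sub>0\<bar>\<bar> v\<^sub>0 - v\<^sub>0)"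
          using r by (intro diff) auto
        ultimately show ?case by linarith
      qed
    qed
    then show ?thesis by (simp add: LIM_zero_iff split_beta')
  qed
  then show ?thesis
    by (auto simp: continuous_on_eq_continuous_at isCont_def)
qed

lemma C0_semigroup_joint_measurable:
  assumes T: "C0_semigroup T"
  shows "(\<lambda>(r, v). T \<bar>r\<bar> v) \<in> borel_measurable (borel \<Otimes>\<^sub>M borel)"
  using borel_measurable_continuous_onI[OF C0_semigroup_joint_continuous[OF T]] by (simp add: borel_prod)

text \<open>The integrand may itself depend on \<open>h\<close>, as \<open>T (h - r)\<close> does in
  the computation of the generator.\<close>

lemma average_tendsto:
  fixes k :: "real \<Rightarrow> real \<Rightarrow> 'b::{banach, second_countable_topology}"
  assumes int: "\<And>h. 0 < h \<Longrightarrow> h < 1 \<Longrightarrow> set_integrable lborel {0..h} (k h)"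
    and lim: "\<And>e. e > 0 \<Longrightarrow> \<exists>\<delta>>0. \<forall>h r. 0 < h \<longrightarrow> h < \<delta> \<longrightarrow> 0 \<le> r \<longrightarrow> r \<le> h \<longrightarrow> norm (k h r - c) \<le> e"
  shows "((\<lambda>h. (1 / h) *\<^sub>R (LINT r:{0..h}|lborel. k h r)) \<longlongrightarrow> c) (at_right 0)"
proof (rule tendstoI)
  fix e :: real assume e: "e > 0"
  obtain \<delta> where d: "\<delta> > 0" "\<And>h r. 0 < h \<Longrightarrow> h < \<delta> \<Longrightarrow> 0 \<le> r \<Longrightarrow> r \<le> h \<Longrightarrow> norm (k h r - c) \<le> e / 2"
    using lim[of "e / 2"] e by auto
  have "dist ((1 / h) *\<^sub>R (LINT r:{0..h}|lborel. k h r)) c < e" if h: "0 < h" "h < min \<delta> 1" for h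
  proof -
    have i: "integrable lborel (\<lambda>r. indicator {0..h} r *\<^sub>R k h r)" using int h by (simp add: set_integrable_def)
    have ic: "integrable lborel (\<lambda>r. indicator {0..h} r *\<^sub>R v)" for v :: "'c::{banach, second_countable_topology}"
      by (intro integrable_scaleR_left integrable_real_indicator) (auto simp: emeasure_lborel_Icc_eq)
    have "(LINT r:{0..h}|lborel. k h r) - h *\<^sub>R c = (LINT r|lborel. indicator {0..h} r *\<^sub>R k h r - indicator {0..h} r *\<^sub>R c)"
      unfolding set_lebesgue_integral_def using i ic[of c] h by (simp add: emeasure_lborel_Icc_eq)
    also have "norm \<dots> \<le> (LINT r|lborel. indicator {0..h} r *\<^sub>R (e / 2))"
      by (rule Bochner_Integration.integral_norm_bound_integral[OF Bochner_Integration.integrable_diff[OF i ic] ic])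
        (use d h in \<open>auto simp: indicator_def\<close>)
    also have "\<dots> = h * (e / 2)" using h by (simp add: emeasure_lborel_Icc_eq)
    finally have "norm ((LINT r:{0..h}|lborel. k h r) - h *\<^sub>R c) \<le> h * (e / 2)" .
    moreover have "(LINT r:{0..h}|lborel. k h r) - h *\<^sub>R c = h *\<^sub>R ((1 / h) *\<^sub>R (LINT r:{0..h}|lborel. k h r) - c)"
      using h by (simp add: scaleR_diff_right)
    ultimately show ?thesis using h e by (simp add: dist_norm)
  qed
  then show "\<forall>\<^sub>F h in at_right 0. dist ((1 / h) *\<^sub>R (LINT r:{0..h}|lborel. k h r)) c < e"
    unfolding eventually_at_right_field using d(1) by (intro exI[of _ "min \<delta> 1"]) auto
qed

section \<open>Convolution of the semigroup with a forcing term\<close>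

lemma C0_semigroup_convolution_integrable:
  fixes F :: "real \<Rightarrow> L2I"
  assumes T: "C0_semigroup T" and F: "integrable lborel F" and A: "A \<in> sets borel" "A \<subseteq> {-K..K}"
  shows "integrable lborel (\<lambda>s. indicator A s *\<^sub>R T \<bar>c - s\<bar> (F s))"
proof -
  have [measurable]: "F \<in> borel_measurable borel" using borel_measurable_integrable[OF F] by simp
  have [measurable]: "A \<in> sets borel" by (rule A)
  obtain M where M: "M \<ge> 1" "\<And>t. 0 \<le> t \<Longrightarrow> t \<le> \<bar>c\<bar> + K \<Longrightarrow> norm (T t) \<le> M"
    using C0_semigroup_bounded[OF T, of "\<bar>c\<bar> + K"] by blast
  note [measurable] = C0_semigroup_joint_measurable[OF T]
  have "(\<lambda>s. (\<lambda>(r, v). T \<bar>r\<bar> v) (c - s, F s)) \<in> borel_measurable borel" by measurable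
  then have [measurable]: "(\<lambda>s. T \<bar>c - s\<bar> (F s)) \<in> borel_measurable borel" by simp
  show ?thesis
  proof (rule Bochner_Integration.integrable_bound[of _ "\<lambda>s. M *\<^sub>R F s"])
    show "integrable lborel (\<lambda>s. M *\<^sub>R F s)" by (intro integrable_scaleR_right F)
    show "AE s in lborel. norm (indicator A s *\<^sub>R T \<bar>c - s\<bar> (F s)) \<le> norm (M *\<^sub>R F s)"
    proof (intro AE_I2)
      fix s
      show "norm (indicator A s *\<^sub>R T \<bar>c - s\<bar> (F s)) \<le> norm (M *\<^sub>R F s)"
      proof (cases "s \<in> A")
        case True
        then have "s \<in> {-K..K}" using A(2) by blast
          then have "\<bar>c - s\<bar> \<le> \<bar>c\<bar> + K" by auto
        then have "norm (T \<bar>c - s\<bar>) * norm (F s) \<le> M * norm (F s)" by (intro mult_right_mono M) auto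
        then show ?thesis using True M(1) norm_blinfun[of "T \<bar>c - s\<bar>" "F s"] by simp
      qed simp
    qed
  qed measurable
qed

text \<open>The forcing is cut off at an upper time bound \<open>N\<close>, which makes it
  integrable on the whole line, and \<open>|t - s|\<close> replaces \<open>t - s\<close>; both forms
  agree where the indicator is nonzero.\<close>

lemma variation_of_constants_eq:
  assumes v: "variation_of_constants T y0 F y" and t: "0 \<le> t" "t \<le> N"
  shows "y t = T \<bar>t\<bar> y0 + (LINT s|lborel. indicator {0..t} s *\<^sub>R T \<bar>t - s\<bar> (indicator {0..N} s *\<^sub>R F s))"
proof -
  have "(LINT s:{0..t}|lborel. T (t - s) (F s)) = (LINT s|lborel. indicator {0..t} s *\<^sub>R T \<bar>t - s\<bar> (indicator {0..N} s *\<^sub>R F s))"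
    unfolding set_lebesgue_integral_def
    using t by (intro Bochner_Integration.integral_cong) (auto simp: indicator_def)
  then show ?thesis using v t by (simp add: variation_of_constants_def)
qed

lemma variation_of_constants_integrable:
  assumes v: "variation_of_constants T y0 F y" and t: "0 \<le> a"
  shows "set_integrable lborel {a..b} F"
proof (cases "0 \<le> b")
  case True
  then have "set_integrable lborel {0..b} F" using v by (simp add: variation_of_constants_def)
  then show ?thesis by (rule set_integrable_subset) (use t in auto)
next
  case False
  then have "{a..b} = {}" using t by auto
  then show ?thesis by (simp add: set_integrable_def)
qed

text \<open>Dominated convergence in the convolution integral; the indicator of
  \<open>[0, u n]\<close> converges at every \<open>s\<close> except possibly at
  \<open>s = t\<close>.\<close>

lemma mild_continuous:
  assumes T: "C0_semigroup T" and v: "variation_of_constants T y0 F y"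
  shows "continuous_on {0..} y"
proof -
  have c: "continuous_on {0..N} y" if "0 \<le> N" for N
  proof -
    define F' where "F' s = indicator {0..N} s *\<^sub>R F s" for s
    have F': "integrable lborel F'"
      using variation_of_constants_integrable[OF v, of 0 N] by (simp add: F'_def[abs_def] set_integrable_def)
    have [measurable]: "F' \<in> borel_measurable borel" using borel_measurable_integrable[OF F'] by simp
    obtain M where M: "M \<ge> 1" "\<And>t. 0 \<le> t \<Longrightarrow> t \<le> N \<Longrightarrow> norm (T t) \<le> M"
      using C0_semigroup_bounded[OF T, of N] by blast
    have jc: "(\<lambda>n. T \<bar>f n\<bar> (g n)) \<longlonglongrightarrow> T \<bar>a\<bar> b" if "f \<longlonglongrightarrow> a" "g \<longlonglongrightarrow> b" for f g a b
      using continuous_on_tendsto_compose[OF C0_semigroup_joint_continuous[OF T] tendsto_Pair[OF that]] by simp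
    have "continuous_on {0..N} (\<lambda>t. T \<bar>t\<bar> y0 + (LINT s|lborel. indicator {0..t} s *\<^sub>R T \<bar>t - s\<bar> (F' s)))"
      unfolding continuous_on_sequentially comp_def
    proof (intro allI ballI impI, elim conjE)
      fix u :: "nat \<Rightarrow> real" and t assume "t \<in> {0..N}" "\<forall>n. u n \<in> {0..N}" and u: "u \<longlonglongrightarrow> t"
      then have t: "0 \<le> t" "t \<le> N" "\<forall>n. 0 \<le> u n \<and> u n \<le> N" by auto
      have "(\<lambda>n. LINT s|lborel. indicator {0..u n} s *\<^sub>R T \<bar>u n - s\<bar> (F' s))
          \<longlonglongrightarrow> (LINT s|lborel. indicator {0..t} s *\<^sub>R T \<bar>t - s\<bar> (F' s))"
      proof (rule integral_dominated_convergence[where w = "\<lambda>s. M * norm (F' s)"])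
        show "(\<lambda>s. indicator {0..t} s *\<^sub>R T \<bar>t - s\<bar> (F' s)) \<in> borel_measurable lborel"
          by (rule borel_measurable_integrable[OF C0_semigroup_convolution_integrable[OF T F', of _ t]]) (use t in auto)
        show "(\<lambda>s. indicator {0..u n} s *\<^sub>R T \<bar>u n - s\<bar> (F' s)) \<in> borel_measurable lborel" for n
          by (rule borel_measurable_integrable[OF C0_semigroup_convolution_integrable[OF T F', of _ "u n"]]) (use t in auto)
        show "integrable lborel (\<lambda>s. M * norm (F' s))" using F' by simp
        show "AE s in lborel. norm (indicator {0..u n} s *\<^sub>R T \<bar>u n - s\<bar> (F' s)) \<le> M * norm (F' s)" for n
        proof (intro AE_I2)
          fix s
          show "norm (indicator {0..u n} s *\<^sub>R T \<bar>u n - s\<bar> (F' s)) \<le> M * norm (F' s)"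
          proof (cases "s \<in> {0..u n}")
            case True
            then have "norm (T \<bar>u n - s\<bar>) \<le> M" using t(3) by (intro M) (auto intro: order_trans[of _ "u n"])
            then have "norm (T \<bar>u n - s\<bar>) * norm (F' s) \<le> M * norm (F' s)" by (rule mult_right_mono) simp
            then show ?thesis using True norm_blinfun[of "T \<bar>u n - s\<bar>" "F' s"] by simp
          qed (use M(1) in simp)
        qed
        show "AE s in lborel. (\<lambda>n. indicator {0..u n} s *\<^sub>R T \<bar>u n - s\<bar> (F' s)) \<longlonglongrightarrow> indicator {0..t} s *\<^sub>R T \<bar>t - s\<bar> (F' s)"
          using AE_lborel_singleton[of t]
        proof eventually_elim
          case (elim s)
          have "eventually (\<lambda>n. (indicator {0..u n} s :: real) = indicator {0..t} s) sequentially"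
            using eventually_indicator_atMost[OF u elim] by eventually_elim (auto simp: indicator_def)
          then show ?case by (intro tendsto_scaleR jc tendsto_eventually tendsto_intros u)
        qed
      qed
      then show "(\<lambda>n. T \<bar>u n\<bar> y0 + (LINT s|lborel. indicator {0..u n} s *\<^sub>R T \<bar>u n - s\<bar> (F' s)))
          \<longlonglongrightarrow> T \<bar>t\<bar> y0 + (LINT s|lborel. indicator {0..t} s *\<^sub>R T \<bar>t - s\<bar> (F' s))"
        by (intro tendsto_add jc u tendsto_const)
    qed
    moreover have "continuous_on {0..N} y \<longleftrightarrow>
        continuous_on {0..N} (\<lambda>t. T \<bar>t\<bar> y0 + (LINT s|lborel. indicator {0..t} s *\<^sub>R T \<bar>t - s\<bar> (F' s)))"
      by (rule continuous_on_cong) (use variation_of_constants_eq[OF v, of _ N] in \<open>auto simp: F'_def\<close>)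
    ultimately show ?thesis by simp
  qed
  show ?thesis
    unfolding continuous_on_eq_continuous_within
  proof
    fix t :: real assume t: "t \<in> {0..}"
    have "at t within {0..} = at t within {0..t + 1}"
      by (rule at_within_nhd[of _ "{..<t + 1}"]) auto
    then show "continuous (at t within {0..}) y"
      using c[of "t + 1"] t by (auto simp: continuous_on_eq_continuous_within continuous_within)
  qed
qed

lemma lborel_set_integral_shift:
  fixes f :: "real \<Rightarrow> 'b::{banach, second_countable_topology}"
  shows "(LINT s:{a + h..b + h}|lborel. f s) = (LINT s:{a..b}|lborel. f (h + s))"
proof -
  have "(LINT s:{a + h..b + h}|lborel. f s) = (LINT s|lborel. indicator {a + h..b + h} (h + s) *\<^sub>R f (h + s))"
    unfolding set_lebesgue_integral_def by (subst lborel_integral_real_affine[of 1 _ h]) auto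
  also have "\<dots> = (LINT s:{a..b}|lborel. f (h + s))"
    unfolding set_lebesgue_integral_def by (intro Bochner_Integration.integral_cong) (auto simp: indicator_def)
  finally show ?thesis .
qed

text \<open>By the semigroup law the formula can be restarted at time \<open>t\<close> from the
  value \<open>y t\<close>.\<close>

lemma mild_step:
  assumes T: "C0_semigroup T" and v: "variation_of_constants T y0 F y"
    and t: "0 \<le> t" "0 \<le> h" "t + h \<le> N"
  defines "F' \<equiv> \<lambda>s. indicator {0..N} s *\<^sub>R F s"
  shows "y (t + h) = T h (y t) + (LINT r:{0..h}|lborel. T \<bar>h - r\<bar> (F' (t + r)))"
proof -
  have F': "integrable lborel F'"
    using variation_of_constants_integrable[OF v, of 0 N] by (simp add: F'_def set_integrable_def)
  have add: "T (s + t) = T s o\<^sub>L T t" if "0 \<le> s" "0 \<le> t" for s t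
    using T that by (simp add: C0_semigroup_def)
  define k where "k s = T \<bar>t + h - s\<bar> (F' s)" for s
  have ki: "set_integrable lborel {0..t + h} k"
    unfolding set_integrable_def k_def
    by (rule C0_semigroup_convolution_integrable[OF T F', of _ "t + h"]) (use t in auto)
  have "T h (y t) = T h (T t y0) + T h (LINT s|lborel. indicator {0..t} s *\<^sub>R T \<bar>t - s\<bar> (F' s))"
    using variation_of_constants_eq[OF v, of t N] t by (simp add: F'_def blinfun.add_right)
  also have "T h (T t y0) = T (t + h) y0" using add[of h t] t by (simp add: add.commute)
  also have "T h (LINT s|lborel. indicator {0..t} s *\<^sub>R T \<bar>t - s\<bar> (F' s))
     = (LINT s|lborel. T h (indicator {0..t} s *\<^sub>R T \<bar>t - s\<bar> (F' s)))"
    by (rule integral_bounded_linear[OF blinfun.bounded_linear_right, symmetric])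
      (rule C0_semigroup_convolution_integrable[OF T F', of _ t], use t in auto)
  also have "\<dots> = (LINT s:{0..t}|lborel. k s)"
    unfolding set_lebesgue_integral_def
  proof (intro Bochner_Integration.integral_cong refl)
    fix s
    show "T h (indicator {0..t} s *\<^sub>R T \<bar>t - s\<bar> (F' s)) = indicator {0..t} s *\<^sub>R k s"
      using add[of h "t - s"] t
      by (auto simp: indicator_def k_def blinfun.zero_right algebra_simps)
  qed
  finally have 1: "T h (y t) = T (t + h) y0 + (LINT s:{0..t}|lborel. k s)" .
  have "y (t + h) = T (t + h) y0 + (LINT s:{0..t + h}|lborel. k s)"
    using variation_of_constants_eq[OF v, of "t + h" N] t by (simp add: F'_def k_def set_lebesgue_integral_def)
  also have "(LINT s:{0..t + h}|lborel. k s) = (LINT s:{0..t}|lborel. k s) + (LINT s:{t..t + h}|lborel. k s)"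
    by (rule set_integral_Icc_split) (use t ki in auto)
  also have "(LINT s:{t..t + h}|lborel. k s) = (LINT r:{0..h}|lborel. k (t + r))"
    using lborel_set_integral_shift[of 0 t h k] by (simp add: add.commute)
  finally show ?thesis using 1 by (simp add: k_def)
qed

lemma mild_set_integrable:
  assumes T: "C0_semigroup T" and v: "variation_of_constants T y0 F y" and a: "0 \<le> a"
  shows "set_integrable lborel {a..b} y"
  unfolding set_integrable_def
  by (rule borel_integrable_compact) (use a in \<open>auto intro: continuous_on_subset[OF mild_continuous[OF T v]]\<close>)

text \<open>By \<open>mild_step\<close>, \<open>T h\<close> maps the integral \<open>Y\<close> of
  \<open>y\<close> over \<open>[a, b]\<close> to the integral over \<open>[a + h, b + h]\<close>
  minus a double integral of the forcing. Divided by \<open>h\<close>, the change of interval leaves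
  averages of \<open>y\<close> near \<open>b\<close> and \<open>a\<close>, and the double integral
  becomes an average of \<open>T (h - r)\<close> applied to a continuous function. So the generator
  is identified at \<open>Y\<close>, although \<open>y t\<close> itself is not known to lie in its
  domain.\<close>

theorem mild_solution_integrated:
  assumes T: "C0_semigroup T" and v: "variation_of_constants T y0 F y" and ab: "0 \<le> a" "a \<le> b"
  shows "((LINT t:{a..b}|lborel. y t), y b - y a - (LINT t:{a..b}|lborel. F t)) \<in> generator T"
proof -
  \<comment> \<open>With \<open>h < 1\<close> all times that occur, up to \<open>b + h\<close>, stay
    below \<open>N\<close>.\<close>
  define N where "N = b + 1"
  define F' where "F' s = indicator {0..N} s *\<^sub>R F s" for s
  have F': "integrable lborel F'"
    using variation_of_constants_integrable[OF v, of 0 N] by (simp add: F'_def[abs_def] set_integrable_def)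
  have [measurable]: "F' \<in> borel_measurable borel" using borel_measurable_integrable[OF F'] by simp
  obtain M where M: "M \<ge> 1" "\<And>t. 0 \<le> t \<Longrightarrow> t \<le> 1 \<Longrightarrow> norm (T t) \<le> M"
    using C0_semigroup_bounded[OF T, of 1] by blast
  have yi: "set_integrable lborel {u..w} y" if "0 \<le> u" for u w by (rule mild_set_integrable[OF T v that])
  \<comment> \<open>The forcing integrated over the shifted interval. While the forcing is only
    integrable, this is continuous in the shift, so averages over \<open>[0, h]\<close> converge to
    \<open>\<Phi> 0\<close>.\<close>
  define \<Phi> where "\<Phi> r = (LINT t:{a..b}|lborel. F' (t + r))" for r
  define Y where "Y = (LINT t:{a..b}|lborel. y t)"
  have \<Phi>0: "\<Phi> 0 = (LINT t:{a..b}|lborel. F t)"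
    unfolding \<Phi>_def set_lebesgue_integral_def F'_def N_def
    by (intro Bochner_Integration.integral_cong) (use ab in \<open>auto simp: indicator_def\<close>)
  have \<Phi>c: "continuous_on UNIV \<Phi>"
  proof -
    have "\<Phi> r = (LINT s|lborel. indicator {..b + r} s *\<^sub>R F' s) - (LINT s|lborel. indicator {..a + r} s *\<^sub>R F' s)" for r
    proof -
      have "\<Phi> r = (LINT s:{a + r..b + r}|lborel. F' s)"
        using lborel_set_integral_shift[of a r b F'] by (simp add: \<Phi>_def add.commute)
      also have "\<dots> = (LINT s|lborel. indicator {..b + r} s *\<^sub>R F' s - indicator {..a + r} s *\<^sub>R F' s)"
        unfolding set_lebesgue_integral_def
      proof (rule integral_cong_AE)
        show "AE s in lborel. indicator {a + r..b + r} s *\<^sub>R F' s = indicator {..b + r} s *\<^sub>R F' s - indicator {..a + r} s *\<^sub>R F' s"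
          using AE_lborel_singleton[of "a + r"] by eventually_elim (use ab in \<open>auto simp: indicator_def\<close>)
      qed measurable
      also have "\<dots> = (LINT s|lborel. indicator {..b + r} s *\<^sub>R F' s) - (LINT s|lborel. indicator {..a + r} s *\<^sub>R F' s)"
        by (intro Bochner_Integration.integral_diff integrable_mult_indicator F') auto
      finally show ?thesis .
    qed
    then have "\<Phi> = (\<lambda>r. (LINT s|lborel. indicator {..b + r} s *\<^sub>R F' s) - (LINT s|lborel. indicator {..a + r} s *\<^sub>R F' s))" by blast
    then show ?thesis
      by (simp only:) (intro continuous_intros continuous_on_compose2[OF indicator_Iic_integral_continuous[OF F']]; simp)
  qed
  \<comment> \<open>Interchanging the integrals lets the integration over \<open>[a, b]\<close> act
    on the forcing alone and produce \<open>\<Phi>\<close>.\<close>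
  have fub: "(LINT t:{a..b}|lborel. LINT r:{0..h}|lborel. T \<bar>h - r\<bar> (F' (t + r))) = (LINT r:{0..h}|lborel. T \<bar>h - r\<bar> (\<Phi> r))"
    if h: "0 \<le> h" "h \<le> 1" for h
  proof -
    define k where "k t r = (indicator {a..b} t * indicator {0..h} r) *\<^sub>R T \<bar>h - r\<bar> (F' (t + r))" for t r :: real
    note [measurable] = C0_semigroup_joint_measurable[OF T]
    have "(\<lambda>z. (\<lambda>(r, v). T \<bar>r\<bar> v) (h - fst z, F' (snd z + fst z))) \<in> borel_measurable (lborel \<Otimes>\<^sub>M lborel)" by measurable
    then have [measurable]: "(\<lambda>z. T \<bar>h - fst z\<bar> (F' (snd z + fst z))) \<in> borel_measurable (lborel \<Otimes>\<^sub>M lborel)" by simp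
    have km: "(\<lambda>(r, t). k t r) \<in> borel_measurable (lborel \<Otimes>\<^sub>M lborel)"
      unfolding k_def split_beta' by measurable
    have kb: "norm (k t r) \<le> indicator {0..h} r * (M * norm (F' (r + t)))" for t r
    proof (cases "r \<in> {0..h} \<and> t \<in> {a..b}")
      case True
      then have "norm (T \<bar>h - r\<bar>) * norm (F' (t + r)) \<le> M * norm (F' (t + r))"
        using h by (intro mult_right_mono M) auto
      then show ?thesis using True norm_blinfun[of "T \<bar>h - r\<bar>" "F' (t + r)"] by (simp add: k_def add.commute)
    qed (use M in \<open>auto simp: k_def indicator_def\<close>)
    have Fs: "integrable lborel (\<lambda>t. F' (r + t))" for r
      using lborel_integrable_real_affine[OF F', of 1 r] by simp
    have ki: "integrable (lborel \<Otimes>\<^sub>M lborel) (\<lambda>(r, t). k t r)"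
    proof (rule Bochner_Integration.integrable_bound[OF _ km])
      show "integrable (lborel \<Otimes>\<^sub>M lborel) (\<lambda>(r, t). indicator {0..h} r * (M * norm (F' (r + t))))"
      proof (rule lborel_pair.Fubini_integrable)
        show "(\<lambda>(r, t). indicator {0..h} r * (M * norm (F' (r + t)))) \<in> borel_measurable (lborel \<Otimes>\<^sub>M lborel)"
          unfolding split_beta' by measurable
        have "(LINT t|lborel. norm (F' (r + t))) = (LINT t|lborel. norm (F' t))" for r
          using lborel_integral_real_affine[of 1 "\<lambda>t. norm (F' t)" r] by simp
        then have e: "(\<lambda>r. LINT t|lborel. norm (case (r, t) of (r, t) \<Rightarrow> indicator {0..h} r * (M * norm (F' (r + t)))))
          = (\<lambda>r. indicator {0..h} r * (M * (LINT t|lborel. norm (F' t))))"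
          using M(1) by (auto simp: abs_mult)
        then show "integrable lborel (\<lambda>r. LINT t|lborel. norm (case (r, t) of (r, t) \<Rightarrow> indicator {0..h} r * (M * norm (F' (r + t)))))"
          unfolding e by (intro integrable_mult_left integrable_real_indicator) (auto simp: emeasure_lborel_Icc_eq)
        show "AE r in lborel. integrable lborel (\<lambda>t. case (r, t) of (r, t) \<Rightarrow> indicator {0..h} r * (M * norm (F' (r + t))))"
          using Fs by auto
      qed
      show "AE p in lborel \<Otimes>\<^sub>M lborel. norm (case p of (r, t) \<Rightarrow> k t r) \<le> norm (case p of (r, t) \<Rightarrow> indicator {0..h} r * (M * norm (F' (r + t))))"
        using kb by (intro AE_I2) (auto intro: order_trans[OF _ abs_ge_self])
    qed
    have "(LINT t|lborel. LINT r|lborel. k t r) = (LINT r|lborel. LINT t|lborel. k t r)"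
      using lborel_pair.Fubini_integral[OF ki] by simp
    moreover have "(LINT r|lborel. k t r) = indicator {a..b} t *\<^sub>R (LINT r:{0..h}|lborel. T \<bar>h - r\<bar> (F' (t + r)))" for t
      by (auto simp: k_def indicator_def set_lebesgue_integral_def)
    moreover have "(LINT t|lborel. k t r) = indicator {0..h} r *\<^sub>R T \<bar>h - r\<bar> (\<Phi> r)" for r
    proof -
      have "(LINT t|lborel. k t r) = (LINT t|lborel. indicator {0..h} r *\<^sub>R T \<bar>h - r\<bar> (indicator {a..b} t *\<^sub>R F' (t + r)))"
        by (intro Bochner_Integration.integral_cong) (auto simp: k_def indicator_def blinfun.zero_right)
      also have "\<dots> = indicator {0..h} r *\<^sub>R (LINT t|lborel. T \<bar>h - r\<bar> (indicator {a..b} t *\<^sub>R F' (t + r)))"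
        by (auto simp: indicator_def)
      also have "(LINT t|lborel. T \<bar>h - r\<bar> (indicator {a..b} t *\<^sub>R F' (t + r))) = T \<bar>h - r\<bar> (\<Phi> r)"
        unfolding \<Phi>_def set_lebesgue_integral_def
        using integrable_mult_indicator[OF _ Fs[of r], of "{a..b}"]
        by (intro integral_bounded_linear[OF blinfun.bounded_linear_right]) (simp add: add.commute)
      finally show ?thesis .
    qed
    ultimately show ?thesis by (simp add: set_lebesgue_integral_def)
  qed
  have main: "T h Y - Y = (LINT t:{b..b + h}|lborel. y t) - (LINT t:{a..a + h}|lborel. y t) - (LINT r:{0..h}|lborel. T \<bar>h - r\<bar> (\<Phi> r))"
    if h: "0 < h" "h < 1" for h
  proof -
    have step: "T h (y t) = y (h + t) - (LINT r:{0..h}|lborel. T \<bar>h - r\<bar> (F' (t + r)))" if "t \<in> {a..b}" for t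
      using mild_step[OF T v, of t h N] that h ab by (simp add: F'_def N_def add.commute)
    have ysh: "set_integrable lborel {a..b} (\<lambda>t. y (h + t))"
      unfolding set_integrable_def
      by (intro borel_integrable_compact continuous_on_compose2[OF mild_continuous[OF T v]] continuous_intros) (use ab h in auto)
    have "T h Y = (LINT t|lborel. T h (indicator {a..b} t *\<^sub>R y t))"
      unfolding Y_def set_lebesgue_integral_def
      by (rule integral_bounded_linear[OF blinfun.bounded_linear_right, symmetric])
        (use yi[OF ab(1), of b] in \<open>simp add: set_integrable_def\<close>)
    also have "\<dots> = (LINT t|lborel. indicator {a..b} t *\<^sub>R y (h + t) - indicator {a..b} t *\<^sub>R (LINT r:{0..h}|lborel. T \<bar>h - r\<bar> (F' (t + r))))"
      using step by (intro Bochner_Integration.integral_cong) (auto simp: indicator_def blinfun.zero_right)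
    also have "\<dots> = (LINT t:{a..b}|lborel. y (h + t)) - (LINT t:{a..b}|lborel. LINT r:{0..h}|lborel. T \<bar>h - r\<bar> (F' (t + r)))"
      unfolding set_lebesgue_integral_def[of lborel "{a..b}"]
    proof (rule Bochner_Integration.integral_diff)
      show i1: "integrable lborel (\<lambda>t. indicator {a..b} t *\<^sub>R y (h + t))" using ysh by (simp add: set_integrable_def)
      have "integrable lborel (\<lambda>t. indicator {a..b} t *\<^sub>R y (h + t) - T h (indicator {a..b} t *\<^sub>R y t))"
        by (intro Bochner_Integration.integrable_diff i1 integrable_bounded_linear[OF blinfun.bounded_linear_right])
          (use yi[OF ab(1), of b] in \<open>simp add: set_integrable_def\<close>)
      moreover have "(\<lambda>t. indicator {a..b} t *\<^sub>R y (h + t) - T h (indicator {a..b} t *\<^sub>R y t))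
        = (\<lambda>t. indicator {a..b} t *\<^sub>R (LINT r:{0..h}|lborel. T \<bar>h - r\<bar> (F' (t + r))))"
        using step by (auto simp: indicator_def blinfun.zero_right fun_eq_iff)
      ultimately show "integrable lborel (\<lambda>t. indicator {a..b} t *\<^sub>R (LINT r:{0..h}|lborel. T \<bar>h - r\<bar> (F' (t + r))))" by simp
    qed
    also have "(LINT t:{a..b}|lborel. y (h + t)) = (LINT t:{a + h..b + h}|lborel. y t)"
      by (rule lborel_set_integral_shift[symmetric])
    finally have "T h Y = (LINT t:{a + h..b + h}|lborel. y t) - (LINT r:{0..h}|lborel. T \<bar>h - r\<bar> (\<Phi> r))"
      using fub h by simp
    moreover have "(LINT t:{a..b + h}|lborel. y t) = (LINT t:{a..a + h}|lborel. y t) + (LINT t:{a + h..b + h}|lborel. y t)"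
      using ab h by (intro set_integral_Icc_split yi) auto
    moreover have "(LINT t:{a..b + h}|lborel. y t) = Y + (LINT t:{b..b + h}|lborel. y t)"
      unfolding Y_def using ab h by (intro set_integral_Icc_split yi) auto
    ultimately show ?thesis by (simp add: algebra_simps)
  qed
  have ylim: "((\<lambda>h. (1 / h) *\<^sub>R (LINT t:{c..c + h}|lborel. y t)) \<longlongrightarrow> y c) (at_right 0)" if c: "0 \<le> c" for c
  proof -
    have "((\<lambda>h. (1 / h) *\<^sub>R (LINT r:{0..h}|lborel. y (c + r))) \<longlongrightarrow> y c) (at_right 0)"
    proof (rule average_tendsto)
      show "set_integrable lborel {0..h} (\<lambda>r. y (c + r))" if "0 < h" "h < 1" for h
        unfolding set_integrable_def
        by (intro borel_integrable_compact continuous_on_compose2[OF mild_continuous[OF T v]] continuous_intros) (use that c in auto)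
      fix e :: real assume "e > 0"
      then obtain d where d: "d > 0" "\<And>t. t \<ge> 0 \<Longrightarrow> dist t c < d \<Longrightarrow> dist (y t) (y c) < e"
        using mild_continuous[OF T v] c unfolding continuous_on_iff by (metis atLeast_iff)
      show "\<exists>\<delta>>0. \<forall>h r. 0 < h \<longrightarrow> h < \<delta> \<longrightarrow> 0 \<le> r \<longrightarrow> r \<le> h \<longrightarrow> norm (y (c + r) - y c) \<le> e"
        using d(1) d(2)[of "c + _"] c by (intro exI[of _ d]) (auto simp: dist_norm intro!: less_imp_le)
    qed
    moreover have "(LINT r:{0..h}|lborel. y (c + r)) = (LINT t:{c..c + h}|lborel. y t)" for h
      using lborel_set_integral_shift[of 0 c h y] by (simp add: add.commute)
    ultimately show ?thesis by simp
  qed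
  have \<Phi>lim: "((\<lambda>h. (1 / h) *\<^sub>R (LINT r:{0..h}|lborel. T \<bar>h - r\<bar> (\<Phi> r))) \<longlongrightarrow> \<Phi> 0) (at_right 0)"
  proof (rule average_tendsto)
    show "set_integrable lborel {0..h} (\<lambda>r. T \<bar>h - r\<bar> (\<Phi> r))" for h
      unfolding set_integrable_def
    proof (rule borel_integrable_compact)
      have "continuous_on {0..h} (\<lambda>r. (\<lambda>(r, v). T \<bar>r\<bar> v) (h - r, \<Phi> r))"
        by (intro continuous_on_compose2[OF C0_semigroup_joint_continuous[OF T]] continuous_intros continuous_on_subset[OF \<Phi>c]) auto
      then show "continuous_on {0..h} (\<lambda>r. T \<bar>h - r\<bar> (\<Phi> r))" by simp
    qed simp
    fix e :: real assume e: "e > 0"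
    have "T \<bar>0\<bar> (\<Phi> 0) = \<Phi> 0" using T by (simp add: C0_semigroup_def)
    moreover have "isCont (\<lambda>p. (\<lambda>(r, v). T \<bar>r\<bar> v) (fst p - snd p, \<Phi> (snd p))) (0, 0)"
    proof -
      have "continuous_on UNIV (\<lambda>p. (\<lambda>(r, v). T \<bar>r\<bar> v) (fst p - snd p, \<Phi> (snd p)))"
        by (intro continuous_on_compose2[OF C0_semigroup_joint_continuous[OF T]] continuous_intros continuous_on_compose2[OF \<Phi>c]) auto
      then show ?thesis by (simp add: continuous_on_eq_continuous_at)
    qed
    ultimately obtain d where d: "d > 0" "\<And>p. dist p (0, 0) < d \<Longrightarrow> dist (T \<bar>fst p - snd p\<bar> (\<Phi> (snd p))) (\<Phi> 0) < e"
      using e unfolding continuous_at_eps_delta by force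
    show "\<exists>\<delta>>0. \<forall>h r. 0 < h \<longrightarrow> h < \<delta> \<longrightarrow> 0 \<le> r \<longrightarrow> r \<le> h \<longrightarrow> norm (T \<bar>h - r\<bar> (\<Phi> r) - \<Phi> 0) \<le> e"
    proof (intro exI[of _ "d / 2"] conjI allI impI)
      fix h r :: real assume hr: "0 < h" "h < d / 2" "0 \<le> r" "r \<le> h"
      have "dist (h, r) (0, 0) \<le> \<bar>h\<bar> + \<bar>r\<bar>"
        using sqrt_sum_squares_le_sum_abs[of h r] by (simp add: dist_Pair_Pair)
      then have "dist (h, r) (0, 0) < d" using hr by simp
      from d(2)[OF this] show "norm (T \<bar>h - r\<bar> (\<Phi> r) - \<Phi> 0) \<le> e" by (simp add: dist_norm)
    qed (use d in simp)
  qed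
  have "((\<lambda>h. (1 / h) *\<^sub>R (T h Y - Y)) \<longlongrightarrow> y b - y a - \<Phi> 0) (at_right 0)"
  proof (rule Lim_transform_eventually)
    show "((\<lambda>h. (1 / h) *\<^sub>R (LINT t:{b..b + h}|lborel. y t) - (1 / h) *\<^sub>R (LINT t:{a..a + h}|lborel. y t)
        - (1 / h) *\<^sub>R (LINT r:{0..h}|lborel. T \<bar>h - r\<bar> (\<Phi> r))) \<longlongrightarrow> y b - y a - \<Phi> 0) (at_right 0)"
      using ab by (intro tendsto_intros ylim \<Phi>lim) auto
    show "\<forall>\<^sub>F h in at_right 0. (1 / h) *\<^sub>R (LINT t:{b..b + h}|lborel. y t) - (1 / h) *\<^sub>R (LINT t:{a..a + h}|lborel. y t)
        - (1 / h) *\<^sub>R (LINT r:{0..h}|lborel. T \<bar>h - r\<bar> (\<Phi> r)) = (1 / h) *\<^sub>R (T h Y - Y)"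
      unfolding eventually_at_right_field using main
      by (intro exI[of _ 1]) (simp add: scaleR_diff_right)
  qed
  then show ?thesis by (simp add: generator_def Y_def \<Phi>0)
qed

section \<open>The energy space\<close>

lemma integrable_leb_I_iff: "integrable leb_I f \<longleftrightarrow> set_integrable lborel II f"
  for f :: "real \<Rightarrow> 'b::{banach, second_countable_topology}"
  unfolding leb_I_def set_integrable_def by (rule integrable_restrict_space) simp

lemma integral_leb_I: "(LINT x|leb_I. f x) = (LINT x:II|lborel. f x)"
  for f :: "real \<Rightarrow> 'b::{banach, second_countable_topology}"
  unfolding leb_I_def set_lebesgue_integral_def by (rule integral_restrict_space) simp

lemma AE_leb_I_iff: "(AE x in leb_I. P x) \<longleftrightarrow> (AE x in lborel. x \<in> II \<longrightarrow> P x)"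
  unfolding leb_I_def by (rule AE_restrict_space_iff) simp

lemma AE_in_II: "AE x in leb_I. x \<in> II"
  by (rule AE_I2) simp

text \<open>\<open>leb_I\<close> has mass 2, so an almost everywhere statement cannot be void;
  inequalities between constants are extracted from pointwise bounds in this way.\<close>

lemma AE_leb_I_constD: "AE x in leb_I. P \<Longrightarrow> P"
proof (rule ccontr)
  assume "AE x in leb_I. P" "\<not> P"
  then have "emeasure leb_I (space leb_I) = 0"
    by (subst (asm) AE_iff_measurable[of "space leb_I"]) (use sets.top[of leb_I] in auto)
  then show False using emeasure_space_leb_I by simp
qed

lemma borel_measurable_leb_I: "f \<in> borel_measurable borel \<Longrightarrow> f \<in> borel_measurable leb_I"
  unfolding leb_I_def by (intro measurable_restrict_space1) simp

lemma continuous_leb_I_measurable: "continuous_on II f \<Longrightarrow> f \<in> borel_measurable leb_I"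
  for f :: "real \<Rightarrow> real"
  using borel_measurable_continuous_on_restrict[of II f]
  by (simp add: leb_I_def measurable_def sets_restrict_space space_restrict_space)

lemma II_interval: "open II" "is_interval II" "II \<noteq> {}" "0 \<in> II"
  by auto

text \<open>Local integrability controls \<open>d\<close> on compact subintervals only;
  \<open>d\<close> is the pointwise limit of its restrictions to the exhausting intervals
  \<open>K n\<close>.\<close>

lemma loc_int_II_measurable:
  fixes d :: "real \<Rightarrow> real"
  assumes d: "loc_int II d"
  shows "d \<in> borel_measurable leb_I"
proof -
  define K where "K n = {-1 + 1 / real (n + 2)..1 - 1 / real (n + 2)}" for n
  have Ksub: "K n \<subseteq> II" for n
  proof -
    have "1 / real (n + 2) > 0" by simp
    then show ?thesis unfolding K_def by (intro subsetI) (simp only: atLeastAtMost_iff greaterThanLessThan_iff, linarith)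
  qed
  have m: "(\<lambda>x. indicator (K n) x *\<^sub>R d x) \<in> borel_measurable lborel" for n
  proof -
    have "set_integrable lborel (K n) d" using d Ksub[of n] by (auto simp: loc_int_def K_def)
    then show ?thesis unfolding set_integrable_def by (rule borel_measurable_integrable)
  qed
  have "(\<lambda>x. indicator II x *\<^sub>R d x) \<in> borel_measurable lborel"
  proof (rule borel_measurable_LIMSEQ_real[OF _ m])
    fix x :: real
    have "eventually (\<lambda>n. (indicator (K n) x :: real) = indicator II x) sequentially"
    proof (cases "x \<in> II")
      case True
      have "(\<lambda>n. 1 / real (n + 2)) \<longlonglongrightarrow> 0" by (rule LIMSEQ_ignore_initial_segment[OF lim_1_over_n])
      then have "eventually (\<lambda>n. 1 / real (n + 2) < min (1 + x) (1 - x)) sequentially"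
        using True by (intro order_tendstoD) auto
      then show ?thesis by eventually_elim (use True in \<open>auto simp: K_def indicator_def\<close>)
    next
      case False
      then have "x \<notin> K n" for n using Ksub by blast
      then show ?thesis using False by simp
    qed
    then show "(\<lambda>n. indicator (K n) x *\<^sub>R d x) \<longlonglongrightarrow> indicator II x *\<^sub>R d x"
      by (intro tendsto_intros tendsto_eventually)
  qed
  then show ?thesis unfolding leb_I_def by (subst borel_measurable_restrict_space_iff) auto
qed

lemma sq_int_measurable: "sq_int f \<Longrightarrow> f \<in> borel_measurable leb_I"
  by (simp add: sq_int_def)

lemma sq_int_bounded:
  assumes "f \<in> borel_measurable leb_I" "AE x in leb_I. \<bar>f x\<bar> \<le> C"
  shows "sq_int f"
  unfolding sq_int_def
proof
  show "integrable leb_I (\<lambda>x. (f x)\<^sup>2)"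
  proof (rule leb_I.integrable_const_bound[of _ "C\<^sup>2"])
    show "AE x in leb_I. norm ((f x)\<^sup>2) \<le> C\<^sup>2"
      using assms(2)
    proof eventually_elim
      case (elim x)
      then show ?case using power_mono[of "\<bar>f x\<bar>" C 2] by simp
    qed
  qed (use assms(1) in measurable)
qed (rule assms)

lemma sq_int_const: "sq_int (\<lambda>x. c)"
  by (rule sq_int_bounded[of _ "\<bar>c\<bar>"]) auto

lemma sq_int_integrable: "sq_int f \<Longrightarrow> integrable leb_I f"
  using sq_int_mult[OF _ sq_int_const[of 1]] by simp

lemma sq_int_set_integrable: "sq_int f \<Longrightarrow> set_integrable lborel II f"
  using sq_int_integrable integrable_leb_I_iff by blast

lemma set_integrable_II_loc_int:
  fixes f :: "real \<Rightarrow> 'b::{banach, second_countable_topology}"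
  assumes "set_integrable lborel II f"
  shows "loc_int II f"
  unfolding loc_int_def
  by (intro allI impI set_integrable_subset[OF assms]) (auto simp: compact_imp_closed borel_closed)

lemma sq_int_loc_int: "sq_int f \<Longrightarrow> loc_int II f"
  by (intro set_integrable_II_loc_int sq_int_set_integrable)

lemma inner_to_L2: "sq_int f \<Longrightarrow> sq_int g \<Longrightarrow> inner (to_L2 f) (to_L2 g) = (LINT x|leb_I. f x * g x)"
  by (simp add: to_L2_def inner_L2I.abs_eq ae_eq_def)

lemma inner_L2_fun: "inner v w = (LINT x|leb_I. L2_fun v x * L2_fun w x)"
  using inner_to_L2[OF sq_int_L2_fun sq_int_L2_fun, of v w] by (simp add: to_L2_L2_fun)

lemma inner_to_L2_right: "sq_int g \<Longrightarrow> inner v (to_L2 g) = (LINT x|leb_I. L2_fun v x * g x)"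
  using inner_to_L2[OF sq_int_L2_fun, of g v] by (simp add: to_L2_L2_fun)

lemma to_L2_cong: "sq_int f \<Longrightarrow> sq_int g \<Longrightarrow> (AE x in leb_I. f x = g x) \<Longrightarrow> to_L2 f = to_L2 g"
  by (simp add: to_L2_eq_iff)

lemma L2_fun_add_scaled: "AE x in leb_I. L2_fun (v + c *\<^sub>R w) x = L2_fun v x + c * L2_fun w x"
proof -
  have s: "sq_int (\<lambda>x. c * L2_fun w x)" by (intro sq_int_scale sq_int_L2_fun)
  have "v + c *\<^sub>R w = to_L2 (\<lambda>x. L2_fun v x + c * L2_fun w x)"
    by (simp add: to_L2_add to_L2_scale sq_int_L2_fun s to_L2_L2_fun)
  then show ?thesis using L2_fun_to_L2[OF sq_int_add[OF sq_int_L2_fun s]] by simp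
qed

lemma L2_fun_add: "AE x in leb_I. L2_fun (v + w) x = L2_fun v x + L2_fun w x"
  using L2_fun_add_scaled[of v 1 w] by simp

lemma loc_int_AE_cong:
  fixes f g :: "real \<Rightarrow> real"
  assumes f: "loc_int II f" and g: "g \<in> borel_measurable leb_I" and eq: "AE x in leb_I. f x = g x"
  shows "loc_int II g"
  unfolding loc_int_def
proof (intro allI impI)
  fix K :: "real set" assume K: "compact K \<and> K \<subseteq> II"
  then have [measurable]: "K \<in> sets borel" by (simp add: compact_imp_closed borel_closed)
  have f': "integrable lborel (\<lambda>x. indicator K x *\<^sub>R f x)" using f K by (simp add: loc_int_def set_integrable_def)
  have "(\<lambda>x. indicator II x *\<^sub>R g x) \<in> borel_measurable borel"
    using g unfolding leb_I_def by (subst (asm) borel_measurable_restrict_space_iff) auto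
  then have "(\<lambda>x. indicator K x *\<^sub>R (indicator II x *\<^sub>R g x)) \<in> borel_measurable borel" by measurable
  moreover have "(\<lambda>x. indicator K x *\<^sub>R (indicator II x *\<^sub>R g x)) = (\<lambda>x. indicator K x *\<^sub>R g x)"
    using K by (auto simp: indicator_def fun_eq_iff)
  ultimately have m: "(\<lambda>x. indicator K x *\<^sub>R g x) \<in> borel_measurable lborel" by simp
  have "AE x in lborel. indicator K x *\<^sub>R f x = indicator K x *\<^sub>R g x"
    using eq unfolding AE_leb_I_iff by eventually_elim (use K in \<open>auto simp: indicator_def\<close>)
  then show "set_integrable lborel K g"
    unfolding set_integrable_def using integrable_cong_AE_imp[OF f' m] by blast
qed

text \<open>A function and the representative that \<open>L2_fun\<close> picks for its class agree
  only almost everywhere, so weak derivatives have to be carried from one to the other.\<close>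

lemma weak_deriv_AE_cong:
  fixes f g d :: "real \<Rightarrow> real"
  assumes w: "weak_deriv II f d" and g: "g \<in> borel_measurable leb_I" and eq: "AE x in leb_I. f x = g x"
  shows "weak_deriv II g d"
  unfolding weak_deriv_iff
proof (intro conjI allI impI)
  have f: "loc_int II f" using w by (simp add: weak_deriv_iff)
  show "loc_int II g" by (rule loc_int_AE_cong[OF f g eq])
  show "loc_int II d" using w by (simp add: weak_deriv_iff)
  fix \<phi> assume \<phi>: "test_function II \<phi>"
  have "(LINT x:II|lborel. deriv \<phi> x *\<^sub>R g x) = (LINT x:II|lborel. deriv \<phi> x *\<^sub>R f x)"
    unfolding integral_leb_I[symmetric]
  proof (rule integral_cong_AE)
    have [measurable]: "deriv \<phi> \<in> borel_measurable leb_I"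
      using test_function_measurable[OF test_function_deriv[OF \<phi> II_interval(2,3)]] by (rule borel_measurable_leb_I)
    show "(\<lambda>x. deriv \<phi> x *\<^sub>R g x) \<in> borel_measurable leb_I" "(\<lambda>x. deriv \<phi> x *\<^sub>R f x) \<in> borel_measurable leb_I"
      using g loc_int_II_measurable[OF f] by measurable
    show "AE x in leb_I. deriv \<phi> x *\<^sub>R g x = deriv \<phi> x *\<^sub>R f x" using eq by eventually_elim simp
  qed
  then show "(LINT x:II|lborel. deriv \<phi> x *\<^sub>R g x) = - (LINT x:II|lborel. \<phi> x *\<^sub>R d x)"
    using w \<phi> by (simp add: weak_deriv_iff)
qed

section \<open>The weight, the weighted gradient and the energy space\<close>

lemma rho_pos: "x \<in> II \<Longrightarrow> rho x > 0"
  using abs_square_less_1[of x] by (auto simp: rho_def abs_less_iff)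

lemma rho_simps: "-1 < x \<Longrightarrow> x < 1 \<Longrightarrow> 0 < rho x" "-1 < x \<Longrightarrow> x < 1 \<Longrightarrow> 0 \<le> rho x"
  "-1 < x \<Longrightarrow> x < 1 \<Longrightarrow> rho x \<noteq> 0"
  using rho_pos[of x] by auto

lemma rho_le_1: "rho x \<le> 1"
  by (simp add: rho_def)

lemma rho_measurable [measurable]: "rho \<in> borel_measurable leb_I"
  unfolding rho_def by (intro borel_measurable_leb_I) measurable

text \<open>The energy is the \<open>L2I\<close> inner product of weighted gradients. So
  \<open>V\<close> is handled through the pairs \<open>(w, wgrad w)\<close> in
  \<open>L2I \<times> L2I\<close>, and Hilbert space arguments apply without a separate topology on
  \<open>V\<close>.\<close>

definition wgrad :: "L2I \<Rightarrow> L2I" where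
  "wgrad w = to_L2 (\<lambda>x. sqrt (rho x) * wd w x)"

lemma wd_weak_deriv: "weak_deriv II (L2_fun w) d \<Longrightarrow> weak_deriv II (L2_fun w) (wd w)"
  unfolding wd_def by (rule someI[of "weak_deriv II (L2_fun w)"])

lemma wd_unique: "weak_deriv II (L2_fun w) d \<Longrightarrow> AE x in leb_I. wd w x = d x"
  using weak_deriv_unique[OF II_interval(1) wd_weak_deriv, of w d d] by (simp add: AE_leb_I_iff)

lemma weak_deriv_measurable:
  fixes f d :: "real \<Rightarrow> real"
  shows "weak_deriv II f d \<Longrightarrow> d \<in> borel_measurable leb_I"
  by (auto simp: weak_deriv_iff intro: loc_int_II_measurable)

lemma sq_int_sqrt_rho_iff:
  assumes "d \<in> borel_measurable leb_I"
  shows "sq_int (\<lambda>x. sqrt (rho x) * d x) \<longleftrightarrow> set_integrable lborel II (\<lambda>x. rho x * (d x)\<^sup>2)"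
proof -
  have "integrable leb_I (\<lambda>x. (sqrt (rho x) * d x)\<^sup>2) \<longleftrightarrow> integrable leb_I (\<lambda>x. rho x * (d x)\<^sup>2)"
    by (intro Bochner_Integration.integrable_cong refl) (use rho_pos in \<open>auto simp: power_mult_distrib less_imp_le\<close>)
  moreover have "(\<lambda>x. sqrt (rho x) * d x) \<in> borel_measurable leb_I" using assms by measurable
  ultimately show ?thesis by (simp add: sq_int_def integrable_leb_I_iff)
qed

lemma V_I:
  assumes w: "weak_deriv II (L2_fun w) d" and d: "sq_int (\<lambda>x. sqrt (rho x) * d x)"
  shows "w \<in> V" "wgrad w = to_L2 (\<lambda>x. sqrt (rho x) * d x)" "sq_int (\<lambda>x. sqrt (rho x) * wd w x)"
proof -
  show "w \<in> V" unfolding V_def using w d sq_int_sqrt_rho_iff[OF weak_deriv_measurable[OF w]] by blast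
  have m: "wd w \<in> borel_measurable leb_I" by (rule weak_deriv_measurable[OF wd_weak_deriv[OF w]])
  have ae: "AE x in leb_I. sqrt (rho x) * wd w x = sqrt (rho x) * d x"
    using wd_unique[OF w] by eventually_elim simp
  then have "AE x in leb_I. (sqrt (rho x) * wd w x)\<^sup>2 = (sqrt (rho x) * d x)\<^sup>2"
    by eventually_elim (simp only:)
  then have "integrable leb_I (\<lambda>x. (sqrt (rho x) * wd w x)\<^sup>2)"
    using d m by (subst integrable_cong_AE) (auto simp: sq_int_def)
  then show s: "sq_int (\<lambda>x. sqrt (rho x) * wd w x)"
    using m by (simp add: sq_int_def)
  show "wgrad w = to_L2 (\<lambda>x. sqrt (rho x) * d x)"
    unfolding wgrad_def by (rule to_L2_cong[OF s d ae])
qed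

lemma V_D:
  assumes "w \<in> V"
  shows "weak_deriv II (L2_fun w) (wd w)" "sq_int (\<lambda>x. sqrt (rho x) * wd w x)"
proof -
  obtain d where d: "weak_deriv II (L2_fun w) d" "set_integrable lborel II (\<lambda>x. rho x * (d x)\<^sup>2)"
    using assms by (auto simp: V_def)
  then have "sq_int (\<lambda>x. sqrt (rho x) * d x)" using sq_int_sqrt_rho_iff[OF weak_deriv_measurable] by blast
  then show "sq_int (\<lambda>x. sqrt (rho x) * wd w x)" using V_I(3)[OF d(1)] by blast
  show "weak_deriv II (L2_fun w) (wd w)" by (rule wd_weak_deriv[OF d(1)])
qed

lemma V_fun:
  assumes f: "sq_int f" "weak_deriv II f d" "sq_int (\<lambda>x. sqrt (rho x) * d x)"
  shows "to_L2 f \<in> V" "wgrad (to_L2 f) = to_L2 (\<lambda>x. sqrt (rho x) * d x)"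
proof -
  have "AE x in leb_I. f x = L2_fun (to_L2 f) x" using L2_fun_to_L2[OF f(1)] by eventually_elim simp
  then have "weak_deriv II (L2_fun (to_L2 f)) d"
    by (rule weak_deriv_AE_cong[OF f(2) sq_int_measurable[OF sq_int_L2_fun]])
  from V_I[OF this f(3)] show "to_L2 f \<in> V" "wgrad (to_L2 f) = to_L2 (\<lambda>x. sqrt (rho x) * d x)" by blast+
qed

lemma V_add_scaled:
  assumes v: "v \<in> V" and w: "w \<in> V"
  shows "v + c *\<^sub>R w \<in> V" "wgrad (v + c *\<^sub>R w) = wgrad v + c *\<^sub>R wgrad w"
proof -
  let ?f = "\<lambda>x. L2_fun v x + c * L2_fun w x" and ?d = "\<lambda>x. wd v x + c * wd w x"
  have f: "sq_int ?f" by (intro sq_int_add sq_int_scale sq_int_L2_fun)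
  have e: "v + c *\<^sub>R w = to_L2 ?f"
    by (simp add: to_L2_add to_L2_scale sq_int_L2_fun sq_int_scale to_L2_L2_fun)
  have wdv: "weak_deriv II ?f ?d"
    using weak_deriv_add_scaled[OF II_interval(2,3) V_D(1)[OF v] V_D(1)[OF w], of c] by simp
  have g: "(\<lambda>x. sqrt (rho x) * ?d x) = (\<lambda>x. sqrt (rho x) * wd v x + c * (sqrt (rho x) * wd w x))"
    by (auto simp: algebra_simps)
  have s: "sq_int (\<lambda>x. sqrt (rho x) * ?d x)"
    unfolding g by (intro sq_int_add sq_int_scale V_D v w)
  show "v + c *\<^sub>R w \<in> V" unfolding e by (rule V_fun(1)[OF f wdv s])
  show "wgrad (v + c *\<^sub>R w) = wgrad v + c *\<^sub>R wgrad w"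
    unfolding e V_fun(2)[OF f wdv s] unfolding g wgrad_def
    by (simp add: to_L2_add to_L2_scale sq_int_scale V_D v w)
qed

lemma V_zero: "0 \<in> V" "wgrad 0 = 0"
proof -
  have z: "to_L2 (\<lambda>x. 0) = 0" using to_L2_scale[OF sq_int_zero, of 0] by simp
  have "weak_deriv II (\<lambda>x. 0::real) (\<lambda>x. 0)"
    by (auto simp: weak_deriv_iff loc_int_const)
  from V_fun[OF sq_int_zero this] show "0 \<in> V" "wgrad 0 = 0" by (simp_all add: sq_int_zero z)
qed

lemma V_scale: "w \<in> V \<Longrightarrow> c *\<^sub>R w \<in> V" "w \<in> V \<Longrightarrow> wgrad (c *\<^sub>R w) = c *\<^sub>R wgrad w"
  using V_add_scaled[OF V_zero(1), of w c] V_zero(2) by simp_all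

lemma V_add: "v \<in> V \<Longrightarrow> w \<in> V \<Longrightarrow> v + w \<in> V" "v \<in> V \<Longrightarrow> w \<in> V \<Longrightarrow> wgrad (v + w) = wgrad v + wgrad w"
  using V_add_scaled[of v w 1] by simp_all

lemma V_diff: "v \<in> V \<Longrightarrow> w \<in> V \<Longrightarrow> v - w \<in> V" "v \<in> V \<Longrightarrow> w \<in> V \<Longrightarrow> wgrad (v - w) = wgrad v - wgrad w"
  using V_add_scaled[of v w "-1"] by simp_all

lemma energy_eq:
  assumes "v \<in> V" "w \<in> V"
  shows "energy v w = inner (wgrad v) (wgrad w)"
proof -
  have "energy v w = (LINT x|leb_I. (sqrt (rho x) * wd v x) * (sqrt (rho x) * wd w x))"
    unfolding energy_def integral_leb_I[symmetric]
    by (intro Bochner_Integration.integral_cong) (auto simp: rho_simps algebra_simps simp flip: real_sqrt_mult)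
  then show ?thesis unfolding wgrad_def using assms by (subst inner_to_L2) (auto intro: V_D)
qed

lemma norm_V_eq:
  assumes w: "w \<in> V"
  shows "norm_V w = norm w + norm (wgrad w)"
proof -
  have "energy w w = (LINT x:II|lborel. rho x * (wd w x)\<^sup>2)" by (simp add: energy_def power2_eq_square mult.assoc)
  then show ?thesis using energy_eq[OF w w] by (simp add: norm_V_def norm_eq_sqrt_inner)
qed

lemma rho_compact_bound:
  assumes "compact K" "K \<subseteq> II"
  obtains c where "c > 0" "\<And>x. x \<in> K \<Longrightarrow> c \<le> rho x"
proof (cases "K = {}")
  case False
  have "continuous_on K rho" unfolding rho_def by (intro continuous_intros)
  then obtain z where "z \<in> K" "\<And>x. x \<in> K \<Longrightarrow> rho z \<le> rho x"
    using continuous_attains_inf[OF assms(1) False] by blast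
  then show thesis using that[of "rho z"] rho_pos[of z] assms(2) by blast
qed (use that[of 1] in auto)

lemma test_function_bounded:
  assumes \<phi>: "test_function J \<phi>"
  obtains C where "\<And>x. \<bar>\<phi> x\<bar> \<le> C"
proof -
  obtain K where K: "compact K" "\<And>x. x \<notin> K \<Longrightarrow> \<phi> x = 0" using \<phi> by (auto simp: test_function_iff)
  have "compact (\<phi> ` K)" using test_function_cont[OF \<phi>] K(1) by (intro compact_continuous_image)
  then obtain C where C: "\<And>x. x \<in> K \<Longrightarrow> \<bar>\<phi> x\<bar> \<le> C"
    using compact_imp_bounded bounded_iff by (metis imageI real_norm_def)
  have "\<bar>\<phi> x\<bar> \<le> max C 0" for x using C[of x] K(2)[of x] by (cases "x \<in> K") auto
  then show thesis by (rule that)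
qed

lemma test_function_sq_int:
  assumes \<phi>: "test_function II \<phi>"
  shows "sq_int \<phi>" "sq_int (\<lambda>x. \<phi> x / sqrt (rho x))"
proof -
  have m [measurable]: "\<phi> \<in> borel_measurable leb_I" using test_function_measurable[OF \<phi>] by (rule borel_measurable_leb_I)
  obtain C where C: "\<And>x. \<bar>\<phi> x\<bar> \<le> C" using test_function_bounded[OF \<phi>] by blast
  show "sq_int \<phi>" by (rule sq_int_bounded[OF m]) (use C in blast)
  obtain K where K: "compact K" "K \<subseteq> II" "\<And>x. x \<notin> K \<Longrightarrow> \<phi> x = 0" using \<phi> by (auto simp: test_function_iff)
  obtain c where c: "c > 0" "\<And>x. x \<in> K \<Longrightarrow> c \<le> rho x" using rho_compact_bound[OF K(1,2)] by blast
  have "C \<ge> 0" using C[of 0] by linarith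
  have "\<bar>\<phi> x / sqrt (rho x)\<bar> \<le> C / sqrt c" for x
  proof (cases "x \<in> K")
    case True
    then have "sqrt c \<le> sqrt (rho x)" "sqrt c > 0" using c by auto
    then have "\<bar>\<phi> x\<bar> / sqrt (rho x) \<le> C / sqrt c" using C[of x] \<open>C \<ge> 0\<close> by (intro frac_le) auto
    then show ?thesis using c(2)[OF True] c(1) by simp
  qed (use K(3) \<open>C \<ge> 0\<close> c in auto)
  then show "sq_int (\<lambda>x. \<phi> x / sqrt (rho x))"
    by (intro sq_int_bounded[of _ "C / sqrt c"]) auto
qed

text \<open>The candidate derivative is \<open>q / sqrt rho\<close>. In the weak identity for
  \<open>v n\<close> the weight is moved to the test function: \<open>\<phi> / sqrt rho\<close> is
  bounded because \<open>rho\<close> is bounded below on the support, so both sides converge as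
  inner products in \<open>L2I\<close>.\<close>

theorem wgrad_closed:
  assumes v: "\<And>n. v n \<in> V" and lim: "v \<longlonglongrightarrow> w" "(\<lambda>n. wgrad (v n)) \<longlonglongrightarrow> q"
  shows "w \<in> V" "wgrad w = q"
proof -
  define d where "d x = L2_fun q x / sqrt (rho x)" for x
  have dm: "d \<in> borel_measurable leb_I"
    unfolding d_def using sq_int_measurable[OF sq_int_L2_fun[of q]] by measurable
  have dphi: "(LINT x:II|lborel. \<phi> x *\<^sub>R d x) = inner q (to_L2 (\<lambda>x. \<phi> x / sqrt (rho x)))"
    if "test_function II \<phi>" for \<phi>
    unfolding inner_to_L2_right[OF test_function_sq_int(2)[OF that]] integral_leb_I[symmetric] d_def
    by (simp add: mult.commute)
  have wdv: "weak_deriv II (L2_fun w) d"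
    unfolding weak_deriv_iff
  proof (intro conjI allI impI)
    show "loc_int II (L2_fun w)" by (intro sq_int_loc_int sq_int_L2_fun)
    show "loc_int II d" unfolding loc_int_def
    proof (intro allI impI)
      fix K :: "real set" assume K: "compact K \<and> K \<subseteq> II"
      then have [measurable]: "K \<in> sets borel" by (simp add: compact_imp_closed borel_closed)
      obtain c where c: "c > 0" "\<And>x. x \<in> K \<Longrightarrow> c \<le> rho x" using rho_compact_bound[of K] K by blast
      have qi: "integrable leb_I (\<lambda>x. (1 / sqrt c) * L2_fun q x)"
        by (intro integrable_mult_right sq_int_integrable sq_int_L2_fun)
      have Kl: "K \<in> sets leb_I" using K by (auto simp: leb_I_def sets_restrict_space_iff)
      have "integrable leb_I (\<lambda>x. indicator K x * d x)"
      proof (rule Bochner_Integration.integrable_bound[OF qi])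
        show "(\<lambda>x. indicator K x * d x) \<in> borel_measurable leb_I" using dm Kl by measurable
        have "\<bar>indicator K x * d x\<bar> \<le> \<bar>(1 / sqrt c) * L2_fun q x\<bar>" for x
        proof (cases "x \<in> K")
          case True
          then have "sqrt c \<le> sqrt (rho x)" "sqrt c > 0" using c by auto
          then have "\<bar>L2_fun q x\<bar> / sqrt (rho x) \<le> \<bar>L2_fun q x\<bar> / sqrt c" by (intro frac_le) auto
          then show ?thesis using True c(2)[OF True] c(1) by (simp add: d_def abs_mult)
        qed simp
        then show "AE x in leb_I. norm (indicator K x * d x) \<le> norm ((1 / sqrt c) * L2_fun q x)" by simp
      qed
      then have "set_integrable lborel II (\<lambda>x. indicator K x * d x)" by (simp add: integrable_leb_I_iff)
      moreover have "(\<lambda>x. indicator II x *\<^sub>R (indicator K x * d x)) = (\<lambda>x. indicator K x *\<^sub>R d x)"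
        using K by (auto simp: indicator_def fun_eq_iff)
      ultimately show "set_integrable lborel K d" by (simp add: set_integrable_def)
    qed
    fix \<phi> assume \<phi>: "test_function II \<phi>"
    note \<phi>' = test_function_sq_int(1)[OF test_function_deriv[OF \<phi> II_interval(2,3)]]
    have eq: "(LINT x:II|lborel. deriv \<phi> x *\<^sub>R L2_fun u x) = inner u (to_L2 (deriv \<phi>))" for u
      unfolding inner_to_L2_right[OF \<phi>'] integral_leb_I[symmetric] by (simp add: mult.commute)
    have "inner (v n) (to_L2 (deriv \<phi>)) = - inner (wgrad (v n)) (to_L2 (\<lambda>x. \<phi> x / sqrt (rho x)))" for n
    proof -
      have "inner (v n) (to_L2 (deriv \<phi>)) = - (LINT x|leb_I. \<phi> x * wd (v n) x)"
        using V_D(1)[OF v[of n]] \<phi> eq[of "v n"] by (simp add: weak_deriv_iff integral_leb_I)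
      also have "(LINT x|leb_I. \<phi> x * wd (v n) x) = (LINT x|leb_I. (sqrt (rho x) * wd (v n) x) * (\<phi> x / sqrt (rho x)))"
        by (intro Bochner_Integration.integral_cong) (auto simp: rho_simps)
      also have "\<dots> = inner (wgrad (v n)) (to_L2 (\<lambda>x. \<phi> x / sqrt (rho x)))"
        unfolding wgrad_def by (subst inner_to_L2[OF V_D(2)[OF v] test_function_sq_int(2)[OF \<phi>]]) simp
      finally show ?thesis .
    qed
    moreover have "(\<lambda>n. inner (v n) (to_L2 (deriv \<phi>))) \<longlonglongrightarrow> inner w (to_L2 (deriv \<phi>))"
      by (intro tendsto_intros lim)
    moreover have "(\<lambda>n. - inner (wgrad (v n)) (to_L2 (\<lambda>x. \<phi> x / sqrt (rho x)))) \<longlonglongrightarrow> - inner q (to_L2 (\<lambda>x. \<phi> x / sqrt (rho x)))"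
      by (intro tendsto_intros lim)
    ultimately have "inner w (to_L2 (deriv \<phi>)) = - inner q (to_L2 (\<lambda>x. \<phi> x / sqrt (rho x)))"
      using LIMSEQ_unique by simp
    then show "(LINT x:II|lborel. deriv \<phi> x *\<^sub>R L2_fun w x) = - (LINT x:II|lborel. \<phi> x *\<^sub>R d x)"
      using eq dphi[OF \<phi>] by simp
  qed
  have ae: "AE x in leb_I. L2_fun q x = sqrt (rho x) * d x"
    using AE_in_II by eventually_elim (auto simp: d_def rho_simps)
  have "AE x in leb_I. \<bar>sqrt (rho x) * d x\<bar>\<^sup>2 = (L2_fun q x)\<^sup>2" using ae by eventually_elim simp
  then have "integrable leb_I (\<lambda>x. (sqrt (rho x) * d x)\<^sup>2)"
    using sq_int_L2_fun[of q] dm by (subst integrable_cong_AE) (auto simp: sq_int_def)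
  then have s: "sq_int (\<lambda>x. sqrt (rho x) * d x)" using dm by (simp add: sq_int_def)
  show "w \<in> V" by (rule V_I(1)[OF wdv s])
  have "to_L2 (L2_fun q) = to_L2 (\<lambda>x. sqrt (rho x) * d x)" by (rule to_L2_cong[OF sq_int_L2_fun s ae])
  then show "wgrad w = q" using V_I(2)[OF wdv s] by (simp add: to_L2_L2_fun)
qed

section \<open>The degenerate diffusion operator\<close>

lemma test_function_weak_deriv:
  assumes \<phi>: "test_function II \<phi>"
  shows "weak_deriv II \<phi> (deriv \<phi>)"
proof -
  have s: "smooth \<phi>" using \<phi> by (simp add: test_function_iff)
  have int: "(LINT x:{u..v}|lborel. deriv \<phi> x) = \<phi> v - \<phi> u" if "u \<le> v" for u v
    using integral_FTC_Icc_real[OF that smooth_DERIV[OF s], of] smooth_cont[OF smooth_deriv[OF s], of UNIV]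
    by (simp add: continuous_on_eq_continuous_at set_lebesgue_integral_def mult.commute)
  have "prim 0 (deriv \<phi>) x = \<phi> x - \<phi> 0" for x
    using int[of 0 x] int[of x 0] set_integral_Icc_degenerate[of x 0 "deriv \<phi>"] set_integral_Icc_degenerate[of 0 x "deriv \<phi>"]
    by (cases "0 \<le> x") (simp_all add: prim_def)
  then have "(\<lambda>x. \<phi> 0 + prim 0 (deriv \<phi>) x) = \<phi>" by auto
  moreover have "loc_int II (deriv \<phi>)"
    by (rule sq_int_loc_int[OF test_function_sq_int(1)[OF test_function_deriv[OF \<phi> II_interval(2,3)]]])
  ultimately show ?thesis using weak_deriv_prim[OF II_interval(1,2) _ II_interval(4), of "deriv \<phi>" "\<phi> 0"] by simp
qed

lemma test_function_V:
  assumes \<phi>: "test_function II \<phi>"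
  shows "to_L2 \<phi> \<in> V" "wgrad (to_L2 \<phi>) = to_L2 (\<lambda>x. sqrt (rho x) * deriv \<phi> x)"
    "sq_int (\<lambda>x. sqrt (rho x) * deriv \<phi> x)"
proof -
  have \<phi>': "test_function II (deriv \<phi>)" by (rule test_function_deriv[OF \<phi> II_interval(2,3)])
  obtain C where C: "\<And>x. \<bar>deriv \<phi> x\<bar> \<le> C" using test_function_bounded[OF \<phi>'] by blast
  show s: "sq_int (\<lambda>x. sqrt (rho x) * deriv \<phi> x)"
  proof (rule sq_int_bounded[of _ C])
    show "(\<lambda>x. sqrt (rho x) * deriv \<phi> x) \<in> borel_measurable leb_I"
      using borel_measurable_leb_I[OF test_function_measurable[OF \<phi>']] by measurable
    show "AE x in leb_I. \<bar>sqrt (rho x) * deriv \<phi> x\<bar> \<le> C"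
      using AE_in_II
    proof eventually_elim
      case (elim x)
      then have "\<bar>sqrt (rho x)\<bar> \<le> 1" using rho_le_1[of x] by (simp add: rho_simps)
      then have "\<bar>sqrt (rho x)\<bar> * \<bar>deriv \<phi> x\<bar> \<le> 1 * C" using C[of x] by (intro mult_mono) auto
      then show ?case by (simp add: abs_mult)
    qed
  qed
  show "to_L2 \<phi> \<in> V" "wgrad (to_L2 \<phi>) = to_L2 (\<lambda>x. sqrt (rho x) * deriv \<phi> x)"
    using V_fun[OF test_function_sq_int(1)[OF \<phi>] test_function_weak_deriv[OF \<phi>] s] by blast+
qed

section \<open>The flux and its boundary behaviour\<close>

lemma inner_wgrad_test_function:
  assumes w: "w \<in> V" and \<phi>: "test_function II \<phi>"
  shows "inner (wgrad w) (wgrad (to_L2 \<phi>)) = (LINT x:II|lborel. deriv \<phi> x *\<^sub>R (rho x * wd w x))"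
  unfolding test_function_V(2)[OF \<phi>] unfolding wgrad_def integral_leb_I[symmetric]
  by (subst inner_to_L2[OF V_D(2)[OF w] test_function_V(3)[OF \<phi>]])
    (auto simp: rho_simps algebra_simps simp flip: real_sqrt_mult intro!: Bochner_Integration.integral_cong)

text \<open>Cauchy-Schwarz against the indicator of \<open>A\<close>. The factor
  \<open>sqrt (b - a)\<close> gives the decay of the flux at the endpoints and the local Hoelder
  bound in \<open>V\<close>.\<close>

lemma integral_abs_le_norm:
  assumes f: "sq_int f" and A: "A \<in> sets borel" "A \<subseteq> {a..b}" "a \<le> b"
  shows "(LINT x|lborel. indicator A x * (indicator II x * \<bar>f x\<bar>)) \<le> norm (to_L2 f) * sqrt (b - a)"
proof -
  have [measurable]: "f \<in> borel_measurable leb_I" by (rule sq_int_measurable[OF f])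
  have Am: "(indicator A :: real \<Rightarrow> real) \<in> borel_measurable leb_I"
    using A(1) by (intro borel_measurable_leb_I) simp
  have sA: "sq_int (indicator A)"
    by (rule sq_int_bounded[OF Am, of 1]) (auto simp: indicator_def)
  have sf: "sq_int (\<lambda>x. \<bar>f x\<bar>)" using f by (auto simp: sq_int_def)
  have "(LINT x|lborel. indicator A x * (indicator II x * \<bar>f x\<bar>)) = inner (to_L2 (\<lambda>x. \<bar>f x\<bar>)) (to_L2 (indicator A))"
    unfolding inner_to_L2[OF sf sA] integral_leb_I set_lebesgue_integral_def
    by (intro Bochner_Integration.integral_cong) auto
  also have "\<dots> \<le> norm (to_L2 (\<lambda>x. \<bar>f x\<bar>)) * norm (to_L2 (indicator A))" by (rule norm_cauchy_schwarz)
  also have "norm (to_L2 (\<lambda>x. \<bar>f x\<bar>)) = norm (to_L2 f)"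
  proof -
    have "(norm (to_L2 (\<lambda>x. \<bar>f x\<bar>)))\<^sup>2 = (norm (to_L2 f))\<^sup>2"
      unfolding norm_to_L2_sq[OF sf] norm_to_L2_sq[OF f] by simp
    then show ?thesis by simp
  qed
  also have "norm (to_L2 (indicator A)) \<le> sqrt (b - a)"
  proof (rule real_le_rsqrt)
    have "(norm (to_L2 (indicator A)))\<^sup>2 = (LINT x|lborel. indicator (II \<inter> A) x)"
      unfolding norm_to_L2_sq[OF sA] integral_leb_I set_lebesgue_integral_def
      by (intro Bochner_Integration.integral_cong) (auto simp: indicator_def)
    also have "\<dots> \<le> (LINT x|lborel. indicator {a..b} x)"
    proof (rule integral_mono)
      show "integrable lborel (indicator {a..b} :: real \<Rightarrow> real)"
        by (rule integrable_real_indicator) (auto simp: emeasure_lborel_Icc_eq)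
      then show "integrable lborel (indicator (II \<inter> A) :: real \<Rightarrow> real)"
        by (rule Bochner_Integration.integrable_bound) (use A in \<open>auto simp: indicator_def intro!: AE_I2\<close>)
    qed (use A in \<open>auto simp: indicator_def\<close>)
    also have "\<dots> = b - a" using A(3) by simp
    finally show "(norm (to_L2 (indicator A)))\<^sup>2 \<le> b - a" .
  qed
  finally show ?thesis by (simp add: mult_left_mono)
qed

lemma not_integrable_inverse:
  shows "\<not> set_integrable lborel {-1<..<0} (\<lambda>x::real. 1 / (1 + x))"
proof
  assume i: "set_integrable lborel {-1<..<0} (\<lambda>x::real. 1 / (1 + x))"
  define I where "I = (LINT x:{-1<..<0}|lborel. 1 / (1 + x :: real))"
  \<comment> \<open>Chosen so that the integral over \<open>[e - 1, 0]\<close>, which is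
    \<open>- ln e\<close>, exceeds the assumed finite value.\<close>
  define e where "e = exp (- (\<bar>I\<bar> + 1))"
  have e: "0 < e" "e < 1" by (auto simp: e_def)
  have c: "(LINT x|lborel. (1 / (1 + x)) * indicator {e - 1..0} x) = ln (1 + 0) - ln (1 + (e - 1))"
    using e by (intro integral_FTC_Icc_real) (auto intro!: derivative_eq_intros continuous_intros)
  have ci: "integrable lborel (\<lambda>x. indicator {e - 1..0} x *\<^sub>R (1 / (1 + x)))"
    using e by (intro borel_integrable_compact continuous_intros) auto
  have "(LINT x|lborel. (1 / (1 + x)) * indicator {e - 1..0} x) \<le> I"
    unfolding I_def set_lebesgue_integral_def
  proof (rule integral_mono_AE)
    show "AE x in lborel. (1 / (1 + x)) * indicator {e - 1..0} x \<le> indicator {-1<..<0} x *\<^sub>R (1 / (1 + x))"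
      using AE_lborel_singleton[of 0] by eventually_elim (use e in \<open>auto simp: indicator_def\<close>)
  qed (use i ci in \<open>auto simp: set_integrable_def mult.commute\<close>)
  then have "\<bar>I\<bar> + 1 \<le> I" using c by (simp add: e_def)
  then show False by linarith
qed

text \<open>If \<open>c\<close> were not zero, \<open>1 / (1 + x)\<close> would be integrable up to the endpoint.\<close>

lemma flux_boundary_zero:
  fixes c B :: real
  assumes k: "\<And>x. x \<in> {-1<..<0} \<Longrightarrow> \<bar>k x\<bar> \<le> B * sqrt (1 + x)" and km: "k \<in> borel_measurable borel"
    and i: "set_integrable lborel {-1<..<0} (\<lambda>x. (c + k x)\<^sup>2 / rho x)"
  shows "c = 0"
proof (rule ccontr)
  assume c: "c \<noteq> 0"
  have ic: "set_integrable lborel {-1<..<0} (\<lambda>x::real. a)" for a :: real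
    unfolding set_integrable_def by (intro integrable_scaleR_left integrable_real_indicator) auto
  have "set_integrable lborel {-1<..<0} (\<lambda>x. 4 / c\<^sup>2 * ((c + k x)\<^sup>2 / rho x) + 4 / c\<^sup>2 * B\<^sup>2)"
    by (intro set_integral_add(1) set_integrable_mult_right ic i)
  then have "set_integrable lborel {-1<..<0} (\<lambda>x::real. 1 / (1 + x))"
  proof (rule set_integrable_bound)
    have "\<bar>1 / (1 + x)\<bar> \<le> 4 / c\<^sup>2 * ((c + k x)\<^sup>2 / rho x) + 4 / c\<^sup>2 * B\<^sup>2" if x: "x \<in> {-1<..<0}" for x
    proof -
      have "(k x)\<^sup>2 \<le> (B * sqrt (1 + x))\<^sup>2" using power_mono[OF k[OF x], of 2] by simp
      then have kx: "(k x)\<^sup>2 \<le> B\<^sup>2 * (1 + x)" using x by (simp add: power_mult_distrib)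
      \<comment> \<open>The right side minus the left side is the square of
        \<open>c + 2 k x\<close>.\<close>
      have "c\<^sup>2 \<le> 2 * (c + k x)\<^sup>2 + 2 * (k x)\<^sup>2"
        using sum_squares_ge_zero[of "c + 2 * k x" 0] by (simp add: power2_eq_square algebra_simps)
      then have 1: "c\<^sup>2 \<le> 2 * (c + k x)\<^sup>2 + 2 * (B\<^sup>2 * (1 + x))" using kx by simp
      have r: "rho x = (1 - x) * (1 + x)" by (simp add: rho_def power2_eq_square algebra_simps)
      have "1 + x > 0" "1 - x > 0" "1 - x \<le> 2" using x by auto
      then have "(c + k x)\<^sup>2 / (2 * (1 + x)) \<le> (c + k x)\<^sup>2 / rho x"
        unfolding r by (intro divide_left_mono mult_right_mono mult_pos_pos) auto
      moreover have "c\<^sup>2 / (1 + x) \<le> (2 * (c + k x)\<^sup>2 + 2 * (B\<^sup>2 * (1 + x))) / (1 + x)"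
        using 1 \<open>1 + x > 0\<close> by (intro divide_right_mono) auto
      moreover have "\<dots> = 4 * ((c + k x)\<^sup>2 / (2 * (1 + x))) + 2 * B\<^sup>2"
        using \<open>1 + x > 0\<close> by (simp add: field_simps)
      ultimately have "c\<^sup>2 / (1 + x) \<le> 4 * ((c + k x)\<^sup>2 / rho x) + 4 * B\<^sup>2"
        using zero_le_power2[of B] by linarith
      then have "c\<^sup>2 / (1 + x) / c\<^sup>2 \<le> (4 * ((c + k x)\<^sup>2 / rho x) + 4 * B\<^sup>2) / c\<^sup>2"
        by (rule divide_right_mono) simp
      moreover have "c\<^sup>2 / (1 + x) / c\<^sup>2 = \<bar>1 / (1 + x)\<bar>" using c \<open>1 + x > 0\<close> by simp
      moreover have "(4 * ((c + k x)\<^sup>2 / rho x) + 4 * B\<^sup>2) / c\<^sup>2 = 4 / c\<^sup>2 * ((c + k x)\<^sup>2 / rho x) + 4 / c\<^sup>2 * B\<^sup>2"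
        by (simp add: add_divide_distrib)
      ultimately show ?thesis by simp
    qed
    then show "AE x in lborel. x \<in> {-1<..<0} \<longrightarrow> norm (1 / (1 + x)) \<le> norm (4 / c\<^sup>2 * ((c + k x)\<^sup>2 / rho x) + 4 / c\<^sup>2 * B\<^sup>2)"
      by (intro AE_I2) force
    show "set_borel_measurable lborel {-1<..<0} (\<lambda>x::real. 1 / (1 + x))"
      unfolding set_borel_measurable_def by measurable
  qed
  then show False using not_integrable_inverse by blast
qed

text \<open>Integrating gives \<open>rho w' = c + P\<close>, with \<open>P\<close> the integral of
  \<open>h\<close> from -1. Since \<open>P\<close> is of order \<open>sqrt (1 + x)\<close>, square
  integrability of \<open>sqrt rho w'\<close> forces \<open>c = 0\<close>. Reflection at 0 applies
  the same argument to the other endpoint, where the flux tends to the total integral of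
  \<open>h\<close>.\<close>

lemma diffusion_flux:
  assumes "(w, h) \<in> diffusion_graph"
  defines "H \<equiv> \<lambda>s. indicator II s * L2_fun h s"
  shows "integrable lborel H" "(LINT s|lborel. H s) = 0"
    "AE x in leb_I. rho x * wd w x = (LINT s|lborel. indicator {..x} s * H s)"
proof -
  have w: "w \<in> V" and fl: "weak_deriv II (\<lambda>x. rho x * wd w x) (L2_fun h)"
    using assms(1) by (auto simp: diffusion_graph_def)
  show Hi: "integrable lborel H"
    using sq_int_set_integrable[OF sq_int_L2_fun[of h]] by (simp add: H_def set_integrable_def)
  then have [measurable]: "H \<in> borel_measurable borel" using borel_measurable_integrable by fastforce
  obtain C where C: "AE x in lborel. x \<in> II \<longrightarrow> rho x * wd w x = C + prim 0 (L2_fun h) x"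
    using weak_deriv_primitive[OF II_interval(1,2,4) fl] by blast
  define P where "P x = (LINT s|lborel. indicator {..x} s * H s)" for x
  define R where "R x = (LINT s|lborel. indicator {x<..} s * H s)" for x
  have indi: "integrable lborel (\<lambda>s. indicator A s * H s)" if "A \<in> sets borel" for A
    using integrable_mult_indicator[OF _ Hi, of A] that by simp
  have PR: "P x + R x = (LINT s|lborel. H s)" for x
    unfolding P_def R_def by (rule integral_atMost_add_greaterThan[OF Hi])
  have Pdiff: "P z - P x = (LINT s:{x..z}|lborel. L2_fun h s)" if "x \<in> II" "z \<in> II" "x \<le> z" for x z
  proof -
    have "P z - P x = (LINT s|lborel. indicator {..z} s * H s - indicator {..x} s * H s)"
      unfolding P_def by (intro Bochner_Integration.integral_diff[symmetric] indi) auto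
    also have "\<dots> = (LINT s|lborel. indicator {x..z} s * H s)"
    proof (rule integral_cong_AE)
      show "AE s in lborel. indicator {..z} s * H s - indicator {..x} s * H s = indicator {x..z} s * H s"
        using AE_lborel_singleton[of x] by eventually_elim (use that in \<open>auto simp: indicator_def\<close>)
    qed measurable
    also have "\<dots> = (LINT s:{x..z}|lborel. L2_fun h s)"
      unfolding set_lebesgue_integral_def H_def using that
      by (intro Bochner_Integration.integral_cong) (auto simp: indicator_def)
    finally show ?thesis .
  qed
  have Pp: "prim 0 (L2_fun h) x = P x - P 0" if "x \<in> II" for x
    using that Pdiff[of 0 x] Pdiff[of x 0] set_integral_Icc_degenerate[of x 0 "L2_fun h"] set_integral_Icc_degenerate[of 0 x "L2_fun h"]
    by (cases "0 \<le> x") (simp_all add: prim_def)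
  define c where "c = C - P 0"
  have W: "AE x in leb_I. rho x * wd w x = c + P x"
    unfolding AE_leb_I_iff using C by eventually_elim (auto simp: Pp c_def)
  define B where "B = norm h"
  have abs_le: "\<bar>LINT s|lborel. indicator A s * H s\<bar> \<le> B * sqrt (b - a)"
    if "A \<in> sets borel" "A \<inter> II \<subseteq> {a..b}" "a \<le> b" for A a b
  proof -
    have "\<bar>LINT s|lborel. indicator A s * H s\<bar> \<le> (LINT s|lborel. \<bar>indicator A s * H s\<bar>)"
      by (rule integral_abs_bound)
    also have "\<dots> = (LINT s|lborel. indicator (A \<inter> II) s * (indicator II s * \<bar>L2_fun h s\<bar>))"
      by (intro Bochner_Integration.integral_cong) (auto simp: H_def indicator_def)
    also have "\<dots> \<le> norm (to_L2 (L2_fun h)) * sqrt (b - a)"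
      using that by (intro integral_abs_le_norm sq_int_L2_fun) auto
    finally show ?thesis by (simp add: to_L2_L2_fun B_def)
  qed
  have Pb: "\<bar>P x\<bar> \<le> B * sqrt (1 + x)" if "x \<in> II" for x
    using abs_le[of "{..x}" "-1" x] that unfolding P_def by (force simp: add.commute)
  have Rb: "\<bar>R x\<bar> \<le> B * sqrt (1 - x)" if "x \<in> II" for x
    using abs_le[of "{x<..}" x 1] that unfolding R_def by force
  have Pc: "continuous_on UNIV P"
    using indicator_Iic_integral_continuous[OF Hi] by (simp add: P_def[abs_def])
  have Pm: "P \<in> borel_measurable borel" by (rule borel_measurable_continuous_onI[OF Pc])
  have sqi: "set_integrable lborel II (\<lambda>x. (c + P x)\<^sup>2 / rho x)"
  proof -
    have i: "integrable leb_I (\<lambda>x. (sqrt (rho x) * wd w x)\<^sup>2)" using V_D(2)[OF w] by (simp add: sq_int_def)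
    have e: "AE x in leb_I. (sqrt (rho x) * wd w x)\<^sup>2 = (c + P x)\<^sup>2 / rho x"
      using W AE_in_II
    proof eventually_elim
      case (elim x)
      then have "rho x > 0" by (simp add: rho_simps)
      then have "(sqrt (rho x) * wd w x)\<^sup>2 = (rho x * wd w x)\<^sup>2 / rho x"
        by (simp add: power_mult_distrib power2_eq_square)
      then show ?case using elim by simp
    qed
    have "(\<lambda>x. (c + P x)\<^sup>2 / rho x) \<in> borel_measurable leb_I"
      using borel_measurable_leb_I[OF Pm] by measurable
    then have "integrable leb_I (\<lambda>x. (c + P x)\<^sup>2 / rho x)"
      by (rule integrable_cong_AE_imp[OF i _ e])
    then show ?thesis by (simp add: integrable_leb_I_iff)
  qed
  have c0: "c = 0"
  proof (rule flux_boundary_zero[OF _ Pm])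
    show "\<bar>P x\<bar> \<le> B * sqrt (1 + x)" if "x \<in> {-1<..<0}" for x using Pb[of x] that by simp
    show "set_integrable lborel {-1<..<0} (\<lambda>x. (c + P x)\<^sup>2 / rho x)"
      by (rule set_integrable_subset[OF sqi]) auto
  qed
  \<comment> \<open>Substituting \<open>-x\<close> moves the right endpoint to -1; the flux is then
    the total integral of \<open>h\<close> minus the tail \<open>R (- x)\<close>.\<close>
  have "(LINT s|lborel. H s) = 0"
  proof (rule flux_boundary_zero)
    show "\<bar>- R (- x)\<bar> \<le> B * sqrt (1 + x)" if "x \<in> {-1<..<0}" for x using Rb[of "- x"] that by simp
    have "R = (\<lambda>x. (LINT s|lborel. H s) - P x)" using PR by (auto simp: algebra_simps)
    then show "(\<lambda>x. - R (- x)) \<in> borel_measurable borel" using Pm by simp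
    have "set_integrable lborel {0<..<1} (\<lambda>x. (c + P x)\<^sup>2 / rho x)"
      by (rule set_integrable_subset[OF sqi]) auto
    then have "integrable lborel (\<lambda>x. indicator {0<..<1} (- x) *\<^sub>R ((c + P (- x))\<^sup>2 / rho (- x)))"
      unfolding set_integrable_def by (drule_tac lborel_integrable_real_affine[of _ "-1" 0]) simp_all
    moreover have "c + P (- x) = (LINT s|lborel. H s) + - R (- x)" for x using PR[of "- x"] c0 by simp
    moreover have "indicator {0<..<1} (- x) = (indicator {-1<..<0} x :: real)" for x :: real
      by (auto simp: indicator_def)
    ultimately show "set_integrable lborel {-1<..<0} (\<lambda>x. ((LINT s|lborel. H s) + - R (- x))\<^sup>2 / rho x)"
      by (simp add: set_integrable_def rho_def)
  qed
  then show "(LINT s|lborel. H s) = 0" .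
  show "AE x in leb_I. rho x * wd w x = (LINT s|lborel. indicator {..x} s * H s)"
    using W c0 by (simp add: P_def)
qed

lemma integral_norm_bound_AE:
  fixes f :: "'a \<Rightarrow> 'b::{banach, second_countable_topology}"
  assumes "integrable M g" "AE x in M. norm (f x) \<le> g x"
  shows "norm (integral\<^sup>L M f) \<le> integral\<^sup>L M g"
proof -
  have "norm (integral\<^sup>L M f) \<le> (LINT x|M. norm (f x))" by (rule integral_norm_bound)
  also have "\<dots> \<le> integral\<^sup>L M g"
    by (rule integral_mono_AE'[OF assms]) (use assms(2) in \<open>auto elim!: eventually_mono intro: order_trans[OF norm_ge_zero]\<close>)
  finally show ?thesis .
qed

lemma rho_sqrt_bounds:
  assumes "x \<in> II"
  shows "0 \<le> x \<Longrightarrow> 1 - x \<le> rho x" "x \<le> 0 \<Longrightarrow> 1 + x \<le> rho x"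
proof -
  have r: "rho x = (1 - x) * (1 + x)" by (simp add: rho_def power2_eq_square algebra_simps)
  show "0 \<le> x \<Longrightarrow> 1 - x \<le> rho x" unfolding r using assms by (simp add: mult_le_cancel_left1)
  show "x \<le> 0 \<Longrightarrow> 1 + x \<le> rho x" unfolding r using assms by (simp add: mult_le_cancel_right1)
qed

lemma sq_int_wgrad_energy:
  assumes "w \<in> V" "v \<in> V"
  shows "inner (wgrad w) (wgrad v) = (LINT x|leb_I. (rho x * wd w x) * wd v x)"
  unfolding energy_eq[OF assms, symmetric] energy_def integral_leb_I by simp

text \<open>The flux at \<open>x\<close> is written as the integral of \<open>h\<close> from the nearer endpoint. Fubini then applies to \<open>k\<close>,
  because this integral is bounded by \<open>norm h * sqrt (1 - \<bar>x\<bar>)\<close>.\<close>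

lemma diffusion_graph_inner:
  assumes g: "(w, h) \<in> diffusion_graph" and v: "v \<in> V"
  shows "inner (wgrad w) (wgrad v) = - inner h v"
proof -
  have w: "w \<in> V" using g by (auto simp: diffusion_graph_def)
  define H where "H s = indicator II s * L2_fun h s" for s
  define D where "D x = indicator II x * wd v x" for x
  have Hi: "integrable lborel H" and H0: "(LINT s|lborel. H s) = 0"
    and fl: "AE x in leb_I. rho x * wd w x = (LINT s|lborel. indicator {..x} s * H s)"
    using diffusion_flux[OF g] by (simp_all add: H_def[abs_def])
  have wdv: "weak_deriv II (L2_fun v) (wd v)" by (rule V_D(1)[OF v])
  then have lv: "loc_int II (wd v)" by (simp add: weak_deriv_iff)
  have [measurable]: "H \<in> borel_measurable borel" using borel_measurable_integrable[OF Hi] by simp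
  have [measurable]: "D \<in> borel_measurable borel"
    using weak_deriv_measurable[OF wdv] unfolding D_def leb_I_def
    by (subst (asm) borel_measurable_restrict_space_iff) auto
  have indi: "integrable lborel (\<lambda>s. indicator A s * H s)" if "A \<in> sets borel" for A
    using integrable_mult_indicator[OF _ Hi, of A] that by simp
  define P where "P x = (LINT s|lborel. indicator {..x} s * H s)" for x
  define R where "R x = (LINT s|lborel. indicator {x<..} s * H s)" for x
  have PR: "P x + R x = 0" for x
    using integral_atMost_add_greaterThan[OF Hi, of x] H0 by (simp add: P_def R_def)
  \<comment> \<open>The flux is \<open>P x\<close>, which also equals minus the tail beyond
    \<open>x\<close>. For \<open>x > 0\<close> the kernel takes the tail, for \<open>x < 0\<close>
    the integral from the left, so \<open>k x\<close> always lives between \<open>x\<close> and the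
    nearer endpoint.\<close>
  define \<sigma> where "\<sigma> x s = (if 0 < x \<and> x < s then - 1 else if s \<le> x \<and> x < 0 then 1 else 0 :: real)" for x s :: real
  define k where "k x s = D x * (\<sigma> x s * H s)" for x s
  have \<sigma>1: "\<bar>\<sigma> x s\<bar> \<le> 1" for x s by (simp add: \<sigma>_def)
  have km: "case_prod k \<in> borel_measurable (lborel \<Otimes>\<^sub>M lborel)"
    unfolding k_def \<sigma>_def split_beta' by measurable
  have ks: "(LINT s|lborel. k x s) = D x * P x" if "x \<noteq> 0" for x
  proof (cases "0 < x")
    case True
    have "(LINT s|lborel. k x s) = (LINT s|lborel. - D x * (indicator {x<..} s * H s))"
      using True by (intro Bochner_Integration.integral_cong) (auto simp: k_def \<sigma>_def indicator_def)
    also have "\<dots> = - D x * R x" unfolding R_def by simp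
    also have "\<dots> = D x * P x" using PR[of x] by (simp add: add_eq_0_iff)
    finally show ?thesis .
  next
    case False
    then have "(LINT s|lborel. k x s) = (LINT s|lborel. D x * (indicator {..x} s * H s))"
      using that by (intro Bochner_Integration.integral_cong) (auto simp: k_def \<sigma>_def indicator_def)
    then show ?thesis by (simp add: P_def)
  qed
  \<comment> \<open>Integrating in \<open>x\<close> first, the kernel collects \<open>v'\<close>
    between 0 and \<open>s\<close>, on whichever side of 0 the point \<open>s\<close> lies.\<close>
  have kx: "(LINT x|lborel. k x s) = - H s * prim 0 (wd v) s" for s
  proof (cases "s \<in> II")
    case s: True
    show ?thesis
    proof (cases "0 < s")
      case True
      have "(LINT x|lborel. k x s) = (LINT x|lborel. - H s * (indicator {0..s} x *\<^sub>R wd v x))"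
      proof (rule integral_cong_AE)
        show "AE x in lborel. k x s = - H s * (indicator {0..s} x *\<^sub>R wd v x)"
          using AE_lborel_singleton[of 0] AE_lborel_singleton[of s]
          by eventually_elim (use True s in \<open>auto simp: k_def \<sigma>_def D_def indicator_def\<close>)
        show "(\<lambda>x. k x s) \<in> borel_measurable lborel" unfolding k_def \<sigma>_def by measurable
        have "{0..s} \<subseteq> II" using s by auto
        then have "set_integrable lborel {0..s} (wd v)" using lv by (auto simp: loc_int_def)
        then show "(\<lambda>x. - H s * (indicator {0..s} x *\<^sub>R wd v x)) \<in> borel_measurable lborel"
          unfolding set_integrable_def by (intro borel_measurable_times borel_measurable_integrable) auto
      qed
      then show ?thesis using True set_integral_Icc_degenerate[of 0 s "wd v"]
        by (simp add: prim_def set_lebesgue_integral_def)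
    next
      case False
      have "(LINT x|lborel. k x s) = (LINT x|lborel. H s * (indicator {s..0} x *\<^sub>R wd v x))"
      proof (rule integral_cong_AE)
        show "AE x in lborel. k x s = H s * (indicator {s..0} x *\<^sub>R wd v x)"
          using AE_lborel_singleton[of 0] AE_lborel_singleton[of s]
          by eventually_elim (use False s in \<open>auto simp: k_def \<sigma>_def D_def indicator_def\<close>)
        show "(\<lambda>x. k x s) \<in> borel_measurable lborel" unfolding k_def \<sigma>_def by measurable
        have "{s..0} \<subseteq> II" using s by auto
        then have "set_integrable lborel {s..0} (wd v)" using lv by (auto simp: loc_int_def)
        then show "(\<lambda>x. H s * (indicator {s..0} x *\<^sub>R wd v x)) \<in> borel_measurable lborel"
          unfolding set_integrable_def by (intro borel_measurable_times borel_measurable_integrable) auto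
      qed
      then show ?thesis using False set_integral_Icc_degenerate[of s 0 "wd v"]
        by (simp add: prim_def set_lebesgue_integral_def)
    qed
  qed (simp add: k_def H_def)
  have ki: "integrable (lborel \<Otimes>\<^sub>M lborel) (case_prod k)"
  proof (rule lborel_pair.Fubini_integrable[OF km])
    show "AE x in lborel. integrable lborel (\<lambda>s. case (x, s) of (x, s) \<Rightarrow> k x s)"
    proof (rule AE_I2)
      fix x
      have "integrable lborel (\<lambda>s. D x * H s)" using Hi by simp
      then have "integrable lborel (k x)"
      proof (rule Bochner_Integration.integrable_bound)
        show "k x \<in> borel_measurable lborel" unfolding k_def \<sigma>_def by measurable
        have "\<bar>k x s\<bar> \<le> \<bar>D x * H s\<bar>" for s
          unfolding k_def abs_mult using mult_right_mono[OF \<sigma>1, of "\<bar>H s\<bar>" x s] by (intro mult_left_mono) auto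
        then show "AE s in lborel. norm (k x s) \<le> norm (D x * H s)" by simp
      qed
      then show "integrable lborel (\<lambda>s. case (x, s) of (x, s) \<Rightarrow> k x s)" by simp
    qed
    have vi: "integrable leb_I (\<lambda>x. norm h * (sqrt (rho x) * wd v x))"
      by (intro integrable_mult_right sq_int_integrable V_D(2)[OF v])
    \<comment> \<open>The bound \<open>norm h * sqrt (rho x)\<close> on the inner integral leaves
      \<open>sqrt rho * v'\<close>, which is square integrable and hence integrable on the bounded
      interval.\<close>
    have bnd: "\<bar>LINT s|lborel. \<bar>k x s\<bar>\<bar> \<le> \<bar>indicator II x * (norm h * (sqrt (rho x) * wd v x))\<bar>" for x
    proof (cases "x \<in> II")
      case x: True
      have tail: "(LINT s|lborel. indicator A s * \<bar>H s\<bar>) \<le> norm h * sqrt (b - a)"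
        if "A \<in> sets borel" "A \<inter> II \<subseteq> {a..b}" "a \<le> b" for A a b
      proof -
        have "(LINT s|lborel. indicator A s * \<bar>H s\<bar>) = (LINT s|lborel. indicator (A \<inter> II) s * (indicator II s * \<bar>L2_fun h s\<bar>))"
          by (intro Bochner_Integration.integral_cong) (auto simp: H_def indicator_def)
        also have "\<dots> \<le> norm (to_L2 (L2_fun h)) * sqrt (b - a)"
          using that by (intro integral_abs_le_norm sq_int_L2_fun) auto
        finally show ?thesis by (simp add: to_L2_L2_fun)
      qed
      obtain A where A: "A \<in> sets borel" "\<And>s. \<bar>\<sigma> x s\<bar> \<le> indicator A s" "(LINT s|lborel. indicator A s * \<bar>H s\<bar>) \<le> norm h * sqrt (rho x)"
      proof (cases "0 < x")
        case True
        have "(LINT s|lborel. indicator {x<..} s * \<bar>H s\<bar>) \<le> norm h * sqrt (1 - x)"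
          using x by (intro tail) auto
        also have "\<dots> \<le> norm h * sqrt (rho x)" using rho_sqrt_bounds(1)[OF x] True by (intro mult_left_mono) auto
        finally show thesis using that[of "{x<..}"] True by (auto simp: \<sigma>_def indicator_def)
      next
        case False
        have "(LINT s|lborel. indicator {..x} s * \<bar>H s\<bar>) \<le> norm h * sqrt (x - (-1))"
          using x by (intro tail) auto
        also have "\<dots> \<le> norm h * sqrt (rho x)" using rho_sqrt_bounds(2)[OF x] False by (intro mult_left_mono) auto
        finally show thesis using that[of "{..x}"] False by (auto simp: \<sigma>_def indicator_def)
      qed
      have Ai: "integrable lborel (\<lambda>s. \<bar>D x\<bar> * (indicator A s * \<bar>H s\<bar>))"
        using indi[OF A(1)] integrable_norm[OF indi[OF A(1)]] by (simp add: abs_mult)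
      have "\<bar>LINT s|lborel. \<bar>k x s\<bar>\<bar> = (LINT s|lborel. \<bar>k x s\<bar>)" by simp
      also have "\<dots> \<le> (LINT s|lborel. \<bar>D x\<bar> * (indicator A s * \<bar>H s\<bar>))"
      proof (rule integral_mono')
        show "\<bar>k x s\<bar> \<le> \<bar>D x\<bar> * (indicator A s * \<bar>H s\<bar>)" for s
          unfolding k_def abs_mult using A(2) by (intro mult_left_mono mult_right_mono) auto
      qed (use Ai in auto)
      also have "\<dots> = \<bar>D x\<bar> * (LINT s|lborel. indicator A s * \<bar>H s\<bar>)" by simp
      also have "\<dots> \<le> \<bar>D x\<bar> * (norm h * sqrt (rho x))" by (intro mult_left_mono A(3)) auto
      also have "\<dots> = \<bar>indicator II x * (norm h * (sqrt (rho x) * wd v x))\<bar>"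
        using x rho_pos[OF x] by (simp add: D_def abs_mult)
      finally show ?thesis .
    qed (simp add: k_def D_def)
    show "integrable lborel (\<lambda>x. LINT s|lborel. norm (case (x, s) of (x, s) \<Rightarrow> k x s))"
    proof (rule Bochner_Integration.integrable_bound)
      show "integrable lborel (\<lambda>x. indicator II x * (norm h * (sqrt (rho x) * wd v x)))"
        using vi unfolding integrable_leb_I_iff set_integrable_def by (simp only: real_scaleR_def)
      show "AE x in lborel. norm (LINT s|lborel. norm (case (x, s) of (x, s) \<Rightarrow> k x s)) \<le> norm (indicator II x * (norm h * (sqrt (rho x) * wd v x)))"
        using bnd by simp
      have [measurable]: "(\<lambda>(x, s). k x s) \<in> borel_measurable (lborel \<Otimes>\<^sub>M lborel)" using km .
      show "(\<lambda>x. LINT s|lborel. norm (case (x, s) of (x, s) \<Rightarrow> k x s)) \<in> borel_measurable lborel"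
        by measurable
    qed
  qed
  \<comment> \<open>The undetermined constant of the primitive of \<open>v'\<close> does no harm
    because \<open>h\<close> has integral 0.\<close>
  obtain C where C: "AE x in lborel. x \<in> II \<longrightarrow> L2_fun v x = C + prim 0 (wd v) x"
    using weak_deriv_primitive[OF II_interval(1,2,4) wdv] by blast
  have pm: "prim 0 (wd v) \<in> borel_measurable leb_I"
    by (rule continuous_leb_I_measurable[OF prim_continuous[OF II_interval(1,2) lv II_interval(4)]])
  have hv: "integrable leb_I (\<lambda>x. L2_fun h x * L2_fun v x)" "integrable leb_I (L2_fun h)"
    by (intro sq_int_mult sq_int_integrable sq_int_L2_fun)+
  have Pm [measurable]: "P \<in> borel_measurable borel"
    using borel_measurable_continuous_onI[OF indicator_Iic_integral_continuous[OF Hi]] by (simp add: P_def[abs_def])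
  have "inner (wgrad w) (wgrad v) = (LINT x|leb_I. P x * wd v x)"
    unfolding sq_int_wgrad_energy[OF w v]
  proof (rule integral_cong_AE)
    show "AE x in leb_I. rho x * wd w x * wd v x = P x * wd v x"
      using fl by eventually_elim (simp add: P_def)
    show "(\<lambda>x. rho x * wd w x * wd v x) \<in> borel_measurable leb_I" "(\<lambda>x. P x * wd v x) \<in> borel_measurable leb_I"
      using weak_deriv_measurable[OF wdv] weak_deriv_measurable[OF V_D(1)[OF w]] borel_measurable_leb_I[OF Pm]
      by measurable
  qed
  also have "\<dots> = (LINT x|lborel. D x * P x)"
    unfolding integral_leb_I set_lebesgue_integral_def by (simp add: D_def mult_ac)
  also have "\<dots> = (LINT x|lborel. LINT s|lborel. k x s)"
  proof (rule integral_cong_AE)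
    show "AE x in lborel. D x * P x = (LINT s|lborel. k x s)"
      using AE_lborel_singleton[of 0] by eventually_elim (simp add: ks)
    have [measurable]: "(\<lambda>(x, s). k x s) \<in> borel_measurable (lborel \<Otimes>\<^sub>M lborel)" using km .
    show "(\<lambda>x. LINT s|lborel. k x s) \<in> borel_measurable lborel" by measurable
  qed measurable
  also have "\<dots> = (LINT s|lborel. LINT x|lborel. k x s)" using lborel_pair.Fubini_integral[OF ki] by simp
  also have "\<dots> = - (LINT s|leb_I. L2_fun h s * prim 0 (wd v) s)"
    unfolding kx integral_leb_I set_lebesgue_integral_def by (simp add: H_def mult.assoc)
  also have "(LINT s|leb_I. L2_fun h s * prim 0 (wd v) s) = (LINT s|leb_I. L2_fun h s * L2_fun v s - C * L2_fun h s)"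
  proof (rule integral_cong_AE)
    show "AE s in leb_I. L2_fun h s * prim 0 (wd v) s = L2_fun h s * L2_fun v s - C * L2_fun h s"
      using C unfolding AE_leb_I_iff by eventually_elim (auto simp: algebra_simps)
    show "(\<lambda>s. L2_fun h s * prim 0 (wd v) s) \<in> borel_measurable leb_I"
      using pm sq_int_measurable[OF sq_int_L2_fun[of h]] by measurable
    show "(\<lambda>s. L2_fun h s * L2_fun v s - C * L2_fun h s) \<in> borel_measurable leb_I"
      using sq_int_measurable[OF sq_int_L2_fun[of h]] sq_int_measurable[OF sq_int_L2_fun[of v]] by measurable
  qed
  also have "\<dots> = inner h v - C * (LINT s|leb_I. L2_fun h s)"
    using hv by (simp add: inner_L2_fun)
  also have "(LINT s|leb_I. L2_fun h s) = 0"
    using H0 by (simp add: integral_leb_I set_lebesgue_integral_def H_def)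
  finally show ?thesis by simp
qed

text \<open>For the converse one tests with test functions, which lie in \<open>V\<close>; square
  integrability of \<open>rho w'\<close> follows from \<open>rho^2 \<le> rho\<close> on the
  interval. In this form linearity is immediate and limits can be taken.\<close>

theorem diffusion_graph_iff:
  "(w, h) \<in> diffusion_graph \<longleftrightarrow> w \<in> V \<and> (\<forall>v\<in>V. inner (wgrad w) (wgrad v) = - inner h v)"
proof
  assume "(w, h) \<in> diffusion_graph"
  then show "w \<in> V \<and> (\<forall>v\<in>V. inner (wgrad w) (wgrad v) = - inner h v)"
    using diffusion_graph_inner by (auto simp: diffusion_graph_def)
next
  assume a: "w \<in> V \<and> (\<forall>v\<in>V. inner (wgrad w) (wgrad v) = - inner h v)"
  then have w: "w \<in> V" by blast
  have "weak_deriv II (\<lambda>x. rho x * wd w x) (L2_fun h)"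
    unfolding weak_deriv_iff
  proof (intro conjI allI impI)
    have "sq_int (\<lambda>x. rho x * wd w x)"
      unfolding sq_int_def
    proof
      show m: "(\<lambda>x. rho x * wd w x) \<in> borel_measurable leb_I"
        using weak_deriv_measurable[OF V_D(1)[OF w]] by measurable
      have i: "integrable leb_I (\<lambda>x. (sqrt (rho x) * wd w x)\<^sup>2)" using V_D(2)[OF w] by (simp add: sq_int_def)
      show "integrable leb_I (\<lambda>x. (rho x * wd w x)\<^sup>2)"
      proof (rule Bochner_Integration.integrable_bound[OF i])
        show "(\<lambda>x. (rho x * wd w x)\<^sup>2) \<in> borel_measurable leb_I" using m by measurable
        show "AE x in leb_I. norm ((rho x * wd w x)\<^sup>2) \<le> norm ((sqrt (rho x) * wd w x)\<^sup>2)"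
          using AE_in_II
        proof eventually_elim
          case (elim x)
          then have "(rho x)\<^sup>2 \<le> rho x" using rho_le_1[of x] rho_pos[of x]
            by (simp add: power2_eq_square mult_le_cancel_right1)
          then show ?case using elim by (simp add: power_mult_distrib rho_simps mult_right_mono)
        qed
      qed
    qed
    then show "loc_int II (\<lambda>x. rho x * wd w x)" by (rule sq_int_loc_int)
    show "loc_int II (L2_fun h)" by (intro sq_int_loc_int sq_int_L2_fun)
    fix \<phi> assume \<phi>: "test_function II \<phi>"
    have "(LINT x:II|lborel. deriv \<phi> x *\<^sub>R (rho x * wd w x)) = - inner h (to_L2 \<phi>)"
      using a inner_wgrad_test_function[OF w \<phi>] test_function_V(1)[OF \<phi>] by simp
    also have "inner h (to_L2 \<phi>) = (LINT x:II|lborel. \<phi> x *\<^sub>R L2_fun h x)"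
      unfolding inner_to_L2_right[OF test_function_sq_int(1)[OF \<phi>]] integral_leb_I[symmetric] by (simp add: mult.commute)
    finally show "(LINT x:II|lborel. deriv \<phi> x *\<^sub>R (rho x * wd w x)) = - (LINT x:II|lborel. \<phi> x *\<^sub>R L2_fun h x)" .
  qed
  then show "(w, h) \<in> diffusion_graph" using w by (simp add: diffusion_graph_def)
qed

theorem diffusion_graph_subspace: "subspace diffusion_graph"
  unfolding subspace_def
  by (auto simp: diffusion_graph_iff zero_prod_def V_zero V_add V_scale inner_add_left algebra_simps)

text \<open>Convergence of the gradients is not given. Testing the difference of two elements with
  itself bounds the squared gradient difference by
  \<open>norm (h m - h n) * norm (w m - w n)\<close>, so the gradients are Cauchy and
  \<open>wgrad_closed\<close> applies.\<close>

theorem diffusion_graph_closed: "closed diffusion_graph"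
  unfolding closed_sequential_limits
proof (intro allI impI, elim conjE)
  fix X :: "nat \<Rightarrow> L2I \<times> L2I" and l assume X: "\<forall>n. X n \<in> diffusion_graph" and l: "X \<longlonglongrightarrow> l"
  define w h where "w n = fst (X n)" and "h n = snd (X n)" for n
  have g: "(w n, h n) \<in> diffusion_graph" for n using X by (simp add: w_def h_def)
  have wl: "w \<longlonglongrightarrow> fst l" and hl: "h \<longlonglongrightarrow> snd l"
    unfolding w_def h_def by (intro tendsto_intros l)+
  have w: "w n \<in> V" for n using g by (simp add: diffusion_graph_iff)
  have e: "(norm (wgrad (w m) - wgrad (w n)))\<^sup>2 \<le> norm (h m - h n) * norm (w m - w n)" for m n
  proof -
    have "(w m - w n, h m - h n) \<in> diffusion_graph"
      using subspace_diff[OF diffusion_graph_subspace g g, of m n] by (simp add: minus_prod_def)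
    then have "(norm (wgrad (w m - w n)))\<^sup>2 = - inner (h m - h n) (w m - w n)"
      by (auto simp: power2_norm_eq_inner diffusion_graph_iff)
    also have "\<dots> \<le> norm (h m - h n) * norm (w m - w n)"
      using Cauchy_Schwarz_ineq2[of "h m - h n" "w m - w n"] by linarith
    finally show ?thesis using w by (simp add: V_diff)
  qed
  have "Cauchy (\<lambda>n. wgrad (w n))"
  proof (rule CauchyI)
    fix r :: real assume r: "r > 0"
    obtain M1 where M1: "\<And>m n. m \<ge> M1 \<Longrightarrow> n \<ge> M1 \<Longrightarrow> norm (w m - w n) < r"
      using CauchyD[OF LIMSEQ_imp_Cauchy[OF wl] r] by blast
    obtain M2 where M2: "\<And>m n. m \<ge> M2 \<Longrightarrow> n \<ge> M2 \<Longrightarrow> norm (h m - h n) < r"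
      using CauchyD[OF LIMSEQ_imp_Cauchy[OF hl] r] by blast
    show "\<exists>M. \<forall>m\<ge>M. \<forall>n\<ge>M. norm (wgrad (w m) - wgrad (w n)) < r"
    proof (intro exI[of _ "max M1 M2"] allI impI)
      fix m n assume mn: "max M1 M2 \<le> m" "max M1 M2 \<le> n"
      have "norm (h m - h n) * norm (w m - w n) < r * r"
        using M1[of m n] M2[of m n] mn r by (intro mult_strict_mono') auto
      then have "(norm (wgrad (w m) - wgrad (w n)))\<^sup>2 < r\<^sup>2" using e[of m n] by (simp add: power2_eq_square)
      then show "norm (wgrad (w m) - wgrad (w n)) < r" using r by (simp add: power2_less_imp_less)
    qed
  qed
  then obtain q where q: "(\<lambda>n. wgrad (w n)) \<longlonglongrightarrow> q" using Cauchy_convergent convergentD by blast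
  have lV: "fst l \<in> V" "wgrad (fst l) = q" using wgrad_closed[OF w wl q] by blast+
  have "inner q (wgrad v) = - inner (snd l) v" if v: "v \<in> V" for v
  proof -
    have "inner (wgrad (w n)) (wgrad v) = - inner (h n) v" for n using g v by (simp add: diffusion_graph_iff)
    moreover have "(\<lambda>n. inner (wgrad (w n)) (wgrad v)) \<longlonglongrightarrow> inner q (wgrad v)" by (intro tendsto_intros q)
    moreover have "(\<lambda>n. - inner (h n) v) \<longlonglongrightarrow> - inner (snd l) v" by (intro tendsto_intros hl)
    ultimately show ?thesis using LIMSEQ_unique by simp
  qed
  then have "(fst l, snd l) \<in> diffusion_graph"
    by (intro diffusion_graph_iff[THEN iffD2]) (use lV in auto)
  then show "l \<in> diffusion_graph" by simp
qed

text \<open>Uniqueness of weak derivatives makes the \<open>THE\<close> in \<open>diffusion\<close>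
  well defined.\<close>

lemma diffusion_eq:
  assumes g: "(w, h) \<in> diffusion_graph"
  shows "diffusion w = h"
proof -
  have "h' = h" if "(w, h') \<in> diffusion_graph" for h'
  proof -
    have "weak_deriv II (\<lambda>x. rho x * wd w x) (L2_fun h)" "weak_deriv II (\<lambda>x. rho x * wd w x) (L2_fun h')"
      using g that by (auto simp: diffusion_graph_def)
    then have "AE x in lborel. x \<in> II \<longrightarrow> L2_fun h x = L2_fun h' x"
      by (rule weak_deriv_unique[OF II_interval(1)])
    then have "to_L2 (L2_fun h) = to_L2 (L2_fun h')"
      by (intro to_L2_cong sq_int_L2_fun) (simp add: AE_leb_I_iff)
    then show ?thesis by (simp add: to_L2_L2_fun)
  qed
  then show ?thesis unfolding diffusion_def using g by blast
qed

lemma diffusion_in_graph: "w \<in> Domain diffusion_graph \<Longrightarrow> (w, diffusion w) \<in> diffusion_graph"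
  using diffusion_eq by auto

text \<open>A bounded \<open>(rho w')'\<close> makes \<open>w\<close> Lipschitz.\<close>

lemma diffusion_domain_bounded:
  assumes g: "(w, h) \<in> diffusion_graph" and b: "AE x in leb_I. \<bar>L2_fun h x\<bar> \<le> C"
  shows "AE x in leb_I. \<bar>L2_fun w x\<bar> \<le> norm w + 2 * C"
proof -
  have w: "w \<in> V" using g by (auto simp: diffusion_graph_def)
  define H where "H s = indicator II s * L2_fun h s" for s
  have Hi: "integrable lborel H" and H0: "(LINT s|lborel. H s) = 0"
    and fl: "AE x in leb_I. rho x * wd w x = (LINT s|lborel. indicator {..x} s * H s)"
    using diffusion_flux[OF g] by (simp_all add: H_def[abs_def])
  have PR: "(LINT s|lborel. indicator {..x} s * H s) + (LINT s|lborel. indicator {x<..} s * H s) = 0" for x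
    using integral_atMost_add_greaterThan[OF Hi, of x] H0 by simp
  have C0: "C \<ge> 0" by (rule AE_leb_I_constD, use b in eventually_elim) linarith
  have Ci: "integrable lborel (\<lambda>s. C * indicator {a..b} s)" for a b :: real
    by (intro integrable_mult_right integrable_real_indicator) (auto simp: emeasure_lborel_Icc_eq)
  have tail: "\<bar>LINT s|lborel. indicator A s * H s\<bar> \<le> C * (b - a)"
    if "A \<in> sets borel" "A \<inter> II \<subseteq> {a..b}" "a \<le> b" for A a b
  proof -
    have "norm (LINT s|lborel. indicator A s * H s) \<le> (LINT s|lborel. C * indicator {a..b} s)"
    proof (rule integral_norm_bound_AE)
      show "integrable lborel (\<lambda>s. C * indicator {a..b} s)" by (rule Ci)
      show "AE s in lborel. norm (indicator A s * H s) \<le> C * indicator {a..b} s"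
        using b unfolding AE_leb_I_iff
        by eventually_elim (use that(2) C0 in \<open>auto simp: H_def indicator_def\<close>)
    qed
    then show ?thesis using that(3) by simp
  qed
  \<comment> \<open>Integrating from the nearer endpoint bounds the flux by \<open>C\<close> times
    the distance to it, which is at most \<open>C rho\<close>; dividing by \<open>rho\<close> bounds
    \<open>w'\<close> itself.\<close>
  have wb: "AE x in leb_I. \<bar>wd w x\<bar> \<le> C"
    using fl AE_in_II
  proof eventually_elim
    case (elim x)
    have "\<bar>rho x * wd w x\<bar> \<le> C * rho x"
    proof (cases "0 \<le> x")
      case True
      have "\<bar>rho x * wd w x\<bar> = \<bar>LINT s|lborel. indicator {x<..} s * H s\<bar>" using elim PR[of x] by (simp add: add_eq_0_iff)
      also have "\<dots> \<le> C * (1 - x)" using elim by (intro tail) auto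
      also have "\<dots> \<le> C * rho x" using rho_sqrt_bounds(1)[OF elim(2) True] C0 by (rule mult_left_mono)
      finally show ?thesis .
    next
      case False
      have "\<bar>rho x * wd w x\<bar> \<le> C * (x - (-1))" unfolding elim(1) using elim by (intro tail) auto
      also have "\<dots> \<le> C * rho x" using rho_sqrt_bounds(2)[OF elim(2)] False C0 by (intro mult_left_mono) auto
      finally show ?thesis .
    qed
    then show ?case using rho_pos[OF elim(2)] by (simp add: abs_mult mult.commute)
  qed
  have wdw: "weak_deriv II (L2_fun w) (wd w)" by (rule V_D(1)[OF w])
  have seg: "\<bar>LINT s:{a..b}|lborel. wd w s\<bar> \<le> C" if "{a..b} \<subseteq> II" "a \<le> b" "b - a \<le> 1" for a b
  proof -
    have "norm (LINT s|lborel. indicator {a..b} s *\<^sub>R wd w s) \<le> (LINT s|lborel. C * indicator {a..b} s)"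
    proof (rule integral_norm_bound_AE[OF Ci])
      show "AE s in lborel. norm (indicator {a..b} s *\<^sub>R wd w s) \<le> C * indicator {a..b} s"
        using wb unfolding AE_leb_I_iff
        by eventually_elim (use subsetD[OF that(1)] C0 in \<open>auto simp: indicator_def\<close>)
    qed
    also have "\<dots> \<le> C" using that C0 mult_left_mono[of "b - a" 1 C] by simp
    finally show ?thesis by (simp add: set_lebesgue_integral_def)
  qed
  obtain c where c: "AE x in lborel. x \<in> II \<longrightarrow> L2_fun w x = c + prim 0 (wd w) x"
    using weak_deriv_primitive[OF II_interval(1,2,4) wdw] by blast
  have pb: "\<bar>prim 0 (wd w) x\<bar> \<le> C" if x: "x \<in> II" for x
  proof (cases "0 \<le> x")
    case True
    have "{0..x} \<subseteq> II" using x by auto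
    then show ?thesis using seg[of 0 x] True x set_integral_Icc_degenerate[of 0 x "wd w"] by (simp add: prim_def)
  next
    case False
    have "{x..0} \<subseteq> II" using x by auto
    then show ?thesis using seg[of x 0] False x set_integral_Icc_degenerate[of x 0 "wd w"] by (simp add: prim_def)
  qed
  have near: "AE x in leb_I. \<bar>L2_fun w x - c\<bar> \<le> C"
    unfolding AE_leb_I_iff using c by eventually_elim (use pb in auto)
  \<comment> \<open>Integrating over the interval of length 2, \<open>2 |c|\<close> is at most the
    \<open>L^1\<close> norm of \<open>w\<close> plus \<open>2 C\<close>, and the \<open>L^1\<close>
    norm is at most \<open>sqrt 2\<close> times the norm of \<open>w\<close>. A second
    \<open>C\<close> enters when returning from \<open>c\<close> to \<open>w\<close>.\<close>
  have "\<bar>c\<bar> \<le> norm w + C"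
  proof -
    have wi: "integrable leb_I (\<lambda>x. \<bar>L2_fun w x\<bar> + C)"
      by (intro Bochner_Integration.integrable_add integrable_abs sq_int_integrable sq_int_L2_fun sq_int_const)
    have m2: "measure leb_I {-1<..<1} = 2" using emeasure_space_leb_I by (simp add: measure_def)
    have "(LINT x|leb_I. \<bar>c\<bar>) \<le> (LINT x|leb_I. \<bar>L2_fun w x\<bar> + C)"
    proof (rule integral_mono_AE[OF _ wi])
      show "integrable leb_I (\<lambda>x. \<bar>c\<bar>)" by (intro sq_int_integrable sq_int_const)
      show "AE x in leb_I. \<bar>c\<bar> \<le> \<bar>L2_fun w x\<bar> + C" using near by eventually_elim linarith
    qed
    also have "\<dots> = (LINT x|leb_I. \<bar>L2_fun w x\<bar>) + 2 * C"
      by (subst Bochner_Integration.integral_add) (auto simp: m2 intro!: integrable_abs sq_int_integrable[OF sq_int_L2_fun])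
    also have "(LINT x|leb_I. \<bar>L2_fun w x\<bar>) = (LINT x|lborel. indicator II x * (indicator II x * \<bar>L2_fun w x\<bar>))"
      unfolding integral_leb_I set_lebesgue_integral_def
      by (intro Bochner_Integration.integral_cong) (auto simp: indicator_def)
    also have "\<dots> \<le> norm (to_L2 (L2_fun w)) * sqrt (1 - (-1))"
      by (intro integral_abs_le_norm sq_int_L2_fun) auto
    also have "\<dots> \<le> norm w * 2" by (auto simp: to_L2_L2_fun sqrt2_less_2 less_imp_le intro!: mult_left_mono)
    finally show ?thesis using m2 by simp
  qed
  then show ?thesis using near by (auto elim!: eventually_mono)
qed

section \<open>Compactness and monotone graphs\<close>

lemma to_L2_tendsto:
  assumes f: "\<And>n. f n \<in> borel_measurable leb_I" and F: "F \<in> borel_measurable leb_I"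
    and b: "\<And>n. AE x in leb_I. \<bar>f n x\<bar> \<le> C" and lim: "AE x in leb_I. (\<lambda>n. f n x) \<longlonglongrightarrow> F x"
  shows "AE x in leb_I. \<bar>F x\<bar> \<le> C" "(\<lambda>n. to_L2 (f n)) \<longlonglongrightarrow> to_L2 F"
proof -
  have ba: "AE x in leb_I. \<forall>n. \<bar>f n x\<bar> \<le> C" using b by (simp add: AE_all_countable)
  show Fb: "AE x in leb_I. \<bar>F x\<bar> \<le> C"
    using ba lim
  proof eventually_elim
    case (elim x)
    have "(\<lambda>n. \<bar>f n x\<bar>) \<longlonglongrightarrow> \<bar>F x\<bar>" by (intro tendsto_intros elim)
    then show ?case by (rule LIMSEQ_le_const2) (use elim in auto)
  qed
  have sf: "sq_int (f n)" for n by (rule sq_int_bounded[OF f b])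
  have sF: "sq_int F" by (rule sq_int_bounded[OF F Fb])
  have "(\<lambda>n. LINT x|leb_I. (f n x - F x)\<^sup>2) \<longlonglongrightarrow> (LINT x|leb_I. 0)"
  proof (rule integral_dominated_convergence)
    show "integrable leb_I (\<lambda>x. (2 * C)\<^sup>2)" by (intro sq_int_integrable sq_int_const)
    show "AE x in leb_I. (\<lambda>n. (f n x - F x)\<^sup>2) \<longlonglongrightarrow> 0"
      using lim
    proof eventually_elim
      case (elim x)
      then have "(\<lambda>n. (f n x - F x)\<^sup>2) \<longlonglongrightarrow> (F x - F x)\<^sup>2" by (intro tendsto_intros)
      then show ?case by simp
    qed
    show "AE x in leb_I. norm ((f n x - F x)\<^sup>2) \<le> (2 * C)\<^sup>2" for n
      using b[of n] Fb
    proof eventually_elim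
      case (elim x)
      then have "\<bar>f n x - F x\<bar> \<le> 2 * C" by linarith
      then have "\<bar>f n x - F x\<bar>\<^sup>2 \<le> (2 * C)\<^sup>2" by (intro power_mono) auto
      then show ?case by simp
    qed
  qed (use f F in auto)
  then have "(\<lambda>n. (norm (to_L2 (f n) - to_L2 F))\<^sup>2) \<longlonglongrightarrow> 0"
    using sf sF by (simp add: norm_to_L2_sq[OF sq_int_minus] flip: to_L2_diff)
  then have "(\<lambda>n. sqrt ((norm (to_L2 (f n) - to_L2 F))\<^sup>2)) \<longlonglongrightarrow> sqrt 0" by (rule tendsto_real_sqrt)
  then have "(\<lambda>n. norm (to_L2 (f n) - to_L2 F)) \<longlonglongrightarrow> 0" by simp
  then show "(\<lambda>n. to_L2 (f n)) \<longlonglongrightarrow> to_L2 F"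
    by (simp add: tendsto_norm_zero_iff LIM_zero_iff)
qed

text \<open>Convergence in \<open>L2I\<close> is \<open>L^1\<close> convergence to 0 of the squared
  differences, for which an almost everywhere convergent subsequence is available.\<close>

lemma L2_convergent_AE_subseq:
  assumes "v \<longlonglongrightarrow> w"
  obtains r :: "nat \<Rightarrow> nat" where "strict_mono r" "AE x in leb_I. (\<lambda>n. L2_fun (v (r n)) x) \<longlonglongrightarrow> L2_fun w x"
proof -
  have s: "sq_int (\<lambda>x. L2_fun (v n) x - L2_fun w x)" for n by (intro sq_int_minus sq_int_L2_fun)
  have "(\<lambda>n. norm (v n - w)) \<longlonglongrightarrow> 0" using assms by (simp add: tendsto_norm_zero_iff LIM_zero_iff)
  then have "(\<lambda>n. (norm (v n - w))\<^sup>2) \<longlonglongrightarrow> 0\<^sup>2" by (intro tendsto_intros)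
  moreover have "(norm (v n - w))\<^sup>2 = (LINT x|leb_I. norm ((L2_fun (v n) x - L2_fun w x)\<^sup>2))" for n
    using norm_to_L2_sq[OF s[of n]] by (simp add: to_L2_diff sq_int_L2_fun to_L2_L2_fun)
  ultimately have "(\<lambda>n. LINT x|leb_I. norm ((L2_fun (v n) x - L2_fun w x)\<^sup>2)) \<longlonglongrightarrow> 0" by simp
  moreover have "integrable leb_I (\<lambda>x. (L2_fun (v n) x - L2_fun w x)\<^sup>2)" for n
    using s[of n] by (simp add: sq_int_def)
  ultimately obtain r :: "nat \<Rightarrow> nat" where r: "strict_mono r"
      and l: "AE x in leb_I. (\<lambda>n. (L2_fun (v (r n)) x - L2_fun w x)\<^sup>2) \<longlonglongrightarrow> 0"
    using tendsto_L1_AE_subseq[of leb_I "\<lambda>n x. (L2_fun (v n) x - L2_fun w x)\<^sup>2"] by blast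
  have "AE x in leb_I. (\<lambda>n. L2_fun (v (r n)) x) \<longlonglongrightarrow> L2_fun w x"
    using l
  proof eventually_elim
    case (elim x)
    then have "(\<lambda>n. sqrt ((L2_fun (v (r n)) x - L2_fun w x)\<^sup>2)) \<longlonglongrightarrow> sqrt 0" by (rule tendsto_real_sqrt)
    then have "(\<lambda>n. L2_fun (v (r n)) x - L2_fun w x) \<longlonglongrightarrow> 0" by (simp add: tendsto_rabs_zero_iff)
    then show ?case by (simp add: LIM_zero_iff)
  qed
  with r show thesis by (rule that)
qed

text \<open>A closed linear subspace of \<open>L2I \<times> L2I\<close>, hence closed and convex:
  weak cluster points of such pairs are again of this form, which is how membership in
  \<open>V\<close> passes to limits.\<close>

definition wgrad_graph :: "(L2I \<times> L2I) set" where
  "wgrad_graph = {(w, q). w \<in> V \<and> wgrad w = q}"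

lemma wgrad_graph_closed: "closed wgrad_graph"
  unfolding closed_sequential_limits
proof (intro allI impI, elim conjE)
  fix X :: "nat \<Rightarrow> L2I \<times> L2I" and l assume X: "\<forall>n. X n \<in> wgrad_graph" and l: "X \<longlonglongrightarrow> l"
  have "fst (X n) \<in> V" "wgrad (fst (X n)) = snd (X n)" for n
    using X[rule_format, of n] by (cases "X n"; simp add: wgrad_graph_def)+
  moreover have "(\<lambda>n. fst (X n)) \<longlonglongrightarrow> fst l" "(\<lambda>n. snd (X n)) \<longlonglongrightarrow> snd l" by (intro tendsto_intros l)+
  ultimately show "l \<in> wgrad_graph"
    using wgrad_closed[of "\<lambda>n. fst (X n)" "fst l" "snd l"] by (auto simp: wgrad_graph_def)
qed

lemma wgrad_graph_convex: "convex wgrad_graph"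
  by (rule subspace_imp_convex)
    (auto simp: subspace_def wgrad_graph_def zero_prod_def V_zero V_add V_scale)

text \<open>A cluster point of the bounded pairs \<open>(v n, wgrad (v n))\<close> lies in
  \<open>wgrad_graph\<close>, and its first component can only be the strong limit
  \<open>w\<close>.\<close>

lemma V_weak_limit:
  assumes v: "\<And>n. v n \<in> V" "\<And>n. norm (wgrad (v n)) \<le> E" and lim: "v \<longlonglongrightarrow> w"
  shows "w \<in> V"
proof -
  have "bounded (range v)" using lim by (rule convergent_imp_bounded)
  then obtain B where B: "\<And>n. norm (v n) \<le> B" by (auto simp: bounded_iff)
  have "norm (v n, wgrad (v n)) \<le> B + E" for n
    using norm_Pair_le[of "v n" "wgrad (v n)"] B[of n] v(2)[of n] by linarith
  then have "bounded (range (\<lambda>n. (v n, wgrad (v n))))" by (auto simp: bounded_iff)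
  then obtain q where q: "\<And>e c. (\<lambda>n. inner (v n, wgrad (v n)) e) \<longlonglongrightarrow> c \<Longrightarrow> inner q e = c"
    "\<And>K. closed K \<Longrightarrow> convex K \<Longrightarrow> range (\<lambda>n. (v n, wgrad (v n))) \<subseteq> K \<Longrightarrow> q \<in> K"
    using weak_cluster_point by blast
  have "q \<in> wgrad_graph"
    by (rule q(2)[OF wgrad_graph_closed wgrad_graph_convex]) (use v in \<open>auto simp: wgrad_graph_def\<close>)
  moreover have "inner (fst q) e = inner w e" for e
  proof -
    have "(\<lambda>n. inner (v n, wgrad (v n)) (e, 0)) \<longlonglongrightarrow> inner w e"
      by (simp add: tendsto_inner lim)
    from q(1)[OF this] show ?thesis by (cases q) simp
  qed
  then have "fst q = w" by (metis vector_eq_rdot)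
  ultimately show ?thesis by (auto simp: wgrad_graph_def)
qed

text \<open>Where \<open>rho \<ge> m\<close> the derivative is controlled by the weighted gradient
  up to the factor \<open>1 / sqrt m\<close>; this factor blows up at the endpoints, so the bound is
  used on compact subintervals.\<close>

lemma V_local_Hoelder:
  assumes w: "w \<in> V" and xz: "{x..z} \<subseteq> II" "x \<le> z" and m: "m > 0" "\<And>s. s \<in> {x..z} \<Longrightarrow> m \<le> rho s"
  shows "\<bar>LINT s:{x..z}|lborel. wd w s\<bar> \<le> norm (wgrad w) * sqrt (z - x) / sqrt m"
proof -
  have s: "sq_int (\<lambda>s. sqrt (rho s) * wd w s)" by (rule V_D(2)[OF w])
  let ?g = "\<lambda>s. (1 / sqrt m) * (indicator {x..z} s * (indicator II s * \<bar>sqrt (rho s) * wd w s\<bar>))"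
  have "integrable lborel (\<lambda>s. indicator II s * \<bar>sqrt (rho s) * wd w s\<bar>)"
    using integrable_abs[OF sq_int_integrable[OF s]] by (simp add: integrable_leb_I_iff set_integrable_def)
  then have gi: "integrable lborel ?g"
    using integrable_mult_indicator[of "{x..z}" lborel "\<lambda>s. indicator II s * \<bar>sqrt (rho s) * wd w s\<bar>"] by simp
  have "norm (LINT s|lborel. indicator {x..z} s *\<^sub>R wd w s) \<le> (LINT s|lborel. ?g s)"
  proof (rule integral_norm_bound_AE[OF gi], rule AE_I2)
    fix s
    show "norm (indicator {x..z} s *\<^sub>R wd w s) \<le> ?g s"
    proof (cases "s \<in> {x..z}")
      case True
      then have r: "m \<le> rho s" "s \<in> II" using m(2) xz by auto
      then have "1 \<le> sqrt (rho s) / sqrt m" using m(1) by simp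
      then have "1 * \<bar>wd w s\<bar> \<le> (sqrt (rho s) / sqrt m) * \<bar>wd w s\<bar>" by (rule mult_right_mono) simp
      then show ?thesis using True r m(1) by (simp add: abs_mult)
    qed simp
  qed
  also have "\<dots> = (1 / sqrt m) * (LINT s|lborel. indicator {x..z} s * (indicator II s * \<bar>sqrt (rho s) * wd w s\<bar>))" by simp
  also have "\<dots> \<le> (1 / sqrt m) * (norm (to_L2 (\<lambda>s. sqrt (rho s) * wd w s)) * sqrt (z - x))"
    using m(1) xz(2) by (intro mult_left_mono integral_abs_le_norm[OF s]) auto
  finally show ?thesis by (simp add: set_lebesgue_integral_def wgrad_def)
qed

text \<open>A local Arzela-Ascoli argument: a diagonal subsequence converges at the rational points,
  the Hoelder bound near each \<open>x\<close> carries the convergence to \<open>x\<close>, and the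
  common bound \<open>C\<close> turns pointwise convergence into convergence in \<open>L2I\<close>,
  which takes care of the endpoints.\<close>

theorem V_compact_embedding:
  assumes v: "\<And>n. v n \<in> V" "\<And>n. norm (wgrad (v n)) \<le> E" and b: "\<And>n. AE x in leb_I. \<bar>L2_fun (v n) x\<bar> \<le> C"
  obtains r w where "strict_mono (r :: nat \<Rightarrow> nat)" "(\<lambda>n. v (r n)) \<longlonglongrightarrow> w" "w \<in> V" "AE x in leb_I. \<bar>L2_fun w x\<bar> \<le> C"
proof -
  have wdv: "weak_deriv II (L2_fun (v n)) (wd (v n))" for n by (rule V_D(1)[OF v(1)])
  then have lv: "loc_int II (wd (v n))" for n by (simp add: weak_deriv_iff)
  have "\<exists>c. AE x in lborel. x \<in> II \<longrightarrow> L2_fun (v n) x = c + prim 0 (wd (v n)) x" for n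
    using weak_deriv_primitive[OF II_interval(1,2,4) wdv[of n]] by blast
  then obtain c where c: "\<And>n. AE x in lborel. x \<in> II \<longrightarrow> L2_fun (v n) x = c n + prim 0 (wd (v n)) x" by metis
  \<comment> \<open>The continuous representatives; pointwise values and increments are meaningful
    only for these.\<close>
  define u where "u n x = c n + prim 0 (wd (v n)) x" for n x
  have uc: "continuous_on II (u n)" for n
    unfolding u_def by (intro continuous_intros prim_continuous II_interval lv)
  have um: "u n \<in> borel_measurable leb_I" for n by (rule continuous_leb_I_measurable[OF uc])
  have uv: "AE x in leb_I. L2_fun (v n) x = u n x" for n using c[of n] by (simp add: AE_leb_I_iff u_def)
  have ub: "\<bar>u n x\<bar> \<le> C" if x: "x \<in> II" for n x
  proof -
    have "u n x \<in> {-C..C}"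
    proof (rule continuous_AE_in_closed[OF II_interval(1) uc _ _ x])
      show "AE z in lborel. z \<in> II \<longrightarrow> u n z \<in> {-C..C}"
        using b[of n, unfolded AE_leb_I_iff] uv[of n, unfolded AE_leb_I_iff]
        by eventually_elim (auto simp: abs_le_iff)
    qed simp
    then show ?thesis by (auto simp: abs_le_iff)
  qed
  have inc: "\<bar>u n z - u n x\<bar> \<le> E * sqrt \<bar>z - x\<bar> / sqrt m"
    if xz: "x \<in> K" "z \<in> K" and K: "is_interval K" "K \<subseteq> II" and m: "m > 0" "\<And>s. s \<in> K \<Longrightarrow> m \<le> rho s" for n x z m K
  proof -
    have *: "\<bar>u n z - u n x\<bar> \<le> E * sqrt (z - x) / sqrt m" if "x \<in> K" "z \<in> K" "x \<le> z" for x z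
    proof -
      have sub: "{x..z} \<subseteq> K" by (rule Icc_subset_interval[OF K(1) that(1,2)])
      have "x \<in> II" "z \<in> II" using that K(2) by blast+
      then have "u n z - u n x = (LINT s:{x..z}|lborel. wd (v n) s)"
        unfolding u_def using prim_diff[OF II_interval(2) lv II_interval(4) _ _ that(3), of n] by simp
      also have "\<bar>\<dots>\<bar> \<le> norm (wgrad (v n)) * sqrt (z - x) / sqrt m"
        using sub K(2) that m by (intro V_local_Hoelder v) auto
      also have "\<dots> \<le> E * sqrt (z - x) / sqrt m"
        using that m(1) v(2)[of n] by (intro divide_right_mono mult_right_mono) auto
      finally show ?thesis .
    qed
    show ?thesis using *[of x z] *[of z x] xz by (cases "x \<le> z") (auto simp: abs_minus_commute)
  qed
  have "countable (\<rat> \<inter> II)" by (intro countable_Int1 countable_rat)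
  moreover have "norm (u n x) \<le> C" if "x \<in> \<rat> \<inter> II" for n x using ub that by simp
  ultimately obtain r where r: "strict_mono (r :: nat \<Rightarrow> nat)"
    "\<And>x. x \<in> \<rat> \<inter> II \<Longrightarrow> \<exists>l. (\<lambda>n. u (r n) x) \<longlonglongrightarrow> l"
    using function_convergent_subsequence[of "\<rat> \<inter> II" u C] by blast
  have conv: "convergent (\<lambda>n. u (r n) x)" if x: "x \<in> II" for x
  proof (rule Cauchy_convergent, rule CauchyI)
    fix e :: real assume e: "e > 0"
    obtain \<eta> where \<eta>: "\<eta> > 0" "cball x \<eta> \<subseteq> II" using II_interval(1) x unfolding open_contains_cball by blast
    define K where "K = cball x \<eta>"
    have K: "is_interval K" "K \<subseteq> II" "compact K" using \<eta> by (auto simp: K_def is_interval_cball_1)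
    obtain m where m: "m > 0" "\<And>s. s \<in> K \<Longrightarrow> m \<le> rho s" using rho_compact_bound[OF K(3,2)] by blast
    have "((\<lambda>z. E * sqrt \<bar>z - x\<bar> / sqrt m) \<longlongrightarrow> E * sqrt \<bar>x - x\<bar> / sqrt m) (at x)"
      using m(1) by (intro tendsto_intros) auto
    then have "eventually (\<lambda>z. E * sqrt \<bar>z - x\<bar> / sqrt m < e / 3) (at x)"
      by (rule order_tendstoD) (use e in simp)
    then obtain \<delta> where \<delta>: "\<delta> > 0" "\<And>z. z \<noteq> x \<Longrightarrow> dist z x < \<delta> \<Longrightarrow> E * sqrt \<bar>z - x\<bar> / sqrt m < e / 3"
      unfolding eventually_at by blast
    have "x < x + min \<eta> \<delta>" using \<eta>(1) \<delta>(1) by simp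
    then obtain q where q: "q \<in> \<rat>" "x < q" "q < x + min \<eta> \<delta>" using Rats_dense_in_real by blast
    have qK: "q \<in> K" "x \<in> K" using q \<eta>(1) by (auto simp: K_def dist_real_def)
    have near: "\<bar>u n q - u n x\<bar> < e / 3" for n
    proof -
      have "q \<noteq> x" "dist q x < \<delta>" using q by (auto simp: dist_real_def)
      then have "E * sqrt \<bar>q - x\<bar> / sqrt m < e / 3" by (rule \<delta>(2))
      moreover have "\<bar>u n q - u n x\<bar> \<le> E * sqrt \<bar>q - x\<bar> / sqrt m"
        by (rule inc[OF qK(2,1) K(1,2) m(1)]) (rule m(2))
      ultimately show ?thesis by (rule le_less_trans[rotated])
    qed
    have "Cauchy (\<lambda>n. u (r n) q)" using r(2)[of q] q(1) qK K(2) LIMSEQ_imp_Cauchy by blast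
    then obtain N where N: "\<And>i j. i \<ge> N \<Longrightarrow> j \<ge> N \<Longrightarrow> norm (u (r i) q - u (r j) q) < e / 3"
      using CauchyD[of "\<lambda>n. u (r n) q" "e / 3"] e by auto
    show "\<exists>N. \<forall>i\<ge>N. \<forall>j\<ge>N. norm (u (r i) x - u (r j) x) < e"
    proof (intro exI[of _ N] allI impI)
      fix i j assume "N \<le> i" "N \<le> j"
      then have "\<bar>u (r i) q - u (r j) q\<bar> < e / 3" using N by simp
      then show "norm (u (r i) x - u (r j) x) < e" using near[of "r i"] near[of "r j"]
        unfolding real_norm_def by arith
    qed
  qed
  define F where "F x = lim (\<lambda>n. u (r n) x)" for x
  have Fm: "F \<in> borel_measurable leb_I" unfolding F_def by (rule borel_measurable_lim_metric) (rule um)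
  have lim: "AE x in leb_I. (\<lambda>n. u (r n) x) \<longlonglongrightarrow> F x"
    using AE_in_II by eventually_elim (use conv in \<open>auto simp: F_def convergent_LIMSEQ_iff\<close>)
  have ub': "AE x in leb_I. \<bar>u (r n) x\<bar> \<le> C" for n using AE_in_II by eventually_elim (rule ub)
  note L = to_L2_tendsto[OF um Fm ub' lim]
  have "to_L2 (u n) = v n" for n
  proof -
    have "AE x in leb_I. \<bar>u n x\<bar> \<le> C" using AE_in_II by eventually_elim (rule ub)
    then have "sq_int (u n)" by (rule sq_int_bounded[OF um])
    then have "to_L2 (u n) = to_L2 (L2_fun (v n))"
      using uv[of n] by (intro to_L2_cong sq_int_L2_fun) (auto elim: eventually_mono)
    then show ?thesis by (simp add: to_L2_L2_fun)
  qed
  then have vl: "(\<lambda>n. v (r n)) \<longlonglongrightarrow> to_L2 F" using L(2) by simp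
  show thesis
  proof (rule that[OF r(1) vl])
    show "to_L2 F \<in> V" by (rule V_weak_limit[OF _ _ vl]) (use v in auto)
    show "AE x in leb_I. \<bar>L2_fun (to_L2 F) x\<bar> \<le> C"
      using L2_fun_to_L2[OF sq_int_bounded[OF Fm L(1)]] L(1) by eventually_elim simp
  qed
qed

text \<open>In effect the left limit of the graph at \<open>s\<close>; the segment from here to
  \<open>graph_hi\<close> lies in \<open>\<beta> s\<close>. Inserting \<open>m\<close> keeps the
  supremum over a nonempty set. Both bounds are monotone in \<open>s\<close>, hence Borel, which
  makes the projection onto the segment measurable in \<open>x\<close>.\<close>

definition graph_lo :: "real \<Rightarrow> (real \<Rightarrow> real set) \<Rightarrow> real \<Rightarrow> real" where
  "graph_lo m \<beta> s = Sup (insert m (\<Union>r\<in>{..<s}. \<beta> r))"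

definition graph_hi :: "real \<Rightarrow> (real \<Rightarrow> real set) \<Rightarrow> real \<Rightarrow> real" where
  "graph_hi M \<beta> s = Inf (insert M (\<Union>r\<in>{s<..}. \<beta> r))"

section \<open>Segments of a maximal monotone graph and projection onto them\<close>

context
  fixes \<beta> :: "real \<Rightarrow> real set" and m M :: real
  assumes mono: "maximal_monotone \<beta>" and range: "\<And>s. \<beta> s \<subseteq> {m..M}" and mM: "m \<le> M"
begin

lemma graph_range: "b \<in> \<beta> s \<Longrightarrow> m \<le> b" "b \<in> \<beta> s \<Longrightarrow> b \<le> M"
  using range[of s] by auto

lemma graph_lo_ge: "r < s \<Longrightarrow> b \<in> \<beta> r \<Longrightarrow> b \<le> graph_lo m \<beta> s"
  unfolding graph_lo_def using mM by (intro cSup_upper) (auto intro!: bdd_aboveI[of _ M] dest: graph_range)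

lemma graph_hi_le: "s < r \<Longrightarrow> b \<in> \<beta> r \<Longrightarrow> graph_hi M \<beta> s \<le> b"
  unfolding graph_hi_def using mM by (intro cInf_lower) (auto intro!: bdd_belowI[of _ m] dest: graph_range)

lemma graph_lo_bounds: "m \<le> graph_lo m \<beta> s" "graph_lo m \<beta> s \<le> M"
proof -
  show "m \<le> graph_lo m \<beta> s"
    unfolding graph_lo_def using mM by (intro cSup_upper) (auto intro!: bdd_aboveI[of _ M] dest: graph_range)
  show "graph_lo m \<beta> s \<le> M"
    unfolding graph_lo_def using mM by (intro cSup_least) (auto dest: graph_range)
qed

lemma graph_hi_bounds: "m \<le> graph_hi M \<beta> s" "graph_hi M \<beta> s \<le> M"
proof -
  show "graph_hi M \<beta> s \<le> M"
    unfolding graph_hi_def using mM by (intro cInf_lower) (auto intro!: bdd_belowI[of _ m] dest: graph_range)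
  show "m \<le> graph_hi M \<beta> s"
    unfolding graph_hi_def using mM by (intro cInf_greatest) (auto dest: graph_range)
qed

lemma graph_monotone: "a \<in> \<beta> r \<Longrightarrow> b \<in> \<beta> s \<Longrightarrow> r < s \<Longrightarrow> a \<le> b"
proof -
  assume "a \<in> \<beta> r" "b \<in> \<beta> s" and rs: "r < s"
  then have "0 \<le> (a - b) * (r - s)" using mono unfolding maximal_monotone_def by blast
  then show "a \<le> b" using rs by (simp add: zero_le_mult_iff)
qed

lemma graph_lo_le_hi: "graph_lo m \<beta> s \<le> graph_hi M \<beta> s"
  unfolding graph_lo_def graph_hi_def
proof (rule cSup_least)
  fix a assume a: "a \<in> insert m (\<Union>r\<in>{..<s}. \<beta> r)"
  show "a \<le> Inf (insert M (\<Union>r\<in>{s<..}. \<beta> r))"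
  proof (rule cInf_greatest)
    fix b assume "b \<in> insert M (\<Union>r\<in>{s<..}. \<beta> r)"
    then show "a \<le> b" using a mM by (auto intro: graph_monotone dest: graph_range)
  qed simp
qed simp

text \<open>Such an \<open>a\<close> is in monotone relation to every point of the graph, so
  maximality forces it into \<open>\<beta> s\<close>.\<close>

lemma graph_segment: "graph_lo m \<beta> s \<le> a \<Longrightarrow> a \<le> graph_hi M \<beta> s \<Longrightarrow> a \<in> \<beta> s"
proof -
  assume a: "graph_lo m \<beta> s \<le> a" "a \<le> graph_hi M \<beta> s"
  have "0 \<le> (a - b) * (s - r)" if b: "b \<in> \<beta> r" for r b
  proof -
    consider "r < s" | "r = s" | "s < r" by linarith
    then show ?thesis
    proof cases
      case 1
      then show ?thesis using graph_lo_ge[OF 1 b] a by simp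
    next
      case 3
      then show ?thesis using graph_hi_le[OF 3 b] a by (simp add: mult_nonpos_nonpos)
    qed simp
  qed
  then show "a \<in> \<beta> s" using mono unfolding maximal_monotone_def by blast
qed

lemma graph_lo_mono: "mono (graph_lo m \<beta>)"
  unfolding mono_def graph_lo_def
  using mM by (intro allI impI cSup_subset_mono) (auto intro!: bdd_aboveI[of _ M] dest: graph_range)

lemma graph_hi_mono: "mono (graph_hi M \<beta>)"
  unfolding mono_def graph_hi_def
  using mM by (intro allI impI cInf_superset_mono) (auto intro!: bdd_belowI[of _ m] dest: graph_range)

definition graph_clamp :: "real \<Rightarrow> real \<Rightarrow> real" where
  "graph_clamp s b = max (graph_lo m \<beta> s) (min (graph_hi M \<beta> s) b)"

text \<open>The \<open>b n\<close> themselves need not converge, but their distance to the segment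
  at \<open>s\<close> does tend to 0: a graph point at some \<open>t > s\<close> with value below
  \<open>graph_hi M \<beta> s + e / 2\<close> bounds \<open>b n\<close> once \<open>r n < t\<close>,
  and symmetrically from below. If only the inserted \<open>M\<close> or \<open>m\<close> comes that
  close, the range of \<open>\<beta>\<close> gives the bound.\<close>

lemma graph_clamp_tendsto:
  assumes r: "r \<longlonglongrightarrow> s" and b: "\<And>n. b n \<in> \<beta> (r n)"
  shows "(\<lambda>n. b n - graph_clamp s (b n)) \<longlonglongrightarrow> 0"
proof (rule tendstoI)
  fix e :: real assume e: "e > 0"
  have hi: "eventually (\<lambda>n. b n \<le> graph_hi M \<beta> s + e / 2) sequentially"
  proof -
    obtain c where c: "c \<in> insert M (\<Union>r\<in>{s<..}. \<beta> r)" "c < graph_hi M \<beta> s + e / 2"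
      using cInf_lessD[of "insert M (\<Union>r\<in>{s<..}. \<beta> r)" "graph_hi M \<beta> s + e / 2"] e
      unfolding graph_hi_def by auto
    show ?thesis
    proof (cases "c = M")
      case True
      then show ?thesis
        using order_trans[OF graph_range(2)[OF b] less_imp_le[OF c(2)[unfolded True]]] by (intro always_eventually allI)
    next
      case False
      then obtain t where t: "s < t" "c \<in> \<beta> t" using c(1) by auto
      have "eventually (\<lambda>n. r n < t) sequentially" using order_tendstoD(2)[OF r t(1)] .
      then show ?thesis
        by eventually_elim (rule order_trans[OF graph_monotone[OF b t(2)] less_imp_le[OF c(2)]])
    qed
  qed
  have lo: "eventually (\<lambda>n. graph_lo m \<beta> s - e / 2 \<le> b n) sequentially"
  proof -
    obtain c where c: "c \<in> insert m (\<Union>r\<in>{..<s}. \<beta> r)" "graph_lo m \<beta> s - e / 2 < c"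
      using less_cSupD[of "insert m (\<Union>r\<in>{..<s}. \<beta> r)" "graph_lo m \<beta> s - e / 2"] e
      unfolding graph_lo_def by auto
    show ?thesis
    proof (cases "c = m")
      case True
      then show ?thesis
        using order_trans[OF less_imp_le[OF c(2)[unfolded True]] graph_range(1)[OF b]] by (intro always_eventually allI)
    next
      case False
      then obtain t where t: "t < s" "c \<in> \<beta> t" using c(1) by auto
      have "eventually (\<lambda>n. t < r n) sequentially" using order_tendstoD(1)[OF r t(1)] .
      then show ?thesis
        by eventually_elim (rule order_trans[OF less_imp_le[OF c(2)] graph_monotone[OF t(2) b]])
    qed
  qed
  show "\<forall>\<^sub>F n in sequentially. dist (b n - graph_clamp s (b n)) 0 < e"
    using hi lo by eventually_elim
      (use e graph_lo_le_hi[of s] in \<open>auto simp: graph_clamp_def dist_real_def max_def min_def abs_if\<close>)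
qed

end

section \<open>Selection of times\<close>

lemma borel_prod_section [measurable_dest]:
  fixes F :: "real \<times> real \<Rightarrow> real"
  shows "F \<in> borel_measurable borel \<Longrightarrow> F \<in> borel_measurable (borel \<Otimes>\<^sub>M borel)"
  by (simp add: borel_prod)

lemma section_measurable_leb_I:
  fixes F :: "real \<times> real \<Rightarrow> real"
  assumes "F \<in> borel_measurable borel"
  shows "(\<lambda>x. F (x, t)) \<in> borel_measurable leb_I"
proof (rule borel_measurable_leb_I)
  have [measurable]: "F \<in> borel_measurable (borel \<Otimes>\<^sub>M borel)" using assms by (rule borel_prod_section)
  show "(\<lambda>x. F (x, t)) \<in> borel_measurable borel" by measurable
qed

text \<open>\<open>Linf_cyl\<close> provides a jointly measurable function of \<open>(x, t)\<close>;
  integrating it against \<open>v\<close> gives measurability in \<open>t\<close> of each scalar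
  product, from which a measurable substitute for the dual norm is built.\<close>

lemma Linf_cyl_inner_measurable:
  assumes "w \<in> Linf_cyl"
  obtains \<phi> where "\<phi> \<in> borel_measurable borel" "AE t in lborel. 0 < t \<longrightarrow> inner (w t) v = \<phi> t"
proof -
  obtain F C where F: "F \<in> borel_measurable borel"
    and eq: "AE t in lborel. 0 < t \<longrightarrow> (AE x in leb_I. L2_fun (w t) x = F (x, t))"
    using assms by (auto simp: Linf_cyl_def)
  have [measurable]: "F \<in> borel_measurable (borel \<Otimes>\<^sub>M borel)" using F by (rule borel_prod_section)
  have [measurable]: "(\<lambda>x. indicator II x * L2_fun v x) \<in> borel_measurable borel"
    using sq_int_measurable[OF sq_int_L2_fun[of v]] unfolding leb_I_def
    by (subst (asm) borel_measurable_restrict_space_iff) auto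
  define \<phi> where "\<phi> t = (LINT x|lborel. F (x, t) * (indicator II x * L2_fun v x))" for t
  show thesis
  proof (rule that)
    show "\<phi> \<in> borel_measurable borel" unfolding \<phi>_def by measurable
    show "AE t in lborel. 0 < t \<longrightarrow> inner (w t) v = \<phi> t"
      using eq
    proof eventually_elim
      case (elim t)
      show ?case
      proof
        assume "0 < t"
        then have ae: "AE x in leb_I. L2_fun (w t) x = F (x, t)" using elim by blast
        have "inner (w t) v = (LINT x|leb_I. F (x, t) * L2_fun v x)"
          unfolding inner_L2_fun
        proof (rule integral_cong_AE)
          show "AE x in leb_I. L2_fun (w t) x * L2_fun v x = F (x, t) * L2_fun v x"
            using ae by eventually_elim simp
        qed (use section_measurable_leb_I[OF F, of t] sq_int_measurable[OF sq_int_L2_fun] in auto)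
        also have "\<dots> = \<phi> t"
          unfolding \<phi>_def integral_leb_I set_lebesgue_integral_def
          by (intro Bochner_Integration.integral_cong) auto
        finally show "inner (w t) v = \<phi> t" .
      qed
    qed
  qed
qed

text \<open>By Fubini for null sets almost every time slice inherits the bound; the almost
  everywhere quantifiers first come out with \<open>x\<close> outside and have to be
  exchanged.\<close>

lemma Linf_cyl_bounded:
  assumes "w \<in> Linf_cyl"
  obtains C where "AE t in lborel. 0 < t \<longrightarrow> (AE x in leb_I. \<bar>L2_fun (w t) x\<bar> \<le> C)"
proof -
  obtain F C where F: "F \<in> borel_measurable borel"
    and C: "AE p in lborel. p \<in> II \<times> {0<..} \<longrightarrow> \<bar>F p\<bar> \<le> C"
    and eq: "AE t in lborel. 0 < t \<longrightarrow> (AE x in leb_I. L2_fun (w t) x = F (x, t))"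
    using assms by (auto simp: Linf_cyl_def)
  have [measurable]: "F \<in> borel_measurable (borel \<Otimes>\<^sub>M borel)" using F by (rule borel_prod_section)
  have "AE p in lborel \<Otimes>\<^sub>M lborel. p \<in> II \<times> {0<..} \<longrightarrow> \<bar>F p\<bar> \<le> C"
    using C by (subst lborel_prod)
  then have "AE x in lborel. AE t in lborel. (x, t) \<in> II \<times> {0<..} \<longrightarrow> \<bar>F (x, t)\<bar> \<le> C"
    by (rule lborel_pair.AE_pair)
  then have "AE t in lborel. AE x in lborel. (x, t) \<in> II \<times> {0<..} \<longrightarrow> \<bar>F (x, t)\<bar> \<le> C"
  proof (rule lborel_pair.AE_commute[THEN iffD1, rotated])
    show "{p \<in> space (lborel \<Otimes>\<^sub>M lborel). (fst p, snd p) \<in> II \<times> {0<..} \<longrightarrow> \<bar>F (fst p, snd p)\<bar> \<le> C} \<in> sets (lborel \<Otimes>\<^sub>M lborel)"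
      unfolding mem_Times_iff fst_conv snd_conv prod.collapse by measurable
  qed
  then have "AE t in lborel. 0 < t \<longrightarrow> (AE x in leb_I. \<bar>L2_fun (w t) x\<bar> \<le> C)"
    using eq
  proof eventually_elim
    case (elim t)
    show ?case
    proof
      assume t: "0 < t"
      then have "AE x in leb_I. L2_fun (w t) x = F (x, t)" using elim by blast
      moreover have "AE x in leb_I. \<bar>F (x, t)\<bar> \<le> C"
        unfolding AE_leb_I_iff using elim(1) by eventually_elim (use t in auto)
      ultimately show "AE x in leb_I. \<bar>L2_fun (w t) x\<bar> \<le> C" by eventually_elim simp
    qed
  qed
  then show thesis by (rule that)
qed

section \<open>The norm of \<open>V\<close> and functionals on \<open>V\<close>\<close>

lemma norm_V_nonneg: "v \<in> V \<Longrightarrow> 0 \<le> norm_V v"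
  by (simp add: norm_V_eq)

lemma norm_V_scale: "v \<in> V \<Longrightarrow> norm_V (c *\<^sub>R v) = \<bar>c\<bar> * norm_V v"
  by (simp add: norm_V_eq V_scale algebra_simps)

lemma norm_V_zero_iff: "v \<in> V \<Longrightarrow> norm_V v = 0 \<longleftrightarrow> v = 0"
  by (auto simp: norm_V_eq V_zero add_nonneg_eq_0_iff)

lemma norm_V_triangle: "v \<in> V \<Longrightarrow> w \<in> V \<Longrightarrow> norm_V (v - w) \<le> norm_V v + norm_V w"
  using norm_triangle_ineq4[of v w] norm_triangle_ineq4[of "wgrad v" "wgrad w"]
  by (simp add: norm_V_eq V_diff)

text \<open>The map \<open>v \<mapsto> (v, wgrad v)\<close> embeds the unit ball into the second
  countable space \<open>L2I \<times> L2I\<close>, whose subsets are separable. Suprema over the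
  ball can thus be replaced by countable ones.\<close>

lemma V_ball_separable:
  obtains D where "countable D" "D \<subseteq> {v \<in> V. norm_V v \<le> 1}"
    "\<And>v. v \<in> V \<Longrightarrow> norm_V v \<le> 1 \<Longrightarrow> \<exists>d :: nat \<Rightarrow> L2I. range d \<subseteq> D \<and> (\<lambda>n. norm_V (d n - v)) \<longlonglongrightarrow> 0"
proof -
  define B where "B = {v \<in> V. norm_V v \<le> 1}"
  define j where "j v = (v, wgrad v)" for v
  obtain E where E: "countable E" "E \<subseteq> j ` B" "j ` B \<subseteq> closure E" by (rule separable)
  show thesis
  proof (rule that[of "fst ` E"])
    show "countable (fst ` E)" using E(1) by simp
    show "fst ` E \<subseteq> {v \<in> V. norm_V v \<le> 1}" using E(2) by (auto simp: j_def B_def)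
    fix v assume v: "v \<in> V" "norm_V v \<le> 1"
    then have "j v \<in> closure E" using E(3) by (auto simp: B_def)
    then obtain e where e: "\<And>n. e n \<in> E" "e \<longlonglongrightarrow> j v" unfolding closure_sequential by blast
    have eB: "e n = j (fst (e n))" "fst (e n) \<in> V" for n using e(1)[of n] E(2) by (auto simp: j_def B_def)
    have "(\<lambda>n. norm (fst (e n) - v) + norm (snd (e n) - wgrad v)) \<longlonglongrightarrow> norm (fst (j v) - v) + norm (snd (j v) - wgrad v)"
      by (intro tendsto_intros e(2))
    moreover have "norm (fst (e n) - v) + norm (snd (e n) - wgrad v) = norm_V (fst (e n) - v)" for n
      using eB[of n] v(1) by (metis norm_V_eq V_diff j_def snd_conv)
    ultimately have "(\<lambda>n. norm_V (fst (e n) - v)) \<longlonglongrightarrow> 0" by (simp add: j_def)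
    then show "\<exists>d :: nat \<Rightarrow> L2I. range d \<subseteq> fst ` E \<and> (\<lambda>n. norm_V (d n - v)) \<longlonglongrightarrow> 0"
      using e(1) by (intro exI[of _ "\<lambda>n. fst (e n)"]) auto
  qed
qed

lemma dual_V_D:
  assumes "\<phi> \<in> dual_V"
  shows "v \<in> V \<Longrightarrow> w \<in> V \<Longrightarrow> \<phi> (v + w) = \<phi> v + \<phi> w" "v \<in> V \<Longrightarrow> \<phi> (c *\<^sub>R v) = c * \<phi> v"
    "v \<in> V \<Longrightarrow> w \<in> V \<Longrightarrow> \<phi> (v - w) = \<phi> v - \<phi> w"
proof -
  show a: "v \<in> V \<Longrightarrow> w \<in> V \<Longrightarrow> \<phi> (v + w) = \<phi> v + \<phi> w" for v w
    using assms unfolding dual_V_def by blast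
  show s: "v \<in> V \<Longrightarrow> \<phi> (c *\<^sub>R v) = c * \<phi> v" for v c
    using assms unfolding dual_V_def by blast
  show "v \<in> V \<Longrightarrow> w \<in> V \<Longrightarrow> \<phi> (v - w) = \<phi> v - \<phi> w"
    using a[of v "- 1 *\<^sub>R w"] s[of w "-1"] V_scale(1)[of w "-1"] by simp
qed

lemma dual_V_inner: "inner h \<in> dual_V"
proof -
  have "\<bar>inner h v\<bar> \<le> norm h * norm_V v" if "v \<in> V" for v
  proof -
    have "\<bar>inner h v\<bar> \<le> norm h * norm v" by (rule Cauchy_Schwarz_ineq2)
    also have "\<dots> \<le> norm h * norm_V v" using that by (intro mult_left_mono) (auto simp: norm_V_eq)
    finally show ?thesis .
  qed
  then show ?thesis by (auto simp: dual_V_def inner_add_right)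
qed

lemma dual_V_diff:
  assumes "\<phi> \<in> dual_V" "\<psi> \<in> dual_V"
  shows "(\<lambda>v. \<phi> v - \<psi> v) \<in> dual_V"
proof -
  obtain C C' where C: "\<And>v. v \<in> V \<Longrightarrow> \<bar>\<phi> v\<bar> \<le> C * norm_V v" "\<And>v. v \<in> V \<Longrightarrow> \<bar>\<psi> v\<bar> \<le> C' * norm_V v"
    using assms unfolding dual_V_def by blast
  have "\<bar>\<phi> v - \<psi> v\<bar> \<le> (C + C') * norm_V v" if "v \<in> V" for v
    using C[OF that] by (simp add: distrib_right)
  then show ?thesis using dual_V_D[OF assms(1)] dual_V_D[OF assms(2)]
    unfolding dual_V_def mem_Collect_eq by (intro conjI exI[of _ "C + C'"]) (simp_all add: algebra_simps)
qed

text \<open>Continuity of the functional extends the bound from \<open>D\<close> to the unit ball,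
  and scaling extends it to \<open>V\<close>.\<close>

lemma dual_V_bound_dense:
  assumes \<phi>: "\<phi> \<in> dual_V"
    and D: "\<And>v. v \<in> V \<Longrightarrow> norm_V v \<le> 1 \<Longrightarrow> \<exists>d :: nat \<Rightarrow> L2I. range d \<subseteq> D \<and> (\<lambda>n. norm_V (d n - v)) \<longlonglongrightarrow> 0"
    and DV: "D \<subseteq> V" and b: "\<And>v. v \<in> D \<Longrightarrow> \<bar>\<phi> v\<bar> \<le> c" and v: "v \<in> V"
  shows "\<bar>\<phi> v\<bar> \<le> c * norm_V v"
proof -
  obtain C where C: "\<And>v. v \<in> V \<Longrightarrow> \<bar>\<phi> v\<bar> \<le> C * norm_V v" using \<phi> unfolding dual_V_def by blast
  have 1: "\<bar>\<phi> v\<bar> \<le> c" if v: "v \<in> V" "norm_V v \<le> 1" for v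
  proof -
    obtain d :: "nat \<Rightarrow> L2I" where d: "range d \<subseteq> D" "(\<lambda>n. norm_V (d n - v)) \<longlonglongrightarrow> 0" using D[OF v] by blast
    have dV: "d n \<in> V" for n using d(1) DV by blast
    have "\<bar>\<phi> v\<bar> \<le> c + C * norm_V (d n - v)" for n
    proof -
      have "\<phi> v = \<phi> (d n) - \<phi> (d n - v)" using dual_V_D(3)[OF \<phi> dV v(1)] by simp
      then show ?thesis using b[of "d n"] d(1) C[OF V_diff(1)[OF dV v(1)], of n] by fastforce
    qed
    moreover have "(\<lambda>n. c + C * norm_V (d n - v)) \<longlonglongrightarrow> c + C * 0" by (intro tendsto_intros d(2))
    ultimately have "\<bar>\<phi> v\<bar> \<le> c + C * 0" by (intro LIMSEQ_le_const) auto
    then show ?thesis by simp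
  qed
  show ?thesis
  proof (cases "v = 0")
    case True
    then show ?thesis using dual_V_D(2)[OF \<phi> v, of 0] norm_V_zero_iff[OF v] by simp
  next
    case False
    define k where "k = norm_V v"
    have k: "k > 0" using norm_V_zero_iff[OF v] norm_V_nonneg[OF v] False by (simp add: k_def)
    have "\<bar>\<phi> ((1 / k) *\<^sub>R v)\<bar> \<le> c"
      by (rule 1) (use k v in \<open>auto simp: V_scale norm_V_scale k_def\<close>)
    then have "\<bar>\<phi> v\<bar> / k \<le> c" using k by (simp add: dual_V_D(2)[OF \<phi> v] abs_mult)
    then show ?thesis using k by (simp add: k_def field_simps)
  qed
qed

text \<open>The window eventually leaves every bounded set, so dominated convergence applies with
  \<open>q\<close> itself as majorant.\<close>

lemma window_integral_tendsto_0:
  fixes q :: "real \<Rightarrow> real"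
  assumes q: "integrable lborel q" and nn: "\<And>x. 0 \<le> q x"
  shows "((\<lambda>t. \<integral>\<^sup>+\<tau>\<in>{t - 1..t + 1}. ennreal (q \<tau>) \<partial>lborel) \<longlongrightarrow> 0) at_top"
    "((\<lambda>t. LINT \<tau>:{t - 1..t + 1}|lborel. q \<tau>) \<longlongrightarrow> 0) at_top"
proof -
  have [measurable]: "q \<in> borel_measurable borel" using borel_measurable_integrable[OF q] by simp
  have "((\<lambda>t. LINT \<tau>|lborel. indicator {t - 1..t + 1} \<tau> *\<^sub>R q \<tau>) \<longlongrightarrow> 0) at_top"
  proof (rule tendsto_at_topI_sequentially)
    fix X :: "nat \<Rightarrow> real" assume X: "filterlim X at_top sequentially"
    have "(\<lambda>n. LINT \<tau>|lborel. indicator {X n - 1..X n + 1} \<tau> *\<^sub>R q \<tau>) \<longlonglongrightarrow> (LINT \<tau>::real|lborel. 0 :: real)"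
    proof (rule integral_dominated_convergence[where w = "\<lambda>\<tau>. norm (q \<tau>)"])
      show "AE \<tau> in lborel. (\<lambda>n. indicator {X n - 1..X n + 1} \<tau> *\<^sub>R q \<tau>) \<longlonglongrightarrow> 0"
      proof (rule AE_I2, rule tendsto_eventually)
        fix \<tau> :: real
        have "\<forall>\<^sub>F n in sequentially. \<tau> + 1 < X n" using X by (simp add: filterlim_at_top_dense)
        then show "\<forall>\<^sub>F n in sequentially. indicator {X n - 1..X n + 1} \<tau> *\<^sub>R q \<tau> = 0"
          by eventually_elim (simp add: indicator_def)
      qed
      show "AE \<tau> in lborel. norm (indicator {X n - 1..X n + 1} \<tau> *\<^sub>R q \<tau>) \<le> norm (q \<tau>)" for n
        by (intro AE_I2) (simp add: indicator_def)
      show "integrable lborel (\<lambda>\<tau>. norm (q \<tau>))" using q by (rule integrable_norm)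
    qed auto
    then show "(\<lambda>n. LINT \<tau>|lborel. indicator {X n - 1..X n + 1} \<tau> *\<^sub>R q \<tau>) \<longlonglongrightarrow> 0" by simp
  qed
  then show 1: "((\<lambda>t. LINT \<tau>:{t - 1..t + 1}|lborel. q \<tau>) \<longlongrightarrow> 0) at_top"
    by (simp add: set_lebesgue_integral_def)
  have "(\<integral>\<^sup>+\<tau>\<in>{t - 1..t + 1}. ennreal (q \<tau>) \<partial>lborel) = ennreal (LINT \<tau>:{t - 1..t + 1}|lborel. q \<tau>)" for t
  proof -
    have "(\<integral>\<^sup>+\<tau>\<in>{t - 1..t + 1}. ennreal (q \<tau>) \<partial>lborel) = (\<integral>\<^sup>+\<tau>. ennreal (indicator {t - 1..t + 1} \<tau> *\<^sub>R q \<tau>) \<partial>lborel)"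
      by (intro nn_integral_cong) (simp add: indicator_def)
    also have "\<dots> = ennreal (LINT \<tau>|lborel. indicator {t - 1..t + 1} \<tau> *\<^sub>R q \<tau>)"
      by (intro nn_integral_eq_integral integrable_mult_indicator q AE_I2) (auto simp: nn)
    finally show ?thesis by (simp add: set_lebesgue_integral_def)
  qed
  moreover have "((\<lambda>t. ennreal (LINT \<tau>:{t - 1..t + 1}|lborel. q \<tau>)) \<longlongrightarrow> ennreal 0) at_top"
    by (intro tendsto_intros 1)
  ultimately show "((\<lambda>t. \<integral>\<^sup>+\<tau>\<in>{t - 1..t + 1}. ennreal (q \<tau>) \<partial>lborel) \<longlongrightarrow> 0) at_top" by simp
qed

text \<open>\<open>dual_norm_V\<close> is a supremum over an uncountable set, and its measurability
  in time is not known. The countable supremum \<open>N\<close> over a dense subset is measurable,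
  lies below the dual norm at almost every positive time, so that its window integrals tend to 0
  too, and still controls every \<open>v\<close> by density.\<close>

lemma dual_window:
  fixes \<Psi> :: "real \<Rightarrow> L2I \<Rightarrow> real"
  assumes \<Psi>: "\<And>t. \<Psi> t \<in> dual_V"
    and m: "\<And>v. \<exists>\<phi>\<in>borel_measurable borel. AE t in lborel. 0 < t \<longrightarrow> \<Psi> t v = \<phi> t"
    and lim: "((\<lambda>t. \<integral>\<^sup>+\<tau>\<in>{t - 1..t + 1}. dual_norm_V (\<Psi> \<tau>) \<partial>lborel) \<longlongrightarrow> 0) at_top"
  obtains N where "N \<in> borel_measurable borel" "((\<lambda>t. \<integral>\<^sup>+\<tau>\<in>{t - 1..t + 1}. N \<tau> \<partial>lborel) \<longlongrightarrow> 0) at_top"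
    "AE t in lborel. 0 < t \<longrightarrow> (\<forall>v\<in>V. \<bar>\<Psi> t v\<bar> \<le> enn2real (N t) * norm_V v)"
proof -
  obtain D where D: "countable D" "D \<subseteq> {v \<in> V. norm_V v \<le> 1}"
    "\<And>v. v \<in> V \<Longrightarrow> norm_V v \<le> 1 \<Longrightarrow> \<exists>d :: nat \<Rightarrow> L2I. range d \<subseteq> D \<and> (\<lambda>n. norm_V (d n - v)) \<longlonglongrightarrow> 0"
    using V_ball_separable by blast
  then have DV: "D \<subseteq> V" by blast
  obtain \<phi> where \<phi>: "\<And>v. \<phi> v \<in> borel_measurable borel" "\<And>v. AE t in lborel. 0 < t \<longrightarrow> \<Psi> t v = \<phi> v t"
    using m by metis
  have \<phi>D: "AE t in lborel. \<forall>v\<in>D. 0 < t \<longrightarrow> \<Psi> t v = \<phi> v t"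
    unfolding AE_ball_countable[OF D(1)] using \<phi> by blast
  define N where "N t = (SUP v\<in>D. ennreal \<bar>\<phi> v t\<bar>)" for t
  \<comment> \<open>For \<open>t > 1\<close> the window consists of positive times, where the
    representatives \<open>\<phi>\<close> agree with \<open>\<Psi>\<close> up to a null set.\<close>
  have N_le: "(\<integral>\<^sup>+\<tau>\<in>{t - 1..t + 1}. N \<tau> \<partial>lborel) \<le> (\<integral>\<^sup>+\<tau>\<in>{t - 1..t + 1}. dual_norm_V (\<Psi> \<tau>) \<partial>lborel)"
    if t: "t > 1" for t
  proof (rule nn_integral_mono_AE, use \<phi>D in eventually_elim)
    case (elim \<tau>)
    show ?case
    proof (cases "\<tau> \<in> {t - 1..t + 1}")
      case True
      then have "N \<tau> \<le> dual_norm_V (\<Psi> \<tau>)"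
        unfolding N_def dual_norm_V_def using elim t D(2) by (intro SUP_mono) force
      then show ?thesis using True by simp
    qed simp
  qed
  show thesis
  proof (rule that)
    show "N \<in> borel_measurable borel"
      unfolding N_def using \<phi>(1)
      by (intro borel_measurable_SUP D(1) measurable_compose[OF _ measurable_ennreal] borel_measurable_abs) auto
    show "((\<lambda>t. \<integral>\<^sup>+\<tau>\<in>{t - 1..t + 1}. N \<tau> \<partial>lborel) \<longlongrightarrow> 0) at_top"
      by (rule tendsto_sandwich[OF _ _ tendsto_const lim])
        (simp, use eventually_gt_at_top[of 1] in eventually_elim, rule N_le)
    show "AE t in lborel. 0 < t \<longrightarrow> (\<forall>v\<in>V. \<bar>\<Psi> t v\<bar> \<le> enn2real (N t) * norm_V v)"
      using \<phi>D
    proof eventually_elim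
      case (elim t)
      show ?case
      proof (intro impI ballI)
        fix v assume t: "0 < t" and v: "v \<in> V"
        obtain K where K: "\<And>v. v \<in> V \<Longrightarrow> \<bar>\<Psi> t v\<bar> \<le> K * norm_V v"
          using \<Psi>[of t] unfolding dual_V_def by blast
        \<comment> \<open>\<open>enn2real\<close> sends infinity to 0, so finiteness of
          \<open>N t\<close> must be known before the bound can be read off; it comes from the
          boundedness of \<open>\<Psi> t\<close> on the unit ball.\<close>
        have "N t \<le> ennreal \<bar>K\<bar>"
          unfolding N_def
        proof (rule SUP_least)
          fix v assume v: "v \<in> D"
          then have vV: "v \<in> V" "norm_V v \<le> 1" using D(2) by auto
          have "K * norm_V v \<le> \<bar>K\<bar> * 1" using vV norm_V_nonneg[OF vV(1)] by (intro mult_mono) auto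
          then show "ennreal \<bar>\<phi> v t\<bar> \<le> ennreal \<bar>K\<bar>" using K[OF vV(1)] elim t v by (auto intro: ennreal_leI)
        qed
        then have fin: "N t < top" by (rule le_less_trans) simp
        have bd: "\<bar>\<Psi> t v\<bar> \<le> enn2real (N t)" if "v \<in> D" for v
        proof -
          have "ennreal \<bar>\<phi> v t\<bar> \<le> N t" unfolding N_def by (rule SUP_upper[OF that])
          from enn2real_mono[OF this fin] show ?thesis using elim t that by simp
        qed
        show "\<bar>\<Psi> t v\<bar> \<le> enn2real (N t) * norm_V v" by (rule dual_V_bound_dense[OF \<Psi> D(3) DV bd v])
      qed
    qed
  qed
qed

text \<open>A mean value argument on \<open>[t n, t n + 1]\<close>: if \<open>G\<close> were above
  \<open>I n + 1 / Suc n\<close> at every admissible time there, its integral over this interval of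
  length 1 would exceed \<open>I n\<close>. The summand \<open>1 / Suc n\<close> supplies the strict
  inequality.\<close>

lemma exists_good_time:
  fixes G :: "real \<Rightarrow> ennreal" and t :: "nat \<Rightarrow> real"
  assumes P: "AE \<tau> in lborel. 0 < \<tau> \<longrightarrow> P \<tau>"
    and int: "((\<lambda>t. \<integral>\<^sup>+\<tau>\<in>{t - 1..t + 1}. G \<tau> \<partial>lborel) \<longlongrightarrow> 0) at_top"
    and t: "filterlim t at_top sequentially" "\<And>n. 0 < t n"
  obtains s where "\<And>n. t n \<le> s n" "\<And>n. s n \<le> t n + 1" "\<And>n. P (s n)" "(\<lambda>n. G (s n)) \<longlonglongrightarrow> 0"
proof -
  define I where "I n = (\<integral>\<^sup>+\<tau>\<in>{t n - 1..t n + 1}. G \<tau> \<partial>lborel)" for n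
  have I0: "I \<longlonglongrightarrow> 0" unfolding I_def by (rule filterlim_compose[OF int t(1)])
  have "\<exists>s. t n \<le> s \<and> s \<le> t n + 1 \<and> P s \<and> G s \<le> I n + ennreal (1 / Suc n)" for n
  proof (rule ccontr)
    assume c: "\<not> ?thesis"
    have "AE \<tau> in lborel. (I n + ennreal (1 / Suc n)) * indicator {t n..t n + 1} \<tau> \<le> G \<tau> * indicator {t n - 1..t n + 1} \<tau>"
      using P
    proof eventually_elim
      case (elim \<tau>)
      show ?case
      proof (cases "\<tau> \<in> {t n..t n + 1}")
        case True
        then have "P \<tau>" using elim t(2)[of n] by auto
        then have "I n + ennreal (1 / Suc n) \<le> G \<tau>" using c True by (auto simp: not_le less_imp_le)
        then show ?thesis using True by simp
      qed simp
    qed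
    then have "(\<integral>\<^sup>+\<tau>. (I n + ennreal (1 / Suc n)) * indicator {t n..t n + 1} \<tau> \<partial>lborel) \<le> I n"
      unfolding I_def by (rule nn_integral_mono_AE)
    then have le: "I n + ennreal (1 / Suc n) \<le> I n" by (simp add: nn_integral_cmult_indicator)
    \<comment> \<open>When \<open>I n\<close> is infinite the bound on \<open>G\<close> is vacuous,
      so the assumption says that an interval of positive measure contains no admissible time;
      otherwise \<open>I n\<close> can be cancelled.\<close>
    show False
    proof (cases "I n = top")
      case True
      have "AE \<tau> in lborel. \<tau> \<notin> {t n..t n + 1}"
        using P by eventually_elim (use c t(2)[of n] True in auto)
      then have "emeasure lborel {t n..t n + 1} = 0"
        by (subst (asm) AE_iff_measurable[of "{t n..t n + 1}"]) auto
      then show ?thesis by simp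
    next
      case False
      have "0 < ennreal (1 / Suc n)" by simp
      then show ?thesis
        using le ennreal_add_left_cancel_le[of "I n" "ennreal (1 / Suc n)" 0] False by (simp add: not_le)
    qed
  qed
  then obtain s where s: "\<And>n. t n \<le> s n" "\<And>n. s n \<le> t n + 1" "\<And>n. P (s n)" "\<And>n. G (s n) \<le> I n + ennreal (1 / Suc n)"
    by metis
  have "(\<lambda>n. I n + ennreal (1 / Suc n)) \<longlonglongrightarrow> 0 + ennreal 0"
    by (intro tendsto_add I0 tendsto_ennrealI LIMSEQ_Suc lim_1_over_n)
  then have lim: "(\<lambda>n. I n + ennreal (1 / Suc n)) \<longlonglongrightarrow> 0" by simp
  have "(\<lambda>n. G (s n)) \<longlonglongrightarrow> 0"
    by (rule tendsto_sandwich[OF _ _ tendsto_const lim]) (simp_all only: s(4) zero_le always_eventually simp_thms)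
  with s(1-3) show thesis by (rule that)
qed

section \<open>The energy balance along the trajectory\<close>

lemma set_integral_Pair:
  fixes f :: "real \<Rightarrow> 'b::{banach, second_countable_topology}" and g :: "real \<Rightarrow> 'c::{banach, second_countable_topology}"
  assumes f: "set_integrable lborel A f" and g: "set_integrable lborel A g"
  shows "set_integrable lborel A (\<lambda>x. (f x, g x))"
    "(LINT x:A|lborel. (f x, g x)) = ((LINT x:A|lborel. f x), (LINT x:A|lborel. g x))"
proof -
  let ?f = "\<lambda>x. indicator A x *\<^sub>R f x" and ?g = "\<lambda>x. indicator A x *\<^sub>R g x"
  have i: "integrable lborel ?f" "integrable lborel ?g" using f g by (auto simp: set_integrable_def)
  have p: "integrable lborel (\<lambda>x. (?f x, ?g x))"
  proof (rule Bochner_Integration.integrable_bound)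
    show "integrable lborel (\<lambda>x. norm (?f x) + norm (?g x))"
      by (intro Bochner_Integration.integrable_add integrable_norm i)
    show "(\<lambda>x. (?f x, ?g x)) \<in> borel_measurable lborel"
      using borel_measurable_integrable[OF i(1)] borel_measurable_integrable[OF i(2)]
      by (rule borel_measurable_Pair)
    show "AE x in lborel. norm (?f x, ?g x) \<le> norm (norm (?f x) + norm (?g x))"
      by (intro AE_I2) (metis norm_Pair_le norm_ge_zero add_nonneg_nonneg real_norm_def abs_of_nonneg)
  qed
  then show "set_integrable lborel A (\<lambda>x. (f x, g x))" by (simp add: set_integrable_def)
  have "fst (LINT x|lborel. (?f x, ?g x)) = (LINT x|lborel. ?f x)"
    "snd (LINT x|lborel. (?f x, ?g x)) = (LINT x|lborel. ?g x)"
    using integral_bounded_linear[OF bounded_linear_fst p] integral_bounded_linear[OF bounded_linear_snd p] by simp_all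
  then show "(LINT x:A|lborel. (f x, g x)) = ((LINT x:A|lborel. f x), (LINT x:A|lborel. g x))"
    by (simp add: set_lebesgue_integral_def prod_eq_iff)
qed

lemma filterlim_at_top_squeeze:
  fixes t s :: "nat \<Rightarrow> real"
  shows "filterlim t at_top sequentially \<Longrightarrow> (\<And>n. t n \<le> s n) \<Longrightarrow> filterlim s at_top sequentially"
  by (erule filterlim_at_top_mono) simp

text \<open>The section of \<open>\<beta>\<close> hidden in the notion of mild solution becomes a
  parameter \<open>b\<close>, so that the same measurable selection appears in the equation and in
  the limit passage.\<close>

locale energy_balance =
  fixes Q :: real and S :: L2I and g :: "real \<Rightarrow> real" and \<beta> :: "real \<Rightarrow> real set" and m M :: real
    and T :: "real \<Rightarrow> L2I \<Rightarrow>\<^sub>L L2I" and f Z y dy :: "real \<Rightarrow> L2I" and f_inf :: "L2I \<Rightarrow> real" and Z_inf y0 :: L2I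
    and b :: "real \<times> real \<Rightarrow> real"
  assumes S: "S \<in> Linf_I" and g: "continuous_on UNIV g"
    and \<beta>: "maximal_monotone \<beta>" and \<beta>_range: "\<And>s. \<beta> s \<subseteq> {m..M}"
    and T: "C0_semigroup T" and gen: "generator T = diffusion_graph"
    and f: "f \<in> Linf_cyl"
    and Z_dom: "AE t in lborel. 0 < t \<longrightarrow> Z t \<in> Domain diffusion_graph"
    and dZ: "(\<lambda>t. diffusion (Z t)) \<in> Linf_cyl"
    and f_inf: "f_inf \<in> dual_V"
    and Z_lim: "(Z \<longlongrightarrow> Z_inf) at_top" and Z_inf: "Z_inf \<in> Domain diffusion_graph"
    and f_lim: "((\<lambda>t. \<integral>\<^sup>+\<tau>\<in>{t - 1..t + 1}. dual_norm_V (\<lambda>v. inner (f \<tau>) v - f_inf v) \<partial>lborel) \<longlongrightarrow> 0) at_top"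
    and dZ_lim: "((\<lambda>t. \<integral>\<^sup>+\<tau>\<in>{t - 1..t + 1}. dual_norm_V (inner (diffusion (Z \<tau>) - diffusion Z_inf)) \<partial>lborel) \<longlongrightarrow> 0) at_top"
    and b: "measurable_section \<beta> (\<lambda>t. y t + Z t) b"
    and g_sq: "AE t in lborel. 0 < t \<longrightarrow> sq_int (\<lambda>x. g (L2_fun (y t + Z t) x))"
    and voc: "variation_of_constants T y0 (\<lambda>t. reaction Q S g b (\<lambda>t. y t + Z t) t + (f t + diffusion (Z t))) y"
    and y_bdd: "y \<in> Linf_cyl" and y_V: "y \<in> Linf_time_V"
    and dy: "weak_deriv {0<..} y dy" and dy_L2: "dy \<in> L2_time_L2"
begin

definition forcing :: "real \<Rightarrow> L2I" where
  "forcing t = reaction Q S g b (\<lambda>t. y t + Z t) t + (f t + diffusion (Z t))"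

lemma voc': "variation_of_constants T y0 forcing y"
  using voc by (simp add: forcing_def[abs_def])

lemma y_continuous: "continuous_on {0..} y"
  by (rule mild_continuous[OF T voc'])

text \<open>\<open>y\<close> and the primitive of \<open>dy\<close> plus a constant are continuous
  on the positive half-line and agree almost everywhere, hence everywhere.\<close>

lemma y_diff:
  assumes "0 < a" "a \<le> c"
  shows "y c - y a = (LINT t:{a..c}|lborel. dy t)"
proof -
  have J: "open {0::real<..}" "is_interval {0::real<..}" "1 \<in> {0::real<..}" by auto
  have d: "loc_int {0<..} dy" using dy by (simp add: weak_deriv_iff)
  obtain C where C: "AE t in lborel. t \<in> {0<..} \<longrightarrow> y t = C + prim 1 dy t"
    using weak_deriv_primitive[OF J dy] by blast
  have "y t - (C + prim 1 dy t) \<in> {0}" if "t > 0" for t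
  proof (rule continuous_AE_in_closed[OF J(1), where f = "\<lambda>t. y t - (C + prim 1 dy t)"])
    show "continuous_on {0<..} (\<lambda>t. y t - (C + prim 1 dy t))"
      by (intro continuous_intros prim_continuous J d continuous_on_subset[OF y_continuous]) auto
  qed (use that C in auto)
  then have "y t = C + prim 1 dy t" if "t > 0" for t using that by simp
  then show ?thesis using assms prim_diff[OF J(2) d J(3), of a c] by simp
qed

text \<open>By \<open>mild_solution_integrated\<close> and \<open>y_diff\<close>, the integral of
  the pair \<open>(y, dy - forcing)\<close> over every compact interval of positive times lies in
  the diffusion graph. As the graph is a closed subspace, almost every value of the pair lies in
  it.\<close>

lemma pointwise_equation: "AE t in lborel. 0 < t \<longrightarrow> (y t, dy t - forcing t) \<in> diffusion_graph"
proof -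
  have "AE t in lborel. t \<in> {0<..} \<longrightarrow> (y t, dy t - forcing t) \<in> diffusion_graph"
  proof (rule AE_in_closed_subspace[OF _ diffusion_graph_closed diffusion_graph_subspace])
    fix a c :: real assume ac: "{a..c} \<subseteq> {0<..}"
    have i: "set_integrable lborel {a..c} y \<and> set_integrable lborel {a..c} dy \<and> set_integrable lborel {a..c} forcing"
    proof (cases "a \<le> c")
      case True
      then have "0 < a" using ac by auto
      then show ?thesis
        using mild_set_integrable[OF T voc', of a c] variation_of_constants_integrable[OF voc', of a c]
          weak_deriv_loc_integrable(2)[OF dy ac] by simp
    qed (simp add: set_integrable_def)
    then have dF: "set_integrable lborel {a..c} (\<lambda>t. dy t - forcing t)" by (intro set_integral_diff) auto
    show "set_integrable lborel {a..c} (\<lambda>t. (y t, dy t - forcing t))" using i dF by (intro set_integral_Pair) auto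
    assume "a < c"
    then have "a \<in> {0<..}" using subsetD[OF ac, of a] by simp
    then have a: "0 < a" "a \<le> c" using \<open>a < c\<close> by auto
    have "(LINT t:{a..c}|lborel. (y t, dy t - forcing t)) = ((LINT t:{a..c}|lborel. y t), y c - y a - (LINT t:{a..c}|lborel. forcing t))"
      using i dF by (subst set_integral_Pair(2)) (auto simp: y_diff[OF a])
    also have "\<dots> \<in> diffusion_graph"
      using mild_solution_integrated[OF T voc', of a c] a gen by simp
    finally show "(LINT t:{a..c}|lborel. (y t, dy t - forcing t)) \<in> diffusion_graph" .
  qed auto
  then show ?thesis by simp
qed

section \<open>Smallness of the time derivative and the choice of times\<close>

definition dy_sq :: "real \<Rightarrow> real" where
  "dy_sq t = indicator {0<..} t * (norm (dy t))\<^sup>2"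

lemma dy_sq_integrable: "integrable lborel dy_sq"
  using dy_L2 by (simp add: L2_time_L2_def dy_sq_def[abs_def] set_integrable_def)

text \<open>Pointwise, \<open>norm (dy \<tau>)\<close> is at most \<open>\<eta>\<close> plus its
  square over \<open>\<eta>\<close>. Over a window of length 2 on which the square has integral
  below \<open>\<eta>^2\<close> this adds up to \<open>3 \<eta>\<close>, whence
  \<open>\<eta> = e / 3\<close>. Taking \<open>t \<ge> 2\<close> keeps the window in positive
  times.\<close>

lemma y_displacement:
  assumes e: "e > 0"
  shows "\<exists>t0. \<forall>t\<ge>t0. \<forall>a\<in>{t - 1..t + 1}. \<forall>c\<in>{t - 1..t + 1}. norm (y c - y a) \<le> e"
proof -
  define \<eta> where "\<eta> = e / 3"
  have \<eta>: "\<eta> > 0" using e by (simp add: \<eta>_def)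
  have "\<forall>\<^sub>F t in at_top. (LINT \<tau>:{t - 1..t + 1}|lborel. dy_sq \<tau>) < \<eta>\<^sup>2"
    using window_integral_tendsto_0(2)[OF dy_sq_integrable] \<eta> by (intro order_tendstoD(2)) (auto simp: dy_sq_def)
  then obtain t0 where t0: "\<And>t. t \<ge> t0 \<Longrightarrow> (LINT \<tau>:{t - 1..t + 1}|lborel. dy_sq \<tau>) < \<eta>\<^sup>2"
    by (auto simp: eventually_at_top_linorder)
  have *: "norm (y c - y a) \<le> e" if t: "t \<ge> max t0 2" and ac: "t - 1 \<le> a" "a \<le> c" "c \<le> t + 1" for t a c
  proof -
    have a: "0 < a" using t ac by simp
    let ?h = "\<lambda>\<tau>. indicator {t - 1..t + 1} \<tau> * (\<eta> + dy_sq \<tau> / \<eta>)"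
    have qi: "integrable lborel (\<lambda>\<tau>. indicator {t - 1..t + 1} \<tau> * dy_sq \<tau>)"
      using integrable_mult_indicator[OF _ dy_sq_integrable, of "{t - 1..t + 1}"] by simp
    have ci: "integrable lborel (\<lambda>\<tau>. indicator {t - 1..t + 1} \<tau> * \<eta>)"
      by (intro integrable_mult_left integrable_real_indicator) (auto simp: emeasure_lborel_Icc_eq)
    have he: "?h = (\<lambda>\<tau>. indicator {t - 1..t + 1} \<tau> * \<eta> + (1 / \<eta>) * (indicator {t - 1..t + 1} \<tau> * dy_sq \<tau>))"
      by (auto simp: algebra_simps)
    have "norm (y c - y a) = norm (LINT \<tau>|lborel. indicator {a..c} \<tau> *\<^sub>R dy \<tau>)"
      using y_diff[OF a ac(2)] by (simp add: set_lebesgue_integral_def)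
    also have "\<dots> \<le> (LINT \<tau>|lborel. ?h \<tau>)"
    proof (rule integral_norm_bound_AE)
      show "integrable lborel ?h" unfolding he by (intro Bochner_Integration.integrable_add ci integrable_mult_right qi)
      show "AE \<tau> in lborel. norm (indicator {a..c} \<tau> *\<^sub>R dy \<tau>) \<le> ?h \<tau>"
      proof (rule AE_I2)
        fix \<tau> :: real
        show "norm (indicator {a..c} \<tau> *\<^sub>R dy \<tau>) \<le> ?h \<tau>"
        proof (cases "\<tau> \<in> {a..c}")
          case True
          then have \<tau>: "0 < \<tau>" "\<tau> \<in> {t - 1..t + 1}" using a ac by auto
          have "norm (dy \<tau>) \<le> \<eta> + (norm (dy \<tau>))\<^sup>2 / \<eta>"
          proof (cases "norm (dy \<tau>) \<le> \<eta>")
            case True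
            then show ?thesis using \<eta> by (simp add: add_increasing2)
          next
            case False
            then have "norm (dy \<tau>) * \<eta> \<le> norm (dy \<tau>) * norm (dy \<tau>)" by (intro mult_left_mono) auto
            then have "norm (dy \<tau>) \<le> (norm (dy \<tau>))\<^sup>2 / \<eta>" using \<eta> by (simp add: field_simps power2_eq_square)
            then show ?thesis using \<eta> by simp
          qed
          then show ?thesis using True \<tau> by (simp add: dy_sq_def)
        next
          case False
          then show ?thesis using \<eta> by (simp add: dy_sq_def)
        qed
      qed
    qed
    also have "\<dots> = 2 * \<eta> + (1 / \<eta>) * (LINT \<tau>:{t - 1..t + 1}|lborel. dy_sq \<tau>)"
      unfolding he by (subst Bochner_Integration.integral_add)
        (auto intro!: ci qi simp: set_lebesgue_integral_def)
    also have "\<dots> \<le> 2 * \<eta> + (1 / \<eta>) * \<eta>\<^sup>2"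
      using t0[of t] t \<eta> by (intro add_left_mono mult_left_mono) auto
    also have "\<dots> = e" using \<eta> by (simp add: \<eta>_def power2_eq_square)
    finally show ?thesis .
  qed
  show ?thesis
  proof (intro exI[of _ "max t0 2"] allI impI ballI)
    fix t a c assume "t \<ge> max t0 2" "a \<in> {t - 1..t + 1}" "c \<in> {t - 1..t + 1}"
    then show "norm (y c - y a) \<le> e" using *[of t a c] *[of t c a] by (cases "a \<le> c") (auto simp: norm_minus_commute)
  qed
qed

text \<open>The pointwise facts used in the limit are bundled so that they pass to subsequences
  together; \<open>e\<close> bounds the deviations of both data in the dual of
  \<open>V\<close>.\<close>

definition good_sequence :: "(nat \<Rightarrow> real) \<Rightarrow> real \<Rightarrow> (nat \<Rightarrow> real) \<Rightarrow> bool" where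
  "good_sequence s C e \<longleftrightarrow>
    (\<forall>n. (y (s n), dy (s n) - forcing (s n)) \<in> diffusion_graph) \<and>
    (\<forall>n. norm_V (y (s n)) \<le> C) \<and> (\<forall>n. AE x in leb_I. \<bar>L2_fun (y (s n)) x\<bar> \<le> C) \<and>
    (\<forall>n. AE x in leb_I. \<bar>L2_fun (diffusion (Z (s n))) x\<bar> \<le> C) \<and>
    (\<forall>n. AE x in leb_I. b (x, s n) \<in> \<beta> (L2_fun (y (s n) + Z (s n)) x)) \<and>
    (\<forall>n. sq_int (\<lambda>x. g (L2_fun (y (s n) + Z (s n)) x))) \<and>
    (\<forall>n. Z (s n) \<in> Domain diffusion_graph) \<and>
    (\<lambda>n. norm (dy (s n))) \<longlonglongrightarrow> 0 \<and> e \<longlonglongrightarrow> 0 \<and>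
    (\<forall>n. \<forall>v\<in>V. \<bar>inner (f (s n)) v - f_inf v\<bar> \<le> e n * norm_V v) \<and>
    (\<forall>n. \<forall>v\<in>V. \<bar>inner (diffusion (Z (s n)) - diffusion Z_inf) v\<bar> \<le> e n * norm_V v)"

lemma good_sequence_subseq: "good_sequence s C e \<Longrightarrow> strict_mono r \<Longrightarrow> good_sequence (\<lambda>n. s (r n)) C (\<lambda>n. e (r n))"
  unfolding good_sequence_def
  using LIMSEQ_subseq_LIMSEQ[of "\<lambda>n. norm (dy (s n))" 0 r] LIMSEQ_subseq_LIMSEQ[of e 0 r]
  by (simp add: comp_def)

text \<open>A single time has to make three quantities small at once, so
  \<open>exists_good_time\<close> is applied to their sum \<open>G\<close>, with \<open>P\<close>
  gathering the properties that hold at almost every positive time.\<close>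

lemma good_times:
  fixes t :: "nat \<Rightarrow> real"
  assumes t: "filterlim t at_top sequentially" "\<And>n. 0 < t n"
  shows "\<exists>s C e. (\<forall>n. t n \<le> s n \<and> s n \<le> t n + 1) \<and> good_sequence s C e"
proof -
  have [measurable]: "dy_sq \<in> borel_measurable borel" using borel_measurable_integrable[OF dy_sq_integrable] by simp
  have q_lim: "((\<lambda>t. \<integral>\<^sup>+\<tau>\<in>{t - 1..t + 1}. ennreal (dy_sq \<tau>) \<partial>lborel) \<longlongrightarrow> 0) at_top"
    by (rule window_integral_tendsto_0(1)[OF dy_sq_integrable]) (simp add: dy_sq_def)
  have "\<exists>\<phi>\<in>borel_measurable borel. AE t in lborel. 0 < t \<longrightarrow> inner (f t) v - f_inf v = \<phi> t" for v
  proof -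
    obtain \<phi> where "\<phi> \<in> borel_measurable borel" "AE t in lborel. 0 < t \<longrightarrow> inner (f t) v = \<phi> t"
      using Linf_cyl_inner_measurable[OF f] by blast
    then show ?thesis by (intro bexI[of _ "\<lambda>t. \<phi> t - f_inf v"]) auto
  qed
  then obtain M1 where M1 [measurable]: "M1 \<in> borel_measurable borel"
    and M1_lim: "((\<lambda>t. \<integral>\<^sup>+\<tau>\<in>{t - 1..t + 1}. M1 \<tau> \<partial>lborel) \<longlongrightarrow> 0) at_top"
    and M1_bd: "AE t in lborel. 0 < t \<longrightarrow> (\<forall>v\<in>V. \<bar>inner (f t) v - f_inf v\<bar> \<le> enn2real (M1 t) * norm_V v)"
    by (rule dual_window[OF dual_V_diff[OF dual_V_inner f_inf] _ f_lim])
  have "\<exists>\<phi>\<in>borel_measurable borel. AE t in lborel. 0 < t \<longrightarrow> inner (diffusion (Z t) - diffusion Z_inf) v = \<phi> t" for v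
  proof -
    obtain \<phi> where "\<phi> \<in> borel_measurable borel" "AE t in lborel. 0 < t \<longrightarrow> inner (diffusion (Z t)) v = \<phi> t"
      using Linf_cyl_inner_measurable[OF dZ] by blast
    then show ?thesis by (intro bexI[of _ "\<lambda>t. \<phi> t - inner (diffusion Z_inf) v"]) (auto simp: inner_diff_left)
  qed
  then obtain M2 where M2 [measurable]: "M2 \<in> borel_measurable borel"
    and M2_lim: "((\<lambda>t. \<integral>\<^sup>+\<tau>\<in>{t - 1..t + 1}. M2 \<tau> \<partial>lborel) \<longlongrightarrow> 0) at_top"
    and M2_bd: "AE t in lborel. 0 < t \<longrightarrow> (\<forall>v\<in>V. \<bar>inner (diffusion (Z t) - diffusion Z_inf) v\<bar> \<le> enn2real (M2 t) * norm_V v)"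
    by (rule dual_window[OF dual_V_inner _ dZ_lim])
  define G where "G \<tau> = ennreal (dy_sq \<tau>) + (M1 \<tau> + M2 \<tau>)" for \<tau>
  have "(\<integral>\<^sup>+\<tau>\<in>{t - 1..t + 1}. G \<tau> \<partial>lborel) = (\<integral>\<^sup>+\<tau>\<in>{t - 1..t + 1}. ennreal (dy_sq \<tau>) \<partial>lborel)
      + ((\<integral>\<^sup>+\<tau>\<in>{t - 1..t + 1}. M1 \<tau> \<partial>lborel) + (\<integral>\<^sup>+\<tau>\<in>{t - 1..t + 1}. M2 \<tau> \<partial>lborel))" for t
    unfolding G_def by (simp add: distrib_right nn_integral_add)
  moreover have "((\<lambda>t. (\<integral>\<^sup>+\<tau>\<in>{t - 1..t + 1}. ennreal (dy_sq \<tau>) \<partial>lborel)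
      + ((\<integral>\<^sup>+\<tau>\<in>{t - 1..t + 1}. M1 \<tau> \<partial>lborel) + (\<integral>\<^sup>+\<tau>\<in>{t - 1..t + 1}. M2 \<tau> \<partial>lborel))) \<longlongrightarrow> 0 + (0 + 0)) at_top"
    by (intro tendsto_add q_lim M1_lim M2_lim)
  ultimately have G_lim: "((\<lambda>t. \<integral>\<^sup>+\<tau>\<in>{t - 1..t + 1}. G \<tau> \<partial>lborel) \<longlongrightarrow> 0) at_top" by simp
  obtain Cy where Cy: "AE t in lborel. 0 < t \<longrightarrow> (AE x in leb_I. \<bar>L2_fun (y t) x\<bar> \<le> Cy)"
    using Linf_cyl_bounded[OF y_bdd] by blast
  obtain Cz where Cz: "AE t in lborel. 0 < t \<longrightarrow> (AE x in leb_I. \<bar>L2_fun (diffusion (Z t)) x\<bar> \<le> Cz)"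
    using Linf_cyl_bounded[OF dZ] by blast
  obtain Cv where Cv: "AE t in lborel. 0 < t \<longrightarrow> y t \<in> V \<and> norm_V (y t) \<le> Cv"
    using y_V by (auto simp: Linf_time_V_def)
  define C where "C = max Cy (max Cz Cv)"
  define P where "P t \<longleftrightarrow> 0 < t
      \<and> (\<forall>v\<in>V. \<bar>inner (f t) v - f_inf v\<bar> \<le> enn2real (M1 t) * norm_V v)
      \<and> (\<forall>v\<in>V. \<bar>inner (diffusion (Z t) - diffusion Z_inf) v\<bar> \<le> enn2real (M2 t) * norm_V v)
      \<and> (y t, dy t - forcing t) \<in> diffusion_graph \<and> norm_V (y t) \<le> C \<and> (AE x in leb_I. \<bar>L2_fun (y t) x\<bar> \<le> C)
      \<and> (AE x in leb_I. \<bar>L2_fun (diffusion (Z t)) x\<bar> \<le> C)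
      \<and> (AE x in leb_I. b (x, t) \<in> \<beta> (L2_fun (y t + Z t) x))
      \<and> sq_int (\<lambda>x. g (L2_fun (y t + Z t) x)) \<and> Z t \<in> Domain diffusion_graph" for t
  have "AE t in lborel. 0 < t \<longrightarrow> (AE x in leb_I. b (x, t) \<in> \<beta> (L2_fun (y t + Z t) x))"
    using b by (simp add: measurable_section_def)
  then have P: "AE t in lborel. 0 < t \<longrightarrow> P t"
    using M1_bd M2_bd pointwise_equation Cy Cz Cv g_sq Z_dom
  proof eventually_elim
    case (elim t)
    have 1: "AE x in leb_I. \<bar>L2_fun (y t) x\<bar> \<le> C" if "AE x in leb_I. \<bar>L2_fun (y t) x\<bar> \<le> Cy"
      using that by eventually_elim (simp add: C_def)
    have 2: "AE x in leb_I. \<bar>L2_fun (diffusion (Z t)) x\<bar> \<le> C" if "AE x in leb_I. \<bar>L2_fun (diffusion (Z t)) x\<bar> \<le> Cz"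
      using that by eventually_elim (simp add: C_def)
    have 3: "norm_V (y t) \<le> C" if "norm_V (y t) \<le> Cv" using that by (simp add: C_def)
    show ?case unfolding P_def using elim 1 2 3 by blast
  qed
  obtain s where s: "\<And>n. t n \<le> s n" "\<And>n. s n \<le> t n + 1" "\<And>n. P (s n)" "(\<lambda>n. G (s n)) \<longlonglongrightarrow> 0"
    using exists_good_time[OF P G_lim t] by blast
  have le_G: "u \<longlonglongrightarrow> 0" if "\<And>n. u n \<le> G (s n)" for u
    by (rule tendsto_sandwich[OF _ _ tendsto_const s(4)]) (simp_all only: that zero_le always_eventually simp_thms)
  have real_0: "(\<lambda>n. enn2real (u n)) \<longlonglongrightarrow> 0" if "\<And>n. u n \<le> G (s n)" for u
    using tendsto_enn2real[of u 0] le_G[OF that] by simp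
  have q0: "(\<lambda>n. enn2real (ennreal (dy_sq (s n)))) \<longlonglongrightarrow> 0" by (rule real_0) (simp add: G_def)
  define e where "e n = enn2real (M1 (s n)) + enn2real (M2 (s n))" for n
  show ?thesis
  proof (intro exI conjI allI)
    show "t n \<le> s n" "s n \<le> t n + 1" for n by (rule s)+
    have good1: "(y (s n), dy (s n) - forcing (s n)) \<in> diffusion_graph" "norm_V (y (s n)) \<le> C"
      "AE x in leb_I. \<bar>L2_fun (y (s n)) x\<bar> \<le> C"
      "AE x in leb_I. \<bar>L2_fun (diffusion (Z (s n))) x\<bar> \<le> C"
      "AE x in leb_I. b (x, s n) \<in> \<beta> (L2_fun (y (s n) + Z (s n)) x)"
      "sq_int (\<lambda>x. g (L2_fun (y (s n) + Z (s n)) x))"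
      "Z (s n) \<in> Domain diffusion_graph" for n
      using s(3)[of n] unfolding P_def by blast+
    have "(\<lambda>n. enn2real (M1 (s n)) + enn2real (M2 (s n))) \<longlonglongrightarrow> 0 + 0"
      by (intro tendsto_add real_0) (auto simp: G_def add_increasing add_increasing2)
    then have e0: "e \<longlonglongrightarrow> 0" by (simp add: e_def[abs_def])
    from q0 have "(\<lambda>n. sqrt (enn2real (ennreal (dy_sq (s n))))) \<longlonglongrightarrow> sqrt 0" by (rule tendsto_real_sqrt)
    moreover have "sqrt (enn2real (ennreal (dy_sq (s n)))) = norm (dy (s n))" for n
      using s(3)[of n] by (simp add: dy_sq_def P_def)
    ultimately have dy0: "(\<lambda>n. norm (dy (s n))) \<longlonglongrightarrow> 0" by simp
    have good2: "\<bar>inner (f (s n)) v - f_inf v\<bar> \<le> e n * norm_V v"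
      "\<bar>inner (diffusion (Z (s n)) - diffusion Z_inf) v\<bar> \<le> e n * norm_V v" if v: "v \<in> V" for n v
    proof -
      have "enn2real (M1 (s n)) * norm_V v \<le> e n * norm_V v" "enn2real (M2 (s n)) * norm_V v \<le> e n * norm_V v"
        using norm_V_nonneg[OF v] by (auto simp: e_def intro!: mult_right_mono)
      moreover have "\<bar>inner (f (s n)) v - f_inf v\<bar> \<le> enn2real (M1 (s n)) * norm_V v"
        "\<bar>inner (diffusion (Z (s n)) - diffusion Z_inf) v\<bar> \<le> enn2real (M2 (s n)) * norm_V v"
        using s(3)[of n] v unfolding P_def by blast+
      ultimately show "\<bar>inner (f (s n)) v - f_inf v\<bar> \<le> e n * norm_V v"
        "\<bar>inner (diffusion (Z (s n)) - diffusion Z_inf) v\<bar> \<le> e n * norm_V v" by linarith+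
    qed
    show "good_sequence s C e" unfolding good_sequence_def using good1 e0 dy0 good2 by blast
  qed
qed

text \<open>At the selected times \<open>y\<close> is bounded both in \<open>V\<close> and in the
  supremum norm, so the compact embedding yields a limit in \<open>V\<close> that inherits the
  supremum bound.\<close>

theorem omega_limit_nonempty: "omega_limit y \<noteq> {}"
proof -
  have t: "filterlim (\<lambda>n. real n + 1) at_top sequentially"
    by (rule filterlim_at_top_squeeze[OF filterlim_real_sequentially]) simp
  have tp: "0 < real n + 1" for n by simp
  obtain s C e where s: "\<And>n. real n + 1 \<le> s n" and gd: "good_sequence s C e"
    using good_times[OF t tp] by blast
  have gds: "\<And>n. (y (s n), dy (s n) - forcing (s n)) \<in> diffusion_graph"
      "\<And>n. norm_V (y (s n)) \<le> C" "\<And>n. AE x in leb_I. \<bar>L2_fun (y (s n)) x\<bar> \<le> C"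
    using gd unfolding good_sequence_def by blast+
  have yV: "y (s n) \<in> V" for n using gds(1) by (simp add: diffusion_graph_iff)
  have "norm (wgrad (y (s n))) \<le> C" for n
    using gds(2)[of n] norm_ge_zero[of "y (s n)"] unfolding norm_V_eq[OF yV] by linarith
  then obtain r w where r: "strict_mono (r :: nat \<Rightarrow> nat)" "(\<lambda>n. y (s (r n))) \<longlonglongrightarrow> w" "w \<in> V" "AE x in leb_I. \<bar>L2_fun w x\<bar> \<le> C"
    by (rule V_compact_embedding[OF yV _ gds(3)])
  have "filterlim (\<lambda>n. s (r n)) at_top sequentially"
    by (rule filterlim_compose[OF filterlim_at_top_squeeze[OF t s] filterlim_subseq[OF r(1)]])
  then have "w \<in> omega_limit y" using r by (auto simp: omega_limit_def Linf_I_def)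
  then show ?thesis by blast
qed

end

section \<open>Limit points\<close>

lemma sq_int_bounded_mult:
  assumes a: "a \<in> borel_measurable leb_I" "AE x in leb_I. \<bar>a x\<bar> \<le> K" and f: "sq_int f"
  shows "sq_int (\<lambda>x. a x * f x)" "norm (to_L2 (\<lambda>x. a x * f x)) \<le> K * norm (to_L2 f)"
proof -
  have [measurable]: "f \<in> borel_measurable leb_I" by (rule sq_int_measurable[OF f])
  have K: "0 \<le> K" by (rule AE_leb_I_constD, use a(2) in eventually_elim) linarith
  have i: "integrable leb_I (\<lambda>x. K\<^sup>2 * (f x)\<^sup>2)" using f by (simp add: sq_int_def)
  have le: "AE x in leb_I. (a x * f x)\<^sup>2 \<le> K\<^sup>2 * (f x)\<^sup>2"
    using a(2)
  proof eventually_elim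
    case (elim x)
    then have "\<bar>a x\<bar>\<^sup>2 \<le> K\<^sup>2" by (intro power_mono) auto
    then show ?case by (simp add: power_mult_distrib mult_right_mono)
  qed
  have i2: "integrable leb_I (\<lambda>x. (a x * f x)\<^sup>2)"
    by (rule Bochner_Integration.integrable_bound[OF i]) (use a(1) le in \<open>auto elim!: eventually_mono\<close>)
  then show s: "sq_int (\<lambda>x. a x * f x)" using a(1) by (simp add: sq_int_def)
  have "(norm (to_L2 (\<lambda>x. a x * f x)))\<^sup>2 \<le> K\<^sup>2 * (norm (to_L2 f))\<^sup>2"
    unfolding norm_to_L2_sq[OF s] norm_to_L2_sq[OF f] using integral_mono_AE[OF i2 i le] by simp
  then have "(norm (to_L2 (\<lambda>x. a x * f x)))\<^sup>2 \<le> (K * norm (to_L2 f))\<^sup>2" by (simp add: power_mult_distrib)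
  then show "norm (to_L2 (\<lambda>x. a x * f x)) \<le> K * norm (to_L2 f)"
    by (rule power2_le_imp_le) (use K in simp)
qed

text \<open>A closed convex set that keeps the weak cluster points of the projected sections;
  \<open>lo\<close> and \<open>hi\<close> will be the ends of the segments over the limit.\<close>

definition sections :: "(real \<Rightarrow> real) \<Rightarrow> (real \<Rightarrow> real) \<Rightarrow> L2I set" where
  "sections lo hi = {z. AE x in leb_I. lo x \<le> L2_fun z x \<and> L2_fun z x \<le> hi x}"

lemma sections_convex: "convex (sections lo hi)"
  unfolding convex_alt
proof (intro ballI allI impI)
  fix z z' and u :: real assume z: "z \<in> sections lo hi" "z' \<in> sections lo hi" and u: "0 \<le> u \<and> u \<le> 1"
  have "AE x in leb_I. L2_fun ((1 - u) *\<^sub>R z + u *\<^sub>R z') x = (1 - u) * L2_fun z x + u * L2_fun z' x"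
    using L2_fun_add_scaled[of "(1 - u) *\<^sub>R z" u z'] L2_fun_add_scaled[of 0 "1 - u" z] L2_fun_add_scaled[of 0 1 0]
    by eventually_elim simp
  with z[unfolded sections_def mem_Collect_eq]
  have "AE x in leb_I. lo x \<le> L2_fun ((1 - u) *\<^sub>R z + u *\<^sub>R z') x \<and> L2_fun ((1 - u) *\<^sub>R z + u *\<^sub>R z') x \<le> hi x"
  proof eventually_elim
    case (elim x)
    have "(1 - u) * lo x + u * lo x \<le> (1 - u) * L2_fun z x + u * L2_fun z' x"
      using elim u by (intro add_mono mult_left_mono) auto
    moreover have "(1 - u) * L2_fun z x + u * L2_fun z' x \<le> (1 - u) * hi x + u * hi x"
      using elim u by (intro add_mono mult_left_mono) auto
    ultimately show ?case using elim by (simp add: algebra_simps)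
  qed
  then show "(1 - u) *\<^sub>R z + u *\<^sub>R z' \<in> sections lo hi" by (simp add: sections_def)
qed

text \<open>Norm limits have an almost everywhere convergent subsequence, along which the pointwise
  bounds persist.\<close>

lemma sections_closed: "closed (sections lo hi)"
  unfolding closed_sequential_limits
proof (intro allI impI, elim conjE)
  fix X l assume X: "\<forall>n. X n \<in> sections lo hi" and l: "X \<longlonglongrightarrow> l"
  obtain r where r: "strict_mono (r :: nat \<Rightarrow> nat)" "AE x in leb_I. (\<lambda>n. L2_fun (X (r n)) x) \<longlonglongrightarrow> L2_fun l x"
    using L2_convergent_AE_subseq[OF l] by blast
  have "AE x in leb_I. \<forall>n. lo x \<le> L2_fun (X (r n)) x \<and> L2_fun (X (r n)) x \<le> hi x"
    unfolding AE_all_countable using X by (auto simp: sections_def)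
  then have "AE x in leb_I. lo x \<le> L2_fun l x \<and> L2_fun l x \<le> hi x"
    using r(2)
  proof eventually_elim
    case (elim x)
    have "lo x \<le> L2_fun l x" by (rule LIMSEQ_le_const[OF elim(2)]) (use elim(1) in blast)
    moreover have "L2_fun l x \<le> hi x" by (rule LIMSEQ_le_const2[OF elim(2)]) (use elim(1) in blast)
    ultimately show ?case by blast
  qed
  then show "l \<in> sections lo hi" by (simp add: sections_def)
qed

context energy_balance
begin

text \<open>The factor \<open>Q S\<close> is applied to the test function instead of the section:
  the section then enters through an inner product with a fixed vector, as weak limits
  demand.\<close>

definition QS_mult :: "L2I \<Rightarrow> L2I" where
  "QS_mult v = to_L2 (\<lambda>x. Q * L2_fun S x * L2_fun v x)"

lemma QS_mult_bound: "\<exists>K. \<forall>v. norm (QS_mult v) \<le> K * norm v"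
proof -
  obtain C where C: "AE x in leb_I. \<bar>L2_fun S x\<bar> \<le> C" using S by (auto simp: Linf_I_def)
  have "AE x in leb_I. \<bar>Q * L2_fun S x\<bar> \<le> \<bar>Q\<bar> * C"
    using C by eventually_elim (simp add: abs_mult mult_left_mono)
  moreover have "(\<lambda>x. Q * L2_fun S x) \<in> borel_measurable leb_I"
    using sq_int_measurable[OF sq_int_L2_fun[of S]] by measurable
  ultimately have "norm (QS_mult v) \<le> \<bar>Q\<bar> * C * norm v" for v
    using sq_int_bounded_mult(2)[of "\<lambda>x. Q * L2_fun S x" "\<bar>Q\<bar> * C" "L2_fun v"]
    by (simp add: QS_mult_def to_L2_L2_fun sq_int_L2_fun)
  then show ?thesis by blast
qed

lemma QS_sq_int: "sq_int h \<Longrightarrow> sq_int (\<lambda>x. Q * L2_fun S x * h x)"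
proof -
  assume h: "sq_int h"
  obtain C where C: "AE x in leb_I. \<bar>L2_fun S x\<bar> \<le> C" using S by (auto simp: Linf_I_def)
  have "AE x in leb_I. \<bar>Q * L2_fun S x\<bar> \<le> \<bar>Q\<bar> * C"
    using C by eventually_elim (simp add: abs_mult mult_left_mono)
  moreover have "(\<lambda>x. Q * L2_fun S x) \<in> borel_measurable leb_I"
    using sq_int_measurable[OF sq_int_L2_fun[of S]] by measurable
  ultimately show ?thesis using sq_int_bounded_mult(1) h by blast
qed

lemma inner_QS_mult: "sq_int h \<Longrightarrow> inner (to_L2 h) (QS_mult v) = (LINT x|leb_I. Q * L2_fun S x * h x * L2_fun v x)"
  unfolding QS_mult_def using inner_to_L2[OF _ QS_sq_int[OF sq_int_L2_fun[of v]], of h]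
  by (simp only: mult.assoc mult.left_commute)

lemma inner_reaction:
  assumes h: "sq_int (\<lambda>x. b (x, t))" and gs: "sq_int (\<lambda>x. g (L2_fun (y t + Z t) x))"
  shows "inner (reaction Q S g b (\<lambda>t. y t + Z t) t) v
    = inner (to_L2 (\<lambda>x. b (x, t))) (QS_mult v) - inner (to_L2 (\<lambda>x. g (L2_fun (y t + Z t) x))) v"
proof -
  have "inner (to_L2 (\<lambda>x. Q * L2_fun S x * b (x, t))) v = inner (to_L2 (\<lambda>x. b (x, t))) (QS_mult v)"
    unfolding inner_QS_mult[OF h]
    using inner_to_L2[OF QS_sq_int[OF h] sq_int_L2_fun[of v]] by (simp add: to_L2_L2_fun)
  then show ?thesis
    unfolding reaction_def by (simp add: to_L2_diff QS_sq_int h gs inner_diff_left)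
qed

lemma b_measurable: "(\<lambda>x. b (x, t)) \<in> borel_measurable leb_I"
  using b by (intro section_measurable_leb_I) (simp add: measurable_section_def)

theorem omega_limit_point:
  assumes yi: "y_inf \<in> omega_limit y"
  shows "\<exists>t :: nat \<Rightarrow> real. filterlim t at_top sequentially \<and> (\<forall>n. t n > 1) \<and>
          (\<lambda>n. \<integral>\<^sup>+s\<in>{-1<..<1}. ennreal ((norm (y (t n + s) - y_inf))\<^sup>2) \<partial>lborel) \<longlonglongrightarrow> 0"
    and "bounded_stationary_solution Q S g \<beta> f_inf (y_inf + Z_inf)"
    and "\<exists>t :: nat \<Rightarrow> real. filterlim t at_top sequentially \<and> (\<forall>n. t n > 0 \<and> y (t n) \<in> V) \<and>
         (\<lambda>n. norm_V (y (t n) - y_inf)) \<longlonglongrightarrow> 0"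
proof -
  obtain t0 where t0: "filterlim t0 at_top sequentially" "(\<lambda>n. y (t0 n)) \<longlonglongrightarrow> y_inf"
    and yiV: "y_inf \<in> V"
    using yi by (auto simp: omega_limit_def)
  obtain n0 where n0: "\<And>n. n \<ge> n0 \<Longrightarrow> t0 n > 1"
    using t0(1) by (auto simp: filterlim_at_top_dense eventually_sequentially)
  \<comment> \<open>Dropping the first \<open>n0\<close> terms makes \<open>t n > 1\<close>, so that
    the whole window around \<open>t n\<close> lies in positive times.\<close>
  define t where "t n = t0 (n + n0)" for n
  have t: "filterlim t at_top sequentially" "\<And>n. t n > 1" "(\<lambda>n. y (t n)) \<longlonglongrightarrow> y_inf"
    unfolding t_def using n0 LIMSEQ_ignore_initial_segment[OF t0(2)]
    by (auto intro: filterlim_compose[OF t0(1) filterlim_add_const_nat_at_top])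
  \<comment> \<open>Late windows have small displacement, so convergence at \<open>t n\<close>
    spreads uniformly over the window. This yields both the \<open>L^2\<close> convergence in (ii)
    and convergence at the selected times.\<close>
  have close: "\<forall>\<^sub>F n in sequentially. \<forall>c\<in>{t n - 1..t n + 1}. norm (y c - y_inf) < e" if e: "e > 0" for e
  proof -
    have "e / 2 > 0" using e by simp
    from y_displacement[OF this] obtain T0 where T0: "\<forall>t\<ge>T0. \<forall>a\<in>{t - 1..t + 1}. \<forall>c\<in>{t - 1..t + 1}. norm (y c - y a) \<le> e / 2"
      by blast
    have "\<forall>\<^sub>F n in sequentially. t n \<ge> T0" using t(1) by (simp add: filterlim_at_top)
    moreover have "\<forall>\<^sub>F n in sequentially. dist (y (t n)) y_inf < e / 2" using tendstoD[OF t(3), of "e / 2"] e by simp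
    ultimately show ?thesis
    proof eventually_elim
      case (elim n)
      show ?case
      proof
        fix c assume "c \<in> {t n - 1..t n + 1}"
        then have "norm (y c - y (t n)) \<le> e / 2" using T0[rule_format, OF elim(1), of "t n" c] by simp
        moreover have "norm (y c - y_inf) \<le> norm (y c - y (t n)) + norm (y (t n) - y_inf)"
          using norm_triangle_ineq[of "y c - y (t n)" "y (t n) - y_inf"] by simp
        ultimately show "norm (y c - y_inf) < e" using elim(2) by (simp add: dist_norm)
      qed
    qed
  qed
  have "(\<lambda>n. \<integral>\<^sup>+s\<in>{-1<..<1}. ennreal ((norm (y (t n + s) - y_inf))\<^sup>2) \<partial>lborel) \<longlonglongrightarrow> 0"
  proof (rule order_tendstoI)
    fix c :: ennreal assume c: "0 < c"
    \<comment> \<open>The window has length 2, hence the factor in \<open>2 d^2\<close>.\<close>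
    obtain d where d: "0 < d" "ennreal (2 * d\<^sup>2) < c"
    proof -
      have "((\<lambda>d. ennreal (2 * d\<^sup>2)) \<longlongrightarrow> ennreal (2 * 0\<^sup>2)) (at_right (0::real))" by (intro tendsto_intros)
      then have "\<forall>\<^sub>F d in at_right (0::real). ennreal (2 * d\<^sup>2) < c" using c by (intro order_tendstoD) auto
      then have "\<forall>\<^sub>F d in at_right (0::real). 0 < d \<and> ennreal (2 * d\<^sup>2) < c"
        using eventually_at_right_less[of 0] by eventually_elim simp
      then show thesis using that eventually_happens[of _ "at_right (0::real)"] by force
    qed
    show "\<forall>\<^sub>F n in sequentially. (\<integral>\<^sup>+s\<in>{-1<..<1}. ennreal ((norm (y (t n + s) - y_inf))\<^sup>2) \<partial>lborel) < c"
      using close[OF d(1)]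
    proof eventually_elim
      case (elim n)
      have "(\<integral>\<^sup>+s\<in>{-1<..<1}. ennreal ((norm (y (t n + s) - y_inf))\<^sup>2) \<partial>lborel)
        \<le> (\<integral>\<^sup>+s. ennreal (d\<^sup>2) * indicator {-1<..<1::real} s \<partial>lborel)"
      proof (rule nn_integral_mono)
        fix s :: real
        show "ennreal ((norm (y (t n + s) - y_inf))\<^sup>2) * indicator {-1<..<1} s \<le> ennreal (d\<^sup>2) * indicator {-1<..<1} s"
        proof (cases "s \<in> {-1<..<1}")
          case True
          then have "norm (y (t n + s) - y_inf) < d" using elim by simp
          then have "(norm (y (t n + s) - y_inf))\<^sup>2 \<le> d\<^sup>2" by (intro power_mono) auto
          then show ?thesis using True by (simp add: ennreal_leI)
        qed simp
      qed
      also have "\<dots> = ennreal (d\<^sup>2) * 2" by (simp add: nn_integral_cmult_indicator)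
      also have "\<dots> = ennreal (2 * d\<^sup>2)" by (simp add: ennreal_mult mult.commute)
      finally show ?case using d(2) by simp
    qed
  qed simp
  then show "\<exists>t :: nat \<Rightarrow> real. filterlim t at_top sequentially \<and> (\<forall>n. t n > 1) \<and>
          (\<lambda>n. \<integral>\<^sup>+s\<in>{-1<..<1}. ennreal ((norm (y (t n + s) - y_inf))\<^sup>2) \<partial>lborel) \<longlonglongrightarrow> 0"
    using t(1,2) by blast
  have tp: "0 < t n" for n using t(2)[of n] by simp
  obtain s0 C e0 where s0: "\<forall>n. t n \<le> s0 n \<and> s0 n \<le> t n + 1" "good_sequence s0 C e0"
    using good_times[OF t(1) tp] by blast
  have s0_in: "s0 n \<in> {t n - 1..t n + 1}" for n using s0(1)[rule_format, of n] by auto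
  have s0_lim: "filterlim s0 at_top sequentially"
    by (rule filterlim_at_top_squeeze[OF t(1)]) (use s0(1) in blast)
  have y0_lim: "(\<lambda>n. y (s0 n)) \<longlonglongrightarrow> y_inf"
  proof (rule tendstoI)
    fix e :: real assume "e > 0"
    show "\<forall>\<^sub>F n in sequentially. dist (y (s0 n)) y_inf < e"
      using close[OF \<open>e > 0\<close>] by eventually_elim (use s0_in in \<open>auto simp: dist_norm simp del: atLeastAtMost_iff\<close>)
  qed
  have u0_lim: "(\<lambda>n. y (s0 n) + Z (s0 n)) \<longlonglongrightarrow> y_inf + Z_inf"
    by (intro tendsto_add y0_lim filterlim_compose[OF Z_lim s0_lim])
  \<comment> \<open>\<open>g\<close> and \<open>\<beta>\<close> act pointwise, so almost everywhere
    convergence of \<open>y + Z\<close> is needed besides convergence in \<open>L2I\<close>.\<close>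
  obtain r where r: "strict_mono (r :: nat \<Rightarrow> nat)"
    and u_ae: "AE x in leb_I. (\<lambda>n. L2_fun (y (s0 (r n)) + Z (s0 (r n))) x) \<longlonglongrightarrow> L2_fun (y_inf + Z_inf) x"
    using L2_convergent_AE_subseq[OF u0_lim] by blast
  define s where "s n = s0 (r n)" for n
  define e where "e n = e0 (r n)" for n
  have gd: "good_sequence s C e" unfolding s_def e_def by (rule good_sequence_subseq[OF s0(2) r])
  have s_lim: "filterlim s at_top sequentially"
    unfolding s_def by (rule filterlim_compose[OF s0_lim filterlim_subseq[OF r]])
  have y_lim: "(\<lambda>n. y (s n)) \<longlonglongrightarrow> y_inf"
    unfolding s_def using LIMSEQ_subseq_LIMSEQ[OF y0_lim r] by (simp add: comp_def)
  have Z_s_lim: "(\<lambda>n. Z (s n)) \<longlonglongrightarrow> Z_inf" by (rule filterlim_compose[OF Z_lim s_lim])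
  have s_pos: "s n > 0" for n using s0(1) tp[of "r n"] by (auto simp: s_def intro: less_le_trans)
  have eqn: "(y (s n), dy (s n) - forcing (s n)) \<in> diffusion_graph" and yC: "norm_V (y (s n)) \<le> C"
    and y_b: "AE x in leb_I. \<bar>L2_fun (y (s n)) x\<bar> \<le> C"
    and dZ_b: "AE x in leb_I. \<bar>L2_fun (diffusion (Z (s n))) x\<bar> \<le> C"
    and b_sec: "AE x in leb_I. b (x, s n) \<in> \<beta> (L2_fun (y (s n) + Z (s n)) x)"
    and g_s: "sq_int (\<lambda>x. g (L2_fun (y (s n) + Z (s n)) x))"
    and Z_d: "Z (s n) \<in> Domain diffusion_graph" for n
    using gd unfolding good_sequence_def by blast+
  have dy_lim: "(\<lambda>n. norm (dy (s n))) \<longlonglongrightarrow> 0" and e_lim: "e \<longlonglongrightarrow> 0"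
    and f_e: "\<And>n v. v \<in> V \<Longrightarrow> \<bar>inner (f (s n)) v - f_inf v\<bar> \<le> e n * norm_V v"
    and Z_e: "\<And>n v. v \<in> V \<Longrightarrow> \<bar>inner (diffusion (Z (s n)) - diffusion Z_inf) v\<bar> \<le> e n * norm_V v"
    using gd unfolding good_sequence_def by blast+
  have yV: "y (s n) \<in> V" for n using eqn[of n] by (simp add: diffusion_graph_iff)
  define U where "U n = y (s n) + Z (s n)" for n
  define u where "u = y_inf + Z_inf"
  have "bounded (range (\<lambda>n. Z (s n)))" using Z_s_lim by (rule convergent_imp_bounded)
  then obtain CZ where CZ: "\<And>n. norm (Z (s n)) \<le> CZ" by (auto simp: bounded_iff)
  \<comment> \<open>\<open>y\<close> is bounded by \<open>C\<close>; by
    \<open>diffusion_domain_bounded\<close>, \<open>Z\<close> is bounded by its norm plus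
    \<open>2 C\<close>, and \<open>CZ\<close> bounds the norms because \<open>Z\<close>
    converges.\<close>
  define R where "R = C + (CZ + 2 * C)"
  have U_b: "AE x in leb_I. \<bar>L2_fun (U n) x\<bar> \<le> R" for n
  proof -
    have "AE x in leb_I. \<bar>L2_fun (Z (s n)) x\<bar> \<le> norm (Z (s n)) + 2 * C"
      by (rule diffusion_domain_bounded[OF diffusion_in_graph[OF Z_d] dZ_b])
    then show ?thesis using y_b[of n] L2_fun_add[of "y (s n)" "Z (s n)"]
      by eventually_elim (use CZ[of n] in \<open>simp add: U_def R_def\<close>)
  qed
  have U_ae: "AE x in leb_I. (\<lambda>n. L2_fun (U n) x) \<longlonglongrightarrow> L2_fun u x"
    using u_ae by (simp add: U_def u_def s_def)
  have u_b: "AE x in leb_I. \<bar>L2_fun u x\<bar> \<le> R"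
    by (rule to_L2_tendsto(1)[OF _ _ U_b U_ae]) (intro sq_int_measurable sq_int_L2_fun)+
  \<comment> \<open>Continuity gives no growth control on \<open>g\<close>; compactness of
    \<open>[-R, R]\<close> provides the bound for dominated convergence.\<close>
  have "compact (g ` {-R..R})" by (rule compact_continuous_image[OF continuous_on_subset[OF g]]) auto
  then obtain Cg where Cg: "\<And>r. \<bar>r\<bar> \<le> R \<Longrightarrow> \<bar>g r\<bar> \<le> Cg"
    using compact_imp_bounded[of "g ` {-R..R}"] by (force simp: bounded_iff abs_le_iff)
  have g_m: "(\<lambda>x. g (L2_fun w x)) \<in> borel_measurable leb_I" for w
    using measurable_compose[OF sq_int_measurable[OF sq_int_L2_fun[of w]] borel_measurable_continuous_onI[OF g]] .
  define gU where "gU n = to_L2 (\<lambda>x. g (L2_fun (U n) x))" for n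
  define gu where "gu = to_L2 (\<lambda>x. g (L2_fun u x))"
  have gU_b: "AE x in leb_I. \<bar>g (L2_fun (U n) x)\<bar> \<le> Cg" for n
    using U_b[of n] by eventually_elim (rule Cg)
  have gU_ae: "AE x in leb_I. (\<lambda>n. g (L2_fun (U n) x)) \<longlonglongrightarrow> g (L2_fun u x)"
    using U_ae by eventually_elim (use continuous_on_tendsto_compose[OF g] in auto)
  have gU_lim: "gU \<longlonglongrightarrow> gu" and gu_b: "AE x in leb_I. \<bar>g (L2_fun u x)\<bar> \<le> Cg"
    unfolding gU_def gu_def using to_L2_tendsto[OF g_m g_m gU_b gU_ae] by blast+
  have gu_s: "sq_int (\<lambda>x. g (L2_fun u x))" by (rule sq_int_bounded[OF g_m gu_b])
  have b_range: "AE x in leb_I. m \<le> b (x, s n) \<and> b (x, s n) \<le> M" for n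
    using b_sec[of n] by eventually_elim (use \<beta>_range in fastforce)
  \<comment> \<open>\<open>b\<close> has a value in the range interval, so this interval is
    nonempty.\<close>
  have mM: "m \<le> M" by (rule AE_leb_I_constD, use b_range[of 0] in eventually_elim) linarith
  let ?Mb = "\<bar>m\<bar> + \<bar>M\<bar>"
  have b_b: "AE x in leb_I. \<bar>b (x, s n)\<bar> \<le> ?Mb" for n
    using b_range[of n] by eventually_elim linarith
  have b_s: "sq_int (\<lambda>x. b (x, s n))" for n by (rule sq_int_bounded[OF b_measurable b_b])
  define lo where "lo x = graph_lo m \<beta> (L2_fun u x)" for x
  define hi where "hi x = graph_hi M \<beta> (L2_fun u x)" for x
  \<comment> \<open>The section is projected onto the segment over the limit \<open>u\<close> rather
    than over \<open>U n\<close>: it changes by a null sequence and now takes its values in segments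
    independent of \<open>n\<close>.\<close>
  define c where "c n x = max (lo x) (min (hi x) (b (x, s n)))" for n x
  have um [measurable]: "L2_fun u \<in> borel_measurable leb_I" by (intro sq_int_measurable sq_int_L2_fun)
  have [measurable]: "lo \<in> borel_measurable leb_I"
    unfolding lo_def by (rule measurable_compose[OF um borel_measurable_mono[OF graph_lo_mono[OF \<beta> \<beta>_range mM]]])
  have [measurable]: "hi \<in> borel_measurable leb_I"
    unfolding hi_def by (rule measurable_compose[OF um borel_measurable_mono[OF graph_hi_mono[OF \<beta> \<beta>_range mM]]])
  note [measurable] = b_measurable
  have c_m [measurable]: "c n \<in> borel_measurable leb_I" for n unfolding c_def by measurable
  have lohi: "lo x \<le> hi x" "m \<le> lo x" "lo x \<le> M" "m \<le> hi x" "hi x \<le> M" for x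
    unfolding lo_def hi_def
    using graph_lo_le_hi[OF \<beta> \<beta>_range mM] graph_lo_bounds[OF \<beta> \<beta>_range mM] graph_hi_bounds[OF \<beta> \<beta>_range mM] by auto
  have c_lohi: "lo x \<le> c n x" "c n x \<le> hi x" for n x using lohi(1)[of x] by (auto simp: c_def)
  have c_b: "AE x in leb_I. \<bar>c n x\<bar> \<le> ?Mb" for n
  proof (rule AE_I2)
    fix x
    show "\<bar>c n x\<bar> \<le> ?Mb" using c_lohi[where x = x and n = n] lohi[where x = x] by linarith
  qed
  have c_s: "sq_int (c n)" for n by (rule sq_int_bounded[OF c_m c_b])
  define B where "B n = to_L2 (\<lambda>x. b (x, s n))" for n
  define P where "P n = to_L2 (c n)" for n
  have bc_ae: "AE x in leb_I. (\<lambda>n. b (x, s n) - c n x) \<longlonglongrightarrow> 0"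
  proof -
    have "AE x in leb_I. \<forall>n. b (x, s n) \<in> \<beta> (L2_fun (U n) x)"
      unfolding AE_all_countable U_def using b_sec by blast
    then show ?thesis using U_ae
    proof eventually_elim
      case (elim x)
      show ?case
        using graph_clamp_tendsto[OF \<beta> \<beta>_range mM elim(2), of "\<lambda>n. b (x, s n)"] elim(1)
        by (simp add: c_def lo_def hi_def graph_clamp_def[OF \<beta> \<beta>_range mM])
    qed
  qed
  have "(\<lambda>n. to_L2 (\<lambda>x. b (x, s n) - c n x)) \<longlonglongrightarrow> to_L2 (\<lambda>x. 0)"
  proof (rule to_L2_tendsto(2)[OF _ _ _ bc_ae])
    show "AE x in leb_I. \<bar>b (x, s n) - c n x\<bar> \<le> ?Mb + ?Mb" for n
      using b_b[of n] c_b[of n] by eventually_elim linarith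
  qed measurable
  then have BP_lim: "(\<lambda>n. B n - P n) \<longlonglongrightarrow> 0"
    using to_L2_scale[OF sq_int_zero, of 0] by (simp add: B_def P_def to_L2_diff b_s c_s)
  have P_sec: "P n \<in> sections lo hi" for n
    unfolding sections_def P_def mem_Collect_eq
    using L2_fun_to_L2[OF c_s[of n]] by eventually_elim (use c_lohi in auto)
  have energy_s: "inner (wgrad (y (s n))) (wgrad v) = - inner (dy (s n)) v + inner (B n) (QS_mult v) - inner (gU n) v
      + inner (f (s n)) v + inner (diffusion (Z (s n))) v" if v: "v \<in> V" for n v
  proof -
    have "inner (wgrad (y (s n))) (wgrad v) = - inner (dy (s n) - forcing (s n)) v"
      using eqn[of n] v by (simp add: diffusion_graph_iff)
    then show ?thesis
      using inner_reaction[OF b_s g_s, of n v]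
      by (simp add: forcing_def B_def gU_def U_def inner_diff_left inner_add_left)
  qed
  have small: "(\<lambda>n. inner (a n) v) \<longlonglongrightarrow> 0" if "(\<lambda>n. norm (a n)) \<longlonglongrightarrow> 0" for a :: "nat \<Rightarrow> L2I" and v
    using tendsto_inner[OF tendsto_norm_zero_cancel[OF that] tendsto_const, of v] by simp
  have f_lim_v: "(\<lambda>n. inner (f (s n)) v) \<longlonglongrightarrow> f_inf v" if v: "v \<in> V" for v
  proof -
    have "(\<lambda>n. inner (f (s n)) v - f_inf v) \<longlonglongrightarrow> 0"
      by (rule Lim_null_comparison[of _ "\<lambda>n. e n * norm_V v"])
        (use f_e[OF v] tendsto_mult[OF e_lim tendsto_const, of "norm_V v"] in auto)
    then show ?thesis by (simp add: LIM_zero_iff)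
  qed
  have Z_lim_v: "(\<lambda>n. inner (diffusion (Z (s n))) v) \<longlonglongrightarrow> inner (diffusion Z_inf) v" if v: "v \<in> V" for v
  proof -
    have "(\<lambda>n. inner (diffusion (Z (s n)) - diffusion Z_inf) v) \<longlonglongrightarrow> 0"
      by (rule Lim_null_comparison[of _ "\<lambda>n. e n * norm_V v"])
        (use Z_e[OF v] tendsto_mult[OF e_lim tendsto_const, of "norm_V v"] in auto)
    then show ?thesis by (simp add: LIM_zero_iff inner_diff_left)
  qed
  \<comment> \<open>Position, gradient and projected section form one vector so that a single
    cluster point serves all three; cluster points found separately need not belong
    together.\<close>
  define p where "p n = ((y (s n), wgrad (y (s n))), P n)" for n
  have P_norm: "bounded (range P)"
  proof -
    have "norm (P n) \<le> ?Mb * norm (to_L2 (\<lambda>x. 1))" for n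
      using sq_int_bounded_mult(2)[OF c_m c_b sq_int_const[of 1], of n] by (simp add: P_def)
    then show ?thesis by (auto simp: bounded_iff)
  qed
  have "bounded (range p)"
  proof -
    obtain CP where CP: "\<And>n. norm (P n) \<le> CP" using P_norm by (auto simp: bounded_iff)
    have "norm (p n) \<le> C + CP" for n
    proof -
      have "norm (y (s n), wgrad (y (s n))) \<le> norm (y (s n)) + norm (wgrad (y (s n)))" by (rule norm_Pair_le)
      also have "\<dots> \<le> C" using yC[of n] by (simp add: norm_V_eq[OF yV])
      finally show ?thesis
        unfolding p_def using norm_Pair_le[of "(y (s n), wgrad (y (s n)))" "P n"] CP[of n] by linarith
    qed
    then show ?thesis by (auto simp: bounded_iff)
  qed
  then obtain l where l: "\<And>v c. (\<lambda>n. inner (p n) v) \<longlonglongrightarrow> c \<Longrightarrow> inner l v = c"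
    "\<And>K. closed K \<Longrightarrow> convex K \<Longrightarrow> range p \<subseteq> K \<Longrightarrow> l \<in> K"
    using weak_cluster_point by blast
  have "l \<in> wgrad_graph \<times> sections lo hi"
    by (rule l(2)[OF closed_Times[OF wgrad_graph_closed sections_closed] convex_Times[OF wgrad_graph_convex sections_convex]])
      (use yV P_sec in \<open>auto simp: p_def wgrad_graph_def\<close>)
  then obtain w z where lz: "l = ((w, wgrad w), z)" and z: "z \<in> sections lo hi" by (auto simp: wgrad_graph_def)
  have "inner w v = inner y_inf v" for v
  proof -
    have "(\<lambda>n. inner (p n) ((v, 0), 0)) \<longlonglongrightarrow> inner y_inf v" by (simp add: p_def tendsto_inner y_lim)
    from l(1)[OF this] show ?thesis by (simp add: lz)
  qed
  then have w: "w = y_inf" by (metis vector_eq_rdot)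
  \<comment> \<open>Gradient and section terms need not converge separately. Their combination, the
    inner product with \<open>((0, wgrad v), - QS_mult v)\<close>, does converge by the equation,
    and this determines its value at the cluster point.\<close>
  have stat: "inner (wgrad y_inf) (wgrad v) = inner z (QS_mult v) - inner gu v + f_inf v + inner (diffusion Z_inf) v"
    if v: "v \<in> V" for v
  proof -
    have "inner (p n) ((0, wgrad v), - QS_mult v) = - inner (dy (s n)) v + inner (B n - P n) (QS_mult v) - inner (gU n) v
       + inner (f (s n)) v + inner (diffusion (Z (s n))) v" for n
      using energy_s[OF v, of n] by (simp add: p_def inner_diff_left)
    moreover have "(\<lambda>n. - inner (dy (s n)) v + inner (B n - P n) (QS_mult v) - inner (gU n) v
       + inner (f (s n)) v + inner (diffusion (Z (s n))) v) \<longlonglongrightarrow> - 0 + inner 0 (QS_mult v) - inner gu v + f_inf v + inner (diffusion Z_inf) v"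
      by (intro tendsto_intros small dy_lim BP_lim gU_lim f_lim_v Z_lim_v v)
    ultimately have "(\<lambda>n. inner (p n) ((0, wgrad v), - QS_mult v)) \<longlonglongrightarrow> - inner gu v + f_inf v + inner (diffusion Z_inf) v" by simp
    from l(1)[OF this] show ?thesis by (simp add: lz w)
  qed
  have Zg: "(Z_inf, diffusion Z_inf) \<in> diffusion_graph" by (rule diffusion_in_graph[OF Z_inf])
  then have ZV: "Z_inf \<in> V" by (simp add: diffusion_graph_iff)
  have z_b: "AE x in leb_I. \<bar>L2_fun z x\<bar> \<le> ?Mb"
    using z[unfolded sections_def mem_Collect_eq] by eventually_elim (use lohi in \<open>smt (verit)\<close>)
  \<comment> \<open>Adding the identity for \<open>Z_inf\<close> cancels the diffusion term and
    leaves \<open>f_inf\<close> alone as source.\<close>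
  show "bounded_stationary_solution Q S g \<beta> f_inf (y_inf + Z_inf)"
    unfolding bounded_stationary_solution_def u_def[symmetric]
  proof (intro conjI bexI[of _ z])
    show "u \<in> V \<inter> Linf_I" using V_add(1)[OF yiV ZV] u_b by (auto simp: u_def Linf_I_def)
    show "z \<in> Linf_I" using z_b by (auto simp: Linf_I_def)
    show "AE x in leb_I. L2_fun z x \<in> \<beta> (L2_fun u x)"
      using z[unfolded sections_def mem_Collect_eq]
      by eventually_elim (auto simp: lo_def hi_def intro: graph_segment[OF \<beta> \<beta>_range mM])
    show "\<forall>v\<in>V. energy u v + (LINT x|leb_I. g (L2_fun u x) * L2_fun v x)
               = (LINT x|leb_I. Q * L2_fun S x * L2_fun z x * L2_fun v x) + f_inf v"
    proof
      fix v assume v: "v \<in> V"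
      have "energy u v = inner (wgrad y_inf) (wgrad v) + inner (wgrad Z_inf) (wgrad v)"
        using energy_eq[OF V_add(1)[OF yiV ZV] v] by (simp add: u_def V_add yiV ZV inner_add_left)
      moreover have "inner (wgrad Z_inf) (wgrad v) = - inner (diffusion Z_inf) v"
        using Zg v by (simp add: diffusion_graph_iff)
      moreover have "inner gu v = (LINT x|leb_I. g (L2_fun u x) * L2_fun v x)"
        unfolding gu_def using inner_to_L2[OF gu_s sq_int_L2_fun[of v]] by (simp add: to_L2_L2_fun)
      moreover have "inner z (QS_mult v) = (LINT x|leb_I. Q * L2_fun S x * L2_fun z x * L2_fun v x)"
        using inner_QS_mult[OF sq_int_L2_fun[of z], of v] by (simp add: to_L2_L2_fun)
      ultimately show "energy u v + (LINT x|leb_I. g (L2_fun u x) * L2_fun v x)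
               = (LINT x|leb_I. Q * L2_fun S x * L2_fun z x * L2_fun v x) + f_inf v"
        using stat[OF v] by simp
    qed
  qed
  define \<delta> where "\<delta> n = y (s n) - y_inf" for n
  have \<delta>V: "\<delta> n \<in> V" for n unfolding \<delta>_def by (intro V_diff yV yiV)
  have \<delta>0: "(\<lambda>n. norm (\<delta> n)) \<longlonglongrightarrow> 0" unfolding \<delta>_def using y_lim by (simp add: tendsto_norm_zero_iff LIM_zero_iff)
  obtain K where K: "\<And>v. norm (QS_mult v) \<le> K * norm v" using QS_mult_bound by blast
  define CV where "CV = C + norm_V y_inf"
  have \<delta>C: "norm_V (\<delta> n) \<le> CV" for n
    unfolding \<delta>_def CV_def using norm_V_triangle[OF yV[of n] yiV] yC[of n] by linarith
  obtain CP where CP: "\<And>n. norm (P n) \<le> CP" using P_norm by (auto simp: bounded_iff)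
  \<comment> \<open>\<open>B n - z\<close> is only bounded, and \<open>\<delta> n\<close> is so far
    only bounded in \<open>V\<close>; each is multiplied by a factor tending to 0, namely the
    \<open>L2I\<close> norm of \<open>\<delta> n\<close> and the dual deviation \<open>e n\<close>.
    The factor 2 counts the deviations of \<open>f\<close> and of the diffusion of
    \<open>Z\<close>.\<close>
  define h where "h n = norm (dy (s n)) * norm (\<delta> n) + (norm (B n - P n) + (CP + norm z)) * (K * norm (\<delta> n))
      + norm (gU n - gu) * norm (\<delta> n) + 2 * (\<bar>e n\<bar> * CV)" for n
  have bound: "(norm (wgrad (\<delta> n)))\<^sup>2 \<le> h n" for n
  proof -
    have "(norm (wgrad (\<delta> n)))\<^sup>2 = inner (wgrad (y (s n))) (wgrad (\<delta> n)) - inner (wgrad y_inf) (wgrad (\<delta> n))"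
      unfolding power2_norm_eq_inner by (simp add: \<delta>_def V_diff yV yiV inner_diff_left)
    also have "\<dots> = - inner (dy (s n)) (\<delta> n) + inner (B n - z) (QS_mult (\<delta> n)) - inner (gU n - gu) (\<delta> n)
        + (inner (f (s n)) (\<delta> n) - f_inf (\<delta> n)) + inner (diffusion (Z (s n)) - diffusion Z_inf) (\<delta> n)"
      unfolding energy_s[OF \<delta>V] stat[OF \<delta>V] by (simp add: inner_diff_left)
    also have "\<dots> \<le> norm (dy (s n)) * norm (\<delta> n) + norm (B n - z) * norm (QS_mult (\<delta> n)) + norm (gU n - gu) * norm (\<delta> n)
        + e n * norm_V (\<delta> n) + e n * norm_V (\<delta> n)"
      using Cauchy_Schwarz_ineq2[of "dy (s n)" "\<delta> n"] Cauchy_Schwarz_ineq2[of "B n - z" "QS_mult (\<delta> n)"]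
        Cauchy_Schwarz_ineq2[of "gU n - gu" "\<delta> n"] f_e[OF \<delta>V[of n], of n] Z_e[OF \<delta>V[of n], of n] by linarith
    also have "\<dots> \<le> h n"
    proof -
      have "norm (B n - z) \<le> norm (B n - P n) + (CP + norm z)"
        using norm_triangle_ineq[of "B n - P n" "P n - z"] norm_triangle_ineq4[of "P n" z] CP[of n] by simp
      then have 1: "norm (B n - z) * norm (QS_mult (\<delta> n)) \<le> (norm (B n - P n) + (CP + norm z)) * (K * norm (\<delta> n))"
        using K[of "\<delta> n"] order_trans[OF norm_ge_zero] by (intro mult_mono) (auto intro: order_trans[OF norm_ge_zero])
      have "e n * norm_V (\<delta> n) \<le> \<bar>e n\<bar> * CV"
        using \<delta>C[of n] norm_V_nonneg[OF \<delta>V[of n]] by (intro mult_mono) auto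
      then show ?thesis unfolding h_def using 1 by linarith
    qed
    finally show ?thesis .
  qed
  have "h \<longlonglongrightarrow> 0 * 0 + (0 + (CP + norm z)) * (K * 0) + 0 * 0 + 2 * (\<bar>0\<bar> * CV)"
    unfolding h_def
    by (intro tendsto_intros dy_lim \<delta>0 e_lim tendsto_norm_zero[OF BP_lim])
      (use gU_lim in \<open>simp add: tendsto_norm_zero_iff LIM_zero_iff\<close>)
  then have h0: "h \<longlonglongrightarrow> 0" by simp
  have "(\<lambda>n. (norm (wgrad (\<delta> n)))\<^sup>2) \<longlonglongrightarrow> 0"
    by (rule tendsto_sandwich[OF _ _ tendsto_const h0]) (use bound in auto)
  then have "(\<lambda>n. sqrt ((norm (wgrad (\<delta> n)))\<^sup>2)) \<longlonglongrightarrow> sqrt 0" by (rule tendsto_real_sqrt)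
  then have "(\<lambda>n. norm (\<delta> n) + norm (wgrad (\<delta> n))) \<longlonglongrightarrow> 0 + 0" using \<delta>0 by (intro tendsto_add) auto
  then have "(\<lambda>n. norm_V (y (s n) - y_inf)) \<longlonglongrightarrow> 0" using norm_V_eq[OF \<delta>V] by (simp add: \<delta>_def)
  then show "\<exists>t :: nat \<Rightarrow> real. filterlim t at_top sequentially \<and> (\<forall>n. t n > 0 \<and> y (t n) \<in> V) \<and>
         (\<lambda>n. norm_V (y (t n) - y_inf)) \<longlonglongrightarrow> 0"
    using s_lim s_pos yV by blast
qed

end

theorem theorem8:
  fixes Q S0 S1 m M :: real
    and S :: L2I
    and g :: "real \<Rightarrow> real"
    and \<beta> :: "real \<Rightarrow> real set"
    and T :: "real \<Rightarrow> L2I \<Rightarrow>\<^sub>L L2I"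
    and f Z u y dy :: "real \<Rightarrow> L2I"
    and f_inf :: "L2I \<Rightarrow> real"
    and Z_inf u0 :: L2I
  assumes "Q > 0"
    and "S \<in> Linf_I" and "S0 > 0"
    and "AE x in leb_I. S0 \<le> L2_fun S x \<and> L2_fun S x \<le> S1"
    and "continuous_on UNIV g" and "mono g"
    and "maximal_monotone \<beta>" and "\<And>s. \<beta> s \<subseteq> {m..M}"
    and "C0_semigroup T" and "generator T = diffusion_graph"
    and "f \<in> Linf_cyl"
    and "\<And>t. t \<ge> 0 \<Longrightarrow> Z t \<in> V" and "set_borel_measurable lborel {0<..} Z"
    and "AE t in lborel. 0 < t \<longrightarrow> Z t \<in> Domain diffusion_graph"
    and "(\<lambda>t. diffusion (Z t)) \<in> Linf_cyl"
    and "f_inf \<in> dual_V"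
    and "Z_inf \<in> V" and "(Z \<longlongrightarrow> Z_inf) at_top"
    and "Z_inf \<in> Domain diffusion_graph" and "diffusion Z_inf \<in> Linf_I"
    and "((\<lambda>t. \<integral>\<^sup>+\<tau>\<in>{t - 1..t + 1}. dual_norm_V (\<lambda>v. inner (f \<tau>) v - f_inf v) \<partial>lborel) \<longlongrightarrow> 0) at_top"
    and "((\<lambda>t. \<integral>\<^sup>+\<tau>\<in>{t - 1..t + 1}. dual_norm_V (inner (diffusion (Z \<tau>) - diffusion Z_inf)) \<partial>lborel) \<longlongrightarrow> 0) at_top"
    and "((\<lambda>t. \<integral>\<^sup>+\<tau>\<in>{t - 1..t + 1}. ennreal (norm_V (Z \<tau> - Z_inf)) \<partial>lborel) \<longlongrightarrow> 0) at_top"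
    and "u0 \<in> Linf_I \<inter> V"
    and "stochastic_mild_solution T Q S g \<beta> f Z u0 u"
    and "\<And>t. t \<ge> 0 \<Longrightarrow> y t = u t - Z t"
    and "mild_solution T Q S g \<beta> Z (\<lambda>t. f t + diffusion (Z t)) u0 y"
    and "y \<in> Linf_cyl"
    and "y \<in> Linf_time_V"
    and "weak_deriv {0<..} y dy" and "dy \<in> L2_time_L2"
  shows "omega_limit y \<noteq> {} \<and>
    (\<forall>y_inf\<in>omega_limit y.
       (\<exists>t :: nat \<Rightarrow> real. filterlim t at_top sequentially \<and> (\<forall>n. t n > 1) \<and>
          (\<lambda>n. \<integral>\<^sup>+s\<in>{-1<..<1}. ennreal ((norm (y (t n + s) - y_inf))\<^sup>2) \<partial>lborel) \<longlonglongrightarrow> 0) \<and>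
       y_inf \<in> V \<and>
       bounded_stationary_solution Q S g \<beta> f_inf (y_inf + Z_inf)) \<and>
    (\<forall>y_inf\<in>omega_limit y.
       \<exists>t :: nat \<Rightarrow> real. filterlim t at_top sequentially \<and> (\<forall>n. t n > 0 \<and> y (t n) \<in> V) \<and>
         (\<lambda>n. norm_V (y (t n) - y_inf)) \<longlonglongrightarrow> 0)"
proof -
  obtain b where b: "measurable_section \<beta> (\<lambda>t. y t + Z t) b"
    "AE t in lborel. 0 < t \<longrightarrow> sq_int (\<lambda>x. g (L2_fun (y t + Z t) x))"
    "variation_of_constants T u0 (\<lambda>t. reaction Q S g b (\<lambda>t. y t + Z t) t + (f t + diffusion (Z t))) y"
    using \<open>mild_solution T Q S g \<beta> Z (\<lambda>t. f t + diffusion (Z t)) u0 y\<close> by (auto simp: mild_solution_def)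
  interpret energy_balance Q S g \<beta> m M T f Z y dy f_inf Z_inf u0 b
    by unfold_locales (fact assms b)+
  show ?thesis
    using omega_limit_nonempty omega_limit_point by (auto simp: omega_limit_def)
qed

end
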